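(* Let $W:\mathbb{R}^d\to\mathbb{R}_+$ be continuous and let $a\in\mathbb{R}$. Assume that (i) the set $S_a=\{z\in\mathbb{R}^d: z_1=a,\ W(z)=0\}$ consists of exactly two distinct points $u^-$ and $u^+$, and (ii) $\liminf_{z_1\to a,\ |z'|\to\infty} W(z_1,z')>0$, where $z=(z_1,z')\in\mathbb{R}\times\mathbb{R}^{d-1}$. Then the minimization problem $$\inf\Big\{E(u)\;:\; u\in \dot H^1_{div}(\Omega,\mathbb{R}^d),\ \overline{u}(\pm\infty)=u^\pm\Big\}$$ has a solution, i.e. the infimum is attained.
   Context: Let $d\ge 2$, $\mathbb{T}=\mathbb{R}/\mathbb{Z}$ and $\Omega=\mathbb{R}\times\mathbb{T}^{d-1}$, with points $x=(x_1,x')$, $x'\in\mathbb{T}^{d-1}$. Define $\dot H^1_{div}(\Omega,\mathbb{R}^d)=\{u\in H^1_{loc}(\Omega,\mathbb{R}^d): \nabla u\in L^2(\Omega),\ \nabla\cdot u=0 \text{ in }\Omega\}$ and, for $u$ in this space, the energy $E(u)=\int_\Omega \frac12|\nabla u|^2+W(u)\,dx$. The $x'$-average of $u$ is the continuous function $\overline{u}(x_1)=\int_{\mathbb{T}^{d-1}}u(x_1,x')\,dx'$, and $\overline{u}(\pm\infty)=u^\pm$ means $\lim_{x_1\to\pm\infty}\overline{u}(x_1)=u^\pm$. *)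

theory Defs
  imports "HOL-Analysis.Analysis"
begin

text \<open>Points of the cylinder are represented by their periodic lift to
  R x R^(d-1) = real x real^'m (d - 1 = CARD('m) >= 1). Functions on
  Omega = R x T^(d-1) are 1-periodic functions in the second component.\<close>

definition periodic_cyl :: "(real \<times> (real^'m) \<Rightarrow> 'b) \<Rightarrow> bool" where
  "periodic_cyl u \<longleftrightarrow> (\<forall>x1 x' i. u (x1, x' + axis i 1) = u (x1, x'))"

definition cell :: "(real \<times> (real^'m)) set" where
  "cell = UNIV \<times> cbox 0 One"

definition test_fun :: "('a::euclidean_space \<Rightarrow> real) \<Rightarrow> bool" where
  "test_fun \<phi> \<longleftrightarrow> (\<forall>x. \<phi> differentiable (at x))
     \<and> (\<forall>v. continuous_on UNIV (\<lambda>x. frechet_derivative \<phi> (at x) v))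
     \<and> compact (closure {x. \<phi> x \<noteq> 0})"

definition weak_partial ::
  "('a::euclidean_space \<Rightarrow> 'b::euclidean_space) \<Rightarrow> 'a \<Rightarrow> ('a \<Rightarrow> 'b) \<Rightarrow> bool" where
  "weak_partial u v g \<longleftrightarrow> (\<forall>\<phi>. test_fun \<phi> \<longrightarrow>
      integrable lborel (\<lambda>x. frechet_derivative \<phi> (at x) v *\<^sub>R u x)
    \<and> integrable lborel (\<lambda>x. \<phi> x *\<^sub>R g x)
    \<and> (\<integral>x. frechet_derivative \<phi> (at x) v *\<^sub>R u x \<partial>lborel)
        = - (\<integral>x. \<phi> x *\<^sub>R g x \<partial>lborel))"

definition L2loc :: "('a::euclidean_space \<Rightarrow> 'b::euclidean_space) \<Rightarrow> bool" where
  "L2loc u \<longleftrightarrow> u \<in> borel_measurable lborel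
     \<and> (\<forall>K. compact K \<longrightarrow> set_integrable lborel K (\<lambda>x. (norm (u x))\<^sup>2))"

text \<open>|grad u|^2 (Frobenius norm) and div u, from the weak gradient Du,
  where Du x b is the weak derivative of u at x in direction b.\<close>
definition grad_sq :: "('a::euclidean_space \<Rightarrow> 'a \<Rightarrow> 'b::euclidean_space) \<Rightarrow> 'a \<Rightarrow> real" where
  "grad_sq Du x = (\<Sum>b\<in>Basis. (norm (Du x b))\<^sup>2)"

definition divergence :: "('a::euclidean_space \<Rightarrow> 'a \<Rightarrow> 'a) \<Rightarrow> 'a \<Rightarrow> real" where
  "divergence Du x = (\<Sum>b\<in>Basis. Du x b \<bullet> b)"

definition H1div ::
  "(real \<times> (real^'m) \<Rightarrow> real \<times> (real^'m)) \<Rightarrow> (real \<times> (real^'m) \<Rightarrow> real \<times> (real^'m) \<Rightarrow> real \<times> (real^'m)) \<Rightarrow> bool" where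
  "H1div u Du \<longleftrightarrow> periodic_cyl u \<and> L2loc u
     \<and> (\<forall>b\<in>Basis. L2loc (\<lambda>x. Du x b) \<and> weak_partial u b (\<lambda>x. Du x b))
     \<and> set_integrable lborel cell (grad_sq Du)
     \<and> (AE x in lborel. divergence Du x = 0)"

definition xavg :: "(real \<times> (real^'m) \<Rightarrow> real \<times> (real^'m)) \<Rightarrow> real \<Rightarrow> real \<times> (real^'m)" where
  "xavg u x1 = (LINT x':cbox 0 One|lborel. u (x1, x'))"

definition avg_limits ::
  "(real \<times> (real^'m) \<Rightarrow> real \<times> (real^'m)) \<Rightarrow> real \<times> (real^'m) \<Rightarrow> real \<times> (real^'m) \<Rightarrow> bool" where
  "avg_limits u um up \<longleftrightarrow> (\<exists>ub. continuous_on UNIV ub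
      \<and> (AE x1 in lborel. ub x1 = xavg u x1)
      \<and> (ub \<longlongrightarrow> um) at_bot \<and> (ub \<longlongrightarrow> up) at_top)"

definition energy ::
  "(real \<times> (real^'m) \<Rightarrow> real) \<Rightarrow> (real \<times> (real^'m) \<Rightarrow> real \<times> (real^'m))
     \<Rightarrow> (real \<times> (real^'m) \<Rightarrow> real \<times> (real^'m) \<Rightarrow> real \<times> (real^'m)) \<Rightarrow> ennreal" where
  "energy W u Du = (\<integral>\<^sup>+ x\<in>cell. ennreal (grad_sq Du x / 2 + W (u x)) \<partial>lborel)"

definition admissible where
  "admissible um up u Du \<longleftrightarrow> H1div u Du \<and> avg_limits u um up"

end

theory Submission
  imports Defs "HOL-Complex_Analysis.Great_Picard"
begin

text \<open>
  The slice averages of a divergence-free field have constant first component, and a slab whose slice average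
  stays away from both wells costs a fixed amount of energy: by the Poincare inequality the field is close to its
  average on most of the slab, where the potential is bounded below. Hence the averages of a field of finite energy
  converge to wells at both ends, and along a minimizing sequence they leave the neighbourhood of \<open>um\<close> only a
  bounded number of times. Each such exit, translated to the origin, has a limit profile running into \<open>up\<close>
  on the right. If the profile also comes from \<open>up\<close> on the left, then there is an earlier exit, infinitely far away
  in the limit, and one more quantum of energy has been used up. So some exit has a limit profile from \<open>um\<close> to
  \<open>up\<close>, which is a minimizer by lower semicontinuity. No gluing of fields is needed.

  Compactness is obtained by hand: averages over lattice cubes give strong local convergence, and the gradients are
  treated by a Mazur-type argument based on the parallelogram law instead of weak compactness.
\<close>

section \<open>Test functions and the lemma of du Bois-Reymond\<close>

text \<open>The hypotheses control W only near the hyperplane \<open>fst z = a\<close>. They apply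
  because slice averages never leave it, so every estimate compares a field with its averages and no
  pointwise bound on the field is sought. The divergence constraint that provides this also
  obstructs the usual repairs: cutting off or interpolating general fields violates it. Only
  operations respecting it occur: axial translations, midpoints and limits. Midpoints respect the
  constraint but not W, which need not be convex. Hence the original fields yield the almost
  everywhere convergence used for W, and midpoints only identify the gradient of the limit;
  Dirichlet energies are made convergent in advance so that the two parts can be treated separately.
  Exits are last crossings of the sphere of radius \<open>\<delta>\<close> around \<open>um\<close>,
  found from right to left. Each is paired with a right end \<open>e\<close> up to which the average
  stays away from \<open>um\<close>; that \<open>e - \<tau>\<close> tends to infinity is what
  survives in the limit as the behaviour on the right. Counting terminates because all fields of the
  sequence have energy at most \<open>I + 1\<close>.\<close>

lemma test_funI:
  fixes \<phi> :: "'a::euclidean_space \<Rightarrow> real"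
  assumes der: "\<And>x. (\<phi> has_derivative D x) (at x)"
    and cont: "\<And>v. continuous_on UNIV (\<lambda>x. D x v)"
    and K: "compact K" "\<And>x. x \<notin> K \<Longrightarrow> \<phi> x = 0"
  shows "test_fun \<phi>"
proof -
  have eq: "frechet_derivative \<phi> (at x) = D x" for x
    using frechet_derivative_at[OF der] by simp
  have "closure {x. \<phi> x \<noteq> 0} \<subseteq> K"
    using K by (intro closure_minimal) (auto intro: compact_imp_closed)
  then have "compact (closure {x. \<phi> x \<noteq> 0})"
    using K(1) by (metis closed_closure compact_Int_closed inf.absorb_iff2)
  then show ?thesis
    unfolding test_fun_def eq using der cont by (auto simp: differentiable_def)
qed

lemma test_fun_has_derivative:
  "test_fun \<phi> \<Longrightarrow> (\<phi> has_derivative frechet_derivative \<phi> (at x)) (at x)"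
  unfolding test_fun_def by (simp add: frechet_derivative_works)

lemma test_fun_continuous: "test_fun \<phi> \<Longrightarrow> continuous_on A \<phi>"
  by (meson continuous_at_imp_continuous_on has_derivative_continuous test_fun_has_derivative)

lemma test_fun_deriv_continuous:
  "test_fun \<phi> \<Longrightarrow> continuous_on A (\<lambda>x. frechet_derivative \<phi> (at x) v)"
  unfolding test_fun_def by (meson continuous_on_subset subset_UNIV)

lemma test_fun_support:
  assumes "test_fun \<phi>"
  obtains K where "compact K" "\<And>x. x \<notin> K \<Longrightarrow> \<phi> x = 0"
    "\<And>x v. x \<notin> K \<Longrightarrow> frechet_derivative \<phi> (at x) v = 0"
proof
  let ?K = "closure {x. \<phi> x \<noteq> 0}"
  show "compact ?K" using assms by (simp add: test_fun_def)
  show *: "\<phi> x = 0" if "x \<notin> ?K" for x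
    using that closure_subset[of "{x. \<phi> x \<noteq> 0}"] by blast
  show "frechet_derivative \<phi> (at x) v = 0" if "x \<notin> ?K" for x v
  proof -
    \<comment> \<open>The complement of the support is open and \<open>\<phi>\<close> vanishes on
      it, so the derivative there is that of the zero function.\<close>
    have "((\<lambda>_. 0) has_derivative frechet_derivative \<phi> (at x)) (at x)"
    proof (rule has_derivative_transform_within_open[OF test_fun_has_derivative[OF assms]])
      show "open (- ?K)" by auto
      show "x \<in> - ?K" using that by simp
      show "\<And>x. x \<in> - ?K \<Longrightarrow> \<phi> x = 0" using * by blast
    qed
    then have "frechet_derivative \<phi> (at x) = (\<lambda>_. 0)"
      using has_derivative_unique[OF _ has_derivative_const] by blast
    then show ?thesis by simp
  qed
qed

lemma test_fun_bounded:
  fixes \<phi> :: "'a::euclidean_space \<Rightarrow> real"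
  assumes "test_fun \<phi>"
  obtains K B where "compact K" "B > 0" "\<And>x. x \<notin> K \<Longrightarrow> \<phi> x = 0"
    "\<And>x. x \<notin> K \<Longrightarrow> frechet_derivative \<phi> (at x) v = 0"
    "\<And>x. \<bar>\<phi> x\<bar> \<le> B" "\<And>x. \<bar>frechet_derivative \<phi> (at x) v\<bar> \<le> B"
proof -
  obtain K where K: "compact K" "\<And>x. x \<notin> K \<Longrightarrow> \<phi> x = 0"
    "\<And>x v. x \<notin> K \<Longrightarrow> frechet_derivative \<phi> (at x) v = 0"
    using test_fun_support[OF assms] by metis
  have "bounded (\<phi> ` K)" "bounded ((\<lambda>x. frechet_derivative \<phi> (at x) v) ` K)"
    using K(1) test_fun_continuous[OF assms] test_fun_deriv_continuous[OF assms]
    by (auto intro!: compact_imp_bounded compact_continuous_image)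
  then obtain B1 B2 where B: "B1 > 0" "\<And>x. x \<in> K \<Longrightarrow> \<bar>\<phi> x\<bar> \<le> B1"
    "B2 > 0" "\<And>x. x \<in> K \<Longrightarrow> \<bar>frechet_derivative \<phi> (at x) v\<bar> \<le> B2"
    unfolding bounded_pos by auto
  show thesis
  proof (rule that[of K "B1 + B2"])
    show "\<bar>\<phi> x\<bar> \<le> B1 + B2" for x
      using B(1,3) B(2)[of x] K(2)[of x] by (cases "x \<in> K") auto
    show "\<bar>frechet_derivative \<phi> (at x) v\<bar> \<le> B1 + B2" for x
      using B(1,3) B(4)[of x] K(3)[of x v] by (cases "x \<in> K") auto
  qed (use K B in auto)
qed

lemma test_fun_shift:
  fixes \<phi> :: "'a::euclidean_space \<Rightarrow> real"
  assumes "test_fun \<phi>"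
  shows "test_fun (\<lambda>x. \<phi> (x + c))"
    and "frechet_derivative (\<lambda>x. \<phi> (x + c)) (at x) v = frechet_derivative \<phi> (at (x + c)) v"
proof -
  have der: "((\<lambda>x. \<phi> (x + c)) has_derivative frechet_derivative \<phi> (at (x + c))) (at x)" for x
    by (rule has_derivative_compose[of "\<lambda>x. x + c" "\<lambda>h. h" x UNIV \<phi>, OF _ test_fun_has_derivative[OF assms]])
      (auto intro!: derivative_eq_intros)
  then show "frechet_derivative (\<lambda>x. \<phi> (x + c)) (at x) v = frechet_derivative \<phi> (at (x + c)) v"
    using frechet_derivative_at by metis
  obtain K where K: "compact K" "\<And>x. x \<notin> K \<Longrightarrow> \<phi> x = 0"
    using test_fun_support[OF assms] by metis
  show "test_fun (\<lambda>x. \<phi> (x + c))"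
  proof (rule test_funI[OF der])
    show "continuous_on UNIV (\<lambda>x. frechet_derivative \<phi> (at (x + c)) v)" for v
      by (rule continuous_on_compose2[OF test_fun_deriv_continuous[OF assms, of UNIV v]])
        (auto intro!: continuous_intros)
    show "compact ((\<lambda>x. x - c) ` K)"
      using K(1) by (intro compact_continuous_image continuous_intros)
    show "\<phi> (x + c) = 0" if "x \<notin> (\<lambda>x. x - c) ` K" for x
      using that K(2)[of "x + c"] by (force simp: image_iff)
  qed
qed

text \<open>The segment runs backwards from \<open>x\<close> because the identity is applied after a
  translation has been moved from a weak derivative onto the test function.\<close>

lemma test_fun_segment_integral:
  fixes \<phi> :: "'a::euclidean_space \<Rightarrow> real"
  assumes "test_fun \<phi>" "h \<ge> 0"
  shows "(LINT s:{0..h}|lborel. frechet_derivative \<phi> (at (x - s *\<^sub>R v)) v) = \<phi> x - \<phi> (x - h *\<^sub>R v)"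
proof -
  have "((\<lambda>s. - \<phi> (x - s *\<^sub>R v)) has_vector_derivative frechet_derivative \<phi> (at (x - s *\<^sub>R v)) v) (at s within A)" for s A
  proof -
    have "((\<lambda>s. \<phi> (x - s *\<^sub>R v)) has_derivative (\<lambda>t. frechet_derivative \<phi> (at (x - s *\<^sub>R v)) (- t *\<^sub>R v))) (at s within A)"
      by (rule has_derivative_compose[OF _ test_fun_has_derivative[OF assms(1)]])
        (auto intro!: derivative_eq_intros)
    moreover have "linear (frechet_derivative \<phi> (at (x - s *\<^sub>R v)))"
      using test_fun_has_derivative[OF assms(1)] has_derivative_linear by blast
    ultimately have "((\<lambda>s. \<phi> (x - s *\<^sub>R v)) has_vector_derivative - frechet_derivative \<phi> (at (x - s *\<^sub>R v)) v) (at s within A)"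
      unfolding has_vector_derivative_def by (simp add: linear_scale linear_neg)
    from has_vector_derivative_minus[OF this] show ?thesis by simp
  qed
  moreover have "continuous_on {0..h} (\<lambda>s. frechet_derivative \<phi> (at (x - s *\<^sub>R v)) v)"
    by (rule continuous_on_compose2[OF test_fun_deriv_continuous[OF assms(1), of UNIV v]])
      (auto intro!: continuous_intros)
  ultimately have "(\<integral>s. indicator {0..h} s *\<^sub>R frechet_derivative \<phi> (at (x - s *\<^sub>R v)) v \<partial>lborel)
     = - \<phi> (x - h *\<^sub>R v) - (- \<phi> (x - 0 *\<^sub>R v))"
    by (intro integral_FTC_Icc[OF assms(2)]) auto
  then show ?thesis by (simp add: set_lebesgue_integral_def)
qed

text \<open>The class L^1_loc. Weak derivatives are handled here rather than in L^2_loc because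
  differences, translates and segment integrals stay in it by linearity and Fubini.\<close>

definition locint :: "('a::euclidean_space \<Rightarrow> 'b::euclidean_space) \<Rightarrow> bool" where
  "locint f \<longleftrightarrow> f \<in> borel_measurable borel \<and> (\<forall>K. compact K \<longrightarrow> set_integrable lborel K f)"

lemma L2loc_measurable: "L2loc f \<Longrightarrow> f \<in> borel_measurable borel"
  by (simp add: L2loc_def)

lemma finite_measure_compact: "compact K \<Longrightarrow> emeasure lborel (K::'a::euclidean_space set) < \<infinity>"
  using emeasure_compact_finite by (simp add: top.not_eq_extremum)

lemma L2loc_locint:
  assumes "L2loc f"
  shows "locint f"
  unfolding locint_def
proof (intro conjI allI impI)
  show [measurable]: "f \<in> borel_measurable borel" by (rule L2loc_measurable[OF assms])
  fix K :: "'a set" assume K: "compact K"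
  then have [measurable]: "K \<in> sets borel" by (simp add: borel_compact)
  have "set_integrable lborel K (\<lambda>x. (norm (f x))\<^sup>2)" using assms K by (simp add: L2loc_def)
  moreover have "set_integrable lborel K (\<lambda>x. 1::real)"
    using finite_measure_compact[OF K] by (simp add: set_integrable_def)
  ultimately have 1: "set_integrable lborel K (\<lambda>x. 1 + (norm (f x))\<^sup>2)"
    by (intro set_integral_add)
  show "set_integrable lborel K f"
  proof (rule set_integrable_bound[OF 1])
    show "set_borel_measurable lborel K f" unfolding set_borel_measurable_def by measurable
    \<comment> \<open>This dominates \<open>norm (f x)\<close> by an integrable function, since
      compact sets have finite measure.\<close>
    have "n \<le> 1 + n\<^sup>2" for n :: real
      using zero_le_power2[of "n - 1/2"] by (simp add: power2_eq_square algebra_simps)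
    then show "AE x in lborel. x \<in> K \<longrightarrow> norm (f x) \<le> norm (1 + (norm (f x))\<^sup>2)"
      by (intro AE_I2) (simp add: add_nonneg_nonneg)
  qed
qed

lemma locint_integrable_scaleR:
  fixes f :: "'a::euclidean_space \<Rightarrow> 'b::euclidean_space"
  assumes "locint f" "compact K" and [measurable]: "\<psi> \<in> borel_measurable borel"
    and "\<And>x. x \<notin> K \<Longrightarrow> \<psi> x = (0::real)" "\<And>x. \<bar>\<psi> x\<bar> \<le> B"
  shows "integrable lborel (\<lambda>x. \<psi> x *\<^sub>R f x)"
proof -
  have [measurable]: "f \<in> borel_measurable borel" using assms by (simp add: locint_def)
  have "integrable lborel (\<lambda>x. B *\<^sub>R (indicator K x *\<^sub>R f x))"
    using assms by (intro integrable_scaleR_right) (simp add: locint_def set_integrable_def)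
  then show ?thesis
  proof (rule Bochner_Integration.integrable_bound)
    have "B \<ge> 0" using assms(5)[of undefined] by linarith
    then have "norm (\<psi> x *\<^sub>R f x) \<le> norm (B *\<^sub>R indicator K x *\<^sub>R f x)" for x
      using assms(4)[of x] assms(5)[of x]
      by (cases "x \<in> K") (auto intro!: mult_right_mono)
    then show "AE x in lborel. norm (\<psi> x *\<^sub>R f x) \<le> norm (B *\<^sub>R indicator K x *\<^sub>R f x)" by simp
  qed simp
qed

lemma test_fun_measurable: "test_fun \<phi> \<Longrightarrow> \<phi> \<in> borel_measurable borel"
  by (intro borel_measurable_continuous_onI test_fun_continuous)

lemma test_fun_deriv_measurable:
  "test_fun \<phi> \<Longrightarrow> (\<lambda>x. frechet_derivative \<phi> (at x) v) \<in> borel_measurable borel"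
  by (intro borel_measurable_continuous_onI test_fun_deriv_continuous)

lemma test_fun_integrable:
  assumes "test_fun \<phi>" "locint f"
  shows "integrable lborel (\<lambda>x. \<phi> x *\<^sub>R f x)"
    and "integrable lborel (\<lambda>x. frechet_derivative \<phi> (at x) v *\<^sub>R f x)"
proof -
  obtain K B where *: "compact K" "B > 0" "\<And>x. x \<notin> K \<Longrightarrow> \<phi> x = 0"
    "\<And>x. x \<notin> K \<Longrightarrow> frechet_derivative \<phi> (at x) v = 0"
    "\<And>x. \<bar>\<phi> x\<bar> \<le> B" "\<And>x. \<bar>frechet_derivative \<phi> (at x) v\<bar> \<le> B"
    using test_fun_bounded[OF assms(1)] by metis
  show "integrable lborel (\<lambda>x. \<phi> x *\<^sub>R f x)"
    using * assms test_fun_measurable by (intro locint_integrable_scaleR) auto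
  show "integrable lborel (\<lambda>x. frechet_derivative \<phi> (at x) v *\<^sub>R f x)"
    using * assms test_fun_deriv_measurable by (intro locint_integrable_scaleR) auto
qed

text \<open>The squared positive part is C^1, which is the smoothness that \<open>test_fun\<close>
  asks for. It is the building block of the bump functions and of the ramp.\<close>

lemma has_real_derivative_max_0_sq:
  "((\<lambda>t. (max 0 t)\<^sup>2) has_real_derivative 2 * max 0 t) (at (t::real))"
proof -
  consider "t > 0" | "t < 0" | "t = 0" by linarith
  then show ?thesis
  proof cases
    case 1
    have "((\<lambda>t. t\<^sup>2) has_real_derivative 2 * max 0 t) (at t)"
      using 1 by (auto intro!: derivative_eq_intros)
    then show ?thesis
      by (rule has_field_derivative_transform_within_open[of _ _ _ "{0<..}"]) (use 1 in auto)
  next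
    case 2
    have "((\<lambda>t. 0) has_real_derivative 2 * max 0 t) (at t)"
      using 2 by (auto intro!: derivative_eq_intros)
    then show ?thesis
      by (rule has_field_derivative_transform_within_open[of _ _ _ "{..<0}"]) (use 2 in auto)
  next
    case 3
    \<comment> \<open>At the kink the difference quotient is bounded by
      \<open>\<bar>h\<bar>\<close>.\<close>
    have "((\<lambda>h. (max 0 h)\<^sup>2 / h) \<longlongrightarrow> 0) (at (0::real))"
    proof (rule tendsto_rabs_zero_cancel, rule tendsto_sandwich[where f = "\<lambda>_. 0" and h = abs])
      show "(abs \<longlongrightarrow> 0) (at (0::real))" by (auto intro!: tendsto_eq_intros)
      show "\<forall>\<^sub>F h in at (0::real). \<bar>(max 0 h)\<^sup>2 / h\<bar> \<le> \<bar>h\<bar>"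
        by (rule always_eventually) (auto simp: max_def power2_eq_square)
    qed auto
    then show ?thesis using 3 by (simp add: DERIV_def)
  qed
qed

lemma max_0_sq_has_derivative [derivative_intros]:
  fixes f :: "'a::real_normed_vector \<Rightarrow> real"
  assumes "(f has_derivative f') (at x)"
  shows "((\<lambda>x. (max 0 (f x))\<^sup>2) has_derivative (\<lambda>h. 2 * max 0 (f x) * f' h)) (at x)"
  using has_derivative_compose[OF assms has_real_derivative_max_0_sq[unfolded has_field_derivative_def]]
  by simp

text \<open>A C^1 function that is positive exactly on the open box, so that
  \<open>bump / (bump + \<epsilon>)\<close> tends to the indicator of the box as
  \<open>\<epsilon>\<close> tends to 0.\<close>

definition bump :: "'a::euclidean_space \<Rightarrow> 'a \<Rightarrow> 'a \<Rightarrow> real" where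
  "bump a b x = (\<Prod>i\<in>Basis. (max 0 (x \<bullet> i - a \<bullet> i))\<^sup>2 * (max 0 (b \<bullet> i - x \<bullet> i))\<^sup>2)"

lemma bump_nonneg: "bump a b x \<ge> 0"
  unfolding bump_def by (intro prod_nonneg) auto

lemma bump_pos_iff: "bump a b x > 0 \<longleftrightarrow> x \<in> box a b"
proof
  assume "bump a b x > 0"
  then have "\<forall>i\<in>Basis. (max 0 (x \<bullet> i - a \<bullet> i))\<^sup>2 * (max 0 (b \<bullet> i - x \<bullet> i))\<^sup>2 \<noteq> 0"
    unfolding bump_def by (metis (no_types, lifting) finite_Basis less_irrefl prod_zero)
  then show "x \<in> box a b" unfolding mem_box by (force simp: max_def split: if_splits)
next
  assume "x \<in> box a b"
  then show "bump a b x > 0" unfolding mem_box bump_def by (intro prod_pos) auto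
qed

lemma test_fun_box_approx:
  fixes a b :: "'a::euclidean_space"
  shows "test_fun (\<lambda>x. bump a b x / (bump a b x + 1 / Suc k))"
proof -
  let ?w = "\<lambda>i x. (max 0 (x \<bullet> i - a \<bullet> i))\<^sup>2 * (max 0 (b \<bullet> i - x \<bullet> i))\<^sup>2"
  define w' where "w' i x h = (max 0 (x \<bullet> i - a \<bullet> i))\<^sup>2 * (2 * max 0 (b \<bullet> i - x \<bullet> i) * - (h \<bullet> i)) +
    2 * max 0 (x \<bullet> i - a \<bullet> i) * (h \<bullet> i) * (max 0 (b \<bullet> i - x \<bullet> i))\<^sup>2" for i x h
  define D where "D x h = (\<Sum>i\<in>Basis. w' i x h * (\<Prod>j\<in>Basis - {i}. ?w j x))" for x h
  have w': "(?w i has_derivative w' i x) (at x)" for i x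
    unfolding w'_def by (auto intro!: derivative_eq_intros)
  have D: "(bump a b has_derivative D x) (at x)" for x
    unfolding D_def bump_def using w' by (intro has_derivative_prod) auto
  let ?c = "1 / Suc k"
  have pos: "bump a b x + ?c > 0" for x
    using bump_nonneg[of a b x] by (intro add_nonneg_pos) auto
  have nz: "bump a b x + ?c \<noteq> 0" for x using pos[of x] by linarith
  have contw: "continuous_on UNIV (bump a b)"
    unfolding bump_def by (intro continuous_intros)
  have contD: "continuous_on UNIV (\<lambda>x. D x v)" for v
    unfolding D_def w'_def by (intro continuous_intros)
  show ?thesis
  proof (rule test_funI)
    show "((\<lambda>x. bump a b x / (bump a b x + ?c)) has_derivative
       (\<lambda>h. (D x h * (bump a b x + ?c) - bump a b x * D x h) / ((bump a b x + ?c) * (bump a b x + ?c)))) (at x)" for x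
      by (rule has_derivative_divide'[OF D has_derivative_add_const[OF D] nz])
    show "continuous_on UNIV (\<lambda>x. (D x h * (bump a b x + ?c) - bump a b x * D x h) / ((bump a b x + ?c) * (bump a b x + ?c)))" for h
      using contw contD nz by (intro continuous_intros) auto
    show "compact (cbox a b)" by simp
    show "bump a b x / (bump a b x + ?c) = 0" if "x \<notin> cbox a b" for x
      using that bump_pos_iff[of a b x] bump_nonneg[of a b x] box_subset_cbox[of a b] by fastforce
  qed
qed

text \<open>Dominated convergence: the test functions \<open>bump / (bump + 1 / Suc k)\<close> lie
  between 0 and 1, vanish off the box and converge to its indicator.\<close>

lemma box_integral_zero:
  fixes f :: "'a::euclidean_space \<Rightarrow> 'b::euclidean_space"
  assumes f: "locint f" and 0: "\<And>\<phi>. test_fun \<phi> \<Longrightarrow> (\<integral>x. \<phi> x *\<^sub>R f x \<partial>lborel) = 0"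
  shows "(LINT x:box a b|lborel. f x) = 0"
proof -
  have [measurable]: "f \<in> borel_measurable borel" using f by (simp add: locint_def)
  let ?\<phi> = "\<lambda>k x. bump a b x / (bump a b x + 1 / Suc k)"
  have [measurable]: "?\<phi> k \<in> borel_measurable borel" for k
    using test_fun_box_approx test_fun_measurable by blast
  have "(\<lambda>k. \<integral>x. ?\<phi> k x *\<^sub>R f x \<partial>lborel) \<longlonglongrightarrow> (\<integral>x. indicator (box a b) x *\<^sub>R f x \<partial>lborel)"
  proof (rule integral_dominated_convergence[where w = "\<lambda>x. norm (indicator (cbox a b) x *\<^sub>R f x)"])
    show "integrable lborel (\<lambda>x. norm (indicator (cbox a b) x *\<^sub>R f x))"
      using f by (intro integrable_norm) (simp add: locint_def set_integrable_def)
    show "AE x in lborel. (\<lambda>k. ?\<phi> k x *\<^sub>R f x) \<longlonglongrightarrow> indicator (box a b) x *\<^sub>R f x"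
    proof (intro AE_I2 tendsto_scaleR tendsto_const)
      fix x
      show "(\<lambda>k. ?\<phi> k x) \<longlonglongrightarrow> indicator (box a b) x"
      proof (cases "x \<in> box a b")
        case True
        then have "bump a b x > 0" by (simp add: bump_pos_iff)
        then have "(\<lambda>k. ?\<phi> k x) \<longlonglongrightarrow> bump a b x / (bump a b x + 0)"
          using LIMSEQ_inverse_real_of_nat by (intro tendsto_intros) (auto simp: inverse_eq_divide)
        then show ?thesis using True \<open>bump a b x > 0\<close> by simp
      next
        case False
        then have "bump a b x = 0" using bump_pos_iff[of a b x] bump_nonneg[of a b x] by force
        then show ?thesis using False by simp
      qed
    qed
    show "AE x in lborel. norm (?\<phi> k x *\<^sub>R f x) \<le> norm (indicator (cbox a b) x *\<^sub>R f x)" for k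
    proof (rule AE_I2)
      fix x
      have p: "bump a b x + 1 / Suc k > 0"
        using bump_nonneg[of a b x] by (intro add_nonneg_pos) auto
      have "\<bar>?\<phi> k x\<bar> \<le> indicator (cbox a b) x"
      proof (cases "x \<in> box a b")
        case True
        then have "x \<in> cbox a b" using box_subset_cbox by blast
        moreover have "?\<phi> k x \<le> 1" using p by (simp add: divide_le_eq_1)
        moreover have "?\<phi> k x \<ge> 0" using p bump_nonneg[of a b x] by (simp add: divide_nonneg_pos)
        ultimately show ?thesis by (simp only: abs_of_nonneg indicator_simps)
      next
        case False
        then have "bump a b x = 0" using bump_pos_iff[of a b x] bump_nonneg[of a b x] by force
        then show ?thesis by simp
      qed
      then have "\<bar>?\<phi> k x\<bar> * norm (f x) \<le> indicator (cbox a b) x * norm (f x)"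
        by (rule mult_right_mono) simp
      then show "norm (?\<phi> k x *\<^sub>R f x) \<le> norm (indicator (cbox a b) x *\<^sub>R f x)"
        by (simp only: norm_scaleR abs_indicator)
    qed
  qed measurable
  then have "(\<lambda>k. 0) \<longlonglongrightarrow> (\<integral>x. indicator (box a b) x *\<^sub>R f x \<partial>lborel)"
    using 0[OF test_fun_box_approx] by simp
  then show ?thesis
    unfolding set_lebesgue_integral_def by (metis LIMSEQ_unique tendsto_const)
qed

text \<open>Open boxes are closed under intersection and generate the Borel sets, so Dynkin's
  argument extends vanishing integrals from boxes to all Borel sets; then the function itself
  vanishes almost everywhere.\<close>

theorem du_Bois_Reymond:
  fixes f :: "'a::euclidean_space \<Rightarrow> 'b::euclidean_space"
  assumes f: "locint f" and 0: "\<And>\<phi>. test_fun \<phi> \<Longrightarrow> (\<integral>x. \<phi> x *\<^sub>R f x \<partial>lborel) = 0"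
  shows "AE x in lborel. f x = 0"
proof -
  have [measurable]: "f \<in> borel_measurable borel" using f by (simp add: locint_def)
  have "AE x in lborel. x \<in> box (- (real n *\<^sub>R One)) (real n *\<^sub>R One) \<longrightarrow> f x = 0" for n
  proof -
    define C :: "'a set" where "C = box (- (real n *\<^sub>R One)) (real n *\<^sub>R One)"
    have [measurable]: "C \<in> sets borel" by (simp add: C_def)
    \<comment> \<open>Cutting \<open>f\<close> down to a cube gives a globally integrable function,
      which the complement step of the induction needs; boxes intersected with the cube are boxes
      again.\<close>
    define g where "g x = indicator C x *\<^sub>R f x" for x
    have "set_integrable lborel (cbox (- (real n *\<^sub>R One)) (real n *\<^sub>R One)) f"
      using f compact_cbox unfolding locint_def by blast
    then have int: "set_integrable lborel C f"
      by (rule set_integrable_subset) (use box_subset_cbox C_def in auto)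
    then have gint: "integrable lborel g" by (simp add: g_def[abs_def] set_integrable_def)
    have sets_eq: "sets lborel = sigma_sets UNIV (range (\<lambda>(a, b). box a b :: 'a set))"
      unfolding sets_lborel borel_eq_box by (rule sets_measure_of) simp
    have stable: "Int_stable (range (\<lambda>(a, b). box a b :: 'a set))"
      by (rule Int_stableI) (force simp: box_Int_box image_iff)
    have subset_Pow: "range (\<lambda>(a, b). box a b :: 'a set) \<subseteq> Pow UNIV" by simp
    have *: "(LINT x:A|lborel. g x) = 0" if "A \<in> sigma_sets UNIV (range (\<lambda>(a, b). box a b))" for A :: "'a set"
      using stable subset_Pow that
    proof (induction rule: sigma_sets_induct_disjoint)
      case (basic A)
      then obtain a b where A: "A = box a b" by auto
      have "(LINT x:A|lborel. g x) = (LINT x:(A \<inter> C)|lborel. f x)"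
        by (simp add: set_lebesgue_integral_def g_def indicator_inter_arith)
      then show ?case
        using box_integral_zero[OF f 0] by (simp add: A C_def box_Int_box)
    next
      case (compl A)
      then have A: "A \<in> sets lborel" unfolding sets_eq by simp
      have "(LINT x:(UNIV - A)|lborel. g x) = (\<integral>x. g x - indicator A x *\<^sub>R g x \<partial>lborel)"
        unfolding set_lebesgue_integral_def
        by (intro Bochner_Integration.integral_cong) (auto simp: indicator_def)
      also have "\<dots> = (LINT x:UNIV|lborel. g x) - (LINT x:A|lborel. g x)"
        unfolding set_lebesgue_integral_def using gint
        by (subst Bochner_Integration.integral_diff) (use A in \<open>auto intro!: integrable_mult_indicator\<close>)
      finally have "(LINT x:(UNIV - A)|lborel. g x) = (LINT x:UNIV|lborel. g x) - (LINT x:A|lborel. g x)" .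
      moreover have "(LINT x:UNIV|lborel. g x) = 0"
        using box_integral_zero[OF f 0] by (simp add: set_lebesgue_integral_def g_def C_def)
      ultimately show ?case using compl by simp
    next
      case (union A)
      then have "A i \<in> sets lborel" for i unfolding sets_eq by auto
      moreover have "set_integrable lborel (\<Union>i. A i) g"
        unfolding set_integrable_def using gint calculation by (intro integrable_mult_indicator) auto
      ultimately have "(LINT x:(\<Union>i. A i)|lborel. g x) = (\<Sum>i. (LINT x:(A i)|lborel. g x))"
        using union(1) by (intro lebesgue_integral_countable_add) (auto simp: disjoint_family_on_def)
      then show ?case using union by simp
    qed (auto simp: set_lebesgue_integral_def)
    have "AE x in lborel. g x = 0"
      by (rule sigma_finite_measure.density_zero[OF sigma_finite_lborel gint], rule *) (simp only: sets_eq)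
    then show ?thesis by eventually_elim (auto simp: g_def C_def)
  qed
  then have "AE x in lborel. \<forall>n. x \<in> box (- (real n *\<^sub>R One)) (real n *\<^sub>R One) \<longrightarrow> f x = 0"
    by (subst AE_all_countable) blast
  then show ?thesis
  proof eventually_elim
    case (elim x)
    have "x \<in> (\<Union>n. box (- (real n *\<^sub>R One)) (real n *\<^sub>R One))" unfolding UN_box_eq_UNIV by simp
    then show ?case using elim by auto
  qed
qed

section \<open>The fundamental theorem of calculus for weak derivatives\<close>

lemma nn_integral_lborel_shift:
  fixes f :: "'a::euclidean_space \<Rightarrow> ennreal"
  assumes [measurable]: "f \<in> borel_measurable borel"
  shows "(\<integral>\<^sup>+x. f (x + c) \<partial>lborel) = (\<integral>\<^sup>+x. f x \<partial>lborel)"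
proof -
  have "(\<integral>\<^sup>+x. f x \<partial>lborel) = (\<integral>\<^sup>+x. f x \<partial>distr lborel borel ((+) c))"
    by (simp add: lborel_distr_plus)
  then show ?thesis by (simp add: nn_integral_distr add.commute)
qed

lemma integral_lborel_shift:
  fixes f :: "'a::euclidean_space \<Rightarrow> 'b::euclidean_space"
  assumes [measurable]: "f \<in> borel_measurable borel"
  shows "(\<integral>x. f (x + c) \<partial>lborel) = (\<integral>x. f x \<partial>lborel)"
proof -
  have "(\<integral>x. f x \<partial>lborel) = (\<integral>x. f x \<partial>distr lborel borel ((+) c))"
    by (simp add: lborel_distr_plus)
  then show ?thesis by (simp add: integral_distr add.commute)
qed

lemma integrable_lborel_shift:
  fixes f :: "'a::euclidean_space \<Rightarrow> 'b::euclidean_space"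
  assumes "integrable lborel f"
  shows "integrable lborel (\<lambda>x. f (x + c))"
proof -
  have [measurable]: "f \<in> borel_measurable borel" using assms by auto
  have "integrable (distr lborel borel ((+) c)) f"
    using assms by (simp add: lborel_distr_plus)
  then show ?thesis by (simp add: integrable_distr_eq add.commute)
qed

lemma AE_lborel_shift:
  fixes c :: "'a::euclidean_space"
  assumes "AE x in lborel. P x"
  shows "AE x in lborel. P (x + c)"
proof -
  obtain N where N: "{x. \<not> P x} \<subseteq> N" "emeasure lborel N = 0" "N \<in> sets lborel"
    using AE_E[OF assms] by auto
  then have [measurable]: "N \<in> sets borel" by simp
  have "(\<integral>\<^sup>+x. indicator N (x + c) \<partial>lborel) = 0"
    using N by (simp add: nn_integral_lborel_shift)
  then have "AE x in lborel. indicator N (x + c) = (0::ennreal)"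
    by (subst (asm) nn_integral_0_iff_AE) auto
  then show ?thesis
    by eventually_elim (use N in \<open>auto simp: indicator_def split: if_splits\<close>)
qed

lemma locint_measurable: "locint f \<Longrightarrow> f \<in> borel_measurable borel"
  by (simp add: locint_def)

lemma compact_plus_image: "compact K \<Longrightarrow> compact ((\<lambda>x. x + c) ` (K::'a::euclidean_space set))"
  by (intro compact_continuous_image continuous_intros)

lemma locint_shift:
  fixes f :: "'a::euclidean_space \<Rightarrow> 'b::euclidean_space"
  assumes "locint f"
  shows "locint (\<lambda>x. f (x + c))"
  unfolding locint_def
proof (intro conjI allI impI)
  have [measurable]: "f \<in> borel_measurable borel" using assms by (rule locint_measurable)
  show "(\<lambda>x. f (x + c)) \<in> borel_measurable borel" by measurable
  fix K :: "'a set" assume "compact K"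
  then have "set_integrable lborel ((\<lambda>x. x + c) ` K) f"
    using assms compact_plus_image by (auto simp: locint_def)
  from integrable_lborel_shift[OF this[unfolded set_integrable_def], of c]
  show "set_integrable lborel K (\<lambda>x. f (x + c))"
    unfolding set_integrable_def
    by (rule arg_cong[where f = "integrable lborel", THEN iffD1, rotated])
      (auto simp: fun_eq_iff indicator_def)
qed

lemma locint_diff:
  assumes "locint f" "locint g"
  shows "locint (\<lambda>x. f x - g x)"
  using assms by (auto simp: locint_def intro!: set_integral_diff)

lemma locint_nn_finite:
  assumes "locint f" "compact K"
  shows "(\<integral>\<^sup>+x. indicator K x * ennreal (norm (f x)) \<partial>lborel) < \<infinity>"
proof -
  have "integrable lborel (\<lambda>x. indicator K x *\<^sub>R f x)"
    using assms by (simp add: locint_def set_integrable_def)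
  then have "(\<integral>\<^sup>+x. norm (indicator K x *\<^sub>R f x) \<partial>lborel) < \<infinity>"
    by (simp add: integrable_iff_bounded)
  also have "(\<integral>\<^sup>+x. norm (indicator K x *\<^sub>R f x) \<partial>lborel) = (\<integral>\<^sup>+x. indicator K x * ennreal (norm (f x)) \<partial>lborel)"
    by (intro nn_integral_cong) (auto simp: indicator_def)
  finally show ?thesis .
qed

text \<open>A compact set holding all points reached from \<open>K\<close> along the segment, so
  that local integrability controls integrands evaluated at moving points.\<close>

definition sweep :: "'a::euclidean_space set \<Rightarrow> real \<Rightarrow> 'a \<Rightarrow> 'a set" where
  "sweep K h v = (\<lambda>(x, s). x + s *\<^sub>R v) ` (K \<times> {0..h})"

lemma compact_sweep: "compact K \<Longrightarrow> compact (sweep K h v)"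
  unfolding sweep_def case_prod_beta
  by (intro compact_continuous_image continuous_intros compact_Times) auto

lemma mem_sweep: "x \<in> K \<Longrightarrow> s \<in> {0..h} \<Longrightarrow> x + s *\<^sub>R v \<in> sweep K h v"
  unfolding sweep_def by force

text \<open>Tonelli with the integral over \<open>x\<close> taken first: for fixed \<open>s\<close>
  it is at most \<open>B\<close> times the integral of \<open>norm g\<close> over the swept set, a
  bound that does not depend on \<open>s\<close>.\<close>

lemma integrable_segment:
  fixes g :: "'a::euclidean_space \<Rightarrow> 'b::euclidean_space"
  assumes g: "locint g" and K: "compact K" and h: "h \<ge> 0"
    and \<psi> [measurable]: "\<psi> \<in> borel_measurable borel"
    and \<psi>0: "\<And>x. x \<notin> K \<Longrightarrow> \<psi> x = (0::real)" and B: "\<And>x. \<bar>\<psi> x\<bar> \<le> B"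
  shows "integrable (lborel \<Otimes>\<^sub>M lborel) (\<lambda>(x, s). \<psi> x *\<^sub>R indicator {0..h} s *\<^sub>R g (x + s *\<^sub>R v))"
proof -
  have [measurable]: "g \<in> borel_measurable borel" using g by (rule locint_measurable)
  let ?L = "sweep K h v"
  have L: "compact ?L" using compact_sweep[OF K] .
  then have [measurable]: "?L \<in> sets borel" by (simp add: borel_compact)
  have B0: "B \<ge> 0" using B[of undefined] by linarith
  let ?F = "\<lambda>x s. ennreal (norm (\<psi> x *\<^sub>R indicator {0..h} s *\<^sub>R g (x + s *\<^sub>R v)))"
  have "(\<integral>\<^sup>+s. \<integral>\<^sup>+x. ?F x s \<partial>lborel \<partial>lborel)
      \<le> (\<integral>\<^sup>+s. ennreal B * indicator {0..h} s * (\<integral>\<^sup>+x. indicator ?L x * ennreal (norm (g x)) \<partial>lborel) \<partial>lborel)"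
  proof (intro nn_integral_mono)
    fix s
    have "(\<integral>\<^sup>+x. ?F x s \<partial>lborel)
      \<le> (\<integral>\<^sup>+x. ennreal B * indicator {0..h} s * (indicator ?L (x + s *\<^sub>R v) * ennreal (norm (g (x + s *\<^sub>R v)))) \<partial>lborel)"
    proof (intro nn_integral_mono)
      fix x
      show "?F x s \<le> ennreal B * indicator {0..h} s * (indicator ?L (x + s *\<^sub>R v) * ennreal (norm (g (x + s *\<^sub>R v))))"
        using \<psi>0[of x] B[of x] B0 mem_sweep[of x K s h v]
        by (cases "x \<in> K"; cases "s \<in> {0..h}")
          (auto simp: ennreal_mult[symmetric] intro!: ennreal_leI mult_right_mono)
    qed
    also have "\<dots> = ennreal B * indicator {0..h} s * (\<integral>\<^sup>+x. indicator ?L (x + s *\<^sub>R v) * ennreal (norm (g (x + s *\<^sub>R v))) \<partial>lborel)"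
      by (intro nn_integral_cmult) measurable
    also have "(\<integral>\<^sup>+x. indicator ?L (x + s *\<^sub>R v) * ennreal (norm (g (x + s *\<^sub>R v))) \<partial>lborel) = (\<integral>\<^sup>+x. indicator ?L x * ennreal (norm (g x)) \<partial>lborel)"
      by (subst nn_integral_lborel_shift[where c = "s *\<^sub>R v", symmetric]) auto
    finally show "(\<integral>\<^sup>+x. ?F x s \<partial>lborel) \<le> ennreal B * indicator {0..h} s * (\<integral>\<^sup>+x. indicator ?L x * ennreal (norm (g x)) \<partial>lborel)" .
  qed
  also have "\<dots> = ennreal B * ennreal h * (\<integral>\<^sup>+x. indicator ?L x * ennreal (norm (g x)) \<partial>lborel)"
    using h by (simp add: nn_integral_cmult nn_integral_multc)
  also have "\<dots> < \<infinity>"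
    using locint_nn_finite[OF g L] by (simp add: ennreal_mult_less_top)
  finally have fin: "(\<integral>\<^sup>+s. \<integral>\<^sup>+x. ?F x s \<partial>lborel \<partial>lborel) < \<infinity>" .
  show ?thesis
  proof (rule integrableI_bounded)
    show "(\<lambda>(x, s). \<psi> x *\<^sub>R indicator {0..h} s *\<^sub>R g (x + s *\<^sub>R v)) \<in> borel_measurable (lborel \<Otimes>\<^sub>M lborel)"
      by measurable
    have "(\<integral>\<^sup>+z. norm ((\<lambda>(x, s). \<psi> x *\<^sub>R indicator {0..h} s *\<^sub>R g (x + s *\<^sub>R v)) z) \<partial>(lborel \<Otimes>\<^sub>M lborel))
       = (\<integral>\<^sup>+s. \<integral>\<^sup>+x. ?F x s \<partial>lborel \<partial>lborel)"
      by (subst lborel_pair.nn_integral_snd[symmetric]) (auto simp: case_prod_beta)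
    then show "(\<integral>\<^sup>+z. norm ((\<lambda>(x, s). \<psi> x *\<^sub>R indicator {0..h} s *\<^sub>R g (x + s *\<^sub>R v)) z) \<partial>(lborel \<Otimes>\<^sub>M lborel)) < \<infinity>"
      using fin by simp
  qed
qed

lemma locint_segment:
  fixes g :: "'a::euclidean_space \<Rightarrow> 'b::euclidean_space"
  assumes g: "locint g" and h: "h \<ge> 0"
  shows "locint (\<lambda>x. LINT s:{0..h}|lborel. g (x + s *\<^sub>R v))"
  unfolding locint_def
proof (intro conjI allI impI)
  have [measurable]: "g \<in> borel_measurable borel" using g by (rule locint_measurable)
  show "(\<lambda>x. LINT s:{0..h}|lborel. g (x + s *\<^sub>R v)) \<in> borel_measurable borel"
    unfolding set_lebesgue_integral_def by measurable
  fix K :: "'a set" assume K: "compact K"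
  then have [measurable]: "K \<in> sets borel" by (simp add: borel_compact)
  have "integrable (lborel \<Otimes>\<^sub>M lborel) (\<lambda>(x, s). indicator K x *\<^sub>R indicator {0..h} s *\<^sub>R g (x + s *\<^sub>R v))"
    by (rule integrable_segment[OF g K h, where B = 1]) (auto simp: indicator_def)
  from lborel_pair.integrable_fst[OF this]
  show "set_integrable lborel K (\<lambda>x. LINT s:{0..h}|lborel. g (x + s *\<^sub>R v))"
    unfolding set_integrable_def set_lebesgue_integral_def by (simp del: scaleR_scaleR)
qed

lemma weak_partialD:
  assumes "weak_partial u v g" "test_fun \<phi>"
  shows "(\<integral>x. frechet_derivative \<phi> (at x) v *\<^sub>R u x \<partial>lborel) = - (\<integral>x. \<phi> x *\<^sub>R g x \<partial>lborel)"
  using assms by (simp add: weak_partial_def)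

text \<open>For fixed \<open>s\<close> the translation is moved from \<open>g\<close> onto
  \<open>\<phi>\<close>, where the weak derivative can be used. The derivative of the translated
  test function is then integrated along the segment by the classical fundamental theorem, and the
  remaining translation is moved back onto \<open>u\<close>.\<close>

lemma weak_partial_test_segment:
  fixes u g :: "'a::euclidean_space \<Rightarrow> 'b::euclidean_space"
  assumes u: "locint u" and g: "locint g" and w: "weak_partial u v g" and h: "h \<ge> 0"
    and \<phi>: "test_fun \<phi>"
  shows "(\<integral>x. \<phi> x *\<^sub>R (LINT s:{0..h}|lborel. g (x + s *\<^sub>R v)) \<partial>lborel)
    = (\<integral>x. \<phi> x *\<^sub>R u (x + h *\<^sub>R v) \<partial>lborel) - (\<integral>x. \<phi> x *\<^sub>R u x \<partial>lborel)"
proof -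
  have [measurable]: "g \<in> borel_measurable borel" "u \<in> borel_measurable borel" "\<phi> \<in> borel_measurable borel"
    "(\<lambda>x. frechet_derivative \<phi> (at x) v) \<in> borel_measurable borel"
    using g u \<phi> by (auto intro: locint_measurable test_fun_measurable test_fun_deriv_measurable)
  obtain K B where K: "compact K" "B > 0" "\<And>x. x \<notin> K \<Longrightarrow> \<phi> x = 0"
    "\<And>x. x \<notin> K \<Longrightarrow> frechet_derivative \<phi> (at x) v = 0"
    "\<And>x. \<bar>\<phi> x\<bar> \<le> B" "\<And>x. \<bar>frechet_derivative \<phi> (at x) v\<bar> \<le> B"
    using test_fun_bounded[OF \<phi>] by metis
  let ?D = "\<lambda>x. frechet_derivative \<phi> (at x) v"
  have I1: "integrable (lborel \<Otimes>\<^sub>M lborel) (\<lambda>(x, s). \<phi> x *\<^sub>R indicator {0..h} s *\<^sub>R g (x + s *\<^sub>R v))"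
    by (rule integrable_segment[OF g K(1) h _ K(3) K(5)]) measurable
  let ?L = "sweep K h v"
  have L: "compact ?L" using compact_sweep[OF K(1)] .
  then have [measurable]: "?L \<in> sets borel" by (simp add: borel_compact)
  \<comment> \<open>With direction 0 the segment lemma gives a plain product majorant:
    \<open>B\<close> times \<open>norm (u x)\<close> on the swept set, times the interval.\<close>
  have "integrable (lborel \<Otimes>\<^sub>M lborel) (\<lambda>(x, s). (B * indicator ?L x) *\<^sub>R indicator {0..h} s *\<^sub>R u (x + s *\<^sub>R 0))"
    using K(2) by (intro integrable_segment[OF u L h, where B = B]) (auto simp: indicator_def)
  then have I2: "integrable (lborel \<Otimes>\<^sub>M lborel) (\<lambda>(x, s). indicator {0..h} s *\<^sub>R ?D (x - s *\<^sub>R v) *\<^sub>R u x)"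
  proof (rule Bochner_Integration.integrable_bound)
    show "(\<lambda>(x, s). indicator {0..h} s *\<^sub>R ?D (x - s *\<^sub>R v) *\<^sub>R u x) \<in> borel_measurable (lborel \<Otimes>\<^sub>M lborel)"
      by measurable
    have "norm (indicator {0..h} s *\<^sub>R ?D (x - s *\<^sub>R v) *\<^sub>R u x)
      \<le> norm ((B * indicator ?L x) *\<^sub>R indicator {0..h} s *\<^sub>R u (x + s *\<^sub>R 0))" for x s
    proof (cases "s \<in> {0..h} \<and> x - s *\<^sub>R v \<in> K")
      case True
      then have "x \<in> ?L" using mem_sweep[of "x - s *\<^sub>R v" K s h v] by simp
      then show ?thesis using True K(2,6) by (auto intro!: mult_right_mono)
    next
      case False
      then have "s \<in> {0..h} \<Longrightarrow> ?D (x - s *\<^sub>R v) = 0" using K(4) by blast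
      then show ?thesis by (cases "s \<in> {0..h}") auto
    qed
    then show "AE z in lborel \<Otimes>\<^sub>M lborel. norm (case z of (x, s) \<Rightarrow> indicator {0..h} s *\<^sub>R ?D (x - s *\<^sub>R v) *\<^sub>R u x)
      \<le> norm (case z of (x, s) \<Rightarrow> (B * indicator ?L x) *\<^sub>R indicator {0..h} s *\<^sub>R u (x + s *\<^sub>R 0))"
      by auto
  qed
  have inner: "(\<integral>x. \<phi> x *\<^sub>R g (x + s *\<^sub>R v) \<partial>lborel) = - (\<integral>x. ?D (x - s *\<^sub>R v) *\<^sub>R u x \<partial>lborel)" for s
  proof -
    have "(\<integral>x. \<phi> x *\<^sub>R g (x + s *\<^sub>R v) \<partial>lborel) = (\<integral>x. \<phi> (x + - s *\<^sub>R v) *\<^sub>R g x \<partial>lborel)"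
      by (subst integral_lborel_shift[where c = "s *\<^sub>R v", symmetric]) auto
    also have "\<dots> = - (\<integral>x. ?D (x + - s *\<^sub>R v) *\<^sub>R u x \<partial>lborel)"
      using weak_partialD[OF w test_fun_shift(1)[OF \<phi>, of "- s *\<^sub>R v"]]
      by (simp only: test_fun_shift(2)[OF \<phi>] minus_minus)
    finally show ?thesis by simp
  qed
  have "(\<integral>x. \<phi> x *\<^sub>R (LINT s:{0..h}|lborel. g (x + s *\<^sub>R v)) \<partial>lborel)
      = (\<integral>x. \<integral>s. \<phi> x *\<^sub>R indicator {0..h} s *\<^sub>R g (x + s *\<^sub>R v) \<partial>lborel \<partial>lborel)"
    unfolding set_lebesgue_integral_def by (simp del: scaleR_scaleR)
  also have "\<dots> = (\<integral>s. \<integral>x. \<phi> x *\<^sub>R indicator {0..h} s *\<^sub>R g (x + s *\<^sub>R v) \<partial>lborel \<partial>lborel)"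
    using lborel_pair.Fubini_integral[OF I1] by simp
  also have "\<dots> = (\<integral>s. - (\<integral>x. indicator {0..h} s *\<^sub>R ?D (x - s *\<^sub>R v) *\<^sub>R u x \<partial>lborel) \<partial>lborel)"
    using inner
    by (intro Bochner_Integration.integral_cong refl)
      (simp add: scaleR_left_commute[of _ "indicator {0..h} s" for s] del: scaleR_scaleR)
  also have "\<dots> = - (\<integral>x. \<integral>s. indicator {0..h} s *\<^sub>R ?D (x - s *\<^sub>R v) *\<^sub>R u x \<partial>lborel \<partial>lborel)"
    using lborel_pair.Fubini_integral[OF I2] by simp
  also have "(\<integral>x. \<integral>s. indicator {0..h} s *\<^sub>R ?D (x - s *\<^sub>R v) *\<^sub>R u x \<partial>lborel \<partial>lborel)
     = (\<integral>x. (\<phi> x - \<phi> (x - h *\<^sub>R v)) *\<^sub>R u x \<partial>lborel)"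
  proof (intro Bochner_Integration.integral_cong refl)
    fix x
    have "continuous_on {0..h} (\<lambda>s. ?D (x - s *\<^sub>R v))"
      by (rule continuous_on_compose2[OF test_fun_deriv_continuous[OF \<phi>, of UNIV v]])
        (auto intro!: continuous_intros)
    then have int: "integrable lborel (\<lambda>s. indicator {0..h} s *\<^sub>R ?D (x - s *\<^sub>R v))"
      by (rule borel_integrable_atLeastAtMost'[unfolded set_integrable_def])
    have "(\<integral>s. indicator {0..h} s *\<^sub>R ?D (x - s *\<^sub>R v) *\<^sub>R u x \<partial>lborel)
       = (\<integral>s. (indicator {0..h} s *\<^sub>R ?D (x - s *\<^sub>R v)) *\<^sub>R u x \<partial>lborel)" by simp
    also have "\<dots> = (\<integral>s. indicator {0..h} s *\<^sub>R ?D (x - s *\<^sub>R v) \<partial>lborel) *\<^sub>R u x"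
      by (intro integral_scaleR_left int)
    also have "\<dots> = (\<phi> x - \<phi> (x - h *\<^sub>R v)) *\<^sub>R u x"
      using test_fun_segment_integral[OF \<phi> h] by (simp add: set_lebesgue_integral_def)
    finally show "(\<integral>s. indicator {0..h} s *\<^sub>R ?D (x - s *\<^sub>R v) *\<^sub>R u x \<partial>lborel) = (\<phi> x - \<phi> (x - h *\<^sub>R v)) *\<^sub>R u x" .
  qed
  also have "\<dots> = (\<integral>x. \<phi> x *\<^sub>R u x \<partial>lborel) - (\<integral>x. \<phi> (x - h *\<^sub>R v) *\<^sub>R u x \<partial>lborel)"
    using test_fun_integrable(1)[OF \<phi> u] test_fun_integrable(1)[OF test_fun_shift(1)[OF \<phi>, of "- h *\<^sub>R v"] u]
    by (simp add: scaleR_left_diff_distrib)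
  also have "(\<integral>x. \<phi> (x - h *\<^sub>R v) *\<^sub>R u x \<partial>lborel) = (\<integral>x. \<phi> x *\<^sub>R u (x + h *\<^sub>R v) \<partial>lborel)"
    by (subst integral_lborel_shift[where c = "h *\<^sub>R v", symmetric]) auto
  finally show ?thesis by simp
qed


text \<open>Both sides have the same integral against every test function. The exceptional null set
  may depend on \<open>h\<close>, which is why a separate argument is needed later to obtain
  continuous slice averages.\<close>

theorem weak_partial_segment:
  fixes u g :: "'a::euclidean_space \<Rightarrow> 'b::euclidean_space"
  assumes u: "locint u" and g: "locint g" and w: "weak_partial u v g" and h: "h \<ge> 0"
  shows "AE x in lborel. u (x + h *\<^sub>R v) - u x = (LINT s:{0..h}|lborel. g (x + s *\<^sub>R v))"
proof -
  let ?f = "\<lambda>x. u (x + h *\<^sub>R v) - u x - (LINT s:{0..h}|lborel. g (x + s *\<^sub>R v))"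
  have f: "locint ?f"
    by (intro locint_diff locint_shift locint_segment u g h)
  have "AE x in lborel. ?f x = 0"
  proof (rule du_Bois_Reymond[OF f])
    fix \<phi> :: "'a \<Rightarrow> real" assume \<phi>: "test_fun \<phi>"
    have "(\<integral>x. \<phi> x *\<^sub>R ?f x \<partial>lborel) = (\<integral>x. \<phi> x *\<^sub>R u (x + h *\<^sub>R v) \<partial>lborel) - (\<integral>x. \<phi> x *\<^sub>R u x \<partial>lborel)
       - (\<integral>x. \<phi> x *\<^sub>R (LINT s:{0..h}|lborel. g (x + s *\<^sub>R v)) \<partial>lborel)"
      unfolding scaleR_right_diff_distrib
      using test_fun_integrable(1)[OF \<phi> locint_shift[OF u, of "h *\<^sub>R v"]] test_fun_integrable(1)[OF \<phi> u]
        test_fun_integrable(1)[OF \<phi> locint_segment[OF g h, of v]]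
      by (simp add: Bochner_Integration.integral_diff Bochner_Integration.integrable_diff)
    then show "(\<integral>x. \<phi> x *\<^sub>R ?f x \<partial>lborel) = 0"
      using weak_partial_test_segment[OF u g w h \<phi>] by simp
  qed
  then show ?thesis by eventually_elim simp
qed

lemma weak_partial_unique:
  fixes u g g' :: "'a::euclidean_space \<Rightarrow> 'b::euclidean_space"
  assumes "locint g" "locint g'" "weak_partial u v g" "weak_partial u v g'"
  shows "AE x in lborel. g x = g' x"
proof -
  have "AE x in lborel. g x - g' x = 0"
  proof (rule du_Bois_Reymond[OF locint_diff[OF assms(1,2)]])
    fix \<phi> :: "'a \<Rightarrow> real" assume \<phi>: "test_fun \<phi>"
    show "(\<integral>x. \<phi> x *\<^sub>R (g x - g' x) \<partial>lborel) = 0"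
      using weak_partialD[OF assms(3) \<phi>] weak_partialD[OF assms(4) \<phi>]
        test_fun_integrable(1)[OF \<phi> assms(1)] test_fun_integrable(1)[OF \<phi> assms(2)]
      by (simp add: scaleR_right_diff_distrib)
  qed
  then show ?thesis by eventually_elim simp
qed

lemma weak_partialI:
  assumes "locint u" "locint g"
    and "\<And>\<phi>. test_fun \<phi> \<Longrightarrow> (\<integral>x. frechet_derivative \<phi> (at x) v *\<^sub>R u x \<partial>lborel) = - (\<integral>x. \<phi> x *\<^sub>R g x \<partial>lborel)"
  shows "weak_partial u v g"
  unfolding weak_partial_def using test_fun_integrable assms by blast

lemma weak_partial_shift:
  fixes u g :: "'a::euclidean_space \<Rightarrow> 'b::euclidean_space"
  assumes u: "locint u" and g: "locint g" and w: "weak_partial u v g"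
  shows "weak_partial (\<lambda>x. u (x + c)) v (\<lambda>x. g (x + c))"
proof (rule weak_partialI[OF locint_shift[OF u] locint_shift[OF g]])
  fix \<phi> :: "'a \<Rightarrow> real" assume \<phi>: "test_fun \<phi>"
  have [measurable]: "g \<in> borel_measurable borel" "u \<in> borel_measurable borel" "\<phi> \<in> borel_measurable borel"
    "(\<lambda>x. frechet_derivative \<phi> (at x) v) \<in> borel_measurable borel"
    using g u \<phi> by (auto intro: locint_measurable test_fun_measurable test_fun_deriv_measurable)
  have "(\<integral>x. frechet_derivative \<phi> (at x) v *\<^sub>R u (x + c) \<partial>lborel)
     = (\<integral>x. frechet_derivative \<phi> (at (x + - c)) v *\<^sub>R u x \<partial>lborel)"
    by (subst integral_lborel_shift[where c = c, symmetric]) auto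
  also have "\<dots> = - (\<integral>x. \<phi> (x + - c) *\<^sub>R g x \<partial>lborel)"
    using weak_partialD[OF w test_fun_shift(1)[OF \<phi>, of "- c"]]
    by (simp only: test_fun_shift(2)[OF \<phi>])
  also have "(\<integral>x. \<phi> (x + - c) *\<^sub>R g x \<partial>lborel) = (\<integral>x. \<phi> x *\<^sub>R g (x + c) \<partial>lborel)"
    by (subst integral_lborel_shift[where c = c, symmetric]) auto
  finally show "(\<integral>x. frechet_derivative \<phi> (at x) v *\<^sub>R u (x + c) \<partial>lborel) = - (\<integral>x. \<phi> x *\<^sub>R g (x + c) \<partial>lborel)" .
qed

section \<open>Slabs and periodicity\<close>

definition ebas :: "'m \<Rightarrow> real \<times> (real^'m)" where
  "ebas i = (0, axis i 1)"

lemma Basis_cyl: "(Basis :: (real \<times> (real^'m)) set) = insert (1, 0) (range ebas)"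
  by (auto simp: Basis_prod_def Basis_vec_def ebas_def)

lemma ebas_Basis [simp]: "ebas i \<in> Basis"
  by (simp add: Basis_cyl)

lemma e1_Basis [simp]: "(1, 0) \<in> (Basis :: (real \<times> (real^'m)) set)"
  by (simp add: Basis_cyl)

lemma inner_ebas [simp]: "x \<bullet> ebas i = snd x $ i"
  by (cases x) (simp add: ebas_def inner_axis)

lemma inner_e1: "x \<bullet> (1, 0) = fst (x :: real \<times> (real^'m))"
  by (cases x) simp

lemma fst_ebas [simp]: "fst (ebas i) = 0"
  and snd_ebas [simp]: "snd (ebas i) = axis i 1"
  by (auto simp: ebas_def)

lemma periodic_cyl_iff: "periodic_cyl f \<longleftrightarrow> (\<forall>x i. f (x + ebas i) = f x)"
  unfolding periodic_cyl_def by (auto simp: ebas_def)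

text \<open>Half-open, so that its integer translates tile the space without overlap and integrals
  of periodic functions can be shifted exactly. It differs from the closed cell by a null set
  only.\<close>

definition box0 :: "(real^'m) set" where
  "box0 = {y. \<forall>i. 0 \<le> y $ i \<and> y $ i < 1}"

definition slab :: "real set \<Rightarrow> (real \<times> (real^'m)) set" where
  "slab I = I \<times> box0"

lemma mem_slab: "x \<in> slab I \<longleftrightarrow> fst x \<in> I \<and> (\<forall>i. 0 \<le> snd x $ i \<and> snd x $ i < 1)"
  by (auto simp: slab_def box0_def mem_Times_iff)

lemma measurable_box0 [measurable]: "box0 \<in> sets borel"
  unfolding box0_def by measurable

lemma measurable_slab [measurable]: "I \<in> sets borel \<Longrightarrow> slab I \<in> sets borel"
  unfolding slab_def by (simp add: borel_prod[symmetric])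

lemma measurable_fst_borel [measurable]:
  "fst \<in> (borel :: ('a::euclidean_space \<times> 'b::euclidean_space) measure) \<rightarrow>\<^sub>M borel"
  by (intro borel_measurable_continuous_onI continuous_intros)

lemma measurable_snd_borel [measurable]:
  "snd \<in> (borel :: ('a::euclidean_space \<times> 'b::euclidean_space) measure) \<rightarrow>\<^sub>M borel"
  by (intro borel_measurable_continuous_onI continuous_intros)

lemma measurable_grad_sq:
  assumes "\<And>b. b \<in> Basis \<Longrightarrow> (\<lambda>x. Du x b) \<in> borel_measurable borel"
  shows "grad_sq Du \<in> borel_measurable borel"
  unfolding grad_sq_def[abs_def]
proof (intro borel_measurable_sum)
  fix b :: 'a assume "b \<in> Basis"
  note [measurable] = assms[OF this]
  show "(\<lambda>x. (norm (Du x b))\<^sup>2) \<in> borel_measurable borel" by measurable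
qed

lemma AE_lborel_hyperplane:
  fixes b :: "'a::euclidean_space"
  assumes "b \<in> Basis"
  shows "AE x in lborel. x \<bullet> b \<noteq> c"
proof -
  have [measurable]: "{x. x \<bullet> b = c} \<in> sets borel" by measurable
  have "{x. x \<bullet> b = c} \<in> null_sets lebesgue"
    using negligible_standard_hyperplane[OF assms, of c] by (simp add: negligible_iff_null_sets)
  then have "{x. x \<bullet> b = c} \<in> null_sets lborel"
    by (subst (asm) null_sets_completion_iff) auto
  then show ?thesis
    by (rule AE_I') auto
qed

lemma mem_cbox_One: "y \<in> cbox 0 (One :: real^'m) \<longleftrightarrow> (\<forall>i. 0 \<le> y $ i \<and> y $ i \<le> 1)"
proof -
  have "(One :: real^'m) $ i = 1" for i
    using inner_sum_Basis[of "axis i (1::real)"] by (simp add: inner_axis del: inner_sum_Basis)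
  then show ?thesis by (simp add: mem_box_cart)
qed

lemma cell_measurable [measurable]: "cell \<in> sets borel"
  unfolding cell_def by (intro borel_closed closed_Times) auto

lemma AE_slab: "AE x in lborel. x \<in> I \<times> cbox 0 (One :: real^'m) \<longleftrightarrow> x \<in> slab I"
proof -
  have "AE x :: real \<times> (real^'m) in lborel. \<forall>i. snd x $ i \<noteq> 1"
  proof (subst AE_all_countable, intro allI)
    show "AE x in lborel. snd (x :: real \<times> (real^'m)) $ i \<noteq> 1" for i
      using AE_lborel_hyperplane[OF ebas_Basis, of i 1] by simp
  qed
  then show ?thesis
    by eventually_elim (auto simp: mem_slab mem_Times_iff mem_cbox_One order_less_le)
qed

lemma AE_box0: "AE y in lborel. y \<in> cbox 0 (One :: real^'m) \<longleftrightarrow> y \<in> box0"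
proof -
  have "AE y :: real^'m in lborel. \<forall>i. y $ i \<noteq> 1"
  proof (subst AE_all_countable, intro allI)
    show "AE y in lborel. (y :: real^'m) $ i \<noteq> 1" for i
      using AE_lborel_hyperplane[of "axis i (1::real)" 1] by (simp add: inner_axis)
  qed
  then show ?thesis
    by eventually_elim (auto simp: box0_def mem_cbox_One order_less_le)
qed

lemma emeasure_box0 [simp]: "emeasure lborel (box0 :: (real^'m) set) = 1"
proof -
  have "emeasure lborel (box0 :: (real^'m) set) = emeasure lborel (cbox 0 (One :: real^'m))"
    using AE_box0 by (intro emeasure_eq_AE) auto
  also have "\<dots> = 1" by (subst emeasure_lborel_cbox) auto
  finally show ?thesis .
qed

lemma emeasure_slab:
  "I \<in> sets borel \<Longrightarrow> emeasure lborel (slab I :: (real \<times> (real^'m)) set) = emeasure lborel I"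
  unfolding slab_def lborel_prod[symmetric] by (simp add: lborel.emeasure_pair_measure_Times)

lemma periodic_int:
  assumes "\<And>x. f (x + b) = f x"
  shows "f (x + of_int n *\<^sub>R b) = f (x::'a::real_vector)"
proof (induction n arbitrary: x rule: int_induct[where k = 0])
  case (step1 i)
  have "f (x + of_int (i + 1) *\<^sub>R b) = f ((x + of_int i *\<^sub>R b) + b)"
    by (simp add: algebra_simps)
  then show ?case using assms step1 by simp
next
  case (step2 i)
  have "f (x + of_int (i - 1) *\<^sub>R b) = f ((x + of_int (i - 1) *\<^sub>R b) + b)"
    using assms by simp
  also have "\<dots> = f (x + of_int i *\<^sub>R b)" by (simp add: algebra_simps)
  finally show ?case using step2 by simp
qed simp

text \<open>The strip of width 1 is cut at an integer hyperplane and the upper piece is moved down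
  by one period; the two pieces then form a strip between consecutive integers.\<close>

lemma nn_integral_period:
  fixes f :: "'a::euclidean_space \<Rightarrow> ennreal"
  assumes [measurable]: "f \<in> borel_measurable borel"
    and per: "\<And>x. f (x + b) = f x" and b: "b \<bullet> b = 1"
  shows "(\<integral>\<^sup>+x. f x * indicator {x. c \<le> x \<bullet> b \<and> x \<bullet> b < c + 1} x \<partial>lborel)
    = (\<integral>\<^sup>+x. f x * indicator {x. 0 \<le> x \<bullet> b \<and> x \<bullet> b < 1} x \<partial>lborel)"
proof -
  define J where "J p q = (\<integral>\<^sup>+x. f x * indicator {x. p \<le> x \<bullet> b \<and> x \<bullet> b < q} x \<partial>lborel)" for p q
  have shift: "J (p + of_int n) (q + of_int n) = J p q" for p q n
  proof -
    have "J (p + of_int n) (q + of_int n) = (\<integral>\<^sup>+x. f (x + of_int n *\<^sub>R b) *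
        indicator {x. p + of_int n \<le> x \<bullet> b \<and> x \<bullet> b < q + of_int n} (x + of_int n *\<^sub>R b) \<partial>lborel)"
      unfolding J_def by (subst nn_integral_lborel_shift[where c = "of_int n *\<^sub>R b", symmetric]) auto
    also have "\<dots> = J p q"
      unfolding J_def periodic_int[of f, OF per]
      by (intro nn_integral_cong) (auto simp: indicator_def inner_add_left b)
    finally show ?thesis .
  qed
  have add: "J p q + J q r = J p r" if "p \<le> q" "q \<le> r" for p q r
    unfolding J_def using that
    by (subst nn_integral_add[symmetric]) (auto simp: indicator_def intro!: nn_integral_cong)
  define k where "k = \<lceil>c\<rceil>"
  have k: "c \<le> of_int k" "of_int k - 1 \<le> c" unfolding k_def by linarith+
  have "J c (c + 1) = J c (of_int k) + J (of_int k) (c + 1)" using k by (simp add: add)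
  also have "J (of_int k) (c + 1) = J (of_int k - 1) c"
    using shift[of "of_int k - 1" 1 c] by simp
  also have "J c (of_int k) + J (of_int k - 1) c = J (of_int k - 1) (of_int k)"
    using add[of "of_int k - 1" c "of_int k"] k by (simp add: add.commute)
  also have "\<dots> = J 0 1" using shift[of 0 "k - 1" 1] by simp
  finally show ?thesis unfolding J_def .
qed

lemma nn_integral_slab_shift:
  fixes f :: "real \<times> (real^'m) \<Rightarrow> ennreal"
  assumes [measurable]: "f \<in> borel_measurable borel" "I \<in> sets borel" and per: "periodic_cyl f"
  shows "(\<integral>\<^sup>+x\<in>slab I. f (x + c *\<^sub>R ebas i) \<partial>lborel) = (\<integral>\<^sup>+x\<in>slab I. f x \<partial>lborel)"
proof -
  \<comment> \<open>The slab with the constraint on coordinate \<open>i\<close> removed. It is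
    invariant under translation along \<open>ebas i\<close>, so \<open>f\<close> cut off to it is
    still periodic in that direction and the period argument applies.\<close>
  define H :: "(real \<times> (real^'m)) set" where
    "H = {x. fst x \<in> I \<and> (\<forall>j. j \<noteq> i \<longrightarrow> 0 \<le> snd x $ j \<and> snd x $ j < 1)}"
  have [measurable]: "H \<in> sets borel" unfolding H_def by measurable
  have H: "x + c *\<^sub>R ebas i \<in> H \<longleftrightarrow> x \<in> H" for x c
    by (auto simp: H_def axis_def)
  have H1: "x + ebas i \<in> H \<longleftrightarrow> x \<in> H" for x using H[of x 1] by simp
  define h where "h x = f x * indicator H x" for x
  have [measurable]: "h \<in> borel_measurable borel" unfolding h_def by measurable
  have hper: "h (x + ebas i) = h x" for x
    using per[unfolded periodic_cyl_iff, rule_format, of x i] H1[of x] by (simp add: h_def indicator_def)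
  have slab_iff: "x \<in> slab I \<longleftrightarrow> x \<in> H \<and> 0 \<le> x \<bullet> ebas i \<and> x \<bullet> ebas i < 1" for x
    by (simp add: mem_slab H_def) metis
  have b: "ebas i \<bullet> (ebas i :: real \<times> (real^'m)) = 1" by (simp add: axis_def)
  have "(\<integral>\<^sup>+x\<in>slab I. f (x + c *\<^sub>R ebas i) \<partial>lborel)
     = (\<integral>\<^sup>+x. h (x + c *\<^sub>R ebas i) * indicator {x. c \<le> x \<bullet> ebas i \<and> x \<bullet> ebas i < c + 1} (x + c *\<^sub>R ebas i) \<partial>lborel)"
    by (intro nn_integral_cong) (simp add: h_def indicator_def slab_iff H axis_def)
  also have "\<dots> = (\<integral>\<^sup>+x. h x * indicator {x. c \<le> x \<bullet> ebas i \<and> x \<bullet> ebas i < c + 1} x \<partial>lborel)"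
    by (rule nn_integral_lborel_shift) measurable
  also have "\<dots> = (\<integral>\<^sup>+x. h x * indicator {x. 0 \<le> x \<bullet> ebas i \<and> x \<bullet> ebas i < 1} x \<partial>lborel)"
    by (rule nn_integral_period) (use hper b in auto)
  also have "\<dots> = (\<integral>\<^sup>+x\<in>slab I. f x \<partial>lborel)"
    by (intro nn_integral_cong) (simp add: h_def indicator_def slab_iff)
  finally show ?thesis .
qed

lemma nn_integral_slab_UNIV_shift:
  fixes f :: "real \<times> (real^'m) \<Rightarrow> ennreal"
  assumes [measurable]: "f \<in> borel_measurable borel"
  shows "(\<integral>\<^sup>+x\<in>slab UNIV. f (x + c *\<^sub>R (1, 0)) \<partial>lborel) = (\<integral>\<^sup>+x\<in>slab UNIV. f x \<partial>lborel)"
proof -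
  have "(\<integral>\<^sup>+x\<in>slab UNIV. f x \<partial>lborel) = (\<integral>\<^sup>+x. f (x + c *\<^sub>R (1, 0)) * indicator (slab UNIV) (x + c *\<^sub>R (1, 0)) \<partial>lborel)"
    by (subst nn_integral_lborel_shift[where c = "c *\<^sub>R (1, 0)", symmetric]) auto
  then show ?thesis by (simp add: indicator_def mem_slab)
qed

text \<open>Reduction of the torus coordinates modulo 1. Composition with it turns an almost
  everywhere periodic function into one that is periodic at every point.\<close>

definition wrap :: "real \<times> (real^'m) \<Rightarrow> real \<times> (real^'m)" where
  "wrap x = (fst x, \<chi> i. frac (snd x $ i))"

lemma measurable_wrap [measurable]: "wrap \<in> borel \<rightarrow>\<^sub>M borel"
proof -
  have [measurable]: "(\<lambda>x. snd x $ i) \<in> borel_measurable (borel :: (real \<times> (real^'m)) measure)" for i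
    by (rule measurable_compose[OF measurable_snd_borel borel_measurable_nth])
  have "(\<lambda>x. (\<chi> i. frac (snd x $ i)) :: real^'m) \<in> borel_measurable (borel :: (real \<times> (real^'m)) measure)"
    unfolding frac_def
    by (subst borel_measurable_euclidean_space) (auto simp: Basis_vec_def inner_axis)
  then show ?thesis unfolding wrap_def[abs_def] by measurable
qed

lemma wrap_add_ebas: "wrap (x + ebas i) = wrap x"
  by (auto simp: wrap_def vec_eq_iff axis_def frac_def)

text \<open>There are only countably many integer translations, so all the identities hold
  simultaneously off one null set; at a point outside it, translate by minus the integer parts of
  the coordinates.\<close>

lemma AE_eq_wrap:
  fixes g :: "real \<times> (real^'m) \<Rightarrow> 'b"
  assumes "\<And>i. AE x in lborel. g (x + ebas i) = g x"
  shows "AE x in lborel. g (wrap x) = g x"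
proof -
  define P where "P c \<longleftrightarrow> (AE x in lborel. g (x + c) = g x)" for c
  have P_add: "P (c + d)" if "P c" "P d" for c d
    using AE_lborel_shift[OF that(1)[unfolded P_def], of d] that(2) unfolding P_def
    by eventually_elim (simp add: ac_simps)
  have P_neg: "P (- c)" if "P c" for c
    using AE_lborel_shift[OF that[unfolded P_def], of "- c"] unfolding P_def
    by eventually_elim simp
  have P0: "P 0" by (simp add: P_def)
  have P_nat: "P (real n *\<^sub>R ebas i)" for n i
  proof (induction n)
    case (Suc n)
    have "P (ebas i)" using assms by (simp add: P_def)
    from P_add[OF this Suc] show ?case by (simp add: scaleR_left_distrib)
  qed (simp add: P0)
  have P_int: "P (of_int n *\<^sub>R ebas i)" for n i
  proof (cases "n \<ge> 0")
    case True
    then show ?thesis using P_nat[of "nat n"] by simp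
  next
    case False
    then show ?thesis using P_neg[OF P_nat[of "nat (- n)"]] by simp
  qed
  have P_sum: "P (\<Sum>i\<in>A. of_int (n i) *\<^sub>R ebas i)" if "finite A" for A and n :: "'m \<Rightarrow> int"
    using that by (induction A) (auto intro: P0 P_add P_int)
  have "AE x in lborel. \<forall>n :: 'm \<Rightarrow> int. g (x + (\<Sum>i\<in>UNIV. of_int (n i) *\<^sub>R ebas i)) = g x"
    using P_sum[of UNIV] unfolding P_def by (subst AE_all_countable) auto
  then show ?thesis
  proof eventually_elim
    case (elim x)
    have "x + (\<Sum>i\<in>UNIV. of_int (- \<lfloor>snd x $ i\<rfloor>) *\<^sub>R ebas i) = wrap x"
      by (auto simp: prod_eq_iff wrap_def vec_eq_iff fst_sum snd_sum axis_def frac_def if_distrib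
          cong: if_cong)
    then show ?case using elim[rule_format, of "\<lambda>i. - \<lfloor>snd x $ i\<rfloor>"] by simp
  qed
qed

lemma L2loc_cong_AE:
  assumes "L2loc f" and [measurable]: "g \<in> borel_measurable borel" and "AE x in lborel. g x = f x"
  shows "L2loc g"
  unfolding L2loc_def
proof (intro conjI allI impI)
  fix K :: "'a set" assume K: "compact K"
  have [measurable]: "f \<in> borel_measurable borel" using assms(1) by (rule L2loc_measurable)
  have [measurable]: "K \<in> sets borel" using K by (simp add: borel_compact)
  have "set_integrable lborel K (\<lambda>x. (norm (f x))\<^sup>2)" using assms(1) K by (simp add: L2loc_def)
  then show "set_integrable lborel K (\<lambda>x. (norm (g x))\<^sup>2)"
    unfolding set_integrable_def
    by (rule integrable_cong_AE_imp) (use assms(3) in auto)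
qed simp

lemma weak_partial_cong_AE:
  assumes "weak_partial u v f" "locint u" "locint f" "locint g" "AE x in lborel. g x = f x"
  shows "weak_partial u v g"
proof (rule weak_partialI[OF assms(2,4)])
  fix \<phi> :: "'a \<Rightarrow> real" assume \<phi>: "test_fun \<phi>"
  have "(\<integral>x. \<phi> x *\<^sub>R g x \<partial>lborel) = (\<integral>x. \<phi> x *\<^sub>R f x \<partial>lborel)"
    using test_fun_integrable(1)[OF \<phi> assms(3)] test_fun_integrable(1)[OF \<phi> assms(4)] assms(5)
    by (intro integral_cong_AE) auto
  then show "(\<integral>x. frechet_derivative \<phi> (at x) v *\<^sub>R u x \<partial>lborel) = - (\<integral>x. \<phi> x *\<^sub>R g x \<partial>lborel)"
    using weak_partialD[OF assms(1) \<phi>] by simp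
qed

text \<open>\<open>H1div\<close> asks periodicity of \<open>u\<close> only. A gradient that is
  periodic at every point lets slab integrals of gradient terms be translated without null-set
  bookkeeping.\<close>

definition H1per ::
  "(real \<times> (real^'m) \<Rightarrow> real \<times> (real^'m)) \<Rightarrow> (real \<times> (real^'m) \<Rightarrow> real \<times> (real^'m) \<Rightarrow> real \<times> (real^'m)) \<Rightarrow> bool" where
  "H1per u Du \<longleftrightarrow> H1div u Du \<and> (\<forall>b. periodic_cyl (\<lambda>x. Du x b))"

lemma H1div_D:
  assumes "H1div u Du"
  shows "periodic_cyl u" "L2loc u" "locint u" "u \<in> borel_measurable borel"
    "b \<in> Basis \<Longrightarrow> L2loc (\<lambda>x. Du x b)" "b \<in> Basis \<Longrightarrow> locint (\<lambda>x. Du x b)"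
    "b \<in> Basis \<Longrightarrow> (\<lambda>x. Du x b) \<in> borel_measurable borel"
    "b \<in> Basis \<Longrightarrow> weak_partial u b (\<lambda>x. Du x b)" "set_integrable lborel cell (grad_sq Du)"
    "AE x in lborel. divergence Du x = 0"
  using assms by (auto simp: H1div_def intro: L2loc_locint L2loc_measurable)

text \<open>Translation by a period leaves \<open>u\<close> unchanged, so uniqueness of weak
  derivatives makes \<open>Du\<close> periodic almost everywhere. Composition with
  \<open>wrap\<close> corrects it on a null set, which does not affect the energy.\<close>

lemma H1div_imp_H1per:
  assumes "H1div u Du"
  obtains Du' where "H1per u Du'" "AE x in lborel. \<forall>b\<in>Basis. Du' x b = Du x b"
proof -
  note D = H1div_D[OF assms]
  define Du' where "Du' x b = Du (wrap x) b" for x b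
  have ae: "AE x in lborel. Du (wrap x) b = Du x b" if b: "b \<in> Basis" for b
  proof (rule AE_eq_wrap)
    fix i
    have "(\<lambda>x. u (x + ebas i)) = u" using D(1) by (auto simp: periodic_cyl_iff)
    then have "weak_partial u b (\<lambda>x. Du (x + ebas i) b)"
      using weak_partial_shift[OF D(3) D(6)[OF b] D(8)[OF b], of "ebas i"] by simp
    then show "AE x in lborel. Du (x + ebas i) b = Du x b"
      using weak_partial_unique[OF locint_shift[OF D(6)[OF b]] D(6)[OF b] _ D(8)[OF b]] by blast
  qed
  then have ae_all: "AE x in lborel. \<forall>b\<in>Basis. Du' x b = Du x b"
    unfolding Du'_def by (intro AE_finite_allI) auto
  have L2: "L2loc (\<lambda>x. Du' x b)" if b: "b \<in> Basis" for b
    unfolding Du'_def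
    by (rule L2loc_cong_AE[OF D(5)[OF b] _ ae[OF b]]) (use D(7)[OF b] in measurable)
  have grad: "set_integrable lborel cell (grad_sq Du')"
    unfolding set_integrable_def
  proof (rule integrable_cong_AE_imp[OF D(9)[unfolded set_integrable_def]])
    show "(\<lambda>x. indicator cell x *\<^sub>R grad_sq Du' x) \<in> borel_measurable lborel"
      using measurable_grad_sq[OF L2loc_measurable[OF L2]] cell_measurable by measurable
    show "AE x in lborel. indicator cell x *\<^sub>R grad_sq Du x = indicator cell x *\<^sub>R grad_sq Du' x"
      using ae_all by eventually_elim (simp add: grad_sq_def)
  qed
  have "AE x in lborel. divergence Du' x = 0"
    using ae_all D(10) by eventually_elim (simp add: divergence_def)
  moreover have "weak_partial u b (\<lambda>x. Du' x b)" if b: "b \<in> Basis" for b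
    using weak_partial_cong_AE[OF D(8)[OF b] D(3) D(6)[OF b] L2loc_locint[OF L2[OF b]]] ae[OF b]
    by (simp add: Du'_def)
  ultimately have "H1div u Du'"
    unfolding H1div_def using D(1,2) L2 grad by blast
  moreover have "periodic_cyl (\<lambda>x. Du' x b)" for b
    by (simp add: Du'_def periodic_cyl_iff wrap_add_ebas)
  ultimately show thesis using that ae_all by (auto simp: H1per_def)
qed

section \<open>Translation estimates\<close>

lemma norm_add_sq_le:
  fixes x y :: "'a::real_normed_vector"
  shows "(norm (x + y))\<^sup>2 \<le> 2 * (norm x)\<^sup>2 + 2 * (norm y)\<^sup>2"
proof -
  have "(norm (x + y))\<^sup>2 \<le> (norm x + norm y)\<^sup>2"
    by (intro power_mono norm_triangle_ineq) simp
  also have "\<dots> \<le> 2 * (norm x)\<^sup>2 + 2 * (norm y)\<^sup>2"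
    using zero_le_power2[of "norm x - norm y"] by (simp add: power2_eq_square algebra_simps)
  finally show ?thesis .
qed

text \<open>Valued in \<open>ennreal\<close>, so that L^2 quantities make sense, possibly as
  infinity, before any integrability is known and Tonelli applies freely.\<close>

definition nsq :: "'a::real_normed_vector \<Rightarrow> ennreal" where
  "nsq x = ennreal ((norm x)\<^sup>2)"

lemma nsq_0 [simp]: "nsq 0 = 0" by (simp add: nsq_def)
lemma nsq_eq_0_iff: "nsq x = 0 \<longleftrightarrow> x = 0" by (simp add: nsq_def ennreal_eq_0_iff)
lemma nsq_minus: "nsq (x - y) = nsq (y - x)" by (simp add: nsq_def norm_minus_commute)
lemma nsq_uminus [simp]: "nsq (- x) = nsq x" by (simp add: nsq_def)
lemma nsq_less_top [simp]: "nsq x < \<infinity>" "nsq x \<noteq> \<infinity>" by (auto simp: nsq_def)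

lemma nsq_add_le: "nsq (x + y) \<le> 2 * nsq x + 2 * nsq y"
proof -
  have "nsq (x + y) \<le> ennreal (2 * (norm x)\<^sup>2 + 2 * (norm y)\<^sup>2)"
    unfolding nsq_def by (intro ennreal_leI norm_add_sq_le)
  then show ?thesis by (simp add: nsq_def ennreal_plus ennreal_mult)
qed

lemma nsq_triangle: "nsq (x - z) \<le> 2 * nsq (x - y) + 2 * nsq (y - z)"
  using nsq_add_le[of "x - y" "y - z"] by simp

lemma nsq_scaleR: "nsq (c *\<^sub>R x) = ennreal (c\<^sup>2) * nsq x"
  by (simp add: nsq_def ennreal_mult[symmetric] power_mult_distrib)

lemma measurable_nsq [measurable]: "nsq \<in> borel_measurable (borel :: 'a::{real_normed_vector,second_countable_topology} measure)"
  unfolding nsq_def[abs_def] by measurable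

text \<open>Cauchy-Schwarz against the indicator of \<open>A\<close>. Where the integral does not
  exist its value is 0 by convention, and the bound is trivial.\<close>

lemma nsq_set_integral_le:
  fixes f :: "'a \<Rightarrow> 'b::{banach,second_countable_topology}"
  assumes [measurable]: "A \<in> sets M" "f \<in> borel_measurable M"
  shows "nsq (LINT s:A|M. f s) \<le> emeasure M A * (\<integral>\<^sup>+s\<in>A. nsq (f s) \<partial>M)"
proof (cases "integrable M (\<lambda>s. indicator A s *\<^sub>R f s)")
  case True
  let ?g = "\<lambda>s. ennreal (norm (f s)) * indicator A s"
  have "ennreal (norm (LINT s:A|M. f s)) \<le> (\<integral>\<^sup>+s. ennreal (norm (indicator A s *\<^sub>R f s)) \<partial>M)"
    unfolding set_lebesgue_integral_def by (rule integral_norm_bound_ennreal[OF True])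
  also have "\<dots> = (\<integral>\<^sup>+s. indicator A s * ?g s \<partial>M)"
    by (intro nn_integral_cong) (auto simp: indicator_def)
  finally have "(ennreal (norm (LINT s:A|M. f s)))\<^sup>2 \<le> (\<integral>\<^sup>+s. indicator A s * ?g s \<partial>M)\<^sup>2"
    by (intro power_mono) auto
  also have "\<dots> \<le> (\<integral>\<^sup>+s. (indicator A s)\<^sup>2 \<partial>M) * (\<integral>\<^sup>+s. (?g s)\<^sup>2 \<partial>M)"
    by (rule Cauchy_Schwarz_nn_integral) measurable
  also have "(\<integral>\<^sup>+s. (indicator A s)\<^sup>2 \<partial>M) = (\<integral>\<^sup>+s. indicator A s \<partial>M)"
    by (intro nn_integral_cong) (auto simp: indicator_def)
  also have "\<dots> = emeasure M A" by simp
  also have "(\<integral>\<^sup>+s. (?g s)\<^sup>2 \<partial>M) = (\<integral>\<^sup>+s\<in>A. nsq (f s) \<partial>M)"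
    by (intro nn_integral_cong) (auto simp: indicator_def nsq_def ennreal_power)
  finally show ?thesis by (simp add: nsq_def ennreal_power)
next
  case False
  then have "(LINT s:A|M. f s) = 0"
    by (simp add: set_lebesgue_integral_def not_integrable_integral_eq)
  then show ?thesis by simp
qed

text \<open>Cauchy-Schwarz along the segment gives one factor \<open>h\<close>; after Tonelli,
  integrating the bound \<open>C\<close> over \<open>s\<close> in \<open>{0..h}\<close> gives the
  other.\<close>

lemma translation_estimate:
  fixes u g :: "'a::euclidean_space \<Rightarrow> 'b::euclidean_space"
  assumes u: "locint u" and g: "locint g" and w: "weak_partial u v g" and h: "h \<ge> 0"
    and [measurable]: "T \<in> sets borel"
    and C: "\<And>s. s \<in> {0..h} \<Longrightarrow> (\<integral>\<^sup>+x\<in>T. nsq (g (x + s *\<^sub>R v)) \<partial>lborel) \<le> C"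
  shows "(\<integral>\<^sup>+x\<in>T. nsq (u (x + h *\<^sub>R v) - u x) \<partial>lborel) \<le> ennreal (h\<^sup>2) * C"
proof -
  have [measurable]: "g \<in> borel_measurable borel" "u \<in> borel_measurable borel"
    using u g by (auto intro: locint_measurable)
  have "(\<integral>\<^sup>+x\<in>T. nsq (u (x + h *\<^sub>R v) - u x) \<partial>lborel)
     \<le> (\<integral>\<^sup>+x. ennreal h * (\<integral>\<^sup>+s. nsq (g (x + s *\<^sub>R v)) * indicator {0..h} s * indicator T x \<partial>lborel) \<partial>lborel)"
  proof (rule nn_integral_mono_AE)
    show "AE x in lborel. nsq (u (x + h *\<^sub>R v) - u x) * indicator T x
      \<le> ennreal h * (\<integral>\<^sup>+s. nsq (g (x + s *\<^sub>R v)) * indicator {0..h} s * indicator T x \<partial>lborel)"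
      using weak_partial_segment[OF u g w h]
    proof eventually_elim
      case (elim x)
      have "nsq (u (x + h *\<^sub>R v) - u x) \<le> ennreal h * (\<integral>\<^sup>+s\<in>{0..h}. nsq (g (x + s *\<^sub>R v)) \<partial>lborel)"
        unfolding elim using nsq_set_integral_le[of "{0..h}" lborel "\<lambda>s. g (x + s *\<^sub>R v)"] h by simp
      then show ?case by (cases "x \<in> T") auto
    qed
  qed
  also have "\<dots> = ennreal h * (\<integral>\<^sup>+s. \<integral>\<^sup>+x. nsq (g (x + s *\<^sub>R v)) * indicator {0..h} s * indicator T x \<partial>lborel \<partial>lborel)"
    by (subst nn_integral_cmult, measurable, subst lborel_pair.Fubini') measurable
  also have "\<dots> \<le> ennreal h * (\<integral>\<^sup>+s. C * indicator {0..h} s \<partial>lborel)"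
  proof (intro mult_left_mono nn_integral_mono)
    show "(\<integral>\<^sup>+x. nsq (g (x + s *\<^sub>R v)) * indicator {0..h} s * indicator T x \<partial>lborel) \<le> C * indicator {0..h} s" for s
      using C[of s] by (cases "s \<in> {0..h}") auto
  qed simp
  also have "\<dots> = ennreal (h\<^sup>2) * C"
    using h by (simp add: nn_integral_cmult power2_eq_square ennreal_mult ac_simps)
  finally show ?thesis .
qed

text \<open>The coordinate directions along which slab integrals of periodic functions are
  translation invariant; the axial one moves any slab except the whole cylinder.\<close>

definition slab_dir :: "real set \<Rightarrow> real \<times> (real^'m) \<Rightarrow> bool" where
  "slab_dir I b \<longleftrightarrow> b \<in> range ebas \<or> b = (1, 0) \<and> I = UNIV"

lemma slab_dir_Basis: "slab_dir I b \<Longrightarrow> b \<in> Basis"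
  by (auto simp: slab_dir_def)

lemma nn_integral_slab_dir_shift:
  fixes f :: "real \<times> (real^'m) \<Rightarrow> ennreal"
  assumes "slab_dir I b" and "f \<in> borel_measurable borel" "I \<in> sets borel" and "periodic_cyl f"
  shows "(\<integral>\<^sup>+x\<in>slab I. f (x + c *\<^sub>R b) \<partial>lborel) = (\<integral>\<^sup>+x\<in>slab I. f x \<partial>lborel)"
  using assms nn_integral_slab_shift nn_integral_slab_UNIV_shift unfolding slab_dir_def by blast

lemma periodic_cyl_shift: "periodic_cyl f \<Longrightarrow> periodic_cyl (\<lambda>x. f (x + c))"
  unfolding periodic_cyl_iff
proof (intro allI)
  fix x i assume *: "\<forall>x i. f (x + ebas i) = f x"
  have "x + ebas i + c = (x + c) + ebas i" by (simp only: ac_simps)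
  then show "f (x + ebas i + c) = f (x + c)" using * by (simp only:)
qed

lemma periodic_cyl_compose2:
  "periodic_cyl f \<Longrightarrow> periodic_cyl g \<Longrightarrow> periodic_cyl (\<lambda>x. F (f x) (g x))"
  by (simp add: periodic_cyl_iff)

lemma periodic_cyl_compose:
  "periodic_cyl f \<Longrightarrow> periodic_cyl (\<lambda>x. F (f x))"
  by (simp add: periodic_cyl_iff)

lemma H1per_D:
  assumes "H1per u Du"
  shows "H1div u Du" "periodic_cyl (\<lambda>x. Du x b)" "periodic_cyl (grad_sq Du)"
    "grad_sq Du \<in> borel_measurable borel"
proof -
  show *: "H1div u Du" "periodic_cyl (\<lambda>x. Du x b)" for b
    using assms unfolding H1per_def by blast+
  show "periodic_cyl (grad_sq Du)"
    unfolding periodic_cyl_iff grad_sq_def using *(2)[unfolded periodic_cyl_iff, rule_format] by simp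
  show "grad_sq Du \<in> borel_measurable borel"
    by (rule measurable_grad_sq) (rule H1div_D(7)[OF *(1)])
qed

lemma grad_sq_nonneg: "grad_sq Du x \<ge> 0"
  unfolding grad_sq_def by (intro sum_nonneg) auto

lemma nsq_le_grad_sq: "b \<in> Basis \<Longrightarrow> nsq (Du x b) \<le> ennreal (grad_sq Du x)"
  unfolding grad_sq_def nsq_def by (intro ennreal_leI member_le_sum) auto

definition Dirichlet :: "(real \<times> (real^'m) \<Rightarrow> real \<times> (real^'m) \<Rightarrow> real \<times> (real^'m)) \<Rightarrow> real set \<Rightarrow> ennreal" where
  "Dirichlet Du I = (\<integral>\<^sup>+x\<in>slab I. ennreal (grad_sq Du x) \<partial>lborel)"

lemma Dirichlet_mono:
  "I \<subseteq> J \<Longrightarrow> Dirichlet Du I \<le> Dirichlet Du J"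
  unfolding Dirichlet_def by (intro nn_integral_mono) (auto simp: indicator_def mem_slab)

lemma slab_translation_dir:
  assumes H: "H1per u Du" and b: "slab_dir I b" and [measurable]: "I \<in> sets borel"
  shows "(\<integral>\<^sup>+x\<in>slab I. nsq (u (x + c *\<^sub>R b) - u x) \<partial>lborel) \<le> ennreal (c\<^sup>2) * Dirichlet Du I"
proof -
  note D = H1div_D[OF H1per_D(1)[OF H]]
  have bB: "b \<in> Basis" using slab_dir_Basis[OF b] .
  have [measurable]: "u \<in> borel_measurable borel" "(\<lambda>x. Du x b) \<in> borel_measurable borel"
    using D bB by auto
  have pos: "(\<integral>\<^sup>+x\<in>slab I. nsq (u (x + c *\<^sub>R b) - u x) \<partial>lborel) \<le> ennreal (c\<^sup>2) * Dirichlet Du I"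
    if "c \<ge> 0" for c
  proof (rule translation_estimate[OF D(3) D(6)[OF bB] D(8)[OF bB] that])
    fix s
    have "(\<integral>\<^sup>+x\<in>slab I. nsq (Du (x + s *\<^sub>R b) b) \<partial>lborel) = (\<integral>\<^sup>+x\<in>slab I. nsq (Du x b) \<partial>lborel)"
      by (rule nn_integral_slab_dir_shift[OF b, where f = "\<lambda>x. nsq (Du x b)"])
        (use H1per_D(2)[OF H, of b] in \<open>auto intro: periodic_cyl_compose\<close>)
    also have "\<dots> \<le> Dirichlet Du I"
      unfolding Dirichlet_def using nsq_le_grad_sq[OF bB]
      by (intro nn_integral_mono mult_right_mono) auto
    finally show "(\<integral>\<^sup>+x\<in>slab I. nsq (Du (x + s *\<^sub>R b) b) \<partial>lborel) \<le> Dirichlet Du I" .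
  qed measurable
  show ?thesis
  proof (cases "c \<ge> 0")
    case False
    \<comment> \<open>For a negative step the integration variable is translated back by
      \<open>c *\<^sub>R b\<close>, which turns the difference into its negative with the positive
      step \<open>- c\<close>.\<close>
    let ?F = "\<lambda>x. nsq (u (x + c *\<^sub>R b) - u x)"
    have "(\<integral>\<^sup>+x\<in>slab I. ?F x \<partial>lborel) = (\<integral>\<^sup>+x\<in>slab I. ?F (x + (- c) *\<^sub>R b) \<partial>lborel)"
    proof (rule nn_integral_slab_dir_shift[OF b, symmetric])
      show "periodic_cyl ?F"
        using D(1) by (intro periodic_cyl_compose2[where F = "\<lambda>p q. nsq (p - q)"] periodic_cyl_shift)
    qed measurable
    also have "\<dots> = (\<integral>\<^sup>+x\<in>slab I. nsq (u (x + (- c) *\<^sub>R b) - u x) \<partial>lborel)"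
      by (simp add: nsq_minus)
    also have "\<dots> \<le> ennreal ((- c)\<^sup>2) * Dirichlet Du I" using False by (intro pos) auto
    finally show ?thesis by simp
  qed (rule pos)
qed

text \<open>One direction is added at a time. The squared triangle inequality splits off its
  contribution and translation invariance removes the shift from the rest; two terms of twice the
  earlier bound account for the factor 4 per direction.\<close>

lemma slab_translation:
  assumes H: "H1per u Du" and [measurable]: "I \<in> sets borel"
    and "finite B" "\<And>b. b \<in> B \<Longrightarrow> slab_dir I b" "\<And>b. b \<in> B \<Longrightarrow> \<bar>c b\<bar> \<le> r"
  shows "(\<integral>\<^sup>+x\<in>slab I. nsq (u (x + (\<Sum>b\<in>B. c b *\<^sub>R b)) - u x) \<partial>lborel)
    \<le> 4 ^ card B * ennreal (r\<^sup>2) * Dirichlet Du I"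
  using assms(3-)
proof (induction B)
  case (insert b B)
  note D = H1div_D[OF H1per_D(1)[OF H]]
  have [measurable]: "u \<in> borel_measurable borel" using D by auto
  let ?y = "\<Sum>b\<in>B. c b *\<^sub>R b" and ?z = "c b *\<^sub>R b"
  have b: "slab_dir I b" using insert by auto
  have "(\<integral>\<^sup>+x\<in>slab I. nsq (u (x + (\<Sum>b\<in>insert b B. c b *\<^sub>R b)) - u x) \<partial>lborel)
     \<le> (\<integral>\<^sup>+x. 2 * (nsq (u (x + ?z + ?y) - u (x + ?z)) * indicator (slab I) x) + 2 * (nsq (u (x + ?z) - u x) * indicator (slab I) x) \<partial>lborel)"
  proof (intro nn_integral_mono)
    fix x
    show "nsq (u (x + (\<Sum>b\<in>insert b B. c b *\<^sub>R b)) - u x) * indicator (slab I) x \<le>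
      2 * (nsq (u (x + ?z + ?y) - u (x + ?z)) * indicator (slab I) x) + 2 * (nsq (u (x + ?z) - u x) * indicator (slab I) x)"
      using nsq_triangle[of "u (x + ?z + ?y)" "u x" "u (x + ?z)"] insert(1,2)
      by (cases "x \<in> slab I") (auto simp: add.assoc)
  qed
  also have "\<dots> = 2 * (\<integral>\<^sup>+x\<in>slab I. nsq (u (x + ?z + ?y) - u (x + ?z)) \<partial>lborel) + 2 * (\<integral>\<^sup>+x\<in>slab I. nsq (u (x + ?z) - u x) \<partial>lborel)"
    by (subst nn_integral_add, measurable, subst (1 2) nn_integral_cmult) measurable
  also have "(\<integral>\<^sup>+x\<in>slab I. nsq (u (x + ?z + ?y) - u (x + ?z)) \<partial>lborel) = (\<integral>\<^sup>+x\<in>slab I. nsq (u (x + ?y) - u x) \<partial>lborel)"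
  proof (rule nn_integral_slab_dir_shift[OF b, where f = "\<lambda>x. nsq (u (x + ?y) - u x)"])
    show "periodic_cyl (\<lambda>x. nsq (u (x + ?y) - u x))"
      using D(1) by (intro periodic_cyl_compose2[where F = "\<lambda>p q. nsq (p - q)"] periodic_cyl_shift)
  qed measurable
  also have "2 * (\<integral>\<^sup>+x\<in>slab I. nsq (u (x + ?y) - u x) \<partial>lborel) + 2 * (\<integral>\<^sup>+x\<in>slab I. nsq (u (x + ?z) - u x) \<partial>lborel)
     \<le> 2 * (4 ^ card B * ennreal (r\<^sup>2) * Dirichlet Du I) + 2 * (4 ^ card B * ennreal (r\<^sup>2) * Dirichlet Du I)"
  proof (intro add_mono mult_left_mono)
    show "(\<integral>\<^sup>+x\<in>slab I. nsq (u (x + ?y) - u x) \<partial>lborel) \<le> 4 ^ card B * ennreal (r\<^sup>2) * Dirichlet Du I"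
      using insert by auto
    have "(\<integral>\<^sup>+x\<in>slab I. nsq (u (x + ?z) - u x) \<partial>lborel) \<le> ennreal ((c b)\<^sup>2) * Dirichlet Du I"
      by (rule slab_translation_dir[OF H b]) measurable
    also have "\<dots> \<le> ennreal (r\<^sup>2) * Dirichlet Du I"
      using insert(5)[of b] by (intro mult_right_mono ennreal_leI) (auto simp: abs_le_square_iff[symmetric])
    also have "\<dots> = 1 * (ennreal (r\<^sup>2) * Dirichlet Du I)" by simp
    also have "\<dots> \<le> 4 ^ card B * (ennreal (r\<^sup>2) * Dirichlet Du I)"
      by (intro mult_right_mono one_le_power) auto
    finally show "(\<integral>\<^sup>+x\<in>slab I. nsq (u (x + ?z) - u x) \<partial>lborel) \<le> 4 ^ card B * ennreal (r\<^sup>2) * Dirichlet Du I"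
      by (simp add: mult.assoc)
  qed auto
  also have "\<dots> = 4 ^ card (insert b B) * ennreal (r\<^sup>2) * Dirichlet Du I"
  proof -
    have "2 * z + 2 * z = 4 * (z::ennreal)" for z
      by (metis distrib_right numeral_Bit0)
    then show ?thesis using insert(1,2) by (simp add: mult.assoc)
  qed
  finally show ?case .
qed simp

text \<open>Jensen's inequality for the mean over \<open>Q\<close>. In the applications
  \<open>Q\<close> varies with \<open>x\<close> or is fixed, but \<open>Z\<close> is always the same
  set, so integrating over \<open>x\<close> and exchanging integrals leaves one translation estimate
  for each \<open>z\<close>.\<close>

lemma nsq_diff_average_le:
  fixes w :: "'a::euclidean_space \<Rightarrow> 'b::euclidean_space"
  assumes [measurable]: "w \<in> borel_measurable borel" "Q \<in> sets borel" "Z \<in> sets borel"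
    and m: "emeasure lborel Q = ennreal m" "m > 0" and int: "set_integrable lborel Q w"
    and Z: "\<And>y. y \<in> Q \<Longrightarrow> y - x \<in> Z"
  shows "nsq (w x - (1 / m) *\<^sub>R (LINT y:Q|lborel. w y)) \<le> ennreal (1 / m) * (\<integral>\<^sup>+z\<in>Z. nsq (w (x + z) - w x) \<partial>lborel)"
proof -
  have "measure lborel Q = m" using m by (simp add: measure_def)
  have "set_integrable lborel Q (\<lambda>y. w x)" using m by (simp add: set_integrable_def)
  then have "(LINT y:Q|lborel. w x - w y) = m *\<^sub>R w x - (LINT y:Q|lborel. w y)"
    using set_integral_diff(2)[OF _ int] m \<open>measure lborel Q = m\<close> by (simp add: set_lebesgue_integral_def)
  then have "w x - (1 / m) *\<^sub>R (LINT y:Q|lborel. w y) = (1 / m) *\<^sub>R (LINT y:Q|lborel. w x - w y)"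
    using m by (simp add: scaleR_right_diff_distrib)
  then have "nsq (w x - (1 / m) *\<^sub>R (LINT y:Q|lborel. w y)) = ennreal ((1 / m)\<^sup>2) * nsq (LINT y:Q|lborel. w x - w y)"
    by (simp only: nsq_scaleR)
  also have "\<dots> \<le> ennreal ((1 / m)\<^sup>2) * (emeasure lborel Q * (\<integral>\<^sup>+y\<in>Q. nsq (w x - w y) \<partial>lborel))"
    by (intro mult_left_mono nsq_set_integral_le) auto
  also have "\<dots> = ennreal (1 / m) * (\<integral>\<^sup>+y\<in>Q. nsq (w x - w y) \<partial>lborel)"
    using m by (simp add: mult.assoc[symmetric] ennreal_mult[symmetric] power2_eq_square)
  also have "\<dots> \<le> ennreal (1 / m) * (\<integral>\<^sup>+y. nsq (w y - w x) * indicator Z (y - x) \<partial>lborel)"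
    using Z by (intro mult_left_mono nn_integral_mono) (auto simp: indicator_def nsq_minus)
  also have "(\<integral>\<^sup>+y. nsq (w y - w x) * indicator Z (y - x) \<partial>lborel) = (\<integral>\<^sup>+z\<in>Z. nsq (w (x + z) - w x) \<partial>lborel)"
    by (subst nn_integral_lborel_shift[where c = x, symmetric]) (auto simp: add.commute)
  finally show ?thesis .
qed

section \<open>Poincare inequality and slice averages\<close>

lemma AE_lborel_fst:
  assumes "AE t in lborel. P t"
  shows "AE x :: 'a::euclidean_space \<times> 'b::euclidean_space in lborel. P (fst x)"
proof -
  obtain N where N: "{t. \<not> P t} \<subseteq> N" "emeasure lborel N = 0" "N \<in> sets lborel"
    using AE_E[OF assms] by auto
  have "emeasure lborel (N \<times> (UNIV :: 'b set)) = 0"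
    unfolding lborel_prod[symmetric] using N by (simp add: lborel.emeasure_pair_measure_Times)
  moreover have "N \<times> (UNIV :: 'b set) \<in> sets lborel"
    unfolding lborel_prod[symmetric] using N by (intro pair_measureI) auto
  ultimately show ?thesis
    by (intro AE_I'[of "N \<times> UNIV"]) (use N in \<open>auto simp: null_sets_def\<close>)
qed

lemma AE_lborel_slice:
  assumes "AE x :: 'a::euclidean_space \<times> 'b::euclidean_space in lborel. P x"
  shows "AE t in lborel. AE y in lborel. P (t, y)"
  using assms unfolding lborel_prod[symmetric] by (rule lborel_pair.AE_pair)

lemma AE_lborel_ex:
  assumes "AE x :: 'a::euclidean_space in lborel. P x"
  shows "\<exists>x. P x"
proof (rule ccontr)
  assume "\<not> ?thesis"
  then have "AE x :: 'a in lborel. False" using assms by simp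
  then have "emeasure lborel (UNIV :: 'a set) = 0"
    using AE_iff_measurable[of UNIV lborel "\<lambda>x::'a. False"] by simp
  then show False by simp
qed

lemma slab_subset_Times: "slab I \<subseteq> I \<times> cbox 0 (One :: real^'m)"
  by (auto simp: slab_def box0_def mem_cbox_One less_imp_le)

lemma set_integrable_slab:
  fixes f :: "real \<times> (real^'m) \<Rightarrow> 'b::euclidean_space"
  assumes "locint f"
  shows "set_integrable lborel (slab {s..t}) f"
proof (rule set_integrable_subset)
  show "set_integrable lborel ({s..t} \<times> cbox 0 One) f"
    using assms compact_Times[OF compact_Icc[of s t] compact_cbox[of 0 "One :: real^'m"]]
    unfolding locint_def by simp
  show "slab {s..t} \<subseteq> {s..t} \<times> cbox 0 (One :: real^'m)"
    by (rule slab_subset_Times)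
qed simp

lemma AE_slice_integrable:
  fixes u :: "real \<times> (real^'m) \<Rightarrow> 'b::euclidean_space"
  assumes "locint u"
  shows "AE t in lborel. set_integrable lborel box0 (\<lambda>y. u (t, y))"
proof -
  have "AE t in lborel. integrable lborel (\<lambda>y. indicator (slab {-real n..real n}) (t, y) *\<^sub>R u (t, y))" for n
    using set_integrable_slab[OF assms, of "-real n" "real n"]
    unfolding set_integrable_def lborel_prod[symmetric] by (rule lborel_pair.AE_integrable_fst')
  then have "AE t in lborel. \<forall>n. integrable lborel (\<lambda>y. indicator (slab {-real n..real n}) (t, y) *\<^sub>R u (t, y))"
    by (subst AE_all_countable) auto
  then show ?thesis
  proof eventually_elim
    case (elim t)
    obtain n where n: "\<bar>t\<bar> \<le> real n" using real_arch_simple by blast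
    then have "indicator (slab {-real n..real n}) (t, y) = (indicator box0 y :: real)" for y :: "real^'m"
      by (auto simp: indicator_def slab_def)
    then show ?case using elim[rule_format, of n] by (simp add: set_integrable_def)
  qed
qed

lemma measurable_slice [measurable]:
  "u \<in> borel_measurable borel \<Longrightarrow> (\<lambda>y. u (t, y)) \<in> borel_measurable borel"
  for u :: "'a::euclidean_space \<times> 'b::euclidean_space \<Rightarrow> 'c::euclidean_space"
  by (rule measurable_compose[of "\<lambda>y. (t, y)"]) (auto intro!: borel_measurable_continuous_onI continuous_intros)

lemma xavg_box0:
  fixes u :: "real \<times> (real^'m) \<Rightarrow> real \<times> (real^'m)"
  assumes [measurable]: "u \<in> borel_measurable borel"
  shows "xavg u t = (LINT y:box0|lborel. u (t, y))"
  unfolding xavg_def set_lebesgue_integral_def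
proof (rule integral_cong_AE)
  show "AE y in lborel. indicator (cbox 0 One) y *\<^sub>R u (t, y) = indicator box0 y *\<^sub>R u (t, y)"
    using AE_box0 by eventually_elim (simp add: indicator_def)
qed measurable

lemma measurable_xavg [measurable]:
  fixes u :: "real \<times> (real^'m) \<Rightarrow> real \<times> (real^'m)"
  assumes "u \<in> borel_measurable borel"
  shows "xavg u \<in> borel_measurable borel"
proof -
  have [measurable]: "u \<in> borel_measurable (lborel \<Otimes>\<^sub>M lborel)"
    using assms by (simp add: lborel_prod)
  have "(\<lambda>t. LINT y|lborel. indicator box0 y *\<^sub>R u (t, y)) \<in> borel_measurable lborel"
    by measurable
  then show ?thesis
    unfolding xavg_box0[OF assms, abs_def] set_lebesgue_integral_def by simp
qed

text \<open>A factor 4 for each torus direction, from \<open>slab_translation\<close>, times the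
  volume of the cube that contains all differences of points of \<open>box0\<close>.\<close>

definition slice_const :: "'m::finite itself \<Rightarrow> ennreal" where
  "slice_const _ = 4 ^ card (range (ebas :: 'm::finite \<Rightarrow> _)) * emeasure lborel (cbox (- One) (One :: real^'m))"

lemma slice_const_finite: "slice_const TYPE('m::finite) < \<infinity>"
  unfolding slice_const_def
  by (auto simp: ennreal_mult_less_top power_less_top_ennreal emeasure_lborel_cbox_finite)

text \<open>The deviation from the slice average is a mean of differences
  \<open>u (x + (0, z)) - u x\<close>. Enlarging the range of \<open>z\<close> to a fixed cube
  permits Fubini, and each \<open>z\<close> is then covered by the estimate for torus
  translations.\<close>

lemma Poincare_slice:
  assumes H: "H1per u (Du :: real \<times> (real^'m) \<Rightarrow> _)" and [measurable]: "I \<in> sets borel"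
  shows "(\<integral>\<^sup>+x\<in>slab I. nsq (u x - xavg u (fst x)) \<partial>lborel) \<le> slice_const TYPE('m) * Dirichlet Du I"
proof -
  note D = H1div_D[OF H1per_D(1)[OF H]]
  have [measurable]: "u \<in> borel_measurable borel" using D by auto
  let ?Z = "cbox (- One) (One :: real^'m)"
  have "(\<integral>\<^sup>+x\<in>slab I. nsq (u x - xavg u (fst x)) \<partial>lborel)
     \<le> (\<integral>\<^sup>+x. \<integral>\<^sup>+z. indicator (slab I) x * indicator ?Z z * nsq (u (x + (0, z)) - u x) \<partial>lborel \<partial>lborel)"
  proof (rule nn_integral_mono_AE)
    show "AE x in lborel. nsq (u x - xavg u (fst x)) * indicator (slab I) x \<le>
       (\<integral>\<^sup>+z. indicator (slab I) x * indicator ?Z z * nsq (u (x + (0, z)) - u x) \<partial>lborel)"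
      using AE_lborel_fst[OF AE_slice_integrable[OF D(3)]]
    proof eventually_elim
      case (elim x)
      show ?case
      proof (cases "x \<in> slab I")
        case True
        have "nsq (u (fst x, snd x) - (1 / 1) *\<^sub>R (LINT y:box0|lborel. u (fst x, y)))
          \<le> ennreal (1 / 1) * (\<integral>\<^sup>+z\<in>?Z. nsq (u (fst x, snd x + z) - u (fst x, snd x)) \<partial>lborel)"
        proof (rule nsq_diff_average_le[of "\<lambda>y. u (fst x, y)"])
          show "y - snd x \<in> ?Z" if "y \<in> box0" for y
          proof -
            have "(One :: real^'m) $ i = 1" for i
              using inner_sum_Basis[of "axis i (1::real)"] by (simp add: inner_axis del: inner_sum_Basis)
            moreover have "-1 \<le> y $ i - snd x $ i \<and> y $ i - snd x $ i \<le> 1" for i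
              using that True unfolding mem_slab box0_def
              by (smt (verit, best) mem_Collect_eq)
            ultimately show ?thesis by (simp add: mem_box_cart)
          qed
        qed (use elim in auto)
        then show ?thesis using True
          by (simp add: xavg_box0 mult.commute[of "indicator _ _"] plus_prod_def)
      qed simp
    qed
  qed
  also have "\<dots> = (\<integral>\<^sup>+z. \<integral>\<^sup>+x. indicator (slab I) x * indicator ?Z z * nsq (u (x + (0, z)) - u x) \<partial>lborel \<partial>lborel)"
    by (rule lborel_pair.Fubini'[symmetric]) measurable
  also have "\<dots> \<le> (\<integral>\<^sup>+z. 4 ^ card (range (ebas :: 'm \<Rightarrow> _)) * Dirichlet Du I * indicator ?Z z \<partial>lborel)"
  proof (intro nn_integral_mono)
    fix z :: "real^'m"
    show "(\<integral>\<^sup>+x. indicator (slab I) x * indicator ?Z z * nsq (u (x + (0, z)) - u x) \<partial>lborel)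
      \<le> 4 ^ card (range (ebas :: 'm \<Rightarrow> _)) * Dirichlet Du I * indicator ?Z z"
    proof (cases "z \<in> ?Z")
      case True
      have z: "(0, z) = (\<Sum>b\<in>range ebas. ((0, z) \<bullet> b) *\<^sub>R b)"
      proof -
        have "(0, z) = (\<Sum>b\<in>Basis. ((0, z) \<bullet> b) *\<^sub>R b)" by (rule euclidean_representation[symmetric])
        also have "\<dots> = (\<Sum>b\<in>range ebas. ((0, z) \<bullet> b) *\<^sub>R b)"
          unfolding Basis_cyl by (rule sum.mono_neutral_right) auto
        finally show ?thesis .
      qed
      have "\<bar>(0, z) \<bullet> b\<bar> \<le> 1" if "b \<in> range ebas" for b
      proof -
        have "(One :: real^'m) $ i = 1" for i
          using inner_sum_Basis[of "axis i (1::real)"] by (simp add: inner_axis del: inner_sum_Basis)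
        then show ?thesis using True that by (auto simp: mem_box_cart abs_le_iff)
      qed
      then have "(\<integral>\<^sup>+x\<in>slab I. nsq (u (x + (\<Sum>b\<in>range ebas. ((0, z) \<bullet> b) *\<^sub>R b)) - u x) \<partial>lborel)
        \<le> 4 ^ card (range (ebas :: 'm \<Rightarrow> _)) * ennreal (1\<^sup>2) * Dirichlet Du I"
        by (intro slab_translation[OF H]) (auto simp: slab_dir_def)
      then show ?thesis using True unfolding z[symmetric] by (simp add: mult.commute[of "nsq _"])
    qed simp
  qed
  also have "\<dots> = slice_const TYPE('m) * Dirichlet Du I"
    by (simp add: nn_integral_cmult slice_const_def ac_simps)
  finally show ?thesis .
qed

text \<open>The expected increment of the slice average from \<open>s\<close> to \<open>t\<close>,
  because cross-sections have measure 1.\<close>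

definition flux :: "(real \<times> (real^'m) \<Rightarrow> real \<times> (real^'m) \<Rightarrow> real \<times> (real^'m)) \<Rightarrow> real \<Rightarrow> real \<Rightarrow> real \<times> (real^'m)" where
  "flux Du s t = (LINT x:slab {s..t}|lborel. Du x (1, 0))"

lemma nsq_flux_le:
  fixes u :: "real \<times> (real^'m) \<Rightarrow> real \<times> (real^'m)"
  assumes "H1per u Du" "s \<le> t"
  shows "nsq (flux Du s t) \<le> ennreal (t - s) * Dirichlet Du {s..t}"
proof -
  note D = H1div_D[OF H1per_D(1)[OF assms(1)]]
  have [measurable]: "(\<lambda>x. Du x (1, 0)) \<in> borel_measurable borel" using D by auto
  have "nsq (flux Du s t) \<le> emeasure lborel (slab {s..t} :: (real \<times> (real^'m)) set) * (\<integral>\<^sup>+x\<in>slab {s..t}. nsq (Du x (1, 0)) \<partial>lborel)"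
    unfolding flux_def by (rule nsq_set_integral_le) auto
  also have "\<dots> \<le> ennreal (t - s) * Dirichlet Du {s..t}"
    unfolding Dirichlet_def using assms(2)
    by (intro mult_mono nn_integral_mono mult_right_mono nsq_le_grad_sq) (auto simp: emeasure_slab)
  finally show ?thesis .
qed

lemma flux_add:
  fixes u :: "real \<times> (real^'m) \<Rightarrow> real \<times> (real^'m)"
  assumes "H1per u Du" "s \<le> t" "t \<le> r"
  shows "flux Du s t + flux Du t r = flux Du s r"
proof -
  note D = H1div_D[OF H1per_D(1)[OF assms(1)]]
  have "slab {s..r} = slab {s..t} \<union> (slab {t..r} :: (real \<times> (real^'m)) set)" using assms(2,3) by (auto simp: slab_def)
  moreover have "AE x :: real \<times> (real^'m) in lborel. \<not> (x \<in> slab {s..t} \<and> x \<in> slab {t..r})"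
    using AE_lborel_hyperplane[OF e1_Basis, of t] by eventually_elim (auto simp: mem_slab inner_e1)
  ultimately show ?thesis
    unfolding flux_def using set_integrable_slab[OF D(6)[OF e1_Basis]]
    by (simp only:, intro set_integral_Un_AE[symmetric]) auto
qed

lemma cell_slab_nn: "(\<integral>\<^sup>+x\<in>cell. f x \<partial>lborel) = (\<integral>\<^sup>+x\<in>slab UNIV. f x \<partial>lborel)"
proof (rule nn_integral_cong_AE)
  show "AE x in lborel. f x * indicator cell x = f x * indicator (slab UNIV) x"
    using AE_slab[of UNIV] unfolding cell_def by eventually_elim (simp add: indicator_def)
qed

lemma Dirichlet_finite:
  assumes "H1div u Du"
  shows "Dirichlet Du I < \<infinity>"
proof -
  have "integrable lborel (\<lambda>x. indicator cell x *\<^sub>R grad_sq Du x)"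
    using H1div_D(9)[OF assms] by (simp add: set_integrable_def)
  then have "(\<integral>\<^sup>+x. norm (indicator cell x *\<^sub>R grad_sq Du x) \<partial>lborel) < \<infinity>"
    by (simp add: integrable_iff_bounded)
  also have "(\<integral>\<^sup>+x. norm (indicator cell x *\<^sub>R grad_sq Du x) \<partial>lborel) = (\<integral>\<^sup>+x\<in>cell. ennreal (grad_sq Du x) \<partial>lborel)"
    by (intro nn_integral_cong) (auto simp: indicator_def grad_sq_nonneg)
  finally have "Dirichlet Du UNIV < \<infinity>" by (simp add: Dirichlet_def cell_slab_nn)
  then show ?thesis using Dirichlet_mono[of I UNIV Du] by (simp add: le_less_trans)
qed

text \<open>The hypothesis is the Hoelder-1/2 bound that Cauchy-Schwarz yields for slice averages of
  fields with finite Dirichlet energy.\<close>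

lemma Hoelder_continuous:
  fixes f :: "real \<Rightarrow> 'b::real_normed_vector"
  assumes "\<And>s t. s \<le> t \<Longrightarrow> (norm (f t - f s))\<^sup>2 \<le> (t - s) * M"
  shows "uniformly_continuous_on UNIV f"
  unfolding uniformly_continuous_on_def
proof (intro allI impI)
  fix e :: real assume e: "e > 0"
  define d where "d = e\<^sup>2 / (\<bar>M\<bar> + 1)"
  have d: "d > 0" using e by (simp add: d_def)
  have le: "dist (f t) (f s) < e" if "s \<le> t" "t - s < d" for s t
  proof -
    have "(norm (f t - f s))\<^sup>2 \<le> (t - s) * M" using assms that by simp
    also have "\<dots> \<le> (t - s) * (\<bar>M\<bar> + 1)" using that by (intro mult_left_mono) auto
    also have "\<dots> < d * (\<bar>M\<bar> + 1)" using that by (intro mult_strict_right_mono) auto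
    also have "\<dots> = e\<^sup>2" by (simp add: d_def)
    finally show ?thesis using e by (simp add: dist_norm power2_less_imp_less)
  qed
  have "\<forall>x\<in>UNIV. \<forall>x'\<in>UNIV. dist x' x < d \<longrightarrow> dist (f x') (f x) < e"
  proof (intro ballI impI)
    fix x x' :: real assume "dist x' x < d"
    then show "dist (f x') (f x) < e"
      using le[of x x'] le[of x' x] by (cases "x \<le> x'") (auto simp: dist_real_def dist_commute)
  qed
  then show "\<exists>d>0. \<forall>x\<in>UNIV. \<forall>x'\<in>UNIV. dist x' x < d \<longrightarrow> dist (f x') (f x) < e"
    using d by blast
qed

lemma norm_sq_leI_nsq: "nsq x \<le> ennreal a * D \<Longrightarrow> D < \<infinity> \<Longrightarrow> a \<ge> 0 \<Longrightarrow> (norm x)\<^sup>2 \<le> a * enn2real D"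
  unfolding nsq_def by (cases D) (auto simp: ennreal_mult[symmetric])

lemma measurable_slice_snd [measurable]:
  "u \<in> borel_measurable borel \<Longrightarrow> (\<lambda>t. u (t, y)) \<in> borel_measurable borel"
  for u :: "'a::euclidean_space \<times> 'b::euclidean_space \<Rightarrow> 'c::euclidean_space"
  by (rule measurable_compose[of "\<lambda>t. (t, y)"]) (auto intro!: borel_measurable_continuous_onI continuous_intros)

text \<open>The segment identity in the axial direction is averaged over a cross-section. The
  exceptional set of \<open>t\<close> may depend on \<open>h\<close>, so this does not yet produce a
  continuous representative.\<close>

lemma xavg_increment:
  assumes H: "H1per u (Du :: real \<times> (real^'m) \<Rightarrow> _)" and h: "h \<ge> 0"
  shows "AE t in lborel. xavg u (t + h) - xavg u t = flux Du t (t + h)"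
proof -
  note D = H1div_D[OF H1per_D(1)[OF H]]
  let ?g = "\<lambda>x. Du x (1, 0)"
  have [measurable]: "u \<in> borel_measurable borel" "?g \<in> borel_measurable borel" using D by auto
  have 1: "AE t in lborel. AE y in lborel. u (t + h, y) - u (t, y) = (LINT s:{0..h}|lborel. ?g (t + s, y))"
    using AE_lborel_slice[OF weak_partial_segment[OF D(3) D(6)[OF e1_Basis] D(8)[OF e1_Basis] h]] by simp
  have 2: "AE t in lborel. set_integrable lborel box0 (\<lambda>y. u (t, y))"
    by (rule AE_slice_integrable[OF D(3)])
  have 3: "AE t in lborel. set_integrable lborel box0 (\<lambda>y. u (t + h, y))"
    by (rule AE_lborel_shift[OF 2])
  show ?thesis using 1 2 3
  proof eventually_elim
    case (elim t)
    have int: "integrable (lborel \<Otimes>\<^sub>M lborel) (\<lambda>(p, y). indicator (slab {t..t + h}) (p, y) *\<^sub>R ?g (p, y))"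
      using set_integrable_slab[OF D(6)[OF e1_Basis], of t "t + h"]
      unfolding set_integrable_def lborel_prod by (simp add: case_prod_beta')
    have "xavg u (t + h) - xavg u t = (LINT y:box0|lborel. u (t + h, y) - u (t, y))"
      unfolding xavg_box0[OF D(4)] using elim by (intro set_integral_diff(2)[symmetric]) auto
    also have "\<dots> = (LINT y|lborel. indicator box0 y *\<^sub>R (LINT s:{0..h}|lborel. ?g (t + s, y)))"
      unfolding set_lebesgue_integral_def[of _ box0]
    proof (rule integral_cong_AE)
      have "(\<lambda>y. LINT s|lborel. indicator {0..h} s *\<^sub>R ?g (t + s, y)) \<in> borel_measurable lborel"
        by measurable
      then show "(\<lambda>y. indicator box0 y *\<^sub>R (LINT s:{0..h}|lborel. ?g (t + s, y))) \<in> borel_measurable lborel"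
        unfolding set_lebesgue_integral_def by measurable
      show "AE y in lborel. indicator box0 y *\<^sub>R (u (t + h, y) - u (t, y)) = indicator box0 y *\<^sub>R (LINT s:{0..h}|lborel. ?g (t + s, y))"
        using elim(1) by eventually_elim simp
    qed measurable
    also have "\<dots> = (LINT y|lborel. LINT p|lborel. indicator (slab {t..t + h}) (p, y) *\<^sub>R ?g (p, y))"
    proof (intro Bochner_Integration.integral_cong refl)
      fix y :: "real^'m"
      have "(LINT p|lborel. indicator (slab {t..t + h}) (p, y) *\<^sub>R ?g (p, y))
         = (LINT s|lborel. indicator (slab {t..t + h}) (s + t, y) *\<^sub>R ?g (s + t, y))"
        by (rule integral_lborel_shift[symmetric, of "\<lambda>p. indicator (slab {t..t + h}) (p, y) *\<^sub>R ?g (p, y)"]) measurable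
      also have "\<dots> = (LINT s|lborel. indicator box0 y *\<^sub>R indicator {0..h} s *\<^sub>R ?g (t + s, y))"
        by (intro Bochner_Integration.integral_cong refl) (auto simp: indicator_def slab_def add.commute)
      finally show "indicator box0 y *\<^sub>R (LINT s:{0..h}|lborel. ?g (t + s, y)) = (LINT p|lborel. indicator (slab {t..t + h}) (p, y) *\<^sub>R ?g (p, y))"
        unfolding set_lebesgue_integral_def by (simp del: scaleR_scaleR)
    qed
    also have "\<dots> = (LINT x|(lborel \<Otimes>\<^sub>M lborel). indicator (slab {t..t + h}) x *\<^sub>R ?g x)"
      using lborel_pair.integral_snd[OF int] by (simp add: case_prod_beta')
    also have "\<dots> = flux Du t (t + h)"
      unfolding flux_def set_lebesgue_integral_def lborel_prod ..
    finally show ?case .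
  qed
qed

text \<open>Fubini exchanges the quantifiers: a single \<open>t0\<close> satisfies
  \<open>d (t0 + h) = d t0\<close> for almost every \<open>h\<close>, and this already is the
  claim.\<close>

lemma AE_const_of_translation_invariant:
  fixes d :: "real \<Rightarrow> 'b::euclidean_space"
  assumes [measurable]: "d \<in> borel_measurable borel"
    and inv: "\<And>h. h \<ge> 0 \<Longrightarrow> AE t in lborel. d (t + h) = d t"
  obtains c where "AE t in lborel. d t = c"
proof -
  have "AE t in lborel. d (t + h) = d t" for h
  proof (cases "h \<ge> 0")
    case False
    have "AE t in lborel. d (t + h + - h) = d (t + h)"
      by (rule AE_lborel_shift[OF inv]) (use False in simp)
    then show ?thesis by eventually_elim simp
  qed (rule inv)
  then have "AE h in lborel. AE t in lborel. d (t + h) = d t" by simp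
  then have "AE t in lborel. AE h in lborel. d (t + h) = d t"
    by (subst lborel_pair.AE_commute) measurable
  then obtain t0 where "AE h in lborel. d (t0 + h) = d t0" using AE_lborel_ex by blast
  from AE_lborel_shift[OF this, of "- t0"] have "AE h in lborel. d h = d t0" by simp
  then show thesis by (rule that)
qed

text \<open>The primitive \<open>\<Phi>\<close> of the flux is continuous by the Hoelder bound, and
  \<open>xavg u - \<Phi>\<close> is invariant under each translation almost everywhere, hence almost
  everywhere constant.\<close>

lemma slice_average_exists:
  assumes H: "H1per u Du"
  obtains ub where "AE t in lborel. ub t = xavg u t" "\<And>s t. s \<le> t \<Longrightarrow> ub t - ub s = flux Du s t"
proof -
  define \<Phi> where "\<Phi> t = (if t \<ge> 0 then flux Du 0 t else - flux Du t 0)" for t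
  have \<Phi>: "\<Phi> t - \<Phi> s = flux Du s t" if "s \<le> t" for s t
    using that flux_add[OF H, of 0 s t] flux_add[OF H, of s 0 t] flux_add[OF H, of s t 0]
    by (auto simp: \<Phi>_def algebra_simps)
  have "(norm (\<Phi> t - \<Phi> s))\<^sup>2 \<le> (t - s) * enn2real (Dirichlet Du UNIV)" if "s \<le> t" for s t
  proof (rule norm_sq_leI_nsq)
    have "nsq (\<Phi> t - \<Phi> s) \<le> ennreal (t - s) * Dirichlet Du {s..t}"
      using nsq_flux_le[OF H that] \<Phi>[OF that] by simp
    also have "\<dots> \<le> ennreal (t - s) * Dirichlet Du UNIV"
      by (intro mult_left_mono Dirichlet_mono) auto
    finally show "nsq (\<Phi> t - \<Phi> s) \<le> ennreal (t - s) * Dirichlet Du UNIV" .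
  qed (use that Dirichlet_finite[OF H1per_D(1)[OF H]] in auto)
  then have "continuous_on UNIV \<Phi>"
    by (intro uniformly_continuous_imp_continuous Hoelder_continuous)
  then have [measurable]: "\<Phi> \<in> borel_measurable borel" by (rule borel_measurable_continuous_onI)
  have [measurable]: "xavg u \<in> borel_measurable borel"
    using H1div_D(4)[OF H1per_D(1)[OF H]] by (rule measurable_xavg)
  obtain c where c: "AE t in lborel. xavg u t - \<Phi> t = c"
  proof (rule AE_const_of_translation_invariant[of "\<lambda>t. xavg u t - \<Phi> t"])
    show "AE t in lborel. xavg u (t + h) - \<Phi> (t + h) = xavg u t - \<Phi> t" if "h \<ge> 0" for h
      using xavg_increment[OF H that]
    proof eventually_elim
      case (elim t)
      then show ?case using \<Phi>[of t "t + h"] that by (simp add: algebra_simps)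
    qed
  qed measurable
  show thesis
  proof (rule that[of "\<lambda>t. \<Phi> t + c"])
    show "AE t in lborel. \<Phi> t + c = xavg u t" using c by eventually_elim auto
  qed (use \<Phi> in auto)
qed

lemma continuous_AE_eq:
  fixes f g :: "real \<Rightarrow> 'b::real_normed_vector"
  assumes "continuous_on UNIV f" "continuous_on UNIV g" "AE t in lborel. f t = g t"
  shows "f = g"
proof (rule ccontr)
  assume "f \<noteq> g"
  then obtain t where t: "f t \<noteq> g t" by auto
  have "open {t. f t \<noteq> g t}" by (rule open_Collect_neq[OF assms(1,2)])
  then obtain e where e: "e > 0" "ball t e \<subseteq> {t. f t \<noteq> g t}"
    by (rule openE[of _ t]) (use t in auto)
  have "AE s in lborel. s \<notin> ball t e" using assms(3) by eventually_elim (use e in auto)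
  then have "emeasure lborel (ball t e) = 0"
    using AE_iff_measurable[of "ball t e" lborel "\<lambda>s. s \<notin> ball t e"] by (auto simp: ball_def)
  then show False using e by (simp add: ball_eq_greaterThanLessThan)
qed

text \<open>Singles out the continuous representative that \<open>avg_limits\<close> quantifies
  over; it is unique, because continuous functions that agree almost everywhere are equal.\<close>

definition slice_avg ::
  "(real \<times> (real^'m) \<Rightarrow> real \<times> (real^'m)) \<Rightarrow> (real \<Rightarrow> real \<times> (real^'m)) \<Rightarrow> bool" where
  "slice_avg u ub \<longleftrightarrow> continuous_on UNIV ub \<and> (AE t in lborel. ub t = xavg u t)"

lemma slice_avg_unique: "slice_avg u f \<Longrightarrow> slice_avg u g \<Longrightarrow> f = g"
  unfolding slice_avg_def
proof (elim conjE, rule continuous_AE_eq)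
  assume "AE t in lborel. f t = xavg u t" "AE t in lborel. g t = xavg u t"
  then show "AE t in lborel. f t = g t" by eventually_elim simp
qed

text \<open>By uniqueness any continuous representative is the primitive of the flux, so the
  increment formula and the Hoelder bounds hold for every pair of points, without
  exceptions.\<close>

lemma slice_avg_flux:
  assumes H: "H1per u Du" and ub: "slice_avg u ub" and st: "s \<le> t"
  shows "ub t - ub s = flux Du s t"
    and "nsq (ub t - ub s) \<le> ennreal (t - s) * Dirichlet Du {s..t}"
    and "(norm (ub t - ub s))\<^sup>2 \<le> (t - s) * enn2real (Dirichlet Du UNIV)"
proof -
  obtain f where f: "AE t in lborel. f t = xavg u t" "\<And>s t. s \<le> t \<Longrightarrow> f t - f s = flux Du s t"
    using slice_average_exists[OF H] by blast
  have 1: "nsq (f t - f s) \<le> ennreal (t - s) * Dirichlet Du {s..t}" if "s \<le> t" for s t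
    using nsq_flux_le[OF H that] f(2)[OF that] by simp
  have 2: "(norm (f t - f s))\<^sup>2 \<le> (t - s) * enn2real (Dirichlet Du UNIV)" if "s \<le> t" for s t
  proof (rule norm_sq_leI_nsq)
    show "nsq (f t - f s) \<le> ennreal (t - s) * Dirichlet Du UNIV"
      using 1[OF that] Dirichlet_mono[of "{s..t}" UNIV Du]
      by (meson mult_left_mono order_trans subset_UNIV zero_le)
  qed (use that Dirichlet_finite[OF H1per_D(1)[OF H]] in auto)
  then have "continuous_on UNIV f"
    by (intro uniformly_continuous_imp_continuous Hoelder_continuous)
  then have "slice_avg u f" using f by (simp add: slice_avg_def)
  then have "ub = f" using slice_avg_unique[OF ub] by simp
  then show "ub t - ub s = flux Du s t" "nsq (ub t - ub s) \<le> ennreal (t - s) * Dirichlet Du {s..t}"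
    "(norm (ub t - ub s))\<^sup>2 \<le> (t - s) * enn2real (Dirichlet Du UNIV)"
    using f(2)[OF st] 1[OF st] 2[OF st] by auto
qed

lemma slice_avg_exists:
  assumes H: "H1per u Du"
  obtains ub where "slice_avg u ub"
proof -
  obtain f where f: "AE t in lborel. f t = xavg u t" "\<And>s t. s \<le> t \<Longrightarrow> f t - f s = flux Du s t"
    using slice_average_exists[OF H] by blast
  have 2: "(norm (f t - f s))\<^sup>2 \<le> (t - s) * enn2real (Dirichlet Du UNIV)" if "s \<le> t" for s t
  proof (rule norm_sq_leI_nsq)
    show "nsq (f t - f s) \<le> ennreal (t - s) * Dirichlet Du UNIV"
      using nsq_flux_le[OF H that] f(2)[OF that] Dirichlet_mono[of "{s..t}" UNIV Du]
      by (metis mult_left_mono order_trans subset_UNIV zero_le)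
  qed (use that Dirichlet_finite[OF H1per_D(1)[OF H]] in auto)
  then have "continuous_on UNIV f"
    by (intro uniformly_continuous_imp_continuous Hoelder_continuous)
  then show thesis using f that by (simp add: slice_avg_def)
qed

lemma nn_integral_double_add:
  assumes "f \<in> borel_measurable M" "g \<in> borel_measurable M"
  shows "(\<integral>\<^sup>+x. 2 * f x + 2 * g x \<partial>M) = 2 * (\<integral>\<^sup>+x. f x \<partial>M) + 2 * (\<integral>\<^sup>+x. g x \<partial>M)"
  using assms by (simp add: nn_integral_add nn_integral_cmult)

text \<open>The moving average in \<open>Poincare_slice\<close> is replaced by its value at one
  position. The displacement costs \<open>t - s\<close> twice: once in the bound for the increment
  and once as the measure of the slab.\<close>

lemma Poincare_slab:
  fixes u :: "real \<times> (real^'m) \<Rightarrow> real \<times> (real^'m)"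
  assumes H: "H1per u Du" and ub: "slice_avg u ub" and p: "p \<in> {s..t}"
  shows "(\<integral>\<^sup>+x\<in>slab {s..t}. nsq (u x - ub p) \<partial>lborel)
    \<le> (2 * slice_const TYPE('m) + 2 * ennreal ((t - s)\<^sup>2)) * Dirichlet Du {s..t}"
proof -
  note D = H1div_D[OF H1per_D(1)[OF H]]
  have [measurable]: "u \<in> borel_measurable borel" using D by auto
  have [measurable]: "xavg u \<in> borel_measurable borel" using D(4) by (rule measurable_xavg)
  have [measurable]: "(slab {s..t} :: (real \<times> (real^'m)) set) \<in> sets borel" by simp
  have st: "s \<le> t" using p by auto
  have near: "nsq (ub q - ub p) \<le> ennreal (t - s) * Dirichlet Du {s..t}" if "q \<in> {s..t}" for q
  proof -
    have "nsq (ub q' - ub p') \<le> ennreal (t - s) * Dirichlet Du {s..t}" if "p' \<in> {s..t}" "q' \<in> {s..t}" "p' \<le> q'" for p' q'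
    proof -
      have "nsq (ub q' - ub p') \<le> ennreal (q' - p') * Dirichlet Du {p'..q'}"
        by (rule slice_avg_flux(2)[OF H ub that(3)])
      also have "\<dots> \<le> ennreal (t - s) * Dirichlet Du {s..t}"
        using that by (intro mult_mono Dirichlet_mono ennreal_leI) auto
      finally show ?thesis .
    qed
    from this[of p q] this[of q p] show ?thesis
      using that p by (cases "p \<le> q") (auto simp: nsq_minus)
  qed
  have "(\<integral>\<^sup>+x\<in>slab {s..t}. nsq (u x - ub p) \<partial>lborel)
    \<le> (\<integral>\<^sup>+x. 2 * (nsq (u x - xavg u (fst x)) * indicator (slab {s..t}) x)
         + 2 * (ennreal (t - s) * Dirichlet Du {s..t} * indicator (slab {s..t}) x) \<partial>lborel)"
  proof (rule nn_integral_mono_AE)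
    have "AE t in lborel. ub t = xavg u t" using ub by (simp add: slice_avg_def)
    from AE_lborel_fst[OF this]
    show "AE x in lborel. nsq (u x - ub p) * indicator (slab {s..t}) x \<le> 2 * (nsq (u x - xavg u (fst x)) * indicator (slab {s..t}) x)
         + 2 * (ennreal (t - s) * Dirichlet Du {s..t} * indicator (slab {s..t}) x)"
    proof eventually_elim
      case (elim x)
      show ?case
      proof (cases "x \<in> slab {s..t}")
        case True
        have "nsq (u x - ub p) \<le> 2 * nsq (u x - ub (fst x)) + 2 * nsq (ub (fst x) - ub p)"
          by (rule nsq_triangle)
        also have "\<dots> \<le> 2 * nsq (u x - ub (fst x)) + 2 * (ennreal (t - s) * Dirichlet Du {s..t})"
          using near[of "fst x"] True by (intro add_left_mono mult_left_mono) (auto simp: mem_slab)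
        finally show ?thesis using True elim by simp
      qed simp
    qed
  qed
  also have "\<dots> = 2 * (\<integral>\<^sup>+x\<in>slab {s..t}. nsq (u x - xavg u (fst x)) \<partial>lborel)
     + 2 * (ennreal (t - s) * Dirichlet Du {s..t} * ennreal (t - s))"
    using st by (subst nn_integral_double_add) (auto simp: emeasure_slab nn_integral_cmult_indicator)
  also have "\<dots> \<le> 2 * (slice_const TYPE('m) * Dirichlet Du {s..t}) + 2 * (ennreal (t - s) * Dirichlet Du {s..t} * ennreal (t - s))"
    by (intro add_right_mono mult_left_mono Poincare_slice[OF H]) auto
  also have "\<dots> = (2 * slice_const TYPE('m) + 2 * ennreal ((t - s)\<^sup>2)) * Dirichlet Du {s..t}"
  proof -
    have "ennreal ((t - s)\<^sup>2) = ennreal (t - s) * ennreal (t - s)"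
      using st by (simp add: power2_eq_square ennreal_mult)
    then show ?thesis by (simp only: distrib_right distrib_left ac_simps)
  qed
  finally show ?thesis .
qed

text \<open>Reduces to nonnegative functions component by component: \<open>\<sigma> = 1\<close> and
  \<open>\<sigma> = -1\<close> give the positive and the negative part.\<close>

lemma integral_slab_shift:
  fixes G :: "real \<times> (real^'m) \<Rightarrow> 'b::euclidean_space"
  assumes G: "locint G" and per: "periodic_cyl G"
  shows "(LINT x:slab {s..t}|lborel. G (x + c *\<^sub>R ebas i)) = (LINT x:slab {s..t}|lborel. G x)"
proof (rule euclidean_eqI)
  fix k :: 'b assume k: "k \<in> Basis"
  have [measurable]: "G \<in> borel_measurable borel" using G by (rule locint_measurable)
  have [measurable]: "(slab {s..t} :: (real \<times> (real^'m)) set) \<in> sets borel" by simp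
  have 1: "integrable lborel (\<lambda>x. indicator (slab {s..t}) x *\<^sub>R G x)"
    "integrable lborel (\<lambda>x. indicator (slab {s..t}) x *\<^sub>R G (x + c *\<^sub>R ebas i))"
    using set_integrable_slab[OF G] set_integrable_slab[OF locint_shift[OF G]] by (auto simp: set_integrable_def)
  have int: "integrable lborel (\<lambda>x. indicator (slab {s..t}) x * (G x \<bullet> k))"
    "integrable lborel (\<lambda>x. indicator (slab {s..t}) x * (G (x + c *\<^sub>R ebas i) \<bullet> k))"
    using integrable_inner_left[of k, OF 1(1)] integrable_inner_left[of k, OF 1(2)] by auto
  have sh: "(\<integral>\<^sup>+x. ennreal (indicator (slab {s..t}) x * (\<sigma> * (G (x + c *\<^sub>R ebas i) \<bullet> k))) \<partial>lborel)
     = (\<integral>\<^sup>+x. ennreal (indicator (slab {s..t}) x * (\<sigma> * (G x \<bullet> k))) \<partial>lborel)" for \<sigma> :: real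
  proof -
    have *: "ennreal (indicator A x * q) = ennreal q * indicator A x" for A x q
      by (simp add: indicator_def)
    have "periodic_cyl (\<lambda>x. ennreal (\<sigma> * (G x \<bullet> k)))"
      by (rule periodic_cyl_compose[OF per])
    from nn_integral_slab_shift[OF _ _ this, of "{s..t}" c i] show ?thesis unfolding * by simp
  qed
  have "(LINT x|lborel. indicator (slab {s..t}) x * (G (x + c *\<^sub>R ebas i) \<bullet> k)) = (LINT x|lborel. indicator (slab {s..t}) x * (G x \<bullet> k))"
    using real_lebesgue_integral_def[OF int(1)] real_lebesgue_integral_def[OF int(2)] sh[of 1] sh[of "-1"] by simp
  then show "(LINT x:slab {s..t}|lborel. G (x + c *\<^sub>R ebas i)) \<bullet> k = (LINT x:slab {s..t}|lborel. G x) \<bullet> k"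
    unfolding set_lebesgue_integral_def
    using integral_inner_left[of k, OF 1(1)] integral_inner_left[of k, OF 1(2)] by simp
qed

text \<open>By periodicity of \<open>u\<close> the derivative integrates to zero along a full
  period. Integrating this over the slab and exchanging integrals gives, for each \<open>r\<close>,
  a translated copy of the wanted integral, and the translation can be undone.\<close>

lemma transversal_flux_zero:
  fixes u :: "real \<times> (real^'m) \<Rightarrow> real \<times> (real^'m)"
  assumes H: "H1per u Du"
  shows "(LINT x:slab {s..t}|lborel. Du x (ebas i)) = 0"
proof -
  note D = H1div_D[OF H1per_D(1)[OF H]]
  let ?g = "\<lambda>x. Du x (ebas i)"
  have g: "locint ?g" using D by auto
  have [measurable]: "?g \<in> borel_measurable borel" using D by auto
  have [measurable]: "(slab {s..t} :: (real \<times> (real^'m)) set) \<in> sets borel" by simp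
  let ?K = "{s..t} \<times> cbox 0 (One :: real^'m)"
  have "AE x in lborel. u (x + 1 *\<^sub>R ebas i) - u x = (LINT r:{0..1}|lborel. ?g (x + r *\<^sub>R ebas i))"
    by (rule weak_partial_segment[OF D(3) g]) (use D(8) in auto)
  then have z: "AE x in lborel. (LINT r:{0..1}|lborel. ?g (x + r *\<^sub>R ebas i)) = 0"
    by eventually_elim (use D(1)[unfolded periodic_cyl_iff, rule_format] in simp)
  have int: "integrable (lborel \<Otimes>\<^sub>M lborel) (\<lambda>(x, r). indicator (slab {s..t}) x *\<^sub>R indicator {0..1} r *\<^sub>R ?g (x + r *\<^sub>R ebas i))"
  proof (rule integrable_segment[OF g, where K = ?K and B = 1])
    show "compact ?K" by (intro compact_Times) auto
    show "x \<notin> ?K \<Longrightarrow> indicator (slab {s..t}) x = (0::real)" for x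
      using slab_subset_Times[of "{s..t}"] by (auto simp: indicator_def)
  qed (auto simp: indicator_def)
  have "(LINT r|lborel. LINT x|lborel. indicator (slab {s..t}) x *\<^sub>R indicator {0..1} r *\<^sub>R ?g (x + r *\<^sub>R ebas i))
      = (LINT x|lborel. LINT r|lborel. indicator (slab {s..t}) x *\<^sub>R indicator {0..1} r *\<^sub>R ?g (x + r *\<^sub>R ebas i))"
    using lborel_pair.Fubini_integral[OF int] by simp
  also have "\<dots> = (LINT x|lborel. indicator (slab {s..t}) x *\<^sub>R (LINT r:{0..1}|lborel. ?g (x + r *\<^sub>R ebas i)))"
    by (simp add: set_lebesgue_integral_def del: scaleR_scaleR)
  also have "\<dots> = 0"
    by (rule integral_eq_zero_AE) (use z in \<open>eventually_elim, simp\<close>)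
  finally have "0 = (LINT r|lborel. LINT x|lborel. indicator {0..1} r *\<^sub>R indicator (slab {s..t}) x *\<^sub>R ?g (x + r *\<^sub>R ebas i))"
    by (simp add: mult.commute)
  also have "\<dots> = (LINT r|lborel. indicator {0..1} r *\<^sub>R (LINT x:slab {s..t}|lborel. ?g (x + r *\<^sub>R ebas i)))"
    by (simp add: set_lebesgue_integral_def del: scaleR_scaleR)
  also have "\<dots> = (LINT r|lborel. indicator {0..1::real} r *\<^sub>R (LINT x:slab {s..t}|lborel. ?g x))"
    by (simp only: integral_slab_shift[OF g H1per_D(2)[OF H]])
  also have "\<dots> = (LINT x:slab {s..t}|lborel. ?g x)"
    by (subst integral_scaleR_left) auto
  finally show ?thesis by simp
qed

text \<open>The divergence theorem on a slab: the transversal terms vanish, so the first component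
  of the axial flux must vanish as well.\<close>

lemma slice_avg_fst_const:
  fixes u :: "real \<times> (real^'m) \<Rightarrow> real \<times> (real^'m)"
  assumes H: "H1per u Du" and ub: "slice_avg u ub"
  shows "fst (ub t) = fst (ub s)"
proof -
  note D = H1div_D[OF H1per_D(1)[OF H]]
  have "fst (flux Du s t) = 0" for s t
  proof -
    have I: "integrable lborel (\<lambda>x. indicator (slab {s..t}) x *\<^sub>R Du x b)" if "b \<in> Basis" for b
      using set_integrable_slab[OF D(6)[OF that]] by (simp add: set_integrable_def)
    have int: "integrable lborel (\<lambda>x. indicator (slab {s..t}) x * (Du x b \<bullet> b))" if "b \<in> Basis" for b
      using integrable_inner_left[of b, OF I[OF that]] by simp
    have eq: "(LINT x|lborel. indicator (slab {s..t}) x * (Du x b \<bullet> b)) = (LINT x:slab {s..t}|lborel. Du x b) \<bullet> b" if "b \<in> Basis" for b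
      unfolding set_lebesgue_integral_def using integral_inner_left[of b, OF I[OF that]] by simp
    have "(\<Sum>b\<in>Basis. (LINT x:slab {s..t}|lborel. Du x b) \<bullet> b) = (LINT x|lborel. (\<Sum>b\<in>Basis. indicator (slab {s..t}) x * (Du x b \<bullet> b)))"
      using int eq by (subst Bochner_Integration.integral_sum) auto
    also have "\<dots> = 0"
      using D(10) by (intro integral_eq_zero_AE) (auto simp: divergence_def sum_distrib_left[symmetric] elim: eventually_mono)
    finally have "0 = (\<Sum>b\<in>Basis. (LINT x:slab {s..t}|lborel. Du x b) \<bullet> b)" by simp
    also have "\<dots> = (LINT x:slab {s..t}|lborel. Du x (1, 0)) \<bullet> (1, 0) + (\<Sum>b\<in>range ebas. (LINT x:slab {s..t}|lborel. Du x b) \<bullet> b)"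
      unfolding Basis_cyl by (subst sum.insert) (auto simp: ebas_def)
    also have "(\<Sum>b\<in>range ebas. (LINT x:slab {s..t}|lborel. Du x b) \<bullet> b) = 0"
      by (rule sum.neutral) (auto simp: transversal_flux_zero[OF H] simp del: inner_ebas)
    finally show ?thesis by (simp add: flux_def inner_e1)
  qed
  then show ?thesis
    using slice_avg_flux(1)[OF H ub, of s t] slice_avg_flux(1)[OF H ub, of t s]
    by (cases "s \<le> t") (metis eq_iff_diff_eq_0 fst_diff linear)+
qed

section \<open>Lower bounds for the energy of a slab\<close>

definition slab_energy where
  "slab_energy W u Du I = (\<integral>\<^sup>+x\<in>slab I. ennreal (grad_sq Du x / 2 + W (u x)) \<partial>lborel)"

lemma energy_eq: "energy W u Du = slab_energy W u Du UNIV"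
  unfolding energy_def slab_energy_def by (rule cell_slab_nn)

lemma slab_energy_mono: "I \<subseteq> J \<Longrightarrow> slab_energy W u Du I \<le> slab_energy W u Du J"
  unfolding slab_energy_def by (intro nn_integral_mono) (auto simp: indicator_def mem_slab)

text \<open>Compactness treats bounded points \<open>z\<close> of the hyperplane away from the
  wells, the liminf assumption treats the others. The point \<open>y\<close> may leave the
  hyperplane, because only averages of a field lie in it, not its values. The margin in
  \<open>R + 1\<close> and the cap \<open>1 / 2\<close> on the radius keep \<open>snd y\<close>
  beyond \<open>R\<close> for far \<open>z\<close>.\<close>

lemma potential_lower_bound:
  fixes W :: "real \<times> (real^'m) \<Rightarrow> real"
  assumes W_cont: "continuous_on UNIV W" and W_nonneg: "\<And>z. W z \<ge> 0"
    and S_a: "{z. fst z = a \<and> W z = 0} = {um, up}"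
    and liminf: "\<exists>c>0. \<exists>\<delta>>0. \<exists>R. \<forall>z1 z'. \<bar>z1 - a\<bar> < \<delta> \<and> norm z' > R \<longrightarrow> W (z1, z') \<ge> c"
    and \<rho>: "\<rho> > 0"
  obtains r \<kappa> where "r > 0" "\<kappa> > 0"
    "\<And>z y. fst z = a \<Longrightarrow> \<rho> \<le> dist z um \<Longrightarrow> \<rho> \<le> dist z up \<Longrightarrow> dist y z \<le> r \<Longrightarrow> W y \<ge> \<kappa>"
proof -
  obtain c \<delta> R where c: "c > 0" "\<delta> > 0" "\<And>z1 z'. \<bar>z1 - a\<bar> < \<delta> \<and> norm z' > R \<Longrightarrow> W (z1, z') \<ge> c"
    using liminf by blast
  define K where "K = ({a} \<times> cball 0 (R + 1)) \<inter> {z. \<rho> \<le> dist z um} \<inter> {z. \<rho> \<le> dist z up}"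
  have K: "compact K"
    unfolding K_def
    by (intro compact_Int_closed compact_Times closed_Collect_le continuous_intros) auto
  have pos: "W z > 0" if "z \<in> K" for z
  proof -
    have "z \<noteq> um" "z \<noteq> up" "fst z = a" using that \<rho> by (auto simp: K_def)
    then have "W z \<noteq> 0" using S_a by blast
    then show ?thesis using W_nonneg[of z] by linarith
  qed
  obtain w where w: "w > 0" "\<And>z. z \<in> K \<Longrightarrow> w \<le> W z"
  proof (cases "K = {}")
    case True
    then show ?thesis using that[of 1] by simp
  next
    case False
    obtain z0 where "z0 \<in> K" "\<And>z. z \<in> K \<Longrightarrow> W z0 \<le> W z"
      using continuous_attains_inf[OF K False continuous_on_subset[OF W_cont]] by blast
    then show ?thesis using that[of "W z0"] pos by blast
  qed
  have "open {y. w / 2 < W y}"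
    using W_cont by (intro open_Collect_less continuous_intros)
  moreover have "K \<subseteq> {y. w / 2 < W y}" using w by force
  ultimately obtain e where e: "e > 0" "(\<Union>z\<in>K. ball z e) \<subseteq> {y. w / 2 < W y}"
    using compact_subset_open_imp_ball_epsilon_subset[OF K] by blast
  show thesis
  proof (rule that[of "min (e / 2) (min (\<delta> / 2) (1 / 2))" "min c (w / 2)"])
    fix z y
    assume z: "fst z = a" "\<rho> \<le> dist z um" "\<rho> \<le> dist z up" and y: "dist y z \<le> min (e / 2) (min (\<delta> / 2) (1 / 2))"
    show "min c (w / 2) \<le> W y"
    proof (cases "norm (snd z) \<le> R + 1")
      case True
      then have "z \<in> K" using z by (auto simp: K_def mem_Times_iff)
      moreover have "y \<in> ball z e" using y e(1) by (simp add: dist_commute)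
      ultimately have "w / 2 < W y" using e(2) by blast
      then show ?thesis by simp
    next
      case False
      have "norm (snd z) \<le> norm (snd y) + dist y z"
        using dist_snd_le[of y z] norm_triangle_sub[of "snd z" "snd y"] by (simp add: dist_norm norm_minus_commute)
      then have "norm (snd y) > R" using False y by linarith
      moreover have "\<bar>fst y - a\<bar> < \<delta>"
        using dist_fst_le[of y z] y c(2) z(1) by (simp add: dist_real_def)
      ultimately have "W (fst y, snd y) \<ge> c" using c(3) by blast
      then show ?thesis by simp
    qed
  qed (use e c w in auto)
qed

lemma half_Dirichlet_le_slab_energy:
  assumes "\<And>z. W z \<ge> 0" "grad_sq Du \<in> borel_measurable borel" "I \<in> sets borel"
  shows "ennreal (1 / 2) * Dirichlet Du I \<le> slab_energy W u Du I"
proof -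
  note [measurable] = assms(2,3)
  have "ennreal (1 / 2) * Dirichlet Du I = (\<integral>\<^sup>+x. ennreal (1 / 2) * (ennreal (grad_sq Du x) * indicator (slab I) x) \<partial>lborel)"
    unfolding Dirichlet_def by (rule nn_integral_cmult[symmetric]) measurable
  also have "\<dots> \<le> slab_energy W u Du I"
    unfolding slab_energy_def
  proof (intro nn_integral_mono)
    fix x
    have "ennreal (1 / 2) * ennreal (grad_sq Du x) \<le> ennreal (grad_sq Du x / 2 + W (u x))"
      unfolding ennreal_mult[OF _ grad_sq_nonneg, symmetric] using assms(1)[of "u x"]
      by (subst ennreal_mult[symmetric]) (auto intro!: ennreal_leI grad_sq_nonneg)
    then show "ennreal (1 / 2) * (ennreal (grad_sq Du x) * indicator (slab I) x) \<le> ennreal (grad_sq Du x / 2 + W (u x)) * indicator (slab I) x"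
      by (simp add: mult.assoc[symmetric] mult_right_mono)
  qed
  finally show ?thesis .
qed

text \<open>If the Dirichlet energy of the slab is small, Chebyshev's inequality leaves at least
  half of the slab within \<open>r\<close> of the average. The two entries of the minimum belong to
  large and to small Dirichlet energy.\<close>

lemma slab_energy_lower_bound:
  fixes W :: "real \<times> (real^'m) \<Rightarrow> real"
  assumes W_cont: "continuous_on UNIV W" and W_nonneg: "\<And>z. W z \<ge> 0"
    and S_a: "{z. fst z = a \<and> W z = 0} = {um, up}"
    and liminf: "\<exists>c>0. \<exists>\<delta>>0. \<exists>R. \<forall>z1 z'. \<bar>z1 - a\<bar> < \<delta> \<and> norm z' > R \<longrightarrow> W (z1, z') \<ge> c"
    and \<rho>: "\<rho> > 0"
  obtains \<kappa> :: real where "\<kappa> > 0"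
    "\<And>u Du ub t. H1per u Du \<Longrightarrow> slice_avg u ub \<Longrightarrow> fst (ub t) = a \<Longrightarrow> \<rho> \<le> dist (ub t) um \<Longrightarrow> \<rho> \<le> dist (ub t) up
       \<Longrightarrow> ennreal \<kappa> \<le> slab_energy W u Du {t..t + 1}"
proof -
  obtain r \<kappa>0 where r: "r > 0" "\<kappa>0 > 0"
    "\<And>z y. fst z = a \<Longrightarrow> \<rho> \<le> dist z um \<Longrightarrow> \<rho> \<le> dist z up \<Longrightarrow> dist y z \<le> r \<Longrightarrow> W y \<ge> \<kappa>0"
    using potential_lower_bound[OF W_cont W_nonneg S_a liminf \<rho>] by blast
  have [measurable]: "W \<in> borel_measurable borel" using W_cont by (rule borel_measurable_continuous_onI)
  \<comment> \<open>The constant of \<open>Poincare_slab\<close> for a slab of length 1.\<close>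
  define C where "C = 2 * slice_const TYPE('m) + 2"
  have "C < \<infinity>" using slice_const_finite[where 'm = 'm] by (auto simp: C_def ennreal_mult_less_top)
  then obtain Cr where Cr: "C = ennreal Cr" "Cr \<ge> 0" by (cases C) auto
  have "Cr > 0"
  proof -
    have "C \<noteq> 0" by (simp add: C_def)
    then show ?thesis using Cr by (cases "Cr = 0") auto
  qed
  show thesis
  proof (rule that[of "min (r\<^sup>2 / (4 * Cr)) (\<kappa>0 / 2)"])
    fix u :: "real \<times> (real^'m) \<Rightarrow> real \<times> (real^'m)" and Du ub t
    assume H: "H1per u Du" and ub: "slice_avg u ub" and far: "fst (ub t) = a" "\<rho> \<le> dist (ub t) um" "\<rho> \<le> dist (ub t) up"
    let ?S = "slab {t..t + 1} :: (real \<times> (real^'m)) set"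
    let ?G = "Dirichlet Du {t..t + 1}"
    have [measurable]: "?S \<in> sets borel" by simp
    note D = H1div_D[OF H1per_D(1)[OF H]]
    have [measurable]: "u \<in> borel_measurable borel" "grad_sq Du \<in> borel_measurable borel" using D H1per_D(4)[OF H] by auto
    have S1: "emeasure lborel ?S = 1" by (simp add: emeasure_slab)
    show "ennreal (min (r\<^sup>2 / (4 * Cr)) (\<kappa>0 / 2)) \<le> slab_energy W u Du {t..t + 1}"
    \<comment> \<open>This threshold makes Chebyshev's bound for the exceptional set equal to 1/2;
      half of the threshold is the gradient energy in the first case.\<close>
    proof (cases "?G \<ge> ennreal (r\<^sup>2 / (2 * Cr))")
      case True
      have "ennreal (r\<^sup>2 / (4 * Cr)) = ennreal (1 / 2) * ennreal (r\<^sup>2 / (2 * Cr))"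
        using \<open>Cr > 0\<close> by (subst ennreal_mult[symmetric]) auto
      also have "\<dots> \<le> ennreal (1 / 2) * ?G" using True by (intro mult_left_mono) auto
      also have "\<dots> \<le> slab_energy W u Du {t..t + 1}"
        by (rule half_Dirichlet_le_slab_energy[OF W_nonneg]) auto
      finally show ?thesis by (meson ennreal_leI min.cobounded1 order_trans)
    next
      case False
      let ?A = "{x \<in> ?S. norm (u x - ub t) \<le> r}" and ?B = "{x \<in> ?S. norm (u x - ub t) > r}"
      have [measurable]: "?A \<in> sets borel" "?B \<in> sets borel" by measurable
      have "ennreal (r\<^sup>2) * emeasure lborel ?B = (\<integral>\<^sup>+x. ennreal (r\<^sup>2) * indicator ?B x \<partial>lborel)"
        by (simp add: nn_integral_cmult_indicator)
      also have "\<dots> \<le> (\<integral>\<^sup>+x\<in>?S. nsq (u x - ub t) \<partial>lborel)"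
        using r(1) by (intro nn_integral_mono) (auto simp: indicator_def nsq_def intro!: ennreal_leI power_mono)
      also have "\<dots> \<le> (2 * slice_const TYPE('m) + 2 * ennreal ((t + 1 - t)\<^sup>2)) * ?G"
        by (rule Poincare_slab[OF H ub]) simp
      also have "\<dots> = ennreal Cr * ?G" using Cr by (simp add: C_def)
      also have "\<dots> \<le> ennreal Cr * ennreal (r\<^sup>2 / (2 * Cr))"
        using False by (intro mult_left_mono) auto
      also have "\<dots> = ennreal (r\<^sup>2) * ennreal (1 / 2)"
        using \<open>Cr > 0\<close> by (subst (1 2) ennreal_mult[symmetric]) auto
      finally have "emeasure lborel ?B \<le> ennreal (1 / 2)"
        using r(1) by (subst (asm) ennreal_mult_le_mult_iff) auto
      moreover have "emeasure lborel ?A + emeasure lborel ?B = 1"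
        unfolding S1[symmetric] by (subst plus_emeasure) (auto intro!: arg_cong[where f = "emeasure lborel"])
      ultimately have A: "emeasure lborel ?A \<ge> ennreal (1 / 2)"
      proof -
        assume B: "emeasure lborel ?B \<le> ennreal (1 / 2)" and s: "emeasure lborel ?A + emeasure lborel ?B = 1"
        have "1 \<le> emeasure lborel ?A + ennreal (1 / 2)"
          unfolding s[symmetric] by (rule add_left_mono[OF B])
        also have "\<dots> = ennreal (1 / 2) + emeasure lborel ?A" by (rule add.commute)
        finally have "ennreal (1 / 2) + ennreal (1 / 2) \<le> ennreal (1 / 2) + emeasure lborel ?A"
          by (subst ennreal_plus[symmetric]) auto
        then have "ennreal (1 / 2) = \<infinity> \<or> ennreal (1 / 2) \<le> emeasure lborel ?A"
          by (rule ennreal_add_left_cancel_le[THEN iffD1])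
        moreover have "ennreal (1 / 2) \<noteq> \<infinity>" by (simp only: infinity_ennreal_def ennreal_neq_top not_False_eq_True)
        ultimately show ?thesis by blast
      qed
      have "ennreal (\<kappa>0 / 2) = ennreal \<kappa>0 * ennreal (1 / 2)"
        using r by (subst ennreal_mult[symmetric]) auto
      also have "\<dots> \<le> ennreal \<kappa>0 * emeasure lborel ?A" using A by (intro mult_left_mono) auto
      also have "\<dots> = (\<integral>\<^sup>+x. ennreal \<kappa>0 * indicator ?A x \<partial>lborel)"
        by (simp add: nn_integral_cmult_indicator)
      also have "\<dots> \<le> slab_energy W u Du {t..t + 1}"
        unfolding slab_energy_def
      proof (intro nn_integral_mono)
        fix x
        show "ennreal \<kappa>0 * indicator ?A x \<le> ennreal (grad_sq Du x / 2 + W (u x)) * indicator ?S x"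
        proof (cases "x \<in> ?A")
          case True
          then have "\<kappa>0 \<le> W (u x)" using r(3)[OF far, of "u x"] by (simp add: dist_norm)
          then have "\<kappa>0 \<le> grad_sq Du x / 2 + W (u x)" using grad_sq_nonneg[of Du x] by linarith
          then show ?thesis using True by (simp add: ennreal_leI)
        qed simp
      qed
      finally show ?thesis by (meson ennreal_leI min.cobounded2 order_trans)
    qed
  qed (use \<open>Cr > 0\<close> r in auto)
qed

text \<open>Balls of half the distance of the wells are disjoint, so the image of a half-line, being
  connected and contained in their union, stays in one of them. The choice of the well is thus
  settled before smaller radii are considered.\<close>

lemma tendsto_one_of_two:
  fixes f :: "real \<Rightarrow> 'b::metric_space"
  assumes cont: "continuous_on UNIV f" and ne: "um \<noteq> up"
    and ev: "\<And>\<rho>. \<rho> > 0 \<Longrightarrow> eventually (\<lambda>t. dist (f t) um < \<rho> \<or> dist (f t) up < \<rho>) at_top"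
  shows "(f \<longlongrightarrow> um) at_top \<or> (f \<longlongrightarrow> up) at_top"
proof -
  define \<rho> where "\<rho> = dist um up / 2"
  have \<rho>: "\<rho> > 0" using ne by (simp add: \<rho>_def)
  obtain T where T: "\<And>t. t \<ge> T \<Longrightarrow> dist (f t) um < \<rho> \<or> dist (f t) up < \<rho>"
    using ev[OF \<rho>] by (auto simp: eventually_at_top_linorder)
  have disj: "\<not> (dist z um < \<rho> \<and> dist z up < \<rho>)" for z
    using dist_triangle[of um up z] by (auto simp: \<rho>_def dist_commute)
  have lim: "(f \<longlongrightarrow> p) at_top" if p: "p = um \<and> q = up \<or> p = up \<and> q = um" and near: "\<And>t. t \<ge> T \<Longrightarrow> dist (f t) p < \<rho>" for p q
  proof (rule tendstoI)
    fix e :: real assume "e > 0"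
    then have "eventually (\<lambda>t. dist (f t) um < min e \<rho> \<or> dist (f t) up < min e \<rho>) at_top"
      using \<rho> by (intro ev) auto
    then show "eventually (\<lambda>t. dist (f t) p < e) at_top"
      using eventually_ge_at_top[of T]
    proof eventually_elim
      case (elim t)
      then show ?case using near[of t] disj[of "f t"] p by auto
    qed
  qed
  have "connected (f ` {T..})"
    using cont by (intro connected_continuous_image) (auto intro: continuous_on_subset)
  then have "ball um \<rho> \<inter> f ` {T..} = {} \<or> ball up \<rho> \<inter> f ` {T..} = {}"
  proof (rule connectedD)
    show "ball um \<rho> \<inter> ball up \<rho> \<inter> f ` {T..} = {}" using disj by (auto simp: mem_ball dist_commute[of um] dist_commute[of up])
    show "f ` {T..} \<subseteq> ball um \<rho> \<union> ball up \<rho>" using T by (force simp: dist_commute)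
  qed auto
  then show ?thesis
  proof
    assume "ball um \<rho> \<inter> f ` {T..} = {}"
    then have "dist (f t) up < \<rho>" if "t \<ge> T" for t using T[OF that] that by (auto simp: dist_commute)
    then show ?thesis using lim by blast
  next
    assume "ball up \<rho> \<inter> f ` {T..} = {}"
    then have "dist (f t) um < \<rho>" if "t \<ge> T" for t using T[OF that] that by (auto simp: dist_commute)
    then show ?thesis using lim by blast
  qed
qed

lemma slab_energy_tail:
  fixes I :: "nat \<Rightarrow> real set" and u :: "real \<times> (real^'m) \<Rightarrow> real \<times> (real^'m)"
  assumes [measurable]: "\<And>n. I n \<in> sets borel" "W \<in> borel_measurable borel" "u \<in> borel_measurable borel" "grad_sq Du \<in> borel_measurable borel"
    and fin: "slab_energy W u Du UNIV < \<infinity>" and I: "\<And>t. eventually (\<lambda>n. t \<notin> I n) sequentially"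
  shows "(\<lambda>n. slab_energy W u Du (I n)) \<longlonglongrightarrow> 0"
proof -
  let ?f = "\<lambda>x. ennreal (grad_sq Du x / 2 + W (u x))"
  have "(\<lambda>n. \<integral>\<^sup>+x. ?f x * indicator (slab (I n)) x \<partial>lborel) \<longlonglongrightarrow> (\<integral>\<^sup>+x. 0 \<partial>(lborel :: (real \<times> (real^'m)) measure))"
  proof (rule nn_integral_dominated_convergence[where w = "\<lambda>x. ?f x * indicator (slab UNIV) x"])
    show "(\<integral>\<^sup>+x. ?f x * indicator (slab UNIV) x \<partial>lborel) < \<infinity>"
      using fin by (simp add: slab_energy_def)
    show "AE x in lborel. ?f x * indicator (slab (I n)) x \<le> ?f x * indicator (slab UNIV) x" for n
      by (auto simp: indicator_def mem_slab)
    show "AE x in lborel. (\<lambda>n. ?f x * indicator (slab (I n)) x) \<longlonglongrightarrow> 0"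
    proof (rule AE_I2)
      fix x
      have "eventually (\<lambda>n. ?f x * indicator (slab (I n)) x = 0) sequentially"
        using I[of "fst x"] by eventually_elim (simp add: mem_slab)
      then show "(\<lambda>n. ?f x * indicator (slab (I n)) x) \<longlonglongrightarrow> 0" by (rule tendsto_eventually)
    qed
  qed measurable
  then show ?thesis by (simp add: slab_energy_def)
qed

text \<open>Far out the remaining energy is less than the quantum belonging to
  \<open>\<rho>\<close>, so the average is \<open>\<rho>\<close>-close to a well there. The left end
  is treated by reflection.\<close>

lemma slice_avg_limits:
  fixes W :: "real \<times> (real^'m) \<Rightarrow> real"
  assumes W_cont: "continuous_on UNIV W" and W_nonneg: "\<And>z. W z \<ge> 0"
    and S_a: "{z. fst z = a \<and> W z = 0} = {um, up}" and ne: "um \<noteq> up"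
    and liminf: "\<exists>c>0. \<exists>\<delta>>0. \<exists>R. \<forall>z1 z'. \<bar>z1 - a\<bar> < \<delta> \<and> norm z' > R \<longrightarrow> W (z1, z') \<ge> c"
    and H: "H1per u Du" and ub: "slice_avg u ub" and fin: "slab_energy W u Du UNIV < \<infinity>"
    and a: "\<And>t. fst (ub t) = a"
  shows "(ub \<longlongrightarrow> um) at_top \<or> (ub \<longlongrightarrow> up) at_top" "(ub \<longlongrightarrow> um) at_bot \<or> (ub \<longlongrightarrow> up) at_bot"
proof -
  have [measurable]: "W \<in> borel_measurable borel" using W_cont by (rule borel_measurable_continuous_onI)
  have [measurable]: "u \<in> borel_measurable borel" "grad_sq Du \<in> borel_measurable borel"
    using H1div_D[OF H1per_D(1)[OF H]] H1per_D(4)[OF H] by auto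
  have cont: "continuous_on UNIV ub" using ub by (simp add: slice_avg_def)
  have ev: "\<exists>n. \<forall>t. {t..t + 1} \<subseteq> I n \<longrightarrow> dist (ub t) um < \<rho> \<or> dist (ub t) up < \<rho>"
    if "\<rho> > 0" and [measurable]: "\<And>n. I n \<in> sets borel" and I: "\<And>t. eventually (\<lambda>n. t \<notin> I n) sequentially"
    for \<rho> and I :: "nat \<Rightarrow> real set"
  proof -
    note \<rho> = that(1)
    obtain \<kappa> :: real where \<kappa>: "\<kappa> > 0"
      "\<And>u Du ub t. H1per u Du \<Longrightarrow> slice_avg u ub \<Longrightarrow> fst (ub t) = a \<Longrightarrow> \<rho> \<le> dist (ub t) um \<Longrightarrow> \<rho> \<le> dist (ub t) up
       \<Longrightarrow> ennreal \<kappa> \<le> slab_energy W u Du {t..t + 1}"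
      using slab_energy_lower_bound[OF W_cont W_nonneg S_a liminf \<rho>] by metis
    have "(\<lambda>n. slab_energy W u Du (I n)) \<longlonglongrightarrow> 0"
      by (rule slab_energy_tail) (use fin I in auto)
    then have "eventually (\<lambda>n. slab_energy W u Du (I n) < ennreal \<kappa>) sequentially"
      using \<kappa>(1) by (intro order_tendstoD) auto
    then obtain n where n: "slab_energy W u Du (I n) < ennreal \<kappa>"
      by (auto simp: eventually_sequentially)
    have "dist (ub t) um < \<rho> \<or> dist (ub t) up < \<rho>" if "{t..t + 1} \<subseteq> I n" for t
    proof (rule ccontr)
      assume "\<not> ?thesis"
      then have "ennreal \<kappa> \<le> slab_energy W u Du {t..t + 1}" using \<kappa>(2)[OF H ub a] by auto
      also have "\<dots> \<le> slab_energy W u Du (I n)" by (rule slab_energy_mono[OF that])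
      finally show False using n by simp
    qed
    then show ?thesis by blast
  qed
  show "(ub \<longlongrightarrow> um) at_top \<or> (ub \<longlongrightarrow> up) at_top"
  proof (rule tendsto_one_of_two[OF cont ne])
    fix \<rho> :: real assume "\<rho> > 0"
    have "eventually (\<lambda>n. t \<notin> {real n..}) sequentially" for t
      using eventually_gt_at_top[of "nat \<lceil>t\<rceil>"] by eventually_elim (auto, linarith)
    then obtain n where "\<forall>t. {t..t + 1} \<subseteq> {real n..} \<longrightarrow> dist (ub t) um < \<rho> \<or> dist (ub t) up < \<rho>"
      using ev[OF \<open>\<rho> > 0\<close>, of "\<lambda>n. {real n..}"] by auto
    then show "eventually (\<lambda>t. dist (ub t) um < \<rho> \<or> dist (ub t) up < \<rho>) at_top"
      unfolding eventually_at_top_linorder by (intro exI[of _ "real n"]) auto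
  qed
  have "((\<lambda>t. ub (- t)) \<longlongrightarrow> um) at_top \<or> ((\<lambda>t. ub (- t)) \<longlongrightarrow> up) at_top"
  proof (rule tendsto_one_of_two[OF _ ne])
    show "continuous_on UNIV (\<lambda>t. ub (- t))"
      by (rule continuous_on_compose2[OF cont]) (auto intro!: continuous_intros)
    fix \<rho> :: real assume "\<rho> > 0"
    have "eventually (\<lambda>n. t \<notin> {..- real n}) sequentially" for t
      using eventually_gt_at_top[of "nat \<lceil>- t\<rceil>"] by eventually_elim (auto, linarith)
    then obtain n where "\<forall>t. {t..t + 1} \<subseteq> {..- real n} \<longrightarrow> dist (ub t) um < \<rho> \<or> dist (ub t) up < \<rho>"
      using ev[OF \<open>\<rho> > 0\<close>, of "\<lambda>n. {..- real n}"] by auto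
    \<comment> \<open>The unit slab starting at \<open>- t\<close> reaches up to
      \<open>- t + 1\<close>, hence the extra 1.\<close>
    then show "eventually (\<lambda>t. dist (ub (- t)) um < \<rho> \<or> dist (ub (- t)) up < \<rho>) at_top"
      unfolding eventually_at_top_linorder by (intro exI[of _ "real n + 1"]) auto
  qed
  then show "(ub \<longlongrightarrow> um) at_bot \<or> (ub \<longlongrightarrow> up) at_bot"
    by (simp add: filterlim_at_bot_mirror)
qed

section \<open>Invariance under axial translation\<close>

lemma grad_sq_shift: "grad_sq (\<lambda>x. Du (x + c)) x = grad_sq Du (x + c)"
  by (simp add: grad_sq_def)

lemma L2loc_shift:
  fixes f :: "'a::euclidean_space \<Rightarrow> 'b::euclidean_space"
  assumes "L2loc f"
  shows "L2loc (\<lambda>x. f (x + c))"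
proof -
  have "f \<in> borel_measurable borel" by (rule L2loc_measurable[OF assms])
  moreover have "locint (\<lambda>x. (norm (f x))\<^sup>2)"
    using assms calculation by (auto simp: L2loc_def locint_def)
  from locint_shift[OF this, of c] have "locint (\<lambda>x. (norm (f (x + c)))\<^sup>2)" .
  ultimately show ?thesis by (auto simp: L2loc_def locint_def)
qed

lemma H1per_shift:
  fixes u :: "real \<times> (real^'m) \<Rightarrow> real \<times> (real^'m)"
  assumes H: "H1per u Du"
  shows "H1per (\<lambda>x. u (x + (\<tau>, 0))) (\<lambda>x. Du (x + (\<tau>, 0)))"
proof -
  note D = H1div_D[OF H1per_D(1)[OF H]]
  let ?c = "(\<tau>, 0) :: real \<times> (real^'m)"
  have [measurable]: "grad_sq Du \<in> borel_measurable borel" by (rule H1per_D(4)[OF H])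
  have "set_integrable lborel cell (grad_sq (\<lambda>x. Du (x + ?c)))"
    using integrable_lborel_shift[OF D(9)[unfolded set_integrable_def], of ?c]
    unfolding set_integrable_def grad_sq_shift[abs_def]
    by (rule arg_cong[where f = "integrable lborel", THEN iffD1, rotated])
      (auto simp: fun_eq_iff indicator_def cell_def)
  moreover have "AE x in lborel. divergence (\<lambda>x. Du (x + ?c)) x = 0"
    using AE_lborel_shift[OF D(10), of ?c] by (simp add: divergence_def)
  moreover have "L2loc (\<lambda>x. Du (x + ?c) b) \<and> weak_partial (\<lambda>x. u (x + ?c)) b (\<lambda>x. Du (x + ?c) b)"
    if "b \<in> Basis" for b
    using L2loc_shift[OF D(5)[OF that]] weak_partial_shift[OF D(3) D(6)[OF that] D(8)[OF that]] by blast
  ultimately show ?thesis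
    unfolding H1per_def H1div_def
    using periodic_cyl_shift[OF D(1)] periodic_cyl_shift[OF H1per_D(2)[OF H]] L2loc_shift[OF D(2)] by blast
qed

lemma slice_avg_shift:
  fixes u :: "real \<times> (real^'m) \<Rightarrow> real \<times> (real^'m)"
  assumes "slice_avg u ub"
  shows "slice_avg (\<lambda>x. u (x + (\<tau>, 0))) (\<lambda>t. ub (t + \<tau>))"
  unfolding slice_avg_def
proof
  show "continuous_on UNIV (\<lambda>t. ub (t + \<tau>))"
    by (rule continuous_on_compose2[of UNIV ub, OF _ continuous_on_add[OF continuous_on_id continuous_on_const]])
      (use assms in \<open>auto simp: slice_avg_def\<close>)
  have "xavg (\<lambda>x. u (x + (\<tau>, 0))) t = xavg u (t + \<tau>)" for t
    by (simp add: xavg_def)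
  then show "AE t in lborel. ub (t + \<tau>) = xavg (\<lambda>x. u (x + (\<tau>, 0))) t"
    using assms AE_lborel_shift[of "\<lambda>t. ub t = xavg u t" \<tau>] by (simp add: slice_avg_def)
qed

lemma slab_energy_shift:
  fixes u :: "real \<times> (real^'m) \<Rightarrow> real \<times> (real^'m)"
  assumes [measurable]: "W \<in> borel_measurable borel" "u \<in> borel_measurable borel" "grad_sq Du \<in> borel_measurable borel"
  shows "slab_energy W (\<lambda>x. u (x + (\<tau>, 0))) (\<lambda>x. Du (x + (\<tau>, 0))) UNIV = slab_energy W u Du UNIV"
  unfolding slab_energy_def grad_sq_shift
  using nn_integral_slab_UNIV_shift[of "\<lambda>x. ennreal (grad_sq Du x / 2 + W (u x))" \<tau>] by simp

section \<open>Strong local convergence\<close>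

lemma tendsto_0_if_eventually_le:
  fixes f :: "nat \<Rightarrow> ennreal"
  assumes "\<And>e::real. e > 0 \<Longrightarrow> eventually (\<lambda>n. f n \<le> ennreal e) sequentially"
  shows "f \<longlonglongrightarrow> 0"
proof (rule order_tendstoI)
  fix a :: ennreal assume "0 < a"
  then obtain b where b: "0 < b" "b < a" using dense by blast
  then obtain e where e: "b = ennreal e" "e > 0" by (cases b) auto
  show "eventually (\<lambda>n. f n < a) sequentially"
    using assms[OF e(2)] by eventually_elim (use b e in \<open>auto intro: le_less_trans\<close>)
qed simp

lemma term_le_suminf_ennreal: "f k \<le> (\<Sum>k. f k :: ennreal)"
  using sum_le_suminf[of f "{k}"] by simp

text \<open>Riesz-Fischer on an exhaustion. The Cauchy condition is local, so the index
  \<open>r k\<close> is adapted to \<open>S k\<close>, and on \<open>S K\<close> the increments are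
  estimated from index \<open>K\<close> on. Fatou's lemma then gives L^2 convergence of the whole
  sequence, not only of the subsequence.\<close>

lemma L2_complete:
  fixes g :: "nat \<Rightarrow> 'x \<Rightarrow> 'b::euclidean_space" and S :: "nat \<Rightarrow> 'x set"
  assumes [measurable]: "\<And>n. g n \<in> borel_measurable M" "\<And>k. S k \<in> sets M"
    and inc: "\<And>k l. k \<le> l \<Longrightarrow> S k \<subseteq> S l"
    and cauchy: "\<And>k e. e > 0 \<Longrightarrow> \<exists>N. \<forall>i\<ge>N. \<forall>j\<ge>N. (\<integral>\<^sup>+x\<in>S k. nsq (g i x - g j x) \<partial>M) \<le> ennreal e"
  obtains r :: "nat \<Rightarrow> nat" where "strict_mono r"
    "AE x in M. x \<in> (\<Union>k. S k) \<longrightarrow> convergent (\<lambda>i. g (r i) x)"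
    "\<And>k. (\<lambda>n. \<integral>\<^sup>+x\<in>S k. nsq (g n x - lim (\<lambda>i. g (r i) x)) \<partial>M) \<longlonglongrightarrow> 0"
proof -
  have "\<forall>k. \<exists>N. \<forall>i\<ge>N. \<forall>j\<ge>N. (\<integral>\<^sup>+x\<in>S k. nsq (g i x - g j x) \<partial>M) \<le> ennreal ((1/4)^k)"
    using cauchy by simp
  then obtain N where N: "\<And>k i j. i \<ge> N k \<Longrightarrow> j \<ge> N k \<Longrightarrow> (\<integral>\<^sup>+x\<in>S k. nsq (g i x - g j x) \<partial>M) \<le> ennreal ((1/4)^k)"
    by metis
  \<comment> \<open>Summing all thresholds up to \<open>k\<close> gives a monotone sequence above
    \<open>N k\<close>; the summand \<open>k\<close> makes it strictly monotone.\<close>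
  define r where "r k = (\<Sum>j\<le>k. N j) + k" for k
  have r_ge: "r k \<ge> N k" for k
    unfolding r_def by (rule trans_le_add1) (rule member_le_sum, auto)
  have r: "strict_mono r" by (rule strict_mono_Suc_iff[THEN iffD2]) (simp add: r_def)
  let ?d = "\<lambda>k x. g (r (Suc k)) x - g (r k) x"
  have d_le: "(\<integral>\<^sup>+x\<in>S K. nsq (?d (k + K) x) \<partial>M) \<le> ennreal ((1/4)^(k + K))" for k K
  proof -
    have "(\<integral>\<^sup>+x\<in>S K. nsq (?d (k + K) x) \<partial>M) \<le> (\<integral>\<^sup>+x\<in>S (k + K). nsq (?d (k + K) x) \<partial>M)"
      using inc[of K "k + K"] by (intro nn_integral_mono) (auto simp: indicator_def)
    also have "\<dots> \<le> ennreal ((1/4)^(k + K))"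
      using r_ge[of "k + K"] strict_mono_leD[OF r, of "k + K" "Suc (k + K)"] by (intro N) auto
    finally show ?thesis .
  qed
  have conv: "AE x in M. x \<in> S K \<longrightarrow> convergent (\<lambda>i. g (r i) x)" for K
  proof -
    \<comment> \<open>The weight \<open>2^(k + K)\<close> is small against the decay
      \<open>(1/4)^(k + K)\<close>, so the sum has finite integral, and large enough that a finite
      sum at \<open>x\<close> forces geometric decay of the increments.\<close>
    let ?F = "\<lambda>k x. ennreal (2^(k + K)) * (nsq (?d (k + K) x) * indicator (S K) x)"
    have "(\<integral>\<^sup>+x. (\<Sum>k. ?F k x) \<partial>M) = (\<Sum>k. \<integral>\<^sup>+x. ?F k x \<partial>M)"
      by (rule nn_integral_suminf) measurable
    also have "\<dots> = (\<Sum>k. ennreal (2^(k + K)) * (\<integral>\<^sup>+x\<in>S K. nsq (?d (k + K) x) \<partial>M))"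
      by (subst nn_integral_cmult) measurable
    also have "\<dots> \<le> (\<Sum>k. ennreal ((1/2)^k))"
    proof (intro suminf_le)
      fix k
      have "ennreal (2^(k + K)) * (\<integral>\<^sup>+x\<in>S K. nsq (?d (k + K) x) \<partial>M) \<le> ennreal (2^(k + K)) * ennreal ((1/4)^(k + K))"
        by (intro mult_left_mono d_le) auto
      also have "\<dots> = ennreal ((1/2)^(k + K))"
        by (subst ennreal_mult[symmetric]) (auto simp: power_mult_distrib[symmetric])
      also have "\<dots> \<le> ennreal ((1/2)^k)"
        by (intro ennreal_leI power_decreasing) auto
      finally show "ennreal (2^(k + K)) * (\<integral>\<^sup>+x\<in>S K. nsq (?d (k + K) x) \<partial>M) \<le> ennreal ((1/2)^k)" .
    qed auto
    also have "\<dots> = ennreal (\<Sum>k. (1/2)^k)"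
      by (rule suminf_ennreal2) (auto simp: summable_geometric)
    finally have "(\<integral>\<^sup>+x. (\<Sum>k. ?F k x) \<partial>M) \<noteq> \<infinity>"
      by (auto simp: top_unique)
    then have "AE x in M. (\<Sum>k. ?F k x) \<noteq> \<infinity>"
      by (intro nn_integral_PInf_AE) measurable
    then show ?thesis
    proof eventually_elim
      case (elim x)
      show ?case
      proof
        assume x: "x \<in> S K"
        obtain c where c: "(\<Sum>k. ?F k x) = ennreal c" "c \<ge> 0"
          using elim by (cases "\<Sum>k. ?F k x") auto
        have bound: "norm (?d (k + K) x) \<le> sqrt c * (sqrt (1/2))^(k + K)" for k
        proof -
          have "?F k x \<le> (\<Sum>k. ?F k x)" by (rule term_le_suminf_ennreal)
          then have "ennreal (2^(k + K) * (norm (?d (k + K) x))\<^sup>2) \<le> ennreal c"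
            unfolding c using x by (simp add: nsq_def ennreal_mult)
          then have "2^(k + K) * (norm (?d (k + K) x))\<^sup>2 \<le> c" using c by simp
          then have "(norm (?d (k + K) x))\<^sup>2 \<le> c * (1/2)^(k + K)"
            by (simp add: field_simps power_one_over)
          then have "norm (?d (k + K) x) \<le> sqrt (c * (1/2)^(k + K))" by (rule real_le_rsqrt)
          then show ?thesis by (simp add: real_sqrt_mult real_sqrt_power)
        qed
        have "summable (\<lambda>k. sqrt c * (sqrt (1/2))^(k + K))"
        proof -
          have "summable (\<lambda>k. (sqrt (1/2))^k)" by (rule summable_geometric) (simp add: real_sqrt_divide)
          then show ?thesis by (intro summable_mult) (subst summable_iff_shift)
        qed
        then have "summable (\<lambda>k. ?d (k + K) x)"
          by (rule summable_comparison_test'[where N = 0]) (use bound in auto)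
        then have "summable (\<lambda>k. ?d k x)" by (subst (asm) summable_iff_shift)
        then have "convergent (\<lambda>n. \<Sum>k<n. ?d k x)" by (simp add: summable_iff_convergent)
        then have "convergent (\<lambda>n. g (r n) x - g (r 0) x)"
          by (simp add: sum_lessThan_telescope[of "\<lambda>k. g (r k) x"])
        then show "convergent (\<lambda>i. g (r i) x)" by (simp add: convergent_diff_const_right_iff)
      qed
    qed
  qed
  have L2: "(\<lambda>n. \<integral>\<^sup>+x\<in>S k. nsq (g n x - lim (\<lambda>i. g (r i) x)) \<partial>M) \<longlonglongrightarrow> 0" for k
  proof (rule tendsto_0_if_eventually_le)
    fix e :: real assume e: "e > 0"
    obtain N' where N': "\<And>i j. i \<ge> N' \<Longrightarrow> j \<ge> N' \<Longrightarrow> (\<integral>\<^sup>+x\<in>S k. nsq (g i x - g j x) \<partial>M) \<le> ennreal e"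
      using cauchy[OF e] by blast
    have "(\<integral>\<^sup>+x\<in>S k. nsq (g n x - lim (\<lambda>i. g (r i) x)) \<partial>M) \<le> ennreal e" if n: "n \<ge> N'" for n
    proof -
      have "(\<integral>\<^sup>+x\<in>S k. nsq (g n x - lim (\<lambda>i. g (r i) x)) \<partial>M)
         \<le> (\<integral>\<^sup>+x. liminf (\<lambda>i. nsq (g n x - g (r i) x) * indicator (S k) x) \<partial>M)"
      proof (rule nn_integral_mono_AE)
        show "AE x in M. nsq (g n x - lim (\<lambda>i. g (r i) x)) * indicator (S k) x \<le> liminf (\<lambda>i. nsq (g n x - g (r i) x) * indicator (S k) x)"
          using conv[of k]
        proof eventually_elim
          case (elim x)
          show ?case
          proof (cases "x \<in> S k")
            case True
            then have "(\<lambda>i. g (r i) x) \<longlonglongrightarrow> lim (\<lambda>i. g (r i) x)" using elim by (simp add: convergent_LIMSEQ_iff)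
            then have "(\<lambda>i. nsq (g n x - g (r i) x)) \<longlonglongrightarrow> nsq (g n x - lim (\<lambda>i. g (r i) x))"
              unfolding nsq_def by (intro tendsto_intros tendsto_ennrealI)
            from lim_imp_Liminf[OF _ this] show ?thesis using True by simp
          qed simp
        qed
      qed
      also have "\<dots> \<le> liminf (\<lambda>i. \<integral>\<^sup>+x\<in>S k. nsq (g n x - g (r i) x) \<partial>M)"
        by (rule nn_integral_liminf) measurable
      also have "\<dots> \<le> limsup (\<lambda>i. \<integral>\<^sup>+x\<in>S k. nsq (g n x - g (r i) x) \<partial>M)"
        by (rule Liminf_le_Limsup) simp
      also have "\<dots> \<le> ennreal e"
      proof (rule Limsup_bounded)
        show "eventually (\<lambda>i. (\<integral>\<^sup>+x\<in>S k. nsq (g n x - g (r i) x) \<partial>M) \<le> ennreal e) sequentially"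
          using eventually_ge_at_top[of N']
        proof eventually_elim
          case (elim i)
          then show ?case using N'[OF n, of "r i"] seq_suble[OF r, of i] by simp
        qed
      qed
      finally show ?thesis .
    qed
    then show "eventually (\<lambda>n. (\<integral>\<^sup>+x\<in>S k. nsq (g n x - lim (\<lambda>i. g (r i) x)) \<partial>M) \<le> ennreal e) sequentially"
      by (auto simp: eventually_sequentially)
  qed
  have "AE x in M. \<forall>K. x \<in> S K \<longrightarrow> convergent (\<lambda>i. g (r i) x)"
    using conv by (subst AE_all_countable) blast
  then have "AE x in M. x \<in> (\<Union>k. S k) \<longrightarrow> convergent (\<lambda>i. g (r i) x)"
    by eventually_elim auto
  from that[OF r this L2] show thesis .
qed

text \<open>Division by \<open>1 + B x\<close> normalises all bounds to 1, where the diagonal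
  argument is available; multiplication undoes it in the limit.\<close>

lemma pointwise_bounded_convergent_subsequence:
  fixes f :: "nat \<Rightarrow> 'a \<Rightarrow> 'b::euclidean_space"
  assumes "countable S" "\<And>x. x \<in> S \<Longrightarrow> \<exists>B. \<forall>n. norm (f n x) \<le> B"
  obtains r where "strict_mono (r::nat\<Rightarrow>nat)" "\<And>x. x \<in> S \<Longrightarrow> convergent (\<lambda>n. f (r n) x)"
proof -
  have "\<forall>x\<in>S. \<exists>B. \<forall>n. norm (f n x) \<le> B" using assms(2) by blast
  then obtain B where B: "\<And>x n. x \<in> S \<Longrightarrow> norm (f n x) \<le> B x" by metis
  have pos: "B x \<ge> 0" if "x \<in> S" for x using B[OF that, of 0] norm_ge_zero order_trans by blast
  obtain r where r: "strict_mono (r::nat\<Rightarrow>nat)" "\<And>x. x \<in> S \<Longrightarrow> \<exists>l. (\<lambda>n. (1 / (1 + B x)) *\<^sub>R f (r n) x) \<longlonglongrightarrow> l"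
  proof (rule function_convergent_subsequence[OF assms(1), of "\<lambda>n x. (1 / (1 + B x)) *\<^sub>R f n x" 1])
    show "norm ((1 / (1 + B x)) *\<^sub>R f n x) \<le> 1" if "x \<in> S" for n x
      using B[OF that, of n] pos[OF that] by (simp add: field_simps)
  qed blast
  have "convergent (\<lambda>n. f (r n) x)" if x: "x \<in> S" for x
  proof -
    obtain l where "(\<lambda>n. (1 / (1 + B x)) *\<^sub>R f (r n) x) \<longlonglongrightarrow> l" using r(2)[OF x] by blast
    then have "(\<lambda>n. (1 + B x) *\<^sub>R ((1 / (1 + B x)) *\<^sub>R f (r n) x)) \<longlonglongrightarrow> (1 + B x) *\<^sub>R l" by (intro tendsto_intros)
    then show ?thesis using pos[OF x] by (auto simp: convergent_def intro!: exI)
  qed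
  then show thesis using r(1) that by blast
qed

text \<open>Coordinates rounded down to multiples of \<open>1 / Suc N\<close>: the lower corner of
  the lattice cube around \<open>x\<close>. The mesh divides 1, so lattice cubes fit into the
  periodicity cell.\<close>

definition corner :: "nat \<Rightarrow> 'a::euclidean_space \<Rightarrow> 'a" where
  "corner N x = (\<Sum>b\<in>Basis. (of_int \<lfloor>real (Suc N) * (x \<bullet> b)\<rfloor> / real (Suc N)) *\<^sub>R b)"

definition lcube :: "nat \<Rightarrow> 'a::euclidean_space \<Rightarrow> 'a set" where
  "lcube N q = cbox q (q + (1 / real (Suc N)) *\<^sub>R One)"

definition lattice_avg :: "nat \<Rightarrow> ('a::euclidean_space \<Rightarrow> 'b::euclidean_space) \<Rightarrow> 'a \<Rightarrow> 'b" where
  "lattice_avg N u q = real (Suc N) ^ DIM('a) *\<^sub>R (LINT y:lcube N q|lborel. u y)"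

lemma corner_inner:
  "b \<in> Basis \<Longrightarrow> corner N x \<bullet> b = of_int \<lfloor>real (Suc N) * (x \<bullet> b)\<rfloor> / real (Suc N)"
  unfolding corner_def by (simp add: inner_sum_left inner_Basis if_distrib cong: if_cong)

lemma corner_bounds:
  assumes "b \<in> Basis"
  shows "corner N x \<bullet> b \<le> x \<bullet> b" "x \<bullet> b \<le> corner N x \<bullet> b + 1 / real (Suc N)"
proof -
  have "of_int \<lfloor>real (Suc N) * (x \<bullet> b)\<rfloor> \<le> real (Suc N) * (x \<bullet> b)" by simp
  then show "corner N x \<bullet> b \<le> x \<bullet> b"
    unfolding corner_inner[OF assms] by (simp add: divide_le_eq mult.commute)
  have "real (Suc N) * (x \<bullet> b) \<le> of_int \<lfloor>real (Suc N) * (x \<bullet> b)\<rfloor> + 1" by linarith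
  then show "x \<bullet> b \<le> corner N x \<bullet> b + 1 / real (Suc N)"
    unfolding corner_inner[OF assms] by (simp add: add_divide_distrib[symmetric] le_divide_eq mult.commute)
qed

lemma countable_corners: "countable (range (corner N :: 'a::euclidean_space \<Rightarrow> 'a))"
proof -
  let ?F = "\<lambda>k :: 'a \<Rightarrow> int. \<Sum>b\<in>Basis. (of_int (k b) / real (Suc N)) *\<^sub>R b"
  have "range (corner N) \<subseteq> ?F ` (PiE Basis (\<lambda>_. UNIV))"
  proof
    fix q assume "q \<in> range (corner N :: 'a \<Rightarrow> 'a)"
    then obtain x where "q = corner N x" by auto
    then have "q = ?F (restrict (\<lambda>b. \<lfloor>real (Suc N) * (x \<bullet> b)\<rfloor>) Basis)" by (simp add: corner_def)
    then show "q \<in> ?F ` (PiE Basis (\<lambda>_. UNIV))" 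
      by (intro image_eqI[where x = "restrict (\<lambda>b. \<lfloor>real (Suc N) * (x \<bullet> b)\<rfloor>) Basis"]) auto
  qed
  moreover have "countable (PiE (Basis :: 'a set) (\<lambda>_. UNIV :: int set))"
    by (intro countable_PiE) auto
  ultimately show ?thesis by (meson countable_image countable_subset)
qed

lemma lcube_measurable [measurable]: "lcube N q \<in> sets borel"
  by (simp add: lcube_def)

lemma mem_lcube: "y \<in> lcube N q \<longleftrightarrow> (\<forall>b\<in>Basis. q \<bullet> b \<le> y \<bullet> b \<and> y \<bullet> b \<le> q \<bullet> b + 1 / real (Suc N))"
  by (simp add: lcube_def mem_box inner_add_left)

lemma emeasure_lcube: "emeasure lborel (lcube N (q :: 'a::euclidean_space)) = ennreal ((1 / real (Suc N)) ^ DIM('a))"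
  unfolding lcube_def by (subst emeasure_lborel_cbox) (auto simp: inner_add_left)

lemma lcube_corner_diff:
  assumes "y \<in> lcube N (corner N x)"
  shows "y - x \<in> cbox (- (1 / real (Suc N)) *\<^sub>R One) ((1 / real (Suc N)) *\<^sub>R One)"
  unfolding mem_box
proof (intro ballI conjI)
  fix b :: 'a assume b: "b \<in> Basis"
  then show "(- (1 / real (Suc N)) *\<^sub>R One) \<bullet> b \<le> (y - x) \<bullet> b" "(y - x) \<bullet> b \<le> ((1 / real (Suc N)) *\<^sub>R One) \<bullet> b"
    using assms corner_bounds[OF b, where N = N and x = x] unfolding mem_lcube by (force simp: inner_diff_left)+
qed

lemma lattice_avg_diff_le:
  fixes u :: "'a::euclidean_space \<Rightarrow> 'b::euclidean_space"
  assumes "locint u"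
  shows "nsq (u x - lattice_avg N u (corner N x)) \<le> ennreal (real (Suc N) ^ DIM('a)) *
    (\<integral>\<^sup>+z\<in>cbox (- (1 / real (Suc N)) *\<^sub>R One) ((1 / real (Suc N)) *\<^sub>R One). nsq (u (x + z) - u x) \<partial>lborel)"
proof -
  have eq: "1 / (1 / real (Suc N)) ^ DIM('a) = real (Suc N) ^ DIM('a)" by (simp add: power_one_over)
  have "set_integrable lborel (lcube N (corner N x)) u"
    using assms unfolding locint_def lcube_def by (blast intro: compact_cbox)
  from nsq_diff_average_le[OF locint_measurable[OF assms] _ _ emeasure_lcube _ this lcube_corner_diff]
  show ?thesis unfolding eq lattice_avg_def by simp
qed

text \<open>With d the dimension, the constant collects (N+1)^d from the mean value, 4^d / (N+1)^2
  from the translation estimate and (2/(N+1))^d from the volume of the cube of differences. The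
  field enters only through its Dirichlet energy, which makes the error uniform along a bounded
  sequence.\<close>

lemma lattice_avg_error:
  assumes H: "H1per u (Du :: real \<times> (real^'m) \<Rightarrow> _)"
  shows "(\<integral>\<^sup>+x\<in>slab UNIV. nsq (u x - lattice_avg N u (corner N x)) \<partial>lborel)
    \<le> ennreal (8 ^ DIM(real \<times> (real^'m)) / (real (Suc N))\<^sup>2) * Dirichlet Du UNIV"
proof -
  note D = H1div_D[OF H1per_D(1)[OF H]]
  have [measurable]: "u \<in> borel_measurable borel" using D by auto
  define d where "d = DIM(real \<times> (real^'m))"
  let ?r = "1 / real (Suc N)"
  let ?Z = "cbox (- ?r *\<^sub>R One) (?r *\<^sub>R One) :: (real \<times> (real^'m)) set"
  have "(\<integral>\<^sup>+x\<in>slab UNIV. nsq (u x - lattice_avg N u (corner N x)) \<partial>lborel)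
     \<le> (\<integral>\<^sup>+x. \<integral>\<^sup>+z. ennreal (real (Suc N) ^ d) * (indicator (slab UNIV) x * indicator ?Z z * nsq (u (x + z) - u x)) \<partial>lborel \<partial>lborel)"
  proof (intro nn_integral_mono)
    fix x
    show "nsq (u x - lattice_avg N u (corner N x)) * indicator (slab UNIV) x \<le>
      (\<integral>\<^sup>+z. ennreal (real (Suc N) ^ d) * (indicator (slab UNIV) x * indicator ?Z z * nsq (u (x + z) - u x)) \<partial>lborel)"
      using lattice_avg_diff_le[OF D(3), of x N]
      by (cases "x \<in> slab UNIV") (auto simp: d_def nn_integral_cmult[symmetric] mult.commute[of "nsq _"])
  qed
  also have "\<dots> = (\<integral>\<^sup>+z. \<integral>\<^sup>+x. ennreal (real (Suc N) ^ d) * (indicator (slab UNIV) x * indicator ?Z z * nsq (u (x + z) - u x)) \<partial>lborel \<partial>lborel)"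
    by (rule lborel_pair.Fubini'[symmetric]) measurable
  also have "\<dots> \<le> (\<integral>\<^sup>+z. ennreal (real (Suc N) ^ d) * (4 ^ d * ennreal (?r\<^sup>2) * Dirichlet Du UNIV) * indicator ?Z z \<partial>lborel)"
  proof (intro nn_integral_mono)
    fix z
    show "(\<integral>\<^sup>+x. ennreal (real (Suc N) ^ d) * (indicator (slab UNIV) x * indicator ?Z z * nsq (u (x + z) - u x)) \<partial>lborel)
      \<le> ennreal (real (Suc N) ^ d) * (4 ^ d * ennreal (?r\<^sup>2) * Dirichlet Du UNIV) * indicator ?Z z"
    proof (cases "z \<in> ?Z")
      case True
      have "\<bar>z \<bullet> b\<bar> \<le> ?r" if "b \<in> Basis" for b
        using True that unfolding mem_box by (force simp: abs_le_iff)
      then have "(\<integral>\<^sup>+x\<in>slab UNIV. nsq (u (x + (\<Sum>b\<in>Basis. (z \<bullet> b) *\<^sub>R b)) - u x) \<partial>lborel)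
        \<le> 4 ^ card (Basis :: (real \<times> (real^'m)) set) * ennreal (?r\<^sup>2) * Dirichlet Du UNIV"
        by (intro slab_translation[OF H]) (auto simp: slab_dir_def Basis_cyl)
      then have "(\<integral>\<^sup>+x\<in>slab UNIV. nsq (u (x + z) - u x) \<partial>lborel) \<le> 4 ^ d * ennreal (?r\<^sup>2) * Dirichlet Du UNIV"
        unfolding euclidean_representation d_def .
      then show ?thesis
        using True by (subst nn_integral_cmult, measurable) (auto simp: mult.commute[of "nsq _"] intro!: mult_left_mono)
    qed simp
  qed
  also have "\<dots> = ennreal (real (Suc N) ^ d) * (4 ^ d * ennreal (?r\<^sup>2) * Dirichlet Du UNIV) * emeasure lborel ?Z"
    by (rule nn_integral_cmult_indicator) simp
  also have "emeasure lborel ?Z = ennreal ((2 * ?r) ^ d)"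
  proof -
    have *: "(?r *\<^sub>R One - - ?r *\<^sub>R One) \<bullet> b = 2 * ?r" if "b \<in> Basis" for b :: "real \<times> (real^'m)"
      using that by (simp add: inner_diff_left inner_add_left)
    have "prod ((\<bullet>) (?r *\<^sub>R One - - ?r *\<^sub>R (One :: real \<times> (real^'m)))) Basis = (2 * ?r) ^ d"
      unfolding d_def prod_constant[symmetric] by (intro prod.cong refl) (rule *)
    then show ?thesis by (subst emeasure_lborel_cbox) auto
  qed
  also have "ennreal (real (Suc N) ^ d) * (4 ^ d * ennreal (?r\<^sup>2) * Dirichlet Du UNIV) * ennreal ((2 * ?r) ^ d)
     = (ennreal (real (Suc N) ^ d) * ennreal (4 ^ d) * ennreal (?r\<^sup>2) * ennreal ((2 * ?r) ^ d)) * Dirichlet Du UNIV"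
    by (simp add: ac_simps ennreal_power[symmetric])
  also have "ennreal (real (Suc N) ^ d) * ennreal (4 ^ d) * ennreal (?r\<^sup>2) * ennreal ((2 * ?r) ^ d)
     = ennreal (8 ^ d / (real (Suc N))\<^sup>2)"
  proof -
    have "real (Suc N) ^ d * 4 ^ d * ?r\<^sup>2 * (2 * ?r) ^ d = (real (Suc N) * 4 * (2 * ?r)) ^ d * ?r\<^sup>2"
      by (simp only: power_mult_distrib ac_simps)
    also have "real (Suc N) * 4 * (2 * ?r) = 8" by (simp del: of_nat_Suc)
    finally have "real (Suc N) ^ d * 4 ^ d * ?r\<^sup>2 * (2 * ?r) ^ d = 8 ^ d / (real (Suc N))\<^sup>2"
      by (simp add: power_one_over divide_inverse power_inverse)
    then show ?thesis
      by (subst ennreal_mult[symmetric], simp, simp)+ simp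
  qed
  finally show ?thesis unfolding d_def .
qed

text \<open>The composition is constant on each of the countably many Borel sets on which
  \<open>corner N\<close> is constant.\<close>

lemma measurable_lattice_avg_corner:
  fixes u :: "'a::euclidean_space \<Rightarrow> 'b::euclidean_space"
  assumes [measurable]: "u \<in> borel_measurable borel"
  shows "(\<lambda>x. lattice_avg N u (corner N x)) \<in> borel_measurable borel"
proof -
  have "(corner N :: 'a \<Rightarrow> 'a) \<in> borel_measurable borel"
    unfolding corner_def[abs_def]
    by (intro borel_measurable_sum borel_measurable_scaleR borel_measurable_divide
        measurable_compose[OF _ borel_measurable_real_floor] borel_measurable_times
        borel_measurable_inner borel_measurable_const measurable_ident_sets refl)
  then have [measurable]: "(corner N :: 'a \<Rightarrow> 'a) \<in> borel \<rightarrow>\<^sub>M count_space (range (corner N))"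
    by (subst measurable_count_space_eq_countable[OF countable_corners])
      (auto intro: measurable_sets_borel)
  show ?thesis
    by (rule measurable_compose_countable'[where f = "\<lambda>q x. lattice_avg N u q" and I = "range (corner N)"])
      (auto simp: countable_corners)
qed

text \<open>Cauchy-Schwarz on a lattice cube, which lies in the closed periodicity cell and whose
  axial range exceeds that of \<open>x\<close> by at most 1; hence \<open>Suc k\<close>.\<close>

lemma lattice_avg_bound:
  fixes u :: "real \<times> (real^'m) \<Rightarrow> 'b::euclidean_space"
  assumes [measurable]: "u \<in> borel_measurable borel" and x: "x \<in> slab {-real k..real k}"
  shows "nsq (lattice_avg N u (corner N x)) \<le> ennreal (real (Suc N) ^ DIM(real \<times> (real^'m))) *
    (\<integral>\<^sup>+y\<in>slab {-real (Suc k)..real (Suc k)}. nsq (u y) \<partial>lborel)"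
proof -
  define d where "d = DIM(real \<times> (real^'m))"
  let ?Q = "lcube N (corner N x)"
  have sub: "?Q \<subseteq> {-real (Suc k)..real (Suc k)} \<times> cbox 0 One"
  proof
    fix y assume y: "y \<in> ?Q"
    have "fst y \<in> {-real (Suc k)..real (Suc k)}"
    proof -
      have "corner N x \<bullet> (1, 0) \<le> y \<bullet> (1, 0)" "y \<bullet> (1, 0) \<le> corner N x \<bullet> (1, 0) + 1 / real (Suc N)"
        using y unfolding mem_lcube by auto
      moreover have "1 / real (Suc N) \<le> 1" by simp
      ultimately show ?thesis
        using corner_bounds[OF e1_Basis, where N = N and x = x] x unfolding inner_e1 mem_slab of_nat_Suc atLeastAtMost_iff by linarith
    qed
    moreover have "0 \<le> snd y $ i \<and> snd y $ i \<le> 1" for i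
    proof -
      have *: "corner N x \<bullet> ebas i \<le> y \<bullet> ebas i" "y \<bullet> ebas i \<le> corner N x \<bullet> ebas i + 1 / real (Suc N)"
        using y ebas_Basis unfolding mem_lcube by blast+
      have "0 \<le> snd x $ i" "snd x $ i < 1" using x by (auto simp: mem_slab)
      \<comment> \<open>Half-openness of the slab makes the second inequality strict, so the next
        lattice point still does not exceed 1.\<close>
      then have "0 \<le> \<lfloor>real (Suc N) * (snd x $ i)\<rfloor>" "\<lfloor>real (Suc N) * (snd x $ i)\<rfloor> < int (Suc N)"
        by (auto simp: floor_less_iff simp del: of_nat_Suc)
      then have f: "0 \<le> \<lfloor>real (Suc N) * (snd x $ i)\<rfloor>" "\<lfloor>real (Suc N) * (snd x $ i)\<rfloor> + 1 \<le> int (Suc N)" by auto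
      have c: "corner N x \<bullet> ebas i = of_int \<lfloor>real (Suc N) * (snd x $ i)\<rfloor> / real (Suc N)"
        using corner_inner[OF ebas_Basis[of i], where N = N and x = x] by simp
      have "corner N x \<bullet> ebas i + 1 / real (Suc N) = of_int (\<lfloor>real (Suc N) * (snd x $ i)\<rfloor> + 1) / real (Suc N)"
        unfolding c by (simp add: add_divide_distrib)
      also have "\<dots> \<le> 1"
        using f(2) by (subst divide_le_eq_1_pos) (simp, metis of_int_le_iff of_int_of_nat_eq)
      finally have "corner N x \<bullet> ebas i + 1 / real (Suc N) \<le> 1" .
      moreover have "corner N x \<bullet> ebas i \<ge> 0" unfolding c using f(1) by simp
      ultimately show ?thesis using * by simp
    qed
    ultimately show "y \<in> {-real (Suc k)..real (Suc k)} \<times> cbox 0 One"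
      by (simp add: mem_Times_iff mem_cbox_One)
  qed
  have "nsq (lattice_avg N u (corner N x)) = ennreal ((real (Suc N) ^ d)\<^sup>2) * nsq (LINT y:?Q|lborel. u y)"
    unfolding lattice_avg_def nsq_scaleR d_def ..
  also have "\<dots> \<le> ennreal ((real (Suc N) ^ d)\<^sup>2) * (emeasure lborel ?Q * (\<integral>\<^sup>+y\<in>?Q. nsq (u y) \<partial>lborel))"
    by (intro mult_left_mono nsq_set_integral_le) auto
  also have "\<dots> = ennreal ((real (Suc N) ^ d)\<^sup>2 * (1 / real (Suc N)) ^ d) * (\<integral>\<^sup>+y\<in>?Q. nsq (u y) \<partial>lborel)"
    unfolding emeasure_lcube d_def by (subst ennreal_mult) (auto simp: mult.assoc)
  also have "(real (Suc N) ^ d)\<^sup>2 * (1 / real (Suc N)) ^ d = real (Suc N) ^ d"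
    by (simp add: power2_eq_square power_one_over del: of_nat_Suc)
  also have "(\<integral>\<^sup>+y\<in>?Q. nsq (u y) \<partial>lborel) \<le> (\<integral>\<^sup>+y\<in>slab {-real (Suc k)..real (Suc k)}. nsq (u y) \<partial>lborel)"
  proof (rule nn_integral_mono_AE)
    show "AE y in lborel. nsq (u y) * indicator ?Q y \<le> nsq (u y) * indicator (slab {-real (Suc k)..real (Suc k)}) y"
      using AE_slab[of "{-real (Suc k)..real (Suc k)}"]
    proof eventually_elim
      case (elim y)
      then show ?case using sub by (auto simp: indicator_def simp del: of_nat_Suc)
    qed
  qed
  finally show ?thesis unfolding d_def by (simp add: mult_left_mono)
qed


lemma nsq_le_imp_norm_le: "nsq x \<le> ennreal c \<Longrightarrow> norm x \<le> sqrt \<bar>c\<bar>"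
proof -
  assume "nsq x \<le> ennreal c"
  also have "\<dots> \<le> ennreal \<bar>c\<bar>" by (intro ennreal_leI) simp
  finally have "(norm x)\<^sup>2 \<le> \<bar>c\<bar>" by (simp add: nsq_def)
  then show ?thesis by (rule real_le_rsqrt)
qed

lemma tendsto_nsq: "(f \<longlongrightarrow> l) F \<Longrightarrow> ((\<lambda>x. nsq (f x)) \<longlongrightarrow> nsq l) F"
  unfolding nsq_def by (intro tendsto_intros tendsto_ennrealI)

text \<open>The path from \<open>x\<close> to \<open>y\<close> passes through \<open>p\<close>,
  \<open>z\<close> and \<open>q\<close>; three nested uses of the factor 2 give 8.\<close>

lemma nsq_four_terms:
  "nsq (x - y) \<le> 8 * (nsq (x - p) + nsq (y - q) + nsq (p - z) + nsq (q - z))"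
proof -
  have "nsq (x - y) \<le> ennreal (2 * (norm (x - p))\<^sup>2 + 2 * (2 * (norm (p - z))\<^sup>2 + 2 * (2 * (norm (z - q))\<^sup>2 + 2 * (norm (q - y))\<^sup>2)))"
    unfolding nsq_def
    using norm_add_sq_le[of "x - p" "p - y"] norm_add_sq_le[of "p - z" "z - y"] norm_add_sq_le[of "z - q" "q - y"]
    by (intro ennreal_leI) simp
  also have "\<dots> \<le> ennreal (8 * ((norm (x - p))\<^sup>2 + (norm (y - q))\<^sup>2 + (norm (p - z))\<^sup>2 + (norm (q - z))\<^sup>2))"
    by (intro ennreal_leI) (simp add: norm_minus_commute)
  finally show ?thesis by (simp add: nsq_def ennreal_plus ennreal_mult)
qed

text \<open>All lattice averages of all meshes form a countable family of bounded sequences, so one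
  subsequence makes them all converge. For a fixed mesh this gives L^2 convergence on slabs by
  dominated convergence, while the distance of a field to its lattice averages is uniformly small
  for a fine mesh.\<close>

theorem Rellich_slab:
  fixes u :: "nat \<Rightarrow> real \<times> (real^'m) \<Rightarrow> real \<times> (real^'m)"
  assumes H: "\<And>n. H1per (u n) (Du n)" and M: "\<And>n. Dirichlet (Du n) UNIV \<le> ennreal M"
    and B: "\<And>k::nat. \<exists>B. \<forall>n. (\<integral>\<^sup>+x\<in>slab {-real k..real k}. nsq (u n x) \<partial>lborel) \<le> ennreal B"
  obtains r :: "nat \<Rightarrow> nat" where "strict_mono r"
    "\<And>k e. e > 0 \<Longrightarrow> \<exists>N. \<forall>i\<ge>N. \<forall>j\<ge>N. (\<integral>\<^sup>+x\<in>slab {-real k..real k}. nsq (u (r i) x - u (r j) x) \<partial>lborel) \<le> ennreal e"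
proof -
  define d where "d = DIM(real \<times> (real^'m))"
  have [measurable]: "u n \<in> borel_measurable borel" for n
    using H1div_D(4)[OF H1per_D(1)[OF H]] .
  obtain Bk where Bk: "\<And>k n. (\<integral>\<^sup>+x\<in>slab {-real k..real k}. nsq (u n x) \<partial>lborel) \<le> ennreal (Bk k)"
    using B by metis
  define c where "c N k = real (Suc N) ^ d * \<bar>Bk (Suc k)\<bar>" for N k
  have bound: "nsq (lattice_avg N (u n) (corner N x)) \<le> ennreal (c N k)" if "x \<in> slab {-real k..real k}" for N n x k
  proof -
    have "nsq (lattice_avg N (u n) (corner N x)) \<le> ennreal (real (Suc N) ^ d) * (\<integral>\<^sup>+y\<in>slab {-real (Suc k)..real (Suc k)}. nsq (u n y) \<partial>lborel)"
      unfolding d_def by (rule lattice_avg_bound[OF _ that]) simp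
    also have "\<dots> \<le> ennreal (real (Suc N) ^ d) * ennreal (Bk (Suc k))"
      by (intro mult_left_mono Bk) auto
    also have "\<dots> \<le> ennreal (real (Suc N) ^ d) * ennreal \<bar>Bk (Suc k)\<bar>"
      by (intro mult_left_mono ennreal_leI) auto
    also have "\<dots> = ennreal (c N k)" unfolding c_def by (subst ennreal_mult[symmetric]) auto
    finally show ?thesis .
  qed
  have slab_k: "\<exists>k::nat. x \<in> slab {-real k..real k}" if "x \<in> slab UNIV" for x :: "real \<times> (real^'m)"
  proof -
    obtain k where "\<bar>fst x\<bar> \<le> real k" using real_arch_simple by blast
    then show ?thesis using that by (intro exI[of _ k]) (auto simp: mem_slab)
  qed
  define S :: "(nat \<times> (real \<times> (real^'m))) set" where "S = (SIGMA N:UNIV. corner N ` slab UNIV)"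
  have "countable S"
    unfolding S_def by (intro countable_SIGMA) (auto intro: countable_subset[OF _ countable_corners])
  moreover have "\<exists>B. \<forall>n. norm (lattice_avg (fst s) (u n) (snd s)) \<le> B" if sS: "s \<in> S" for s
  proof -
    obtain N q where "s = (N, q)" "q \<in> corner N ` slab UNIV" using sS unfolding S_def by blast
    then obtain x where s: "s = (N, corner N x)" "x \<in> slab UNIV" by blast
    obtain k :: nat where "x \<in> slab {-real k..real k}" using slab_k[OF s(2)] by blast
    from bound[OF this, THEN nsq_le_imp_norm_le] show ?thesis unfolding s(1) fst_conv snd_conv by blast
  qed
  ultimately obtain r where r: "strict_mono (r::nat\<Rightarrow>nat)"
    "\<And>s. s \<in> S \<Longrightarrow> convergent (\<lambda>n. lattice_avg (fst s) (u (r n)) (snd s))"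
    using pointwise_bounded_convergent_subsequence[of S "\<lambda>n s. lattice_avg (fst s) (u n) (snd s)"] by blast
  define L where "L N i x = lattice_avg N (u (r i)) (corner N x)" for N i x
  define p where "p N x = lim (\<lambda>i. L N i x)" for N x
  have L_meas [measurable]: "L N i \<in> borel_measurable borel" for N i
    unfolding L_def[abs_def] by (rule measurable_lattice_avg_corner) simp
  have [measurable]: "p N \<in> borel_measurable borel" for N
    unfolding p_def[abs_def] by (rule borel_measurable_lim_metric) simp
  have Lp: "(\<lambda>i. L N i x) \<longlonglongrightarrow> p N x" if "x \<in> slab UNIV" for N x
  proof -
    have "(N, corner N x) \<in> S" using that by (auto simp: S_def)
    from r(2)[OF this] show ?thesis by (simp add: L_def p_def convergent_LIMSEQ_iff)
  qed
  have slab_UNIV: "x \<in> slab UNIV" if "x \<in> slab I" for x :: "real \<times> (real^'m)" and I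
    using that by (simp add: mem_slab)
  have mid: "(\<lambda>i. \<integral>\<^sup>+x\<in>slab {-real k..real k}. nsq (L N i x - p N x) \<partial>lborel) \<longlonglongrightarrow> 0" for N k
  proof -
    let ?S = "slab {-real k..real k} :: (real \<times> (real^'m)) set"
    have [measurable]: "?S \<in> sets borel" by simp
    have "(\<lambda>i. \<integral>\<^sup>+x. nsq (L N i x - p N x) * indicator ?S x \<partial>lborel) \<longlonglongrightarrow> (\<integral>\<^sup>+x. 0 \<partial>(lborel :: (real \<times> (real^'m)) measure))"
    proof (rule nn_integral_dominated_convergence[where w = "\<lambda>x. 4 * ennreal (c N k) * indicator ?S x"])
      show "(\<integral>\<^sup>+x. 4 * ennreal (c N k) * indicator ?S x \<partial>lborel) < \<infinity>"
        by (subst nn_integral_cmult_indicator) (auto simp: emeasure_slab ennreal_mult_less_top)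
      show "AE x in lborel. nsq (L N i x - p N x) * indicator ?S x \<le> 4 * ennreal (c N k) * indicator ?S x" for i
      proof (rule AE_I2)
        fix x
        show "nsq (L N i x - p N x) * indicator ?S x \<le> 4 * ennreal (c N k) * indicator ?S x"
        proof (cases "x \<in> ?S")
          case True
          have "nsq (p N x) \<le> ennreal (c N k)"
            by (rule LIMSEQ_le_const2[OF tendsto_nsq[OF Lp[OF slab_UNIV[OF True]]]]) (use bound[OF True] L_def in auto)
          moreover have "nsq (L N i x) \<le> ennreal (c N k)" using bound[OF True] by (simp add: L_def)
          ultimately have "2 * nsq (L N i x) + 2 * nsq (- p N x) \<le> 2 * ennreal (c N k) + 2 * ennreal (c N k)"
            by (intro add_mono mult_left_mono) auto
          also have "\<dots> = 4 * ennreal (c N k)" by (metis distrib_right numeral_Bit0)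
          finally show ?thesis using True nsq_add_le[of "L N i x" "- p N x"] by simp
        qed simp
      qed
      show "AE x in lborel. (\<lambda>i. nsq (L N i x - p N x) * indicator ?S x) \<longlonglongrightarrow> 0"
      proof (rule AE_I2)
        fix x
        show "(\<lambda>i. nsq (L N i x - p N x) * indicator ?S x) \<longlonglongrightarrow> 0"
        proof (cases "x \<in> ?S")
          case True
          have "(\<lambda>i. L N i x - p N x) \<longlonglongrightarrow> p N x - p N x" by (intro tendsto_intros Lp slab_UNIV[OF True])
          from tendsto_nsq[OF this] show ?thesis using True by simp
        qed simp
      qed
    qed measurable
    then show ?thesis by simp
  qed
  have "\<exists>N. \<forall>i\<ge>N. \<forall>j\<ge>N. (\<integral>\<^sup>+x\<in>slab {-real k..real k}. nsq (u (r i) x - u (r j) x) \<partial>lborel) \<le> ennreal e"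
    if e: "e > 0" for k e
  proof -
    let ?S = "slab {-real k..real k} :: (real \<times> (real^'m)) set"
    have [measurable]: "?S \<in> sets borel" by simp
    \<comment> \<open>Four errors of size \<open>e'\<close> enter with the factor 8 of
      \<open>nsq_four_terms\<close>.\<close>
    define e' where "e' = e / 32"
    have e': "e' > 0" using e by (simp add: e'_def)
    have "(\<lambda>N. 8 ^ d * \<bar>M\<bar> * (inverse (real (Suc N)))\<^sup>2) \<longlonglongrightarrow> 8 ^ d * \<bar>M\<bar> * 0\<^sup>2"
      by (intro tendsto_intros LIMSEQ_inverse_real_of_nat)
    then have "eventually (\<lambda>N. 8 ^ d * \<bar>M\<bar> * (inverse (real (Suc N)))\<^sup>2 < e') sequentially"
      using e' by (intro order_tendstoD) auto
    then obtain N where N: "8 ^ d * \<bar>M\<bar> * (inverse (real (Suc N)))\<^sup>2 < e'" by (auto simp: eventually_sequentially)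
    have A: "(\<integral>\<^sup>+x\<in>?S. nsq (u (r i) x - L N i x) \<partial>lborel) \<le> ennreal e'" for i
    proof -
      have "(\<integral>\<^sup>+x\<in>?S. nsq (u (r i) x - L N i x) \<partial>lborel) \<le> (\<integral>\<^sup>+x\<in>slab UNIV. nsq (u (r i) x - L N i x) \<partial>lborel)"
        by (intro nn_integral_mono) (auto simp: indicator_def mem_slab)
      also have "\<dots> \<le> ennreal (8 ^ d / (real (Suc N))\<^sup>2) * Dirichlet (Du (r i)) UNIV"
        unfolding L_def d_def by (rule lattice_avg_error[OF H])
      also have "\<dots> \<le> ennreal (8 ^ d / (real (Suc N))\<^sup>2) * ennreal \<bar>M\<bar>"
        using M[of "r i"] by (intro mult_left_mono) (auto intro: order_trans ennreal_leI)
      also have "\<dots> = ennreal (8 ^ d * \<bar>M\<bar> * (inverse (real (Suc N)))\<^sup>2)"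
        by (subst ennreal_mult[symmetric]) (auto simp: divide_inverse power_inverse ac_simps)
      also have "\<dots> \<le> ennreal e'" using N by (intro ennreal_leI) simp
      finally show ?thesis .
    qed
    have "eventually (\<lambda>i. (\<integral>\<^sup>+x\<in>?S. nsq (L N i x - p N x) \<partial>lborel) < ennreal e') sequentially"
      using mid[of N k] e' by (intro order_tendstoD) auto
    then obtain N' where N': "\<And>i. i \<ge> N' \<Longrightarrow> (\<integral>\<^sup>+x\<in>?S. nsq (L N i x - p N x) \<partial>lborel) < ennreal e'"
      by (auto simp: eventually_sequentially)
    have "(\<integral>\<^sup>+x\<in>?S. nsq (u (r i) x - u (r j) x) \<partial>lborel) \<le> ennreal e" if "i \<ge> N'" "j \<ge> N'" for i j
    proof -
      have "(\<integral>\<^sup>+x\<in>?S. nsq (u (r i) x - u (r j) x) \<partial>lborel)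
        \<le> (\<integral>\<^sup>+x. 8 * (nsq (u (r i) x - L N i x) * indicator ?S x + nsq (u (r j) x - L N j x) * indicator ?S x
            + nsq (L N i x - p N x) * indicator ?S x + nsq (L N j x - p N x) * indicator ?S x) \<partial>lborel)"
      proof (intro nn_integral_mono)
        fix x
        show "nsq (u (r i) x - u (r j) x) * indicator ?S x \<le> 8 * (nsq (u (r i) x - L N i x) * indicator ?S x + nsq (u (r j) x - L N j x) * indicator ?S x
            + nsq (L N i x - p N x) * indicator ?S x + nsq (L N j x - p N x) * indicator ?S x)"
          using nsq_four_terms[of "u (r i) x" "u (r j) x" "L N i x" "L N j x" "p N x"] by (cases "x \<in> ?S") simp_all
      qed
      also have "\<dots> = 8 * ((\<integral>\<^sup>+x\<in>?S. nsq (u (r i) x - L N i x) \<partial>lborel) + (\<integral>\<^sup>+x\<in>?S. nsq (u (r j) x - L N j x) \<partial>lborel)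
          + (\<integral>\<^sup>+x\<in>?S. nsq (L N i x - p N x) \<partial>lborel) + (\<integral>\<^sup>+x\<in>?S. nsq (L N j x - p N x) \<partial>lborel))"
        by (simp add: nn_integral_cmult nn_integral_add)
      also have "\<dots> \<le> 8 * (ennreal e' + ennreal e' + ennreal e' + ennreal e')"
        using N'[OF that(1)] N'[OF that(2)] by (intro mult_left_mono add_mono A) auto
      also have "\<dots> = ennreal (8 * (e' + e' + e' + e'))"
      proof -
        have "ennreal (e' + e' + e' + e') = ennreal e' + ennreal e' + ennreal e' + ennreal e'"
          using e' by (simp only: ennreal_plus add_nonneg_nonneg less_imp_le)
        then show ?thesis using e' by (subst ennreal_mult) auto
      qed
      also have "8 * (e' + e' + e' + e') = e" by (simp add: e'_def)
      finally show ?thesis .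
    qed
    then show ?thesis by blast
  qed
  with r(1) show thesis by (rule that)
qed

section \<open>Convergence of gradients\<close>

lemma L2loc_iff_nn:
  "L2loc f \<longleftrightarrow> f \<in> borel_measurable borel \<and> (\<forall>K. compact K \<longrightarrow> (\<integral>\<^sup>+x\<in>K. nsq (f x) \<partial>lborel) < \<infinity>)"
proof -
  have "set_integrable lborel K (\<lambda>x. (norm (f x))\<^sup>2) \<longleftrightarrow> (\<integral>\<^sup>+x\<in>K. nsq (f x) \<partial>lborel) < \<infinity>"
    if [measurable]: "f \<in> borel_measurable borel" and "compact K" for K
  proof -
    have [measurable]: "K \<in> sets borel" using that by (simp add: borel_compact)
    have "(\<integral>\<^sup>+x. norm (indicator K x *\<^sub>R (norm (f x))\<^sup>2) \<partial>lborel) = (\<integral>\<^sup>+x\<in>K. nsq (f x) \<partial>lborel)"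
      by (intro nn_integral_cong) (auto simp: indicator_def nsq_def)
    then show ?thesis by (simp add: set_integrable_def integrable_iff_bounded)
  qed
  then show ?thesis unfolding L2loc_def by auto
qed

lemma set_integrable_grad_sq:
  assumes [measurable]: "grad_sq Du \<in> borel_measurable borel" and "Dirichlet Du UNIV < \<infinity>"
  shows "set_integrable lborel cell (grad_sq Du)"
proof -
  have "(\<integral>\<^sup>+x. norm (indicator cell x *\<^sub>R grad_sq Du x) \<partial>lborel) = (\<integral>\<^sup>+x\<in>cell. ennreal (grad_sq Du x) \<partial>lborel)"
    by (intro nn_integral_cong) (auto simp: indicator_def grad_sq_nonneg)
  also have "\<dots> = Dirichlet Du UNIV" by (simp add: Dirichlet_def cell_slab_nn)
  finally show ?thesis using assms(2) by (simp add: set_integrable_def integrable_iff_bounded)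
qed

text \<open>Finitely many integer translates of one slab cover \<open>K\<close>, and a periodic
  function has the same integral over each. This carries slab estimates over to the compact sets in
  \<open>L2loc\<close> and in the supports of test functions.\<close>

lemma nn_integral_compact_le_slab:
  fixes K :: "(real \<times> (real^'m)) set"
  assumes "compact K"
  obtains c k :: nat where
    "\<And>h. h \<in> borel_measurable borel \<Longrightarrow> periodic_cyl h \<Longrightarrow>
       (\<integral>\<^sup>+x\<in>K. h x \<partial>lborel) \<le> of_nat c * (\<integral>\<^sup>+x\<in>slab {-real k..real k}. h x \<partial>lborel)"
proof -
  obtain R where R: "\<And>x. x \<in> K \<Longrightarrow> norm x \<le> R"
    using compact_imp_bounded[OF assms] unfolding bounded_iff by blast
  \<comment> \<open>Integer parts of coordinates bounded by \<open>R\<close> can be as low as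
    \<open>- R - 1\<close>; the margin keeps them in range.\<close>
  obtain k :: nat where k: "R + 1 \<le> real k" using real_arch_simple by blast
  define A where "A = (PiE UNIV (\<lambda>_::'m. {-int k..int k}))"
  have fin: "finite A" unfolding A_def by (intro finite_PiE) auto
  define e where "e n = (\<Sum>i\<in>UNIV. of_int (n i) *\<^sub>R ebas i :: real \<times> (real^'m))" for n
  let ?S = "slab {-real k..real k} :: (real \<times> (real^'m)) set"
  have e_fst: "fst (e n) = 0" and e_snd: "snd (e n) $ i = of_int (n i)" for n i
    by (auto simp: e_def fst_sum snd_sum axis_def if_distrib cong: if_cong)
  have cover: "\<exists>n\<in>A. x - e n \<in> ?S" if "x \<in> K" for x
  proof -
    define n where "n = (\<lambda>i. \<lfloor>snd x $ i\<rfloor>)"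
    have "\<bar>snd x $ i\<bar> \<le> R" for i
      using R[OF that] component_le_norm_cart[of "snd x" i] norm_snd_le[of "snd x" "fst x"] by simp
    then have "\<bar>snd x $ i\<bar> + 1 \<le> real k" for i using k by (meson add_right_mono order_trans)
    moreover have "of_int (n i) \<le> snd x $ i" "snd x $ i < of_int (n i) + 1" for i
      unfolding n_def by linarith+
    ultimately have "real_of_int (- int k) \<le> of_int (n i)" "real_of_int (n i) \<le> of_int (int k)" for i
      unfolding of_int_minus of_int_of_nat_eq by (smt (verit))+
    then have "n i \<in> {-int k..int k}" for i by (simp only: of_int_le_iff atLeastAtMost_iff)
    then have "n \<in> A" by (auto simp: A_def)
    moreover have "\<bar>fst x\<bar> \<le> real k"
      using R[OF that] k norm_fst_le[of "fst x" "snd x"] by simp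
    then have "x - e n \<in> ?S"
      by (auto simp: mem_slab e_fst e_snd n_def) linarith+
    ultimately show ?thesis by blast
  qed
  have [measurable]: "?S \<in> sets borel" by simp
  show thesis
  proof (rule that[of "card A" k])
    fix h :: "real \<times> (real^'m) \<Rightarrow> ennreal"
    assume [measurable]: "h \<in> borel_measurable borel" and per: "periodic_cyl h"
    have per_e: "h (x + e n) = h x" for x n
    proof -
      have "h (x + (\<Sum>i\<in>B. of_int (n i) *\<^sub>R ebas i)) = h x" if "finite B" for B
        using that
      proof (induction B arbitrary: x)
        case (insert i B)
        have "x + (\<Sum>i\<in>insert i B. of_int (n i) *\<^sub>R ebas i) = (x + of_int (n i) *\<^sub>R ebas i) + (\<Sum>i\<in>B. of_int (n i) *\<^sub>R ebas i)"
          using insert(1,2) by (simp add: add.assoc)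
        then show ?case
          using insert(3) periodic_int[of h "ebas i", OF per[unfolded periodic_cyl_iff, rule_format]] by (simp only:)
      qed simp
      then show ?thesis by (simp add: e_def)
    qed
    have "(\<integral>\<^sup>+x\<in>K. h x \<partial>lborel) \<le> (\<integral>\<^sup>+x. (\<Sum>n\<in>A. h x * indicator ?S (x - e n)) \<partial>lborel)"
    proof (intro nn_integral_mono)
      fix x
      show "h x * indicator K x \<le> (\<Sum>n\<in>A. h x * indicator ?S (x - e n))"
      proof (cases "x \<in> K")
        case True
        then obtain n where n: "n \<in> A" "x - e n \<in> ?S" using cover by blast
        then have "h x * indicator ?S (x - e n) \<le> (\<Sum>n\<in>A. h x * indicator ?S (x - e n))"
          using fin by (intro member_le_sum) auto
        then show ?thesis using n True by simp
      qed simp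
    qed
    also have "\<dots> = (\<Sum>n\<in>A. \<integral>\<^sup>+x. h x * indicator ?S (x - e n) \<partial>lborel)"
      by (rule nn_integral_sum) measurable
    also have "\<dots> = (\<Sum>n\<in>A. \<integral>\<^sup>+x\<in>?S. h x \<partial>lborel)"
    proof (intro sum.cong refl)
      fix n
      have "(\<integral>\<^sup>+x. h x * indicator ?S (x - e n) \<partial>lborel) = (\<integral>\<^sup>+x. h (x + e n) * indicator ?S (x + e n - e n) \<partial>lborel)"
        by (rule nn_integral_lborel_shift[symmetric]) measurable
      then show "(\<integral>\<^sup>+x. h x * indicator ?S (x - e n) \<partial>lborel) = (\<integral>\<^sup>+x\<in>?S. h x \<partial>lborel)"
        by (simp add: per_e)
    qed
    finally show "(\<integral>\<^sup>+x\<in>K. h x \<partial>lborel) \<le> of_nat (card A) * (\<integral>\<^sup>+x\<in>?S. h x \<partial>lborel)"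
      by simp
  qed
qed

lemma tendsto_nsq_0_imp:
  fixes f :: "nat \<Rightarrow> 'b::real_normed_vector"
  assumes "(\<lambda>n. nsq (f n - l)) \<longlonglongrightarrow> 0"
  shows "f \<longlonglongrightarrow> l"
proof (rule tendstoI)
  fix e :: real assume e: "e > 0"
  have "eventually (\<lambda>n. nsq (f n - l) < ennreal (e\<^sup>2)) sequentially"
    using assms e by (intro order_tendstoD) auto
  then show "eventually (\<lambda>n. dist (f n) l < e) sequentially"
    by eventually_elim (use e in \<open>auto simp: nsq_def ennreal_less_iff dist_norm power2_less_imp_less\<close>)
qed

lemma test_integral_tendsto:
  fixes w :: "nat \<Rightarrow> 'a::euclidean_space \<Rightarrow> 'b::euclidean_space"
  assumes K: "compact K" and [measurable]: "\<psi> \<in> borel_measurable borel"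
    and \<psi>: "\<And>x. x \<notin> K \<Longrightarrow> \<psi> x = (0::real)" "\<And>x. \<bar>\<psi> x\<bar> \<le> B"
    and w: "\<And>n. locint (w n)" "locint v"
    and lim: "(\<lambda>n. \<integral>\<^sup>+x\<in>K. nsq (w n x - v x) \<partial>lborel) \<longlonglongrightarrow> 0"
  shows "(\<lambda>n. \<integral>x. \<psi> x *\<^sub>R w n x \<partial>lborel) \<longlonglongrightarrow> (\<integral>x. \<psi> x *\<^sub>R v x \<partial>lborel)"
proof -
  have [measurable]: "w n \<in> borel_measurable borel" "v \<in> borel_measurable borel" "K \<in> sets borel" for n
    using w K by (auto intro: locint_measurable simp: borel_compact)
  have B: "B \<ge> 0" using \<psi>(2)[of undefined] by linarith
  obtain m where m: "emeasure lborel K = ennreal m" "m \<ge> 0"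
    using finite_measure_compact[OF K] by (cases "emeasure lborel K") auto
  have int: "integrable lborel (\<lambda>x. \<psi> x *\<^sub>R f x)" if "locint f" for f :: "'a \<Rightarrow> 'b"
    by (rule locint_integrable_scaleR[OF that K _ \<psi>]) simp
  have bound: "nsq ((\<integral>x. \<psi> x *\<^sub>R w n x \<partial>lborel) - (\<integral>x. \<psi> x *\<^sub>R v x \<partial>lborel))
      \<le> ennreal m * ennreal (B\<^sup>2) * (\<integral>\<^sup>+x\<in>K. nsq (w n x - v x) \<partial>lborel)" for n
  proof -
    have "(\<integral>x. \<psi> x *\<^sub>R w n x \<partial>lborel) - (\<integral>x. \<psi> x *\<^sub>R v x \<partial>lborel) = (LINT x:K|lborel. \<psi> x *\<^sub>R (w n x - v x))"
    proof -
      have "(\<integral>x. \<psi> x *\<^sub>R w n x \<partial>lborel) - (\<integral>x. \<psi> x *\<^sub>R v x \<partial>lborel) = (\<integral>x. \<psi> x *\<^sub>R w n x - \<psi> x *\<^sub>R v x \<partial>lborel)"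
        by (intro Bochner_Integration.integral_diff[symmetric] int w)
      also have "\<dots> = (LINT x:K|lborel. \<psi> x *\<^sub>R (w n x - v x))"
        unfolding set_lebesgue_integral_def using \<psi>(1)
        by (intro Bochner_Integration.integral_cong refl) (auto simp: indicator_def scaleR_right_diff_distrib)
      finally show ?thesis .
    qed
    also have "nsq (LINT x:K|lborel. \<psi> x *\<^sub>R (w n x - v x)) \<le> emeasure lborel K * (\<integral>\<^sup>+x\<in>K. nsq (\<psi> x *\<^sub>R (w n x - v x)) \<partial>lborel)"
      by (rule nsq_set_integral_le) auto
    also have "\<dots> \<le> ennreal m * (\<integral>\<^sup>+x. ennreal (B\<^sup>2) * (nsq (w n x - v x) * indicator K x) \<partial>lborel)"
      unfolding m nsq_scaleR using \<psi>(2) B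
      by (intro mult_left_mono nn_integral_mono) (auto simp: mult.assoc[symmetric] abs_le_square_iff[symmetric] intro!: mult_right_mono ennreal_leI)
    also have "\<dots> = ennreal m * ennreal (B\<^sup>2) * (\<integral>\<^sup>+x\<in>K. nsq (w n x - v x) \<partial>lborel)"
      by (subst nn_integral_cmult) (auto simp: mult.assoc)
    finally show ?thesis .
  qed
  have "(\<lambda>n. ennreal m * ennreal (B\<^sup>2) * (\<integral>\<^sup>+x\<in>K. nsq (w n x - v x) \<partial>lborel)) \<longlonglongrightarrow> ennreal m * ennreal (B\<^sup>2) * 0"
    by (intro ennreal_tendsto_cmult lim) (auto simp: ennreal_mult_less_top)
  then have "(\<lambda>n. nsq ((\<integral>x. \<psi> x *\<^sub>R w n x \<partial>lborel) - (\<integral>x. \<psi> x *\<^sub>R v x \<partial>lborel))) \<longlonglongrightarrow> 0"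
    using tendsto_sandwich[OF always_eventually always_eventually tendsto_const, OF _ allI[OF bound], of 0] by simp
  then show ?thesis by (rule tendsto_nsq_0_imp)
qed

lemma weak_partial_limit:
  fixes w g :: "nat \<Rightarrow> 'a::euclidean_space \<Rightarrow> 'b::euclidean_space"
  assumes w: "\<And>n. locint (w n)" "\<And>n. locint (g n)" "\<And>n. weak_partial (w n) b (g n)" and v: "locint v" "locint G"
    and lim: "\<And>K. compact K \<Longrightarrow> (\<lambda>n. \<integral>\<^sup>+x\<in>K. nsq (w n x - v x) \<partial>lborel) \<longlonglongrightarrow> 0"
      "\<And>K. compact K \<Longrightarrow> (\<lambda>n. \<integral>\<^sup>+x\<in>K. nsq (g n x - G x) \<partial>lborel) \<longlonglongrightarrow> 0"
  shows "weak_partial v b G"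
proof (rule weak_partialI[OF v])
  fix \<phi> :: "'a \<Rightarrow> real" assume \<phi>: "test_fun \<phi>"
  obtain K B where K: "compact K" "B > 0" "\<And>x. x \<notin> K \<Longrightarrow> \<phi> x = 0"
    "\<And>x. x \<notin> K \<Longrightarrow> frechet_derivative \<phi> (at x) b = 0"
    "\<And>x. \<bar>\<phi> x\<bar> \<le> B" "\<And>x. \<bar>frechet_derivative \<phi> (at x) b\<bar> \<le> B"
    using test_fun_bounded[OF \<phi>] by metis
  have "(\<lambda>n. \<integral>x. frechet_derivative \<phi> (at x) b *\<^sub>R w n x \<partial>lborel) \<longlonglongrightarrow> (\<integral>x. frechet_derivative \<phi> (at x) b *\<^sub>R v x \<partial>lborel)"
    by (rule test_integral_tendsto[OF K(1) test_fun_deriv_measurable[OF \<phi>] K(4) K(6) w(1) v(1) lim(1)[OF K(1)]])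
  moreover have "(\<lambda>n. - (\<integral>x. \<phi> x *\<^sub>R g n x \<partial>lborel)) \<longlonglongrightarrow> - (\<integral>x. \<phi> x *\<^sub>R G x \<partial>lborel)"
    by (intro tendsto_minus test_integral_tendsto[OF K(1) test_fun_measurable[OF \<phi>] K(3) K(5) w(2) v(2) lim(2)[OF K(1)]])
  ultimately show "(\<integral>x. frechet_derivative \<phi> (at x) b *\<^sub>R v x \<partial>lborel) = - (\<integral>x. \<phi> x *\<^sub>R G x \<partial>lborel)"
    unfolding weak_partialD[OF w(3) \<phi>] by (rule LIMSEQ_unique)
qed

section \<open>Midpoints of fields and the parallelogram law\<close>

definition avg2 :: "('a \<Rightarrow> 'b::real_vector) \<Rightarrow> ('a \<Rightarrow> 'b) \<Rightarrow> 'a \<Rightarrow> 'b" where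
  "avg2 f g x = (1/2) *\<^sub>R (f x + g x)"

definition avg2D :: "('a \<Rightarrow> 'a \<Rightarrow> 'b::real_vector) \<Rightarrow> ('a \<Rightarrow> 'a \<Rightarrow> 'b) \<Rightarrow> 'a \<Rightarrow> 'a \<Rightarrow> 'b" where
  "avg2D F G x b = (1/2) *\<^sub>R (F x b + G x b)"

lemma parallelogram_norm:
  fixes x y :: "'a::real_inner"
  shows "(norm (x - y))\<^sup>2 + 4 * (norm ((1/2) *\<^sub>R (x + y)))\<^sup>2 = 2 * (norm x)\<^sup>2 + 2 * (norm y)\<^sup>2"
proof -
  have "(norm ((1/2) *\<^sub>R (x + y)))\<^sup>2 = (norm (x + y))\<^sup>2 / 4"
    by (simp only: norm_scaleR power_mult_distrib) (simp add: power2_eq_square)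
  moreover have "(norm (x - y))\<^sup>2 + (norm (x + y))\<^sup>2 = 2 * (norm x)\<^sup>2 + 2 * (norm y)\<^sup>2"
    by (simp add: power2_norm_eq_inner inner_simps inner_commute)
  ultimately show ?thesis by simp
qed

lemma grad_sq_parallelogram:
  "grad_sq (\<lambda>x b. F x b - G x b) x + 4 * grad_sq (avg2D F G) x = 2 * grad_sq F x + 2 * grad_sq G x"
proof -
  have "grad_sq (\<lambda>x b. F x b - G x b) x + 4 * grad_sq (avg2D F G) x = (\<Sum>b\<in>Basis. (norm (F x b - G x b))\<^sup>2 + 4 * (norm ((1/2) *\<^sub>R (F x b + G x b)))\<^sup>2)"
    by (simp only: grad_sq_def avg2D_def sum.distrib sum_distrib_left)
  also have "\<dots> = (\<Sum>b\<in>Basis. 2 * (norm (F x b))\<^sup>2 + 2 * (norm (G x b))\<^sup>2)"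
    by (simp only: parallelogram_norm)
  finally show ?thesis by (simp only: grad_sq_def sum.distrib sum_distrib_left)
qed

text \<open>Stated with sums on both sides, which avoids subtracting quantities that may be
  infinite.\<close>

lemma Dirichlet_parallelogram:
  assumes F: "\<And>b. b \<in> Basis \<Longrightarrow> (\<lambda>x. F x b) \<in> borel_measurable borel" and G: "\<And>b. b \<in> Basis \<Longrightarrow> (\<lambda>x. G x b) \<in> borel_measurable borel"
  shows "Dirichlet (\<lambda>x b. F x b - G x b) UNIV + 4 * Dirichlet (avg2D F G) UNIV = 2 * Dirichlet F UNIV + 2 * Dirichlet G UNIV"
proof -
  have [measurable]: "grad_sq F \<in> borel_measurable borel" "grad_sq G \<in> borel_measurable borel"
    "grad_sq (\<lambda>x b. F x b - G x b) \<in> borel_measurable borel" "grad_sq (avg2D F G) \<in> borel_measurable borel"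
    using F G unfolding avg2D_def by (auto intro!: measurable_grad_sq)
  have "Dirichlet (\<lambda>x b. F x b - G x b) UNIV + 4 * Dirichlet (avg2D F G) UNIV
    = (\<integral>\<^sup>+x. ennreal (grad_sq (\<lambda>x b. F x b - G x b) x) * indicator (slab UNIV) x + 4 * (ennreal (grad_sq (avg2D F G) x) * indicator (slab UNIV) x) \<partial>lborel)"
    unfolding Dirichlet_def by (simp add: nn_integral_add nn_integral_cmult)
  also have "\<dots> = (\<integral>\<^sup>+x. 2 * (ennreal (grad_sq F x) * indicator (slab UNIV) x) + 2 * (ennreal (grad_sq G x) * indicator (slab UNIV) x) \<partial>lborel)"
  proof (intro nn_integral_cong)
    fix x
    have "ennreal (grad_sq (\<lambda>x b. F x b - G x b) x) + 4 * ennreal (grad_sq (avg2D F G) x) = 2 * ennreal (grad_sq F x) + 2 * ennreal (grad_sq G x)"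
      using arg_cong[OF grad_sq_parallelogram[of F G x], of ennreal] by (simp add: ennreal_plus ennreal_mult grad_sq_nonneg)
    then show "ennreal (grad_sq (\<lambda>x b. F x b - G x b) x) * indicator (slab UNIV) x + 4 * (ennreal (grad_sq (avg2D F G) x) * indicator (slab UNIV) x)
      = 2 * (ennreal (grad_sq F x) * indicator (slab UNIV) x) + 2 * (ennreal (grad_sq G x) * indicator (slab UNIV) x)"
      by (cases "x \<in> slab UNIV") auto
  qed
  also have "\<dots> = 2 * Dirichlet F UNIV + 2 * Dirichlet G UNIV"
    unfolding Dirichlet_def by (rule nn_integral_double_add) measurable
  finally show ?thesis .
qed

lemma L2loc_avg2:
  assumes "L2loc f" "L2loc g"
  shows "L2loc (\<lambda>x. (1/2) *\<^sub>R (f x + g x))"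
  unfolding L2loc_iff_nn
proof (intro conjI allI impI)
  have [measurable]: "f \<in> borel_measurable borel" "g \<in> borel_measurable borel"
    using assms by (auto simp: L2loc_iff_nn)
  show "(\<lambda>x. (1/2) *\<^sub>R (f x + g x)) \<in> borel_measurable borel" by measurable
  fix K :: "'a set" assume K: "compact K"
  then have [measurable]: "K \<in> sets borel" by (simp add: borel_compact)
  have "(\<integral>\<^sup>+x\<in>K. nsq ((1/2) *\<^sub>R (f x + g x)) \<partial>lborel) \<le> (\<integral>\<^sup>+x. 2 * (nsq (f x) * indicator K x) + 2 * (nsq (g x) * indicator K x) \<partial>lborel)"
  proof (intro nn_integral_mono)
    fix x
    have "nsq ((1/2) *\<^sub>R (f x + g x)) \<le> 1 * nsq (f x + g x)"
      unfolding nsq_scaleR by (intro mult_right_mono) (auto simp: power2_eq_square)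
    then have "nsq ((1/2) *\<^sub>R (f x + g x)) \<le> 2 * nsq (f x) + 2 * nsq (g x)"
      using nsq_add_le[of "f x" "g x"] by simp
    then show "nsq ((1/2) *\<^sub>R (f x + g x)) * indicator K x \<le> 2 * (nsq (f x) * indicator K x) + 2 * (nsq (g x) * indicator K x)"
      by (cases "x \<in> K") auto
  qed
  also have "\<dots> = 2 * (\<integral>\<^sup>+x\<in>K. nsq (f x) \<partial>lborel) + 2 * (\<integral>\<^sup>+x\<in>K. nsq (g x) \<partial>lborel)"
    by (rule nn_integral_double_add) measurable
  also have "\<dots> < \<infinity>" using assms K by (simp add: L2loc_iff_nn ennreal_mult_less_top)
  finally show "(\<integral>\<^sup>+x\<in>K. nsq ((1/2) *\<^sub>R (f x + g x)) \<partial>lborel) < \<infinity>" .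
qed

lemma weak_partial_avg2:
  assumes "locint u" "locint f" "weak_partial u b f" "locint v" "locint g" "weak_partial v b g"
    and "locint (\<lambda>x. (1/2) *\<^sub>R (u x + v x))" "locint (\<lambda>x. (1/2) *\<^sub>R (f x + g x))"
  shows "weak_partial (\<lambda>x. (1/2) *\<^sub>R (u x + v x)) b (\<lambda>x. (1/2) *\<^sub>R (f x + g x))"
proof (rule weak_partialI[OF assms(7,8)])
  fix \<phi> :: "'a \<Rightarrow> real" assume \<phi>: "test_fun \<phi>"
  have lin: "(\<integral>x. \<psi> x *\<^sub>R ((1/2) *\<^sub>R (p x + q x)) \<partial>lborel) = (1/2) *\<^sub>R ((\<integral>x. \<psi> x *\<^sub>R p x \<partial>lborel) + (\<integral>x. \<psi> x *\<^sub>R q x \<partial>lborel))"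
    if "integrable lborel (\<lambda>x. \<psi> x *\<^sub>R p x)" "integrable lborel (\<lambda>x. \<psi> x *\<^sub>R q x)" for \<psi> :: "'a \<Rightarrow> real" and p q :: "'a \<Rightarrow> 'b"
    using that by (simp only: scaleR_left_commute[of _ "1/2"] scaleR_right_distrib[of "\<psi> _"] integral_scaleR_right Bochner_Integration.integral_add)
  show "(\<integral>x. frechet_derivative \<phi> (at x) b *\<^sub>R ((1/2) *\<^sub>R (u x + v x)) \<partial>lborel) = - (\<integral>x. \<phi> x *\<^sub>R ((1/2) *\<^sub>R (f x + g x)) \<partial>lborel)"
    unfolding lin[OF test_fun_integrable(2)[OF \<phi> assms(1)] test_fun_integrable(2)[OF \<phi> assms(4)]]
      lin[OF test_fun_integrable(1)[OF \<phi> assms(2)] test_fun_integrable(1)[OF \<phi> assms(5)]]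
      weak_partialD[OF assms(3) \<phi>] weak_partialD[OF assms(6) \<phi>]
    by (simp add: scaleR_right_distrib scaleR_right_diff_distrib)
qed

text \<open>Periodicity, weak differentiability and the divergence constraint are linear; finiteness
  of the Dirichlet energy follows from the parallelogram law.\<close>

lemma H1per_avg2:
  fixes u v :: "real \<times> (real^'m) \<Rightarrow> real \<times> (real^'m)"
  assumes u: "H1per u F" and v: "H1per v G"
  shows "H1per (avg2 u v) (avg2D F G)"
proof -
  note U = H1div_D[OF H1per_D(1)[OF u]] and V = H1div_D[OF H1per_D(1)[OF v]]
  have L2: "L2loc (\<lambda>x. avg2D F G x b)" if "b \<in> Basis" for b
    unfolding avg2D_def by (rule L2loc_avg2[OF U(5)[OF that] V(5)[OF that]])
  have L2u: "L2loc (avg2 u v)" unfolding avg2_def[abs_def] by (rule L2loc_avg2[OF U(2) V(2)])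
  have wp: "weak_partial (avg2 u v) b (\<lambda>x. avg2D F G x b)" if "b \<in> Basis" for b
    using weak_partial_avg2[OF U(3) U(6)[OF that] U(8)[OF that] V(3) V(6)[OF that] V(8)[OF that]]
      L2loc_locint[OF L2u] L2loc_locint[OF L2[OF that]] unfolding avg2_def[abs_def] avg2D_def by simp
  have "Dirichlet (avg2D F G) UNIV < \<infinity>"
  proof -
    have "1 * Dirichlet (avg2D F G) UNIV \<le> 4 * Dirichlet (avg2D F G) UNIV" by (intro mult_right_mono) auto
    also have "\<dots> \<le> Dirichlet (\<lambda>x b. F x b - G x b) UNIV + 4 * Dirichlet (avg2D F G) UNIV" by simp
    also have "\<dots> = 2 * Dirichlet F UNIV + 2 * Dirichlet G UNIV"
      by (rule Dirichlet_parallelogram) (use U(7) V(7) in auto)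
    also have "\<dots> < \<infinity>"
      using Dirichlet_finite[OF H1per_D(1)[OF u]] Dirichlet_finite[OF H1per_D(1)[OF v]] by (simp add: ennreal_mult_less_top)
    finally show ?thesis by simp
  qed
  moreover have "grad_sq (avg2D F G) \<in> borel_measurable borel"
    by (rule measurable_grad_sq) (rule L2loc_measurable[OF L2])
  ultimately have gr: "set_integrable lborel cell (grad_sq (avg2D F G))" by (intro set_integrable_grad_sq)
  have "AE x in lborel. divergence (avg2D F G) x = 0"
    using U(10) V(10)
  proof eventually_elim
    case (elim x)
    have "divergence (avg2D F G) x = (1/2) * (divergence F x + divergence G x)"
      by (simp add: divergence_def avg2D_def inner_add_left sum.distrib sum_divide_distrib sum_distrib_left add_divide_distrib)
    then show ?case using elim by simp
  qed
  moreover have "periodic_cyl (avg2 u v)" unfolding avg2_def[abs_def]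
    by (rule periodic_cyl_compose2[OF U(1) V(1)])
  moreover have "periodic_cyl (\<lambda>x. avg2D F G x b)" for b unfolding avg2D_def
    by (rule periodic_cyl_compose2[OF H1per_D(2)[OF u] H1per_D(2)[OF v]])
  ultimately show ?thesis
    unfolding H1per_def H1div_def using L2u L2 wp gr by blast
qed

text \<open>Finite convex combinations with dyadic weights. Field and gradient are averaged in
  parallel, so each pair remains a field with its own gradient; closure under midpoints is what the
  parallelogram law calls for.\<close>

inductive_set mids :: "(('a \<Rightarrow> 'b::real_vector) \<times> ('a \<Rightarrow> 'a \<Rightarrow> 'b)) set \<Rightarrow> (('a \<Rightarrow> 'b) \<times> ('a \<Rightarrow> 'a \<Rightarrow> 'b)) set"
  for Z where
  base: "p \<in> Z \<Longrightarrow> p \<in> mids Z"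
| mid: "(f, F) \<in> mids Z \<Longrightarrow> (g, G) \<in> mids Z \<Longrightarrow> (avg2 f g, avg2D F G) \<in> mids Z"

lemma mids_mono: "p \<in> mids Z \<Longrightarrow> Z \<subseteq> Z' \<Longrightarrow> p \<in> mids Z'"
  by (induction rule: mids.induct) (auto intro: mids.intros)

lemma mids_H1per:
  fixes p :: "(real \<times> (real^'m) \<Rightarrow> real \<times> (real^'m)) \<times> (real \<times> (real^'m) \<Rightarrow> real \<times> (real^'m) \<Rightarrow> real \<times> (real^'m))"
  assumes "p \<in> mids Z" "\<And>f F. (f, F) \<in> Z \<Longrightarrow> H1per f F"
  shows "H1per (fst p) (snd p)"
  using assms(1)
proof induction
  case (base p)
  then show ?case using assms(2)[of "fst p" "snd p"] by (simp only: prod.collapse)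
next
  case (mid f F g G)
  then show ?case by (simp add: H1per_avg2)
qed

text \<open>The parallelogram law with the difference term dropped bounds four times the energy of a
  midpoint by \<open>2 * c + 2 * c\<close>.\<close>

lemma mids_Dirichlet:
  fixes p :: "(real \<times> (real^'m) \<Rightarrow> real \<times> (real^'m)) \<times> (real \<times> (real^'m) \<Rightarrow> real \<times> (real^'m) \<Rightarrow> real \<times> (real^'m))"
  assumes "p \<in> mids Z" and H: "\<And>f F. (f, F) \<in> Z \<Longrightarrow> H1per f F" and c: "\<And>f F. (f, F) \<in> Z \<Longrightarrow> Dirichlet F UNIV \<le> c"
  shows "Dirichlet (snd p) UNIV \<le> c"
  using assms(1)
proof induction
  case (base p)
  then show ?case using c[of "fst p" "snd p"] by (simp only: prod.collapse)
next
  case (mid f F g G)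
  have "H1per f F" "H1per g G" using mids_H1per[OF mid(1) H] mids_H1per[OF mid(2) H] by auto
  note U = H1div_D(7)[OF H1per_D(1)[OF this(1)]] H1div_D(7)[OF H1per_D(1)[OF this(2)]]
  have "4 * Dirichlet (avg2D F G) UNIV \<le> Dirichlet (\<lambda>x b. F x b - G x b) UNIV + 4 * Dirichlet (avg2D F G) UNIV" by simp
  also have "\<dots> = 2 * Dirichlet F UNIV + 2 * Dirichlet G UNIV"
    by (rule Dirichlet_parallelogram[OF U])
  also have "\<dots> \<le> 2 * c + 2 * c" using mid(3,4) by (intro add_mono mult_left_mono) auto
  also have "\<dots> = 4 * c" by (metis distrib_right numeral_Bit0)
  finally show ?case by (subst (asm) ennreal_mult_le_mult_iff) auto
qed

text \<open>L^2 balls around \<open>v\<close> are convex. Hence midpoints built from late members of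
  a sequence converging to \<open>v\<close> converge to \<open>v\<close> too.\<close>

lemma mids_L2:
  fixes p :: "(real \<times> (real^'m) \<Rightarrow> real \<times> (real^'m)) \<times> (real \<times> (real^'m) \<Rightarrow> real \<times> (real^'m) \<Rightarrow> real \<times> (real^'m))"
  assumes "p \<in> mids Z" and H: "\<And>f F. (f, F) \<in> Z \<Longrightarrow> H1per f F"
    and [measurable]: "S \<in> sets borel" "v \<in> borel_measurable borel"
    and c: "\<And>f F. (f, F) \<in> Z \<Longrightarrow> (\<integral>\<^sup>+x\<in>S. nsq (f x - v x) \<partial>lborel) \<le> c"
  shows "(\<integral>\<^sup>+x\<in>S. nsq (fst p x - v x) \<partial>lborel) \<le> c"
  using assms(1)
proof induction
  case (base p)
  then show ?case using c[of "fst p" "snd p"] by (simp only: prod.collapse)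
next
  case (mid f F g G)
  have "H1per f F" "H1per g G" using mids_H1per[OF mid(1) H] mids_H1per[OF mid(2) H] by auto
  then have [measurable]: "f \<in> borel_measurable borel" "g \<in> borel_measurable borel"
    using H1div_D(4) H1per_D(1) by blast+
  have pt: "2 * nsq (avg2 f g x - v x) \<le> nsq (f x - v x) + nsq (g x - v x)" for x
  proof -
    have eq: "avg2 f g x - v x = (1/2) *\<^sub>R ((f x - v x) + (g x - v x))"
    proof -
      have "(f x - v x) + (g x - v x) = (f x + g x) - 2 *\<^sub>R v x" by (simp add: scaleR_2)
      then show ?thesis by (simp only: avg2_def scaleR_right_diff_distrib) simp
    qed
    have "2 * (norm (avg2 f g x - v x))\<^sup>2 \<le> (norm (f x - v x))\<^sup>2 + (norm (g x - v x))\<^sup>2"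
      unfolding eq using parallelogram_norm[of "f x - v x" "g x - v x"] zero_le_power2[of "norm (f x - v x - (g x - v x))"] by linarith
    from ennreal_leI[OF this] show ?thesis by (simp add: nsq_def ennreal_plus ennreal_mult)
  qed
  have "2 * (\<integral>\<^sup>+x\<in>S. nsq (avg2 f g x - v x) \<partial>lborel) = (\<integral>\<^sup>+x. 2 * (nsq (avg2 f g x - v x) * indicator S x) \<partial>lborel)"
    unfolding avg2_def by (rule nn_integral_cmult[symmetric]) measurable
  also have "\<dots> \<le> (\<integral>\<^sup>+x. nsq (f x - v x) * indicator S x + nsq (g x - v x) * indicator S x \<partial>lborel)"
    using pt by (intro nn_integral_mono) (auto simp: indicator_def)
  also have "\<dots> = (\<integral>\<^sup>+x\<in>S. nsq (f x - v x) \<partial>lborel) + (\<integral>\<^sup>+x\<in>S. nsq (g x - v x) \<partial>lborel)"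
    by (rule nn_integral_add) measurable
  also have "\<dots> \<le> c + c" using mid(3,4) by (intro add_mono) auto
  also have "\<dots> = 2 * c" by (simp add: mult_2)
  finally show ?case by (subst (asm) ennreal_mult_le_mult_iff) auto
qed

text \<open>Near-minimisers of the Dirichlet energy over the midpoint-closed tails form a Cauchy sequence by the
  parallelogram law. This replaces weak compactness and makes lower semicontinuity of the energy automatic.\<close>

lemma Dirichlet_Cauchy_selection:
  fixes E :: "nat \<Rightarrow> ((real \<times> (real^'m) \<Rightarrow> real \<times> (real^'m)) \<times> (real \<times> (real^'m) \<Rightarrow> real \<times> (real^'m) \<Rightarrow> real \<times> (real^'m))) set"
  assumes ne: "\<And>n. E n \<noteq> {}" and dec: "\<And>m n. m \<le> n \<Longrightarrow> E n \<subseteq> E m"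
    and mid: "\<And>n f F g G. (f, F) \<in> E n \<Longrightarrow> (g, G) \<in> E n \<Longrightarrow> (avg2 f g, avg2D F G) \<in> E n"
    and H: "\<And>n p. p \<in> E n \<Longrightarrow> H1per (fst p) (snd p)"
    and M: "\<And>n p. p \<in> E n \<Longrightarrow> Dirichlet (snd p) UNIV \<le> ennreal M"
  obtains y where "\<And>n. y n \<in> E n"
    "\<And>e. e > 0 \<Longrightarrow> \<exists>N. \<forall>i\<ge>N. \<forall>j\<ge>N. Dirichlet (\<lambda>x b. snd (y i) x b - snd (y j) x b) UNIV \<le> ennreal e"
proof -
  define q where "q p = enn2real (Dirichlet (snd p) UNIV)" for p :: "(real \<times> (real^'m) \<Rightarrow> real \<times> (real^'m)) \<times> (real \<times> (real^'m) \<Rightarrow> real \<times> (real^'m) \<Rightarrow> real \<times> (real^'m))"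
  have q: "Dirichlet (snd p) UNIV = ennreal (q p)" "q p \<ge> 0" if "p \<in> E n" for p n
    using Dirichlet_finite[OF H1per_D(1)[OF H[OF that]], of UNIV] by (auto simp: q_def)
  have qM: "q p \<le> \<bar>M\<bar>" if "p \<in> E n" for p n
  proof -
    have "ennreal (q p) \<le> ennreal \<bar>M\<bar>"
      by (rule order_trans[OF M[OF that, unfolded q(1)[OF that]] ennreal_leI]) simp
    then show ?thesis by simp
  qed
  \<comment> \<open>The sets \<open>E n\<close> decrease, so these infima increase; being bounded by
    \<open>\<bar>M\<bar>\<close> they converge, and \<open>D - d N\<close> tends to 0.\<close>
  define d where "d n = Inf (q ` E n)" for n
  have bdd: "bdd_below (q ` E n)" for n using q(2) by (intro bdd_belowI[of _ 0]) auto
  have d_le: "d n \<le> q p" if "p \<in> E n" for n p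
    unfolding d_def using that by (intro cInf_lower bdd) auto
  have d_mono: "d m \<le> d n" if "m \<le> n" for m n
    unfolding d_def using ne bdd dec[OF that] by (intro cInf_superset_mono) auto
  have d_M: "d n \<le> \<bar>M\<bar>" for n
  proof -
    obtain p where "p \<in> E n" using ne[of n] by blast
    then show ?thesis using d_le qM by (meson order_trans)
  qed
  have "incseq d" using d_mono by (auto simp: incseq_def)
  then obtain D where D: "d \<longlonglongrightarrow> D" "\<And>n. d n \<le> D"
    using incseq_convergent[of d "\<bar>M\<bar>"] d_M by blast
  have "\<exists>p\<in>E n. q p < d n + 1 / real (Suc n)" for n
    using cInf_lessD[of "q ` E n" "d n + 1 / real (Suc n)"] ne[of n] by (auto simp: d_def)
  then obtain y where y: "\<And>n. y n \<in> E n" "\<And>n. q (y n) < d n + 1 / real (Suc n)" by metis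
  \<comment> \<open>The midpoint of \<open>y i\<close> and \<open>y j\<close> lies in
    \<open>E N\<close> and has energy at least \<open>d N\<close>, while the two ends have energy at
    most \<open>D + 1 / real (Suc N)\<close>; the parallelogram law leaves only the gap for the
    difference.\<close>
  have main: "Dirichlet (\<lambda>x b. snd (y i) x b - snd (y j) x b) UNIV \<le> ennreal (4 * (D - d N) + 4 / real (Suc N))"
    if ij: "i \<ge> N" "j \<ge> N" for i j N
  proof -
    have yN: "y i \<in> E N" "y j \<in> E N" using y(1) dec[OF ij(1)] dec[OF ij(2)] by blast+
    let ?m = "(avg2 (fst (y i)) (fst (y j)), avg2D (snd (y i)) (snd (y j)))"
    have m: "?m \<in> E N" using mid[of "fst (y i)" "snd (y i)" N "fst (y j)" "snd (y j)"] yN by simp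
    have "Dirichlet (\<lambda>x b. snd (y i) x b - snd (y j) x b) UNIV + 4 * Dirichlet (avg2D (snd (y i)) (snd (y j))) UNIV
       = 2 * Dirichlet (snd (y i)) UNIV + 2 * Dirichlet (snd (y j)) UNIV"
      by (rule Dirichlet_parallelogram) (use H1div_D(7)[OF H1per_D(1)[OF H]] yN in blast)+
    also have "Dirichlet (avg2D (snd (y i)) (snd (y j))) UNIV = ennreal (q ?m)"
      using q(1)[OF m] by simp
    finally have eq: "Dirichlet (\<lambda>x b. snd (y i) x b - snd (y j) x b) UNIV + ennreal (4 * q ?m) = ennreal (2 * q (y i) + 2 * q (y j))"
      unfolding q(1)[OF yN(1)] q(1)[OF yN(2)] using q(2)[OF yN(1)] q(2)[OF yN(2)] q(2)[OF m]
      by (simp add: ennreal_plus ennreal_mult)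
    have "Dirichlet (\<lambda>x b. snd (y i) x b - snd (y j) x b) UNIV \<le> ennreal (2 * q (y i) + 2 * q (y j))"
      unfolding eq[symmetric] by simp
    then have "Dirichlet (\<lambda>x b. snd (y i) x b - snd (y j) x b) UNIV < \<infinity>"
      by (rule le_less_trans) simp
    then obtain z where z: "Dirichlet (\<lambda>x b. snd (y i) x b - snd (y j) x b) UNIV = ennreal z" "z \<ge> 0"
      by (cases "Dirichlet (\<lambda>x b. snd (y i) x b - snd (y j) x b) UNIV") auto
    have "z + 4 * q ?m = 2 * q (y i) + 2 * q (y j)"
      using eq q(2)[OF yN(1)] q(2)[OF yN(2)] q(2)[OF m] z(2) unfolding z(1)
      by (subst (asm) ennreal_plus[symmetric]) (auto simp del: ennreal_plus)
    moreover have "d N \<le> q ?m" by (rule d_le[OF m])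
    moreover have "q (y i) \<le> D + 1 / real (Suc N)" "q (y j) \<le> D + 1 / real (Suc N)"
    proof -
      have "1 / real (Suc i) \<le> 1 / real (Suc N)" "1 / real (Suc j) \<le> 1 / real (Suc N)"
        using ij by (auto simp: frac_le)
      then show "q (y i) \<le> D + 1 / real (Suc N)" "q (y j) \<le> D + 1 / real (Suc N)"
        using y(2)[of i] y(2)[of j] D(2)[of i] D(2)[of j] by linarith+
    qed
    ultimately have "z \<le> 4 * (D - d N) + 4 * (1 / real (Suc N))" by (simp add: algebra_simps)
    then show ?thesis unfolding z(1) by (intro ennreal_leI) simp
  qed
  have lim: "(\<lambda>N. 4 * (D - d N) + 4 * inverse (real (Suc N))) \<longlonglongrightarrow> 4 * (D - D) + 4 * 0"
    by (intro tendsto_intros D(1) LIMSEQ_inverse_real_of_nat)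
  have "\<exists>N. \<forall>i\<ge>N. \<forall>j\<ge>N. Dirichlet (\<lambda>x b. snd (y i) x b - snd (y j) x b) UNIV \<le> ennreal e" if "e > 0" for e
  proof -
    have "eventually (\<lambda>N. 4 * (D - d N) + 4 * inverse (real (Suc N)) < e) sequentially"
      using lim that by (intro order_tendstoD) auto
    then obtain N where "4 * (D - d N) + 4 * inverse (real (Suc N)) < e" by (auto simp: eventually_sequentially)
    then have "ennreal (4 * (D - d N) + 4 / real (Suc N)) \<le> ennreal e"
      by (intro ennreal_leI) (simp add: divide_inverse)
    then show ?thesis using main[of N] by (meson order_trans)
  qed
  with y(1) show thesis by (rule that)
qed

text \<open>The indicator of the points where \<open>P\<close> fails is periodic with zero integral
  over slabs, hence over every ball, since a ball is covered by finitely many translates of a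
  slab.\<close>

lemma AE_periodic_extend:
  fixes P :: "real \<times> (real^'m) \<Rightarrow> bool"
  assumes [measurable]: "Measurable.pred borel P" and per: "periodic_cyl P" and ae: "AE x in lborel. x \<in> slab UNIV \<longrightarrow> P x"
  shows "AE x in lborel. P x"
proof -
  define h where "h x = (if P x then 0 else 1 :: ennreal)" for x
  have [measurable]: "h \<in> borel_measurable borel" unfolding h_def by measurable
  have hper: "periodic_cyl h" unfolding h_def by (rule periodic_cyl_compose[OF per])
  have z: "(\<integral>\<^sup>+x\<in>slab I. h x \<partial>lborel) = 0" if [measurable]: "I \<in> sets borel" for I
  proof (subst nn_integral_0_iff_AE)
    show "AE x in lborel. h x * indicator (slab I) x = 0"
      using ae by eventually_elim (auto simp: h_def indicator_def mem_slab)
  qed measurable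
  have "AE x in lborel. x \<in> cball 0 (real n) \<longrightarrow> P x" for n
  proof -
    obtain c k :: nat where "\<And>h. h \<in> borel_measurable borel \<Longrightarrow> periodic_cyl h \<Longrightarrow>
       (\<integral>\<^sup>+x\<in>cball 0 (real n) :: (real \<times> (real^'m)) set. h x \<partial>lborel) \<le> of_nat c * (\<integral>\<^sup>+x\<in>slab {-real k..real k}. h x \<partial>lborel)"
      using nn_integral_compact_le_slab[OF compact_cball[of "0 :: real \<times> (real^'m)" "real n"]] by blast
    from this[of h] have "(\<integral>\<^sup>+x\<in>cball 0 (real n) :: (real \<times> (real^'m)) set. h x \<partial>lborel) = 0"
      using hper z[of "{-real k..real k}"] by simp
    moreover have "(\<lambda>x. h x * indicator (cball 0 (real n)) x) \<in> borel_measurable lborel"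
      by (intro borel_measurable_times_ennreal borel_measurable_indicator) auto
    ultimately have "AE x :: real \<times> (real^'m) in lborel. h x * indicator (cball 0 (real n)) x = 0"
      by (simp add: nn_integral_0_iff_AE)
    then show ?thesis by eventually_elim (auto simp: h_def indicator_def split: if_splits)
  qed
  then have "AE x in lborel. \<forall>n. x \<in> cball 0 (real n) \<longrightarrow> P x"
    by (subst AE_all_countable) blast
  then show ?thesis
  proof eventually_elim
    case (elim x)
    obtain n where "norm x \<le> real n" using real_arch_simple by blast
    then show ?case using elim by (auto simp: mem_cball)
  qed
qed

text \<open>Jensen's inequality on cross-sections of measure 1, then Tonelli.\<close>

lemma slice_avg_L2_le:
  fixes u v :: "real \<times> (real^'m) \<Rightarrow> real \<times> (real^'m)"
  assumes u: "locint u" "slice_avg u f" and v: "locint v" "slice_avg v g"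
  shows "(\<integral>\<^sup>+s\<in>{a..b}. nsq (f s - g s) \<partial>lborel) \<le> (\<integral>\<^sup>+x\<in>slab {a..b}. nsq (u x - v x) \<partial>lborel)"
proof -
  have [measurable]: "u \<in> borel_measurable borel" "v \<in> borel_measurable borel"
    using u v by (auto intro: locint_measurable)
  have [measurable]: "(slab {a..b} :: (real \<times> (real^'m)) set) \<in> sets borel" by simp
  have [measurable]: "(\<lambda>x. nsq (u x - v x) * indicator (slab {a..b}) x) \<in> borel_measurable (lborel \<Otimes>\<^sub>M lborel)"
    unfolding lborel_prod by measurable
  have "(\<integral>\<^sup>+s\<in>{a..b}. nsq (f s - g s) \<partial>lborel) \<le> (\<integral>\<^sup>+s. \<integral>\<^sup>+y. nsq (u (s, y) - v (s, y)) * indicator (slab {a..b}) (s, y) \<partial>lborel \<partial>lborel)"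
  proof (rule nn_integral_mono_AE)
    have "AE s in lborel. f s = xavg u s" "AE s in lborel. g s = xavg v s"
      using u v by (auto simp: slice_avg_def)
    then show "AE s in lborel. nsq (f s - g s) * indicator {a..b} s \<le> (\<integral>\<^sup>+y. nsq (u (s, y) - v (s, y)) * indicator (slab {a..b}) (s, y) \<partial>lborel)"
      using AE_slice_integrable[OF u(1)] AE_slice_integrable[OF v(1)]
    proof eventually_elim
      case (elim s)
      have "f s - g s = (LINT y:box0|lborel. u (s, y) - v (s, y))"
        using elim by (simp add: xavg_box0 set_integral_diff)
      then have "nsq (f s - g s) \<le> 1 * (\<integral>\<^sup>+y\<in>box0. nsq (u (s, y) - v (s, y)) \<partial>lborel)"
        using nsq_set_integral_le[of box0 lborel "\<lambda>y. u (s, y) - v (s, y)"] by simp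
      moreover have "indicator (slab {a..b}) (s, y) = (indicator {a..b} s * indicator box0 y :: ennreal)" for y :: "real^'m"
        by (auto simp: slab_def indicator_def)
      ultimately show ?case by (cases "s \<in> {a..b}") auto
    qed
  qed
  also have "\<dots> = (\<integral>\<^sup>+x. nsq (u x - v x) * indicator (slab {a..b}) x \<partial>(lborel \<Otimes>\<^sub>M lborel))"
    by (rule lborel.nn_integral_fst) measurable
  finally show ?thesis unfolding lborel_prod .
qed

text \<open>The Dirichlet energy controls a field only up to an additive constant, which one value
  of the slice average fixes. In the application an exit is translated to 0, where the average is at
  distance \<open>\<delta>\<close> from \<open>um\<close>.\<close>

lemma slab_L2_bound:
  fixes u :: "real \<times> (real^'m) \<Rightarrow> real \<times> (real^'m)"
  assumes H: "H1per u Du" and ub: "slice_avg u ub" and C0: "norm (ub 0) \<le> C0"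
    and M: "Dirichlet Du UNIV \<le> ennreal M"
  shows "(\<integral>\<^sup>+x\<in>slab {-real k..real k}. nsq (u x) \<partial>lborel)
    \<le> 2 * ((2 * slice_const TYPE('m) + 2 * ennreal ((real k + real k)\<^sup>2)) * ennreal M) + 2 * (ennreal (C0\<^sup>2) * ennreal (2 * real k))"
proof -
  have [measurable]: "u \<in> borel_measurable borel" using H1div_D(4)[OF H1per_D(1)[OF H]] .
  let ?S = "slab {-real k..real k} :: (real \<times> (real^'m)) set"
  have [measurable]: "?S \<in> sets borel" by simp
  have "(\<integral>\<^sup>+x\<in>?S. nsq (u x) \<partial>lborel) \<le> (\<integral>\<^sup>+x. 2 * (nsq (u x - ub 0) * indicator ?S x) + 2 * (ennreal (C0\<^sup>2) * indicator ?S x) \<partial>lborel)"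
  proof (intro nn_integral_mono)
    fix x
    have "nsq (u x) \<le> 2 * nsq (u x - ub 0) + 2 * nsq (ub 0)" using nsq_add_le[of "u x - ub 0" "ub 0"] by simp
    also have "\<dots> \<le> 2 * nsq (u x - ub 0) + 2 * ennreal (C0\<^sup>2)"
      using C0 unfolding nsq_def[of "ub 0"] by (intro add_left_mono mult_left_mono ennreal_leI power_mono) auto
    finally show "nsq (u x) * indicator ?S x \<le> 2 * (nsq (u x - ub 0) * indicator ?S x) + 2 * (ennreal (C0\<^sup>2) * indicator ?S x)"
      by (cases "x \<in> ?S") auto
  qed
  also have "\<dots> = 2 * (\<integral>\<^sup>+x\<in>?S. nsq (u x - ub 0) \<partial>lborel) + 2 * (ennreal (C0\<^sup>2) * ennreal (2 * real k))"
    by (subst nn_integral_double_add) (auto simp: emeasure_slab nn_integral_cmult_indicator)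
  also have "\<dots> \<le> 2 * ((2 * slice_const TYPE('m) + 2 * ennreal ((real k + real k)\<^sup>2)) * ennreal M) + 2 * (ennreal (C0\<^sup>2) * ennreal (2 * real k))"
  proof (intro add_right_mono mult_left_mono)
    have "(\<integral>\<^sup>+x\<in>?S. nsq (u x - ub 0) \<partial>lborel) \<le> (2 * slice_const TYPE('m) + 2 * ennreal ((real k - - real k)\<^sup>2)) * Dirichlet Du {-real k..real k}"
      by (rule Poincare_slab[OF H ub]) simp
    also have "\<dots> \<le> (2 * slice_const TYPE('m) + 2 * ennreal ((real k + real k)\<^sup>2)) * ennreal M"
      using M Dirichlet_mono[of "{-real k..real k}" UNIV Du] by (intro mult_mono) (auto intro: order_trans)
    finally show "(\<integral>\<^sup>+x\<in>?S. nsq (u x - ub 0) \<partial>lborel) \<le> (2 * slice_const TYPE('m) + 2 * ennreal ((real k + real k)\<^sup>2)) * ennreal M" .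
  qed simp
  finally show ?thesis .
qed

section \<open>Stability of bounds and constraints under L^2 limits\<close>

lemma compact_L2_tendsto:
  fixes h :: "nat \<Rightarrow> real \<times> (real^'m) \<Rightarrow> ennreal"
  assumes "\<And>n. h n \<in> borel_measurable borel" "\<And>n. periodic_cyl (h n)"
    and lim: "\<And>k. (\<lambda>n. \<integral>\<^sup>+x\<in>slab {-real k..real k}. h n x \<partial>lborel) \<longlonglongrightarrow> 0" and K: "compact K"
  shows "(\<lambda>n. \<integral>\<^sup>+x\<in>K. h n x \<partial>lborel) \<longlonglongrightarrow> 0"
proof -
  obtain c k :: nat where c: "\<And>h. h \<in> borel_measurable borel \<Longrightarrow> periodic_cyl h \<Longrightarrow>
       (\<integral>\<^sup>+x\<in>K. h x \<partial>lborel) \<le> of_nat c * (\<integral>\<^sup>+x\<in>slab {-real k..real k}. h x \<partial>lborel)"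
    using nn_integral_compact_le_slab[OF K] by blast
  have "(\<lambda>n. of_nat c * (\<integral>\<^sup>+x\<in>slab {-real k..real k}. h n x \<partial>lborel)) \<longlonglongrightarrow> of_nat c * 0"
    by (intro ennreal_tendsto_cmult lim) (simp add: ennreal_of_nat_eq_real_of_nat)
  then show ?thesis
    using tendsto_sandwich[OF always_eventually always_eventually tendsto_const, OF _ allI[OF c[OF assms(1,2)]], of 0] by simp
qed

lemma L2loc_limit:
  assumes w: "\<And>n. L2loc (w n)" and [measurable]: "v \<in> borel_measurable borel"
    and lim: "\<And>K. compact K \<Longrightarrow> (\<lambda>n. \<integral>\<^sup>+x\<in>K. nsq (w n x - v x) \<partial>lborel) \<longlonglongrightarrow> 0"
  shows "L2loc v"
  unfolding L2loc_iff_nn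
proof (intro conjI allI impI)
  fix K :: "'a set" assume K: "compact K"
  then have [measurable]: "K \<in> sets borel" by (simp add: borel_compact)
  have [measurable]: "w n \<in> borel_measurable borel" for n using w by (simp add: L2loc_iff_nn)
  have "eventually (\<lambda>n. (\<integral>\<^sup>+x\<in>K. nsq (w n x - v x) \<partial>lborel) < 1) sequentially"
    using lim[OF K] by (intro order_tendstoD) auto
  then obtain n where n: "(\<integral>\<^sup>+x\<in>K. nsq (w n x - v x) \<partial>lborel) < 1" by (auto simp: eventually_sequentially)
  have "(\<integral>\<^sup>+x\<in>K. nsq (v x) \<partial>lborel) \<le> (\<integral>\<^sup>+x. 2 * (nsq (w n x - v x) * indicator K x) + 2 * (nsq (w n x) * indicator K x) \<partial>lborel)"
  proof (intro nn_integral_mono)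
    fix x
    have "nsq (v x) \<le> 2 * nsq (w n x - v x) + 2 * nsq (w n x)"
      using nsq_add_le[of "v x - w n x" "w n x"] by (simp add: nsq_minus[of "v x"])
    then show "nsq (v x) * indicator K x \<le> 2 * (nsq (w n x - v x) * indicator K x) + 2 * (nsq (w n x) * indicator K x)"
      by (cases "x \<in> K") auto
  qed
  also have "\<dots> = 2 * (\<integral>\<^sup>+x\<in>K. nsq (w n x - v x) \<partial>lborel) + 2 * (\<integral>\<^sup>+x\<in>K. nsq (w n x) \<partial>lborel)"
    by (rule nn_integral_double_add) measurable
  also have "\<dots> < \<infinity>"
    using w[of n] K n by (auto simp: L2loc_iff_nn ennreal_mult_less_top intro: less_trans)
  finally show "(\<integral>\<^sup>+x\<in>K. nsq (v x) \<partial>lborel) < \<infinity>" .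
qed simp

text \<open>The coefficient of \<open>(norm y)\<^sup>2\<close> can be brought arbitrarily close to
  1. The factor 2 of \<open>norm_add_sq_le\<close> would be too lossy for the energy of a
  limit.\<close>

lemma norm_sq_young:
  fixes x y :: "'a::real_normed_vector"
  assumes "\<epsilon> > 0"
  shows "(norm x)\<^sup>2 \<le> (1 + \<epsilon>) * (norm y)\<^sup>2 + (1 + 1 / \<epsilon>) * (norm (y - x))\<^sup>2"
proof -
  define p q where "p = norm y" and "q = norm (y - x)"
  have "norm x \<le> p + q" unfolding p_def q_def by (metis norm_minus_commute norm_triangle_sub)
  then have "(norm x)\<^sup>2 \<le> (p + q)\<^sup>2" by (intro power_mono) auto
  also have "\<dots> = p\<^sup>2 + q\<^sup>2 + 2 * p * q" by (simp add: power2_eq_square algebra_simps)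
  also have "2 * p * q \<le> \<epsilon> * p\<^sup>2 + q\<^sup>2 / \<epsilon>"
  proof -
    have "0 \<le> (\<epsilon> * p - q)\<^sup>2 / \<epsilon>" using assms by simp
    also have "\<dots> = \<epsilon> * p\<^sup>2 + q\<^sup>2 / \<epsilon> - 2 * p * q"
      using assms by (simp add: power2_eq_square field_simps)
    finally show ?thesis by simp
  qed
  finally show ?thesis unfolding p_def q_def by (simp add: algebra_simps)
qed

lemma nn_integral_linear:
  assumes "f \<in> borel_measurable M" "g \<in> borel_measurable M"
  shows "(\<integral>\<^sup>+x. a * f x + b * g x \<partial>M) = a * (\<integral>\<^sup>+x. f x \<partial>M) + b * (\<integral>\<^sup>+x. g x \<partial>M)"
  using assms by (simp add: nn_integral_add nn_integral_cmult)

lemma Dirichlet_limit_le: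
  fixes F :: "nat \<Rightarrow> real \<times> (real^'m) \<Rightarrow> real \<times> (real^'m) \<Rightarrow> real \<times> (real^'m)"
  assumes F: "\<And>n b. b \<in> Basis \<Longrightarrow> (\<lambda>x. F n x b) \<in> borel_measurable borel"
    and G: "\<And>b. b \<in> Basis \<Longrightarrow> (\<lambda>x. G x b) \<in> borel_measurable borel"
    and lim: "\<And>b. b \<in> Basis \<Longrightarrow> (\<lambda>n. \<integral>\<^sup>+x\<in>slab UNIV. nsq (F n x b - G x b) \<partial>lborel) \<longlonglongrightarrow> 0"
    and c: "eventually (\<lambda>n. Dirichlet (F n) UNIV \<le> c) sequentially"
  shows "Dirichlet G UNIV \<le> c"
proof (cases "c = \<infinity>")
  case False
  then obtain cr where cr: "c = ennreal cr" "cr \<ge> 0" by (cases c) auto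
  have [measurable]: "grad_sq (F n) \<in> borel_measurable borel" "grad_sq G \<in> borel_measurable borel" for n
    using F G by (auto intro!: measurable_grad_sq)
  have sq_meas [measurable]: "(\<lambda>x. nsq (F n x b - G x b) * indicator (slab UNIV) x) \<in> borel_measurable borel" if "b \<in> Basis" for n b
  proof -
    note [measurable] = F[OF that] G[OF that]
    show ?thesis by measurable
  qed
  have eps: "Dirichlet G UNIV \<le> ennreal ((1 + \<epsilon>) * cr)" if \<epsilon>: "\<epsilon> > 0" for \<epsilon>
  proof -
    let ?e = "\<lambda>n. \<Sum>b\<in>Basis. \<integral>\<^sup>+x\<in>slab UNIV. nsq (F n x b - G x b) \<partial>lborel"
    have le: "Dirichlet G UNIV \<le> ennreal (1 + \<epsilon>) * Dirichlet (F n) UNIV + ennreal (1 + 1 / \<epsilon>) * ?e n" for n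
    proof -
      have "Dirichlet G UNIV \<le> (\<integral>\<^sup>+x. ennreal (1 + \<epsilon>) * (ennreal (grad_sq (F n) x) * indicator (slab UNIV) x)
          + ennreal (1 + 1 / \<epsilon>) * (\<Sum>b\<in>Basis. nsq (F n x b - G x b) * indicator (slab UNIV) x) \<partial>lborel)"
        unfolding Dirichlet_def
      proof (intro nn_integral_mono)
        fix x
        have "grad_sq G x \<le> (\<Sum>b\<in>Basis. (1 + \<epsilon>) * (norm (F n x b))\<^sup>2 + (1 + 1 / \<epsilon>) * (norm (F n x b - G x b))\<^sup>2)"
          unfolding grad_sq_def by (intro sum_mono norm_sq_young \<epsilon>)
        also have "\<dots> = (1 + \<epsilon>) * grad_sq (F n) x + (1 + 1 / \<epsilon>) * (\<Sum>b\<in>Basis. (norm (F n x b - G x b))\<^sup>2)"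
          unfolding grad_sq_def by (simp only: sum.distrib sum_distrib_left)
        finally have "ennreal (grad_sq G x) \<le> ennreal ((1 + \<epsilon>) * grad_sq (F n) x + (1 + 1 / \<epsilon>) * (\<Sum>b\<in>Basis. (norm (F n x b - G x b))\<^sup>2))"
          by (rule ennreal_leI)
        also have "\<dots> = ennreal (1 + \<epsilon>) * ennreal (grad_sq (F n) x) + ennreal (1 + 1 / \<epsilon>) * (\<Sum>b\<in>Basis. nsq (F n x b - G x b))"
        proof -
          have 1: "0 \<le> (\<Sum>b\<in>Basis. (norm (F n x b - G x b))\<^sup>2)" by (intro sum_nonneg) auto
          have 2: "(\<Sum>b\<in>Basis. nsq (F n x b - G x b)) = ennreal (\<Sum>b\<in>Basis. (norm (F n x b - G x b))\<^sup>2)"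
            unfolding nsq_def by (rule sum_ennreal) auto
          have 3: "0 \<le> 1 + \<epsilon>" "0 \<le> 1 + 1 / \<epsilon>" using \<epsilon> by auto
          show ?thesis unfolding 2
            by (simp only: ennreal_plus[OF mult_nonneg_nonneg[OF 3(1) grad_sq_nonneg] mult_nonneg_nonneg[OF 3(2) 1]]
                ennreal_mult[OF 3(1) grad_sq_nonneg] ennreal_mult[OF 3(2) 1])
        qed
        finally have *: "ennreal (grad_sq G x) \<le> ennreal (1 + \<epsilon>) * ennreal (grad_sq (F n) x) + ennreal (1 + 1 / \<epsilon>) * (\<Sum>b\<in>Basis. nsq (F n x b - G x b))" .
        show "ennreal (grad_sq G x) * indicator (slab UNIV) x \<le> ennreal (1 + \<epsilon>) * (ennreal (grad_sq (F n) x) * indicator (slab UNIV) x)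
          + ennreal (1 + 1 / \<epsilon>) * (\<Sum>b\<in>Basis. nsq (F n x b - G x b) * indicator (slab UNIV) x)"
        proof (cases "x \<in> slab UNIV")
          case True
          then show ?thesis using * by (simp only: indicator_simps mult_1_right)
        next
          case False
          then show ?thesis by (simp only: indicator_simps mult_zero_right zero_le not_False_eq_True)
        qed
      qed
      also have "\<dots> = ennreal (1 + \<epsilon>) * Dirichlet (F n) UNIV + ennreal (1 + 1 / \<epsilon>) * (\<integral>\<^sup>+x. (\<Sum>b\<in>Basis. nsq (F n x b - G x b) * indicator (slab UNIV) x) \<partial>lborel)"
      proof -
        have [measurable]: "(\<lambda>x. \<Sum>b\<in>Basis. nsq (F n x b - G x b) * indicator (slab UNIV) x) \<in> borel_measurable borel"
          by (intro borel_measurable_sum sq_meas)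
        show ?thesis unfolding Dirichlet_def by (rule nn_integral_linear) measurable
      qed
      also have "(\<integral>\<^sup>+x. (\<Sum>b\<in>Basis. nsq (F n x b - G x b) * indicator (slab UNIV) x) \<partial>lborel) = ?e n"
        by (rule nn_integral_sum) (simp add: sq_meas)
      finally show ?thesis .
    qed
    have "(\<lambda>n. ?e n) \<longlonglongrightarrow> (\<Sum>b\<in>(Basis :: (real \<times> (real^'m)) set). 0)"
      by (intro tendsto_sum lim)
    then have "(\<lambda>n. ennreal (1 + 1 / \<epsilon>) * ?e n) \<longlonglongrightarrow> ennreal (1 + 1 / \<epsilon>) * 0"
      by (intro ennreal_tendsto_cmult) auto
    then have "(\<lambda>n. ennreal (1 + \<epsilon>) * c + ennreal (1 + 1 / \<epsilon>) * ?e n) \<longlonglongrightarrow> ennreal (1 + \<epsilon>) * c + ennreal (1 + 1 / \<epsilon>) * 0"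
      by (intro tendsto_add tendsto_const)
    moreover have "eventually (\<lambda>n. Dirichlet G UNIV \<le> ennreal (1 + \<epsilon>) * c + ennreal (1 + 1 / \<epsilon>) * ?e n) sequentially"
      using c
    proof eventually_elim
      case (elim n)
      show ?case by (rule order_trans[OF le[of n] add_right_mono[OF mult_left_mono[OF elim]]]) simp
    qed
    ultimately have "Dirichlet G UNIV \<le> ennreal (1 + \<epsilon>) * c + ennreal (1 + 1 / \<epsilon>) * 0"
      by (intro tendsto_lowerbound) auto
    also have "\<dots> = ennreal ((1 + \<epsilon>) * cr)"
      using \<epsilon> cr by (simp add: ennreal_mult)
    finally show ?thesis .
  qed
  obtain D where D: "Dirichlet G UNIV = ennreal D" "D \<ge> 0"
    using eps[of 1] by (cases "Dirichlet G UNIV") (auto simp: top_unique)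
  have "D \<le> cr + e" if "e > 0" for e
  proof -
    \<comment> \<open>Dividing by \<open>cr + 1\<close> keeps the choice of
      \<open>\<epsilon>\<close> meaningful for \<open>cr = 0\<close> and limits the excess to
      \<open>e\<close>.\<close>
    have "D \<le> (1 + e / (cr + 1)) * cr"
      using eps[of "e / (cr + 1)"] that cr(2) D by (simp add: mult_nonneg_nonneg)
    also have "\<dots> = cr + e * (cr / (cr + 1))" by (simp add: algebra_simps)
    also have "\<dots> \<le> cr + e * 1" using that cr(2) by (intro add_left_mono mult_left_mono) auto
    finally show ?thesis by simp
  qed
  then have "D \<le> cr" by (rule field_le_epsilon)
  then show ?thesis unfolding D(1) cr(1) by (rule ennreal_leI)
qed simp

text \<open>L^2 convergence controls the averages only in the mean over an interval; the common
  Hoelder bound makes the value at \<open>t\<close> differ little from those on a short interval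
  \<open>{t..t + \<epsilon>}\<close>.\<close>

lemma slice_avg_tendsto:
  fixes u :: "nat \<Rightarrow> real \<times> (real^'m) \<Rightarrow> real \<times> (real^'m)"
  assumes H: "\<And>n. H1per (u n) (Du n)" and ub: "\<And>n. slice_avg (u n) (ub n)" and M: "\<And>n. Dirichlet (Du n) UNIV \<le> ennreal M"
    and Hv: "H1per v Dv" and vb: "slice_avg v vb" and Mv: "Dirichlet Dv UNIV \<le> ennreal M"
    and lim: "\<And>k. (\<lambda>n. \<integral>\<^sup>+x\<in>slab {-real k..real k}. nsq (u n x - v x) \<partial>lborel) \<longlonglongrightarrow> 0"
  shows "(\<lambda>n. ub n t) \<longlonglongrightarrow> vb t"
proof (rule tendsto_nsq_0_imp, rule tendsto_0_if_eventually_le)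
  fix e :: real assume e: "e > 0"
  have near: "nsq (f s - f t) \<le> ennreal \<epsilon> * ennreal \<bar>M\<bar>"
    if "H1per w Dw" "slice_avg w f" "Dirichlet Dw UNIV \<le> ennreal M" "s \<in> {t..t + \<epsilon>}" for w :: "real \<times> (real^'m) \<Rightarrow> real \<times> (real^'m)" and Dw f s \<epsilon>
  proof -
    have "nsq (f s - f t) \<le> ennreal (s - t) * Dirichlet Dw {t..s}"
      using slice_avg_flux(2)[OF that(1,2), of t s] that(4) by simp
    also have "\<dots> \<le> ennreal \<epsilon> * ennreal \<bar>M\<bar>"
    proof (intro mult_mono)
      show "Dirichlet Dw {t..s} \<le> ennreal \<bar>M\<bar>"
        by (rule order_trans[OF Dirichlet_mono order_trans[OF that(3) ennreal_leI]]) auto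
    qed (use that(4) in \<open>auto intro: ennreal_leI\<close>)
    finally show ?thesis .
  qed
  \<comment> \<open>Makes the two oscillation terms,
    \<open>16 * (\<epsilon> * \<bar>M\<bar>)\<close> in total, at most \<open>e / 2\<close>; the
    tolerance \<open>\<epsilon> * e / 16\<close> on the integral contributes the other half.\<close>
  define \<epsilon> where "\<epsilon> = e / (32 * (\<bar>M\<bar> + 1))"
  have \<epsilon>: "\<epsilon> > 0" using e by (simp add: \<epsilon>_def add_nonneg_pos)
  obtain k :: nat where k: "\<bar>t\<bar> + \<epsilon> \<le> real k" using real_arch_simple by blast
  have "eventually (\<lambda>n. (\<integral>\<^sup>+x\<in>slab {-real k..real k}. nsq (u n x - v x) \<partial>lborel) < ennreal (\<epsilon> * e / 16)) sequentially"
    using lim[of k] \<epsilon> e by (intro order_tendstoD) auto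
  then show "eventually (\<lambda>n. nsq (ub n t - vb t) \<le> ennreal e) sequentially"
  proof eventually_elim
    case (elim n)
    note Dn = H1div_D[OF H1per_D(1)[OF H[of n]]] and Dv = H1div_D[OF H1per_D(1)[OF Hv]]
    have [measurable]: "ub n \<in> borel_measurable borel" "vb \<in> borel_measurable borel"
      using ub[of n] vb by (auto simp: slice_avg_def intro!: borel_measurable_continuous_onI)
    have small: "(\<integral>\<^sup>+s\<in>{t..t + \<epsilon>}. nsq (ub n s - vb s) \<partial>lborel) \<le> ennreal (\<epsilon> * e / 16)"
    proof -
      have "(\<integral>\<^sup>+s\<in>{t..t + \<epsilon>}. nsq (ub n s - vb s) \<partial>lborel) \<le> (\<integral>\<^sup>+s\<in>{-real k..real k}. nsq (ub n s - vb s) \<partial>lborel)"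
        using k \<epsilon> by (intro nn_integral_mono) (auto simp: indicator_def)
      also have "\<dots> \<le> (\<integral>\<^sup>+x\<in>slab {-real k..real k}. nsq (u n x - v x) \<partial>lborel)"
        by (rule slice_avg_L2_le[OF Dn(3) ub Dv(3) vb])
      finally show ?thesis using elim by simp
    qed
    let ?c = "ennreal \<epsilon> * ennreal \<bar>M\<bar>"
    have "nsq (ub n t - vb t) * ennreal \<epsilon> = (\<integral>\<^sup>+s\<in>{t..t + \<epsilon>}. nsq (ub n t - vb t) \<partial>lborel)"
      using \<epsilon> by (simp add: nn_integral_cmult_indicator)
    also have "\<dots> \<le> (\<integral>\<^sup>+s. 8 * (2 * ?c * indicator {t..t + \<epsilon>} s + nsq (ub n s - vb s) * indicator {t..t + \<epsilon>} s) \<partial>lborel)"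
    proof (intro nn_integral_mono)
      fix s
      show "nsq (ub n t - vb t) * indicator {t..t + \<epsilon>} s \<le> 8 * (2 * ?c * indicator {t..t + \<epsilon>} s + nsq (ub n s - vb s) * indicator {t..t + \<epsilon>} s)"
      proof (cases "s \<in> {t..t + \<epsilon>}")
        case True
        have "nsq (ub n t - vb t) \<le> 8 * (nsq (ub n t - ub n s) + nsq (vb t - vb s) + nsq (ub n s - vb s) + nsq (vb s - vb s))"
          by (rule nsq_four_terms)
        also have "\<dots> \<le> 8 * (?c + ?c + nsq (ub n s - vb s) + nsq (vb s - vb s))"
          using near[OF H ub M True] near[OF Hv vb Mv True]
          by (intro mult_left_mono add_mono) (auto simp: nsq_minus)
        finally show ?thesis using True by (simp add: mult_2)
      qed simp
    qed
    also have "\<dots> = 8 * (2 * ?c * ennreal \<epsilon> + (\<integral>\<^sup>+s\<in>{t..t + \<epsilon>}. nsq (ub n s - vb s) \<partial>lborel))"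
      using \<epsilon> by (simp add: nn_integral_cmult nn_integral_add nn_integral_cmult_indicator)
    also have "\<dots> \<le> 8 * (2 * ?c * ennreal \<epsilon> + ennreal (\<epsilon> * e / 16))"
      by (intro mult_left_mono add_left_mono small) simp
    also have "\<dots> = ennreal (8 * (2 * (\<epsilon> * \<bar>M\<bar>) * \<epsilon> + \<epsilon> * e / 16))"
    proof -
      have 1: "2 * ?c * ennreal \<epsilon> = ennreal (2 * (\<epsilon> * \<bar>M\<bar>) * \<epsilon>)"
        using \<epsilon> by (simp add: ennreal_mult)
      have 2: "ennreal (2 * (\<epsilon> * \<bar>M\<bar>) * \<epsilon>) + ennreal (\<epsilon> * e / 16) = ennreal (2 * (\<epsilon> * \<bar>M\<bar>) * \<epsilon> + \<epsilon> * e / 16)"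
        using \<epsilon> e by (intro ennreal_plus[symmetric]) auto
      show ?thesis unfolding 1 2 using \<epsilon> e by (subst ennreal_mult) auto
    qed
    also have "\<dots> \<le> ennreal (e * \<epsilon>)"
    proof (intro ennreal_leI)
      have "16 * (\<epsilon> * \<bar>M\<bar>) \<le> 16 * (\<epsilon> * (\<bar>M\<bar> + 1))" using \<epsilon> by (intro mult_left_mono) auto
      also have "\<dots> = e / 2"
      proof -
        have "16 * (e / (32 * z) * z) = e / 2" if "z > 0" for z :: real using that by simp
        from this[of "\<bar>M\<bar> + 1"] show ?thesis unfolding \<epsilon>_def by linarith
      qed
      finally have "16 * (\<epsilon> * \<bar>M\<bar>) * \<epsilon> \<le> e / 2 * \<epsilon>" using \<epsilon> by (intro mult_right_mono) auto
      then show "8 * (2 * (\<epsilon> * \<bar>M\<bar>) * \<epsilon> + \<epsilon> * e / 16) \<le> e * \<epsilon>" by (simp add: algebra_simps)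
    qed
    also have "\<dots> = ennreal e * ennreal \<epsilon>" using e \<epsilon> by (simp add: ennreal_mult)
    finally have "ennreal \<epsilon> * nsq (ub n t - vb t) \<le> ennreal \<epsilon> * ennreal e" by (simp only: mult.commute)
    then show ?case using \<epsilon> by (subst (asm) ennreal_mult_le_mult_iff) auto
  qed
qed

text \<open>The divergence is a bounded linear function of the gradient, so it vanishes for the
  limit on the cylinder cell; periodicity of the limit gradient extends this to the whole
  space.\<close>

lemma divergence_limit_zero:
  fixes F :: "nat \<Rightarrow> real \<times> (real^'m) \<Rightarrow> real \<times> (real^'m) \<Rightarrow> real \<times> (real^'m)"
  assumes F: "\<And>n b. b \<in> Basis \<Longrightarrow> (\<lambda>x. F n x b) \<in> borel_measurable borel"
    and G: "\<And>b. b \<in> Basis \<Longrightarrow> (\<lambda>x. G x b) \<in> borel_measurable borel" and per: "\<And>b. periodic_cyl (\<lambda>x. G x b)"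
    and lim: "\<And>b. b \<in> Basis \<Longrightarrow> (\<lambda>n. \<integral>\<^sup>+x\<in>slab UNIV. nsq (F n x b - G x b) \<partial>lborel) \<longlonglongrightarrow> 0"
    and div: "\<And>n. AE x in lborel. divergence (F n) x = 0"
  shows "AE x in lborel. divergence G x = 0"
proof (rule AE_periodic_extend)
  have [measurable]: "divergence G \<in> borel_measurable borel"
    unfolding divergence_def[abs_def] using G by (intro borel_measurable_sum borel_measurable_inner) auto
  show "Measurable.pred borel (\<lambda>x. divergence G x = 0)" by measurable
  show "periodic_cyl (\<lambda>x. divergence G x = 0)"
    unfolding periodic_cyl_iff divergence_def using per[unfolded periodic_cyl_iff, rule_format] by simp
  have sq_meas: "(\<lambda>x. nsq (F n x b - G x b) * indicator (slab UNIV) x) \<in> borel_measurable borel" if "b \<in> Basis" for n b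
  proof -
    note [measurable] = F[OF that] G[OF that]
    show ?thesis by measurable
  qed
  let ?d = "card (Basis :: (real \<times> (real^'m)) set)"
  let ?e = "\<lambda>n. \<Sum>b\<in>Basis. \<integral>\<^sup>+x\<in>slab UNIV. nsq (F n x b - G x b) \<partial>lborel"
  have le: "(\<integral>\<^sup>+x\<in>slab UNIV. nsq (divergence G x) \<partial>lborel) \<le> of_nat ?d * ?e n" for n
  proof -
    have "(\<integral>\<^sup>+x\<in>slab UNIV. nsq (divergence G x) \<partial>lborel) \<le> (\<integral>\<^sup>+x. of_nat ?d * (\<Sum>b\<in>Basis. nsq (F n x b - G x b) * indicator (slab UNIV) x) \<partial>lborel)"
    proof (rule nn_integral_mono_AE)
      show "AE x in lborel. nsq (divergence G x) * indicator (slab UNIV) x \<le> of_nat ?d * (\<Sum>b\<in>Basis. nsq (F n x b - G x b) * indicator (slab UNIV) x)"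
        using div[of n]
      proof eventually_elim
        case (elim x)
        have "- divergence G x = (\<Sum>b\<in>Basis. (F n x b - G x b) \<bullet> b)"
          using elim by (simp add: divergence_def inner_diff_left sum_subtractf)
        then have "(norm (divergence G x))\<^sup>2 = (\<Sum>b\<in>Basis. (F n x b - G x b) \<bullet> b)\<^sup>2"
          by (metis norm_minus_cancel power2_abs real_norm_def)
        also have "\<dots> \<le> (\<Sum>b\<in>Basis. ((F n x b - G x b) \<bullet> b)\<^sup>2) * real ?d"
          by (rule sum_squared_le_sum_of_squares)
        also have "\<dots> \<le> (\<Sum>b\<in>Basis. (norm (F n x b - G x b))\<^sup>2) * real ?d"
          by (intro mult_right_mono sum_mono) (auto simp: Basis_le_norm abs_le_square_iff[symmetric])
        finally have "nsq (divergence G x) \<le> ennreal (real ?d * (\<Sum>b\<in>Basis. (norm (F n x b - G x b))\<^sup>2))"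
          unfolding nsq_def by (intro ennreal_leI) (simp add: mult.commute)
        also have "\<dots> = of_nat ?d * (\<Sum>b\<in>Basis. nsq (F n x b - G x b))"
          unfolding nsq_def ennreal_of_nat_eq_real_of_nat
          by (subst sum_ennreal) (auto simp: ennreal_mult sum_nonneg)
        finally have *: "nsq (divergence G x) \<le> of_nat ?d * (\<Sum>b\<in>Basis. nsq (F n x b - G x b))" .
        show ?case
        proof (cases "x \<in> slab UNIV")
          case True
          then show ?thesis using * by (simp only: indicator_simps mult_1_right)
        next
          case False
          then show ?thesis by (simp only: indicator_simps mult_zero_right zero_le not_False_eq_True)
        qed
      qed
    qed
    also have "\<dots> = of_nat ?d * (\<integral>\<^sup>+x. (\<Sum>b\<in>Basis. nsq (F n x b - G x b) * indicator (slab UNIV) x) \<partial>lborel)"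
    proof (rule nn_integral_cmult)
      show "(\<lambda>x. \<Sum>b\<in>Basis. nsq (F n x b - G x b) * indicator (slab UNIV) x) \<in> borel_measurable lborel"
        unfolding measurable_lborel2 by (intro borel_measurable_sum sq_meas)
    qed
    also have "(\<integral>\<^sup>+x. (\<Sum>b\<in>Basis. nsq (F n x b - G x b) * indicator (slab UNIV) x) \<partial>lborel) = ?e n"
      by (rule nn_integral_sum) (simp add: sq_meas)
    finally show ?thesis .
  qed
  have "(\<lambda>n. ?e n) \<longlonglongrightarrow> (\<Sum>b\<in>(Basis :: (real \<times> (real^'m)) set). 0)"
    by (intro tendsto_sum lim)
  then have "(\<lambda>n. of_nat ?d * ?e n) \<longlonglongrightarrow> of_nat ?d * 0"
    by (intro ennreal_tendsto_cmult) (auto simp: ennreal_of_nat_eq_real_of_nat)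
  then have "(\<integral>\<^sup>+x\<in>slab UNIV. nsq (divergence G x) \<partial>lborel) \<le> of_nat ?d * 0"
    using le by (intro LIMSEQ_le_const) auto
  then have "(\<integral>\<^sup>+x\<in>slab UNIV. nsq (divergence G x) \<partial>lborel) = 0" by simp
  then have "AE x in lborel. nsq (divergence G x) * indicator (slab UNIV) x = 0"
    by (subst (asm) nn_integral_0_iff_AE) auto
  then show "AE x in lborel. x \<in> slab UNIV \<longrightarrow> divergence G x = 0"
    by eventually_elim (auto simp: nsq_eq_0_iff indicator_def split: if_splits)
qed

text \<open>The fields converge strongly along a subsequence. Midpoints taken from its tails
  converge to the same limit and have strongly convergent gradients, which identifies the gradient
  of the limit. Any eventual energy bound is inherited by late midpoints; this is lower
  semicontinuity.\<close>

theorem H1per_compactness: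
  fixes u :: "nat \<Rightarrow> real \<times> (real^'m) \<Rightarrow> real \<times> (real^'m)"
  assumes H: "\<And>n. H1per (u n) (Du n)" and ub: "\<And>n. slice_avg (u n) (ub n)" and C0: "\<And>n. norm (ub n 0) \<le> C0"
    and M: "\<And>n. Dirichlet (Du n) UNIV \<le> ennreal M"
  obtains r v Dv vb where "strict_mono (r::nat\<Rightarrow>nat)" "H1per v Dv" "slice_avg v vb"
    "AE x in lborel. x \<in> slab UNIV \<longrightarrow> (\<lambda>i. u (r i) x) \<longlonglongrightarrow> v x"
    "\<And>t. (\<lambda>i. ub (r i) t) \<longlonglongrightarrow> vb t"
    "\<And>c. eventually (\<lambda>i. Dirichlet (Du (r i)) UNIV \<le> c) sequentially \<Longrightarrow> Dirichlet Dv UNIV \<le> c"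
proof -
  define S :: "nat \<Rightarrow> (real \<times> (real^'m)) set" where "S k = slab {-real k..real k}" for k
  have S_meas [measurable]: "S k \<in> sets borel" for k by (simp add: S_def)
  have S_mono: "S k \<subseteq> S l" if "k \<le> l" for k l using that by (auto simp: S_def mem_slab)
  have S_Un: "(\<Union>k. S k) = slab UNIV"
  proof
    show "slab UNIV \<subseteq> (\<Union>k. S k)"
    proof
      fix x :: "real \<times> (real^'m)" assume x: "x \<in> slab UNIV"
      obtain k where "\<bar>fst x\<bar> \<le> real k" using real_arch_simple by blast
      then have "x \<in> S k" using x by (auto simp: S_def mem_slab)
      then show "x \<in> (\<Union>k. S k)" by blast
    qed
  qed (auto simp: S_def mem_slab)
  have um [measurable]: "u n \<in> borel_measurable borel" for n using H1div_D(4)[OF H1per_D(1)[OF H]] .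
  have "\<exists>B. \<forall>n. (\<integral>\<^sup>+x\<in>slab {-real k..real k}. nsq (u n x) \<partial>lborel) \<le> ennreal B" for k
  proof -
    let ?B = "2 * ((2 * slice_const TYPE('m) + 2 * ennreal ((real k + real k)\<^sup>2)) * ennreal M) + 2 * (ennreal (C0\<^sup>2) * ennreal (2 * real k))"
    have "?B < \<infinity>"
      using slice_const_finite[where 'm = 'm] by (simp add: ennreal_mult_less_top)
    then obtain B where B: "?B = ennreal B" by (cases ?B) auto
    have "(\<integral>\<^sup>+x\<in>slab {-real k..real k}. nsq (u n x) \<partial>lborel) \<le> ennreal B" for n
      unfolding B[symmetric] by (rule slab_L2_bound[OF H ub C0 M])
    then show ?thesis by blast
  qed
  from Rellich_slab[OF H M this] obtain r1 :: "nat \<Rightarrow> nat" where r1: "strict_mono r1"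
    "\<And>k e. e > 0 \<Longrightarrow> \<exists>N. \<forall>i\<ge>N. \<forall>j\<ge>N. (\<integral>\<^sup>+x\<in>S k. nsq (u (r1 i) x - u (r1 j) x) \<partial>lborel) \<le> ennreal e"
    unfolding S_def by blast
  obtain r2 :: "nat \<Rightarrow> nat" where r2: "strict_mono r2"
    "AE x in lborel. x \<in> (\<Union>k. S k) \<longrightarrow> convergent (\<lambda>i. u (r1 (r2 i)) x)"
    "\<And>k. (\<lambda>n. \<integral>\<^sup>+x\<in>S k. nsq (u (r1 n) x - lim (\<lambda>i. u (r1 (r2 i)) x)) \<partial>lborel) \<longlonglongrightarrow> 0"
    using L2_complete[of "\<lambda>n. u (r1 n)" lborel S, OF _ _ S_mono r1(2)] by auto
  define r where "r = r1 \<circ> r2"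
  \<comment> \<open>\<open>lim\<close> is taken at every point; where the sequence diverges its
    value still depends only on the sequence, so \<open>v\<close> is periodic everywhere.\<close>
  define v where "v x = lim (\<lambda>i. u (r i) x)" for x
  have r: "strict_mono r" unfolding r_def by (rule strict_mono_o[OF r1(1) r2(1)])
  have conv: "AE x in lborel. x \<in> slab UNIV \<longrightarrow> (\<lambda>i. u (r i) x) \<longlonglongrightarrow> v x"
    using r2(2) unfolding S_Un by eventually_elim (auto simp: v_def r_def convergent_LIMSEQ_iff)
  have L2v: "(\<lambda>i. \<integral>\<^sup>+x\<in>S k. nsq (u (r i) x - v x) \<partial>lborel) \<longlonglongrightarrow> 0" for k
    using LIMSEQ_subseq_LIMSEQ[OF r2(3)[of k] r2(1)] by (simp add: o_def r_def v_def)
  have [measurable]: "v \<in> borel_measurable borel"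
    unfolding v_def[abs_def] by (rule borel_measurable_lim_metric) simp
  have vper: "periodic_cyl v"
    unfolding periodic_cyl_iff v_def
    using H1div_D(1)[OF H1per_D(1)[OF H], unfolded periodic_cyl_iff, rule_format] by simp
  \<comment> \<open>A tail of pairs of fields and gradients: convex estimates valid from index
    \<open>n\<close> on are inherited by all midpoints in \<open>E n\<close>.\<close>
  define Z where "Z n = {(u (r i), Du (r i)) | i. n \<le> i}" for n
  define E where "E n = mids (Z n)" for n
  have ZH: "H1per f F" if "(f, F) \<in> Z n" for f F n using that H by (auto simp: Z_def)
  obtain y where y: "\<And>n. y n \<in> E n"
    "\<And>e. e > 0 \<Longrightarrow> \<exists>N. \<forall>i\<ge>N. \<forall>j\<ge>N. Dirichlet (\<lambda>x b. snd (y i) x b - snd (y j) x b) UNIV \<le> ennreal e"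
  proof (rule Dirichlet_Cauchy_selection[of E M])
    show "E n \<noteq> {}" for n
      using mids.base[of "(u (r n), Du (r n))" "Z n"] by (auto simp: E_def Z_def)
    show "E n \<subseteq> E m" if "m \<le> n" for m n
    proof -
      have "Z n \<subseteq> Z m" unfolding Z_def using that by (blast intro: order_trans)
      then show ?thesis unfolding E_def using mids_mono by blast
    qed
    show "(avg2 f g, avg2D F G) \<in> E n" if "(f, F) \<in> E n" "(g, G) \<in> E n" for n f F g G
      using that unfolding E_def by (rule mids.mid)
    show "H1per (fst p) (snd p)" if "p \<in> E n" for n p
      using mids_H1per[OF that[unfolded E_def] ZH] .
    show "Dirichlet (snd p) UNIV \<le> ennreal M" if "p \<in> E n" for n p
      by (rule mids_Dirichlet[OF that[unfolded E_def] ZH]) (use M in \<open>auto simp: Z_def\<close>)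
  qed blast
  define f F where "f n = fst (y n)" and "F n = snd (y n)" for n
  have Hf: "H1per (f n) (F n)" for n
    unfolding f_def F_def by (rule mids_H1per[OF y(1)[unfolded E_def] ZH])
  note D = H1div_D[OF H1per_D(1)[OF Hf]]
  have [measurable]: "f n \<in> borel_measurable borel" for n by (rule D(4))
  have Fm: "(\<lambda>x. F n x b) \<in> borel_measurable borel" if "b \<in> Basis" for n b by (rule D(7)[OF that])
  have fL2: "(\<lambda>n. \<integral>\<^sup>+x\<in>S k. nsq (f n x - v x) \<partial>lborel) \<longlonglongrightarrow> 0" for k
  proof (rule tendsto_0_if_eventually_le)
    fix e :: real assume e: "e > 0"
    have "eventually (\<lambda>i. (\<integral>\<^sup>+x\<in>S k. nsq (u (r i) x - v x) \<partial>lborel) < ennreal e) sequentially"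
      using L2v[of k] e by (intro order_tendstoD) auto
    then obtain N where N: "\<And>i. i \<ge> N \<Longrightarrow> (\<integral>\<^sup>+x\<in>S k. nsq (u (r i) x - v x) \<partial>lborel) \<le> ennreal e"
      unfolding eventually_sequentially by (blast intro: less_imp_le)
    have "(\<integral>\<^sup>+x\<in>S k. nsq (f n x - v x) \<partial>lborel) \<le> ennreal e" if "n \<ge> N" for n
      unfolding f_def
    proof (rule mids_L2[OF y(1)[unfolded E_def] ZH])
      show "(\<integral>\<^sup>+x\<in>S k. nsq (f' x - v x) \<partial>lborel) \<le> ennreal e" if "(f', F') \<in> Z n" for f' F'
        using that N \<open>n \<ge> N\<close> by (auto simp: Z_def)
    qed auto
    then show "eventually (\<lambda>n. (\<integral>\<^sup>+x\<in>S k. nsq (f n x - v x) \<partial>lborel) \<le> ennreal e) sequentially"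
      by (auto simp: eventually_sequentially)
  qed
  \<comment> \<open>The subsequence may differ from one direction to another. It only defines the
    limit; the full sequence \<open>F n\<close> converges to it in L^2.\<close>
  have ex_rho: "\<exists>\<rho>. (\<lambda>n. \<integral>\<^sup>+x\<in>slab UNIV. nsq (F n x b - lim (\<lambda>i. F (\<rho> i) x b)) \<partial>lborel) \<longlonglongrightarrow> 0"
    if b: "b \<in> Basis" for b
  proof -
    have cauchy: "\<exists>N. \<forall>i\<ge>N. \<forall>j\<ge>N. (\<integral>\<^sup>+x\<in>slab UNIV. nsq (F i x b - F j x b) \<partial>lborel) \<le> ennreal e" if "e > 0" for e
    proof -
      have "(\<integral>\<^sup>+x\<in>slab UNIV. nsq (F i x b - F j x b) \<partial>lborel) \<le> Dirichlet (\<lambda>x b. F i x b - F j x b) UNIV" for i j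
        unfolding Dirichlet_def using nsq_le_grad_sq[OF b, of "\<lambda>x b. F i x b - F j x b"]
        by (intro nn_integral_mono mult_right_mono) auto
      then show ?thesis using y(2)[OF that] unfolding F_def by (meson order_trans)
    qed
    show ?thesis
    proof (rule L2_complete[of "\<lambda>n x. F n x b" lborel "\<lambda>_. slab UNIV"])
      show "\<exists>N. \<forall>i\<ge>N. \<forall>j\<ge>N. (\<integral>\<^sup>+x\<in>slab UNIV. nsq (F i x b - F j x b) \<partial>lborel) \<le> ennreal e" if "e > 0" for e
        by (rule cauchy[OF that])
    qed (use Fm[OF b] in auto)
  qed
  from bchoice[OF ballI[OF ex_rho]] obtain \<rho> where
    \<rho>: "\<forall>b\<in>Basis. (\<lambda>n. \<integral>\<^sup>+x\<in>slab UNIV. nsq (F n x b - lim (\<lambda>i. F (\<rho> b i) x b)) \<partial>lborel) \<longlonglongrightarrow> 0" ..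
  define Dv where "Dv x b = lim (\<lambda>i. F (\<rho> b i) x b)" for x b
  have GL2: "(\<lambda>n. \<integral>\<^sup>+x\<in>slab UNIV. nsq (F n x b - Dv x b) \<partial>lborel) \<longlonglongrightarrow> 0" if "b \<in> Basis" for b
    unfolding Dv_def by (rule bspec[OF \<rho> that])
  have Dvm: "(\<lambda>x. Dv x b) \<in> borel_measurable borel" if "b \<in> Basis" for b
    unfolding Dv_def using Fm[OF that] by (intro borel_measurable_lim_metric)
  have Dvper: "periodic_cyl (\<lambda>x. Dv x b)" for b
    unfolding periodic_cyl_iff Dv_def using H1per_D(2)[OF Hf, unfolded periodic_cyl_iff, rule_format] by simp
  have cf: "(\<lambda>n. \<integral>\<^sup>+x\<in>K. nsq (f n x - v x) \<partial>lborel) \<longlonglongrightarrow> 0" if "compact K" for K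
  proof (rule compact_L2_tendsto[OF _ _ _ that])
    show "periodic_cyl (\<lambda>x. nsq (f n x - v x))" for n
      by (rule periodic_cyl_compose2[OF D(1) vper])
    show "(\<lambda>n. \<integral>\<^sup>+x\<in>slab {-real k..real k}. nsq (f n x - v x) \<partial>lborel) \<longlonglongrightarrow> 0" for k
      using fL2[of k] by (simp add: S_def)
  qed measurable
  have cF: "(\<lambda>n. \<integral>\<^sup>+x\<in>K. nsq (F n x b - Dv x b) \<partial>lborel) \<longlonglongrightarrow> 0" if b: "b \<in> Basis" and "compact K" for b K
  proof (rule compact_L2_tendsto[OF _ _ _ that(2)])
    note [measurable] = Fm[OF b] Dvm[OF b]
    show "(\<lambda>x. nsq (F n x b - Dv x b)) \<in> borel_measurable borel" for n by measurable
    show "periodic_cyl (\<lambda>x. nsq (F n x b - Dv x b))" for n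
      by (rule periodic_cyl_compose2[OF H1per_D(2)[OF Hf] Dvper])
    show "(\<lambda>n. \<integral>\<^sup>+x\<in>slab {-real k..real k}. nsq (F n x b - Dv x b) \<partial>lborel) \<longlonglongrightarrow> 0" for k
    proof (rule tendsto_sandwich[OF always_eventually always_eventually tendsto_const GL2[OF b]])
      show "\<forall>n. (\<integral>\<^sup>+x\<in>slab {-real k..real k}. nsq (F n x b - Dv x b) \<partial>lborel) \<le> (\<integral>\<^sup>+x\<in>slab UNIV. nsq (F n x b - Dv x b) \<partial>lborel)"
        by (intro allI nn_integral_mono) (auto simp: indicator_def mem_slab)
    qed simp
  qed
  have L2_v: "L2loc v" by (rule L2loc_limit[OF D(2) _ cf]) simp
  have L2_Dv: "L2loc (\<lambda>x. Dv x b)" if b: "b \<in> Basis" for b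
    by (rule L2loc_limit[OF D(5)[OF b] Dvm[OF b] cF[OF b]])
  have wp: "weak_partial v b (\<lambda>x. Dv x b)" if b: "b \<in> Basis" for b
    by (rule weak_partial_limit[OF D(3) D(6)[OF b] D(8)[OF b] L2loc_locint[OF L2_v] L2loc_locint[OF L2_Dv[OF b]] cf cF[OF b]])
  have dir: "Dirichlet Dv UNIV \<le> c" if c: "eventually (\<lambda>i. Dirichlet (Du (r i)) UNIV \<le> c) sequentially" for c
  proof (rule Dirichlet_limit_le[OF Fm Dvm GL2])
    obtain N where N: "\<And>i. i \<ge> N \<Longrightarrow> Dirichlet (Du (r i)) UNIV \<le> c" using c by (auto simp: eventually_sequentially)
    have "Dirichlet (F n) UNIV \<le> c" if "n \<ge> N" for n
      unfolding F_def by (rule mids_Dirichlet[OF y(1)[unfolded E_def] ZH]) (use N that in \<open>auto simp: Z_def\<close>)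
    then show "eventually (\<lambda>n. Dirichlet (F n) UNIV \<le> c) sequentially" by (auto simp: eventually_sequentially)
  qed
  have DvM: "Dirichlet Dv UNIV \<le> ennreal M" by (rule dir) (simp add: M)
  have gr: "set_integrable lborel cell (grad_sq Dv)"
    by (rule set_integrable_grad_sq[OF measurable_grad_sq[OF Dvm]]) (use DvM in \<open>auto intro: le_less_trans\<close>)
  have div: "AE x in lborel. divergence Dv x = 0"
    by (rule divergence_limit_zero[OF Fm Dvm Dvper GL2 D(10)])
  have Hv: "H1per v Dv"
    unfolding H1per_def H1div_def using vper L2_v L2_Dv wp gr div Dvper by blast
  obtain vb where vb: "slice_avg v vb" using slice_avg_exists[OF Hv] .
  have "(\<lambda>i. ub (r i) t) \<longlonglongrightarrow> vb t" for t
    by (rule slice_avg_tendsto[OF H ub M Hv vb DvM L2v[unfolded S_def]])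
  from that[OF r Hv vb conv this dir] show thesis .
qed

section \<open>A competitor of finite energy\<close>

lemma continuous_set_integrable:
  fixes f :: "'a::euclidean_space \<Rightarrow> 'b::{banach, second_countable_topology}"
  shows "continuous_on UNIV f \<Longrightarrow> compact K \<Longrightarrow> set_integrable lborel K f"
  unfolding set_integrable_def by (rule borel_integrable_compact) (auto intro: continuous_on_subset)

lemma continuous_L2loc:
  fixes f :: "'a::euclidean_space \<Rightarrow> 'b::euclidean_space"
  assumes "continuous_on UNIV f"
  shows "L2loc f"
  unfolding L2loc_def
  using assms by (auto intro!: borel_measurable_continuous_onI continuous_set_integrable continuous_intros)

text \<open>The integral of a translate of the derivative does not depend on the translation.
  Averaging over translations along \<open>v\<close> replaces the derivative by
  \<open>\<phi> x - \<phi> (x - v)\<close>, whose integral is zero.\<close>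

lemma test_fun_integral_deriv_zero:
  fixes \<phi> :: "'a::euclidean_space \<Rightarrow> real"
  assumes \<phi>: "test_fun \<phi>"
  shows "(\<integral>x. frechet_derivative \<phi> (at x) v \<partial>lborel) = 0"
proof -
  obtain K B where K: "compact K" "B > 0" "\<And>x. x \<notin> K \<Longrightarrow> \<phi> x = 0"
    "\<And>x. x \<notin> K \<Longrightarrow> frechet_derivative \<phi> (at x) v = 0"
    "\<And>x. \<bar>\<phi> x\<bar> \<le> B" "\<And>x. \<bar>frechet_derivative \<phi> (at x) v\<bar> \<le> B"
    using test_fun_bounded[OF \<phi>] by metis
  let ?D = "\<lambda>x. frechet_derivative \<phi> (at x) v"
  let ?L = "sweep K 1 v"
  have [measurable]: "?D \<in> borel_measurable borel" "\<phi> \<in> borel_measurable borel"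
    using \<phi> by (auto intro: test_fun_measurable test_fun_deriv_measurable)
  have L: "compact ?L" by (rule compact_sweep[OF K(1)])
  then have [measurable]: "?L \<in> sets borel" by (simp add: borel_compact)
  have loc: "locint f" if "continuous_on UNIV f" for f :: "'a \<Rightarrow> real"
    by (rule L2loc_locint[OF continuous_L2loc[OF that]])
  have int: "integrable (lborel \<Otimes>\<^sub>M lborel) (\<lambda>(x, s). indicator ?L x *\<^sub>R indicator {0..1} s *\<^sub>R ?D (x + s *\<^sub>R (- v)))"
    by (rule integrable_segment[OF loc[OF test_fun_deriv_continuous[OF \<phi>]] L, where B = 1]) (auto simp: indicator_def)
  \<comment> \<open>For \<open>s\<close> in \<open>{0..1}\<close> the translated derivative already
    vanishes off the swept set, so the indicator, inserted to have integrability on the product,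
    changes nothing.\<close>
  have supp: "indicator ?L x *\<^sub>R indicator {0..1} s *\<^sub>R ?D (x + s *\<^sub>R (- v)) = indicator {0..1} s *\<^sub>R ?D (x - s *\<^sub>R v)" for x s
  proof (cases "x \<in> ?L \<or> s \<notin> {0..1}")
    case False
    then have "x - s *\<^sub>R v \<notin> K" using mem_sweep[of "x - s *\<^sub>R v" K s 1 v] by auto
    then show ?thesis using K(4) False by simp
  qed auto
  have intphi: "integrable lborel \<phi>"
    using test_fun_integrable(1)[OF \<phi> loc[OF continuous_on_const[of _ 1]]] by simp
  have "(\<integral>s. \<integral>x. indicator {0..1} s *\<^sub>R ?D (x - s *\<^sub>R v) \<partial>lborel \<partial>lborel) = (\<integral>x. \<integral>s. indicator {0..1} s *\<^sub>R ?D (x - s *\<^sub>R v) \<partial>lborel \<partial>lborel)"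
    using lborel_pair.Fubini_integral[OF int] unfolding supp by simp
  also have "\<dots> = (\<integral>x. \<phi> x - \<phi> (x - 1 *\<^sub>R v) \<partial>lborel)"
    using test_fun_segment_integral[OF \<phi>, of 1] by (simp add: set_lebesgue_integral_def)
  also have "\<dots> = 0"
    using intphi integrable_lborel_shift[OF intphi, of "- v"] integral_lborel_shift[of \<phi> "- v"] by simp
  finally have "0 = (\<integral>s. \<integral>x. indicator {0..1} s *\<^sub>R ?D (x - s *\<^sub>R v) \<partial>lborel \<partial>lborel)" by simp
  also have "\<dots> = (\<integral>s. indicator {0..1::real} s *\<^sub>R (\<integral>x. ?D x \<partial>lborel) \<partial>lborel)"
  proof (intro Bochner_Integration.integral_cong refl)
    fix s :: real
    have "(\<integral>x. ?D (x - s *\<^sub>R v) \<partial>lborel) = (\<integral>x. ?D x \<partial>lborel)"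
      using integral_lborel_shift[of ?D "- s *\<^sub>R v"] by simp
    then show "(\<integral>x. indicator {0..1} s *\<^sub>R ?D (x - s *\<^sub>R v) \<partial>lborel) = indicator {0..1} s *\<^sub>R (\<integral>x. ?D x \<partial>lborel)"
      by simp
  qed
  also have "\<dots> = (\<integral>x. ?D x \<partial>lborel)"
    by (subst integral_scaleR_left) auto
  finally show ?thesis by simp
qed

text \<open>Integration by parts: \<open>\<phi>\<close> times the C^1 function \<open>w\<close> is
  again a test function, so the integral of its derivative vanishes. The constant \<open>p\<close>
  drops out for the same reason.\<close>

lemma weak_partial_C1:
  fixes w :: "'a::euclidean_space \<Rightarrow> real" and p d :: "'b::euclidean_space"
  assumes der: "\<And>x. (w has_derivative w' x) (at x)" and cont: "\<And>v. continuous_on UNIV (\<lambda>x. w' x v)"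
  shows "weak_partial (\<lambda>x. p + w x *\<^sub>R d) b (\<lambda>x. w' x b *\<^sub>R d)"
proof (rule weak_partialI)
  have wc: "continuous_on UNIV w"
    using der has_derivative_continuous by (blast intro: continuous_at_imp_continuous_on)
  show "locint (\<lambda>x. p + w x *\<^sub>R d)" "locint (\<lambda>x. w' x b *\<^sub>R d)"
    using wc cont by (auto intro!: L2loc_locint continuous_L2loc continuous_intros)
  fix \<phi> :: "'a \<Rightarrow> real" assume \<phi>: "test_fun \<phi>"
  let ?D = "\<lambda>x v. frechet_derivative \<phi> (at x) v"
  have lw: "locint w" "locint (\<lambda>x. w' x b)" "locint (\<lambda>x. 1 :: real)"
    using wc cont by (auto intro!: L2loc_locint continuous_L2loc)
  have prod: "((\<lambda>x. \<phi> x * w x) has_derivative (\<lambda>h. \<phi> x * w' x h + ?D x h * w x)) (at x)" for x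
    by (rule has_derivative_mult[OF test_fun_has_derivative[OF \<phi>] der])
  obtain K where K: "compact K" "\<And>x. x \<notin> K \<Longrightarrow> \<phi> x = 0" using test_fun_support[OF \<phi>] by metis
  have tp: "test_fun (\<lambda>x. \<phi> x * w x)"
    by (rule test_funI[OF prod _ K(1)])
      (use K(2) cont wc test_fun_continuous[OF \<phi>] test_fun_deriv_continuous[OF \<phi>] in \<open>auto intro!: continuous_intros\<close>)
  have "frechet_derivative (\<lambda>x. \<phi> x * w x) (at x) b = \<phi> x * w' x b + ?D x b * w x" for x
    using frechet_derivative_at[OF prod[of x]] by metis
  then have "(\<integral>x. \<phi> x * w' x b + ?D x b * w x \<partial>lborel) = 0"
    using test_fun_integral_deriv_zero[OF tp, of b] by simp
  moreover have i: "integrable lborel (\<lambda>x. \<phi> x * w' x b)" "integrable lborel (\<lambda>x. ?D x b * w x)" "integrable lborel (\<lambda>x. ?D x b)"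
    using test_fun_integrable(1)[OF \<phi> lw(2)] test_fun_integrable(2)[OF \<phi> lw(1)] test_fun_integrable(2)[OF \<phi> lw(3)] by simp_all
  ultimately have eq: "(\<integral>x. ?D x b * w x \<partial>lborel) = - (\<integral>x. \<phi> x * w' x b \<partial>lborel)" by simp
  have "(\<integral>x. ?D x b *\<^sub>R (p + w x *\<^sub>R d) \<partial>lborel) = (\<integral>x. ?D x b *\<^sub>R p + (?D x b * w x) *\<^sub>R d \<partial>lborel)"
    by (simp add: scaleR_right_distrib)
  also have "\<dots> = (\<integral>x. ?D x b \<partial>lborel) *\<^sub>R p + (\<integral>x. ?D x b * w x \<partial>lborel) *\<^sub>R d"
    using i by (simp add: Bochner_Integration.integral_add)
  also have "\<dots> = - ((\<integral>x. \<phi> x * w' x b \<partial>lborel) *\<^sub>R d)"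
    unfolding eq test_fun_integral_deriv_zero[OF \<phi>] by simp
  also have "(\<integral>x. \<phi> x * w' x b \<partial>lborel) *\<^sub>R d = (\<integral>x. \<phi> x *\<^sub>R (w' x b *\<^sub>R d) \<partial>lborel)"
    using i by simp
  finally show "(\<integral>x. ?D x b *\<^sub>R (p + w x *\<^sub>R d) \<partial>lborel) = - (\<integral>x. \<phi> x *\<^sub>R (w' x b *\<^sub>R d) \<partial>lborel)" .
qed

text \<open>A C^1 transition from 0 to 1 on the unit interval; the two squared positive parts never
  vanish together, so the quotient is well defined.\<close>

definition ramp :: "real \<Rightarrow> real" where
  "ramp t = (max 0 t)\<^sup>2 / ((max 0 t)\<^sup>2 + (max 0 (1 - t))\<^sup>2)"

definition ramp' :: "real \<Rightarrow> real" where
  "ramp' t = (2 * max 0 t * ((max 0 t)\<^sup>2 + (max 0 (1 - t))\<^sup>2) - (max 0 t)\<^sup>2 * (2 * max 0 t - 2 * max 0 (1 - t)))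
     / ((max 0 t)\<^sup>2 + (max 0 (1 - t))\<^sup>2)\<^sup>2"

lemma ramp_denom_pos: "(max 0 t)\<^sup>2 + (max 0 (1 - t))\<^sup>2 > (0::real)"
proof (cases "t > 0")
  case True
  then show ?thesis by (intro add_pos_nonneg) auto
next
  case False
  then show ?thesis by (intro add_nonneg_pos) auto
qed

lemma ramp_deriv: "(ramp has_real_derivative ramp' t) (at t)"
proof -
  have 1: "((\<lambda>t. (max 0 (1 - t))\<^sup>2) has_real_derivative - (2 * max 0 (1 - t))) (at t)"
  proof -
    have "((\<lambda>t. 1 - t) has_real_derivative -1) (at t)" by (auto intro!: derivative_eq_intros)
    from DERIV_chain2[OF has_real_derivative_max_0_sq this] show ?thesis by simp
  qed
  have nz: "(max 0 t)\<^sup>2 + (max 0 (1 - t))\<^sup>2 \<noteq> 0" using ramp_denom_pos[of t] by linarith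
  have "((\<lambda>t. (max 0 t)\<^sup>2 / ((max 0 t)\<^sup>2 + (max 0 (1 - t))\<^sup>2)) has_real_derivative ramp' t) (at t)"
    unfolding ramp'_def power2_eq_square[of "_ + _"]
    by (rule DERIV_divide[OF has_real_derivative_max_0_sq DERIV_cong[OF DERIV_add[OF has_real_derivative_max_0_sq 1]] nz, THEN DERIV_cong]) auto
  then show ?thesis unfolding ramp_def[abs_def] .
qed

lemma ramp'_continuous: "continuous_on UNIV ramp'"
  unfolding ramp'_def[abs_def] using ramp_denom_pos by (intro continuous_intros) (metis less_irrefl power_not_zero)

lemma ramp_continuous: "continuous_on UNIV ramp"
  using ramp_deriv by (blast intro: continuous_at_imp_continuous_on DERIV_isCont)

lemma ramp_0: "t \<le> 0 \<Longrightarrow> ramp t = 0" and ramp_1: "t \<ge> 1 \<Longrightarrow> ramp t = 1"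
  and ramp'_0: "t \<le> 0 \<Longrightarrow> ramp' t = 0" and ramp'_1: "t \<ge> 1 \<Longrightarrow> ramp' t = 0"
  by (auto simp: ramp_def ramp'_def max_def power2_eq_square)

lemma xavg_of_fst: "xavg (\<lambda>x. g (fst x)) t = g t"
  for g :: "real \<Rightarrow> real \<times> (real^'m)"
proof -
  have "measure lborel (cbox 0 (One :: real^'m)) = 1" by (simp add: measure_lborel_cbox_eq)
  then show ?thesis by (simp add: xavg_def set_lebesgue_integral_def)
qed

text \<open>Interpolation in the axial variable alone is divergence-free here, since both wells have
  first component \<open>a\<close>. Outside \<open>{0..1}\<close> the field sits in a well at no
  cost. This makes the infimum finite.\<close>

lemma finite_energy_competitor:
  fixes W :: "real \<times> (real^'m) \<Rightarrow> real"
  assumes W_cont: "continuous_on UNIV W" and S_a: "{z. fst z = a \<and> W z = 0} = {um, up}"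
  obtains u Du where "admissible um up u Du" "energy W u Du < \<infinity>"
proof -
  have wells: "fst um = a" "W um = 0" "fst up = a" "W up = 0" using S_a by auto
  define d where "d = up - um"
  define g where "g t = um + ramp t *\<^sub>R d" for t
  define u where "u x = g (fst x)" for x :: "real \<times> (real^'m)"
  define Du where "Du x b = (ramp' (fst x) * fst b) *\<^sub>R d" for x b :: "real \<times> (real^'m)"
  have g_cont: "continuous_on UNIV g" unfolding g_def[abs_def] by (intro continuous_intros ramp_continuous)
  have "((\<lambda>x :: real \<times> (real^'m). ramp (fst x)) has_derivative (\<lambda>h. ramp' (fst x) * fst h)) (at x)" for x
    by (rule has_derivative_compose[OF has_derivative_fst[OF has_derivative_ident] ramp_deriv[unfolded has_field_derivative_def]])
  moreover have rc: "continuous_on UNIV (\<lambda>x :: real \<times> (real^'m). ramp' (fst x))"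
    by (rule continuous_on_compose2[OF ramp'_continuous]) (auto intro!: continuous_intros)
  ultimately have wp: "weak_partial u b (\<lambda>x. Du x b)" for b
    unfolding u_def[abs_def] g_def Du_def by (intro weak_partial_C1 continuous_intros) auto
  have "continuous_on UNIV u" unfolding u_def[abs_def]
    by (rule continuous_on_compose2[OF g_cont]) (auto intro!: continuous_intros)
  then have L2u: "L2loc u" by (rule continuous_L2loc)
  have Dc: "continuous_on UNIV (\<lambda>x. Du x b)" for b
    unfolding Du_def by (intro continuous_intros rc)
  then have L2: "L2loc (\<lambda>x. Du x b)" for b by (rule continuous_L2loc)
  have gsq: "grad_sq Du x = (ramp' (fst x))\<^sup>2 * (norm d)\<^sup>2" for x
  proof -
    have "grad_sq Du x = (norm (Du x (1, 0)))\<^sup>2 + (\<Sum>b\<in>range ebas. (norm (Du x b))\<^sup>2)"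
      unfolding grad_sq_def Basis_cyl by (subst sum.insert) (auto simp: ebas_def)
    also have "(\<Sum>b\<in>range ebas. (norm (Du x b))\<^sup>2) = 0"
      by (rule sum.neutral) (auto simp: Du_def)
    also have "(norm (Du x (1, 0)))\<^sup>2 = (ramp' (fst x))\<^sup>2 * (norm d)\<^sup>2" by (simp add: Du_def power_mult_distrib)
    finally show ?thesis by simp
  qed
  have [measurable]: "grad_sq Du \<in> borel_measurable borel"
    by (rule measurable_grad_sq) (rule L2loc_measurable[OF L2])
  have bdd: "\<exists>B. \<forall>t\<in>{0..1}. h t \<le> B" if "continuous_on {0..1} h" for h :: "real \<Rightarrow> real"
    using continuous_attains_sup[OF compact_Icc _ that] by fastforce
  have "continuous_on {0..1} (\<lambda>t. (ramp' t)\<^sup>2 * (norm d)\<^sup>2 + W (g t))"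
    by (intro continuous_intros continuous_on_subset[OF ramp'_continuous]
        continuous_on_compose2[OF W_cont continuous_on_subset[OF g_cont]]) auto
  from bdd[OF this] obtain B where B: "\<And>t. t \<in> {0..1} \<Longrightarrow> (ramp' t)\<^sup>2 * (norm d)\<^sup>2 + W (g t) \<le> B" by blast
  have fin: "(\<integral>\<^sup>+x\<in>slab UNIV. ennreal (h (fst x)) \<partial>(lborel :: (real \<times> (real^'m)) measure)) < \<infinity>"
    if "\<And>t. t \<in> {0..1} \<Longrightarrow> h t \<le> B'" "\<And>t. t \<notin> {0..1} \<Longrightarrow> h t = 0" for h B'
  proof -
    have "(\<integral>\<^sup>+x\<in>slab UNIV. ennreal (h (fst x)) \<partial>(lborel :: (real \<times> (real^'m)) measure)) \<le> (\<integral>\<^sup>+x. ennreal B' * indicator (slab {0..1}) x \<partial>(lborel :: (real \<times> (real^'m)) measure))"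
    proof (intro nn_integral_mono)
      fix x :: "real \<times> (real^'m)"
      show "ennreal (h (fst x)) * indicator (slab UNIV) x \<le> ennreal B' * indicator (slab {0..1}) x"
        using that[of "fst x"] by (cases "fst x \<in> {0..1}") (auto simp: indicator_def mem_slab ennreal_leI)
    qed
    also have "\<dots> < \<infinity>" by (simp add: nn_integral_cmult_indicator emeasure_slab)
    finally show ?thesis .
  qed
  have gW: "W (g t) = 0" if "t \<notin> {0..1}" for t
    using that ramp_0[of t] ramp_1[of t] wells by (cases "t \<le> 0") (auto simp: g_def d_def)
  have r0: "ramp' t = 0" if "t \<notin> {0..1}" for t
    using that ramp'_0[of t] ramp'_1[of t] by (cases "t \<le> 0") auto
  have "continuous_on {0..1} (\<lambda>t. (ramp' t)\<^sup>2 * (norm d)\<^sup>2)"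
    by (intro continuous_intros continuous_on_subset[OF ramp'_continuous]) auto
  from bdd[OF this] obtain B2 where B2: "\<And>t. t \<in> {0..1} \<Longrightarrow> (ramp' t)\<^sup>2 * (norm d)\<^sup>2 \<le> B2" by blast
  have "Dirichlet Du UNIV < \<infinity>"
    unfolding Dirichlet_def gsq by (rule fin[of "\<lambda>t. (ramp' t)\<^sup>2 * (norm d)\<^sup>2" B2]) (use B2 r0 in auto)
  then have gr: "set_integrable lborel cell (grad_sq Du)" by (intro set_integrable_grad_sq) auto
  have div: "divergence Du x = 0" for x
  proof -
    have "divergence Du x = Du x (1, 0) \<bullet> (1, 0) + (\<Sum>b\<in>range ebas. Du x b \<bullet> b)"
      unfolding divergence_def Basis_cyl by (subst sum.insert) (auto simp: ebas_def)
    also have "(\<Sum>b\<in>range ebas. Du x b \<bullet> b) = 0"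
      by (rule sum.neutral) (auto simp: Du_def)
    also have "Du x (1, 0) \<bullet> (1, 0) = 0" using wells by (simp add: Du_def inner_e1 d_def)
    finally show ?thesis by simp
  qed
  have "periodic_cyl u" by (simp add: u_def periodic_cyl_iff)
  then have "H1div u Du" unfolding H1div_def using L2u L2 wp gr div by simp
  moreover have "avg_limits u um up"
    unfolding avg_limits_def
  proof (intro exI conjI)
    show "continuous_on UNIV g" by (rule g_cont)
    show "AE t in lborel. g t = xavg u t" by (simp add: u_def[abs_def] xavg_of_fst)
    have "eventually (\<lambda>t. g t = um) at_bot"
      using eventually_le_at_bot[of 0] by eventually_elim (simp add: g_def ramp_0)
    then show "(g \<longlongrightarrow> um) at_bot" by (rule tendsto_eventually)
    have "eventually (\<lambda>t. g t = up) at_top"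
      using eventually_ge_at_top[of 1] by eventually_elim (simp add: g_def ramp_1 d_def)
    then show "(g \<longlongrightarrow> up) at_top" by (rule tendsto_eventually)
  qed
  moreover have "energy W u Du < \<infinity>"
    unfolding energy_eq slab_energy_def gsq u_def
  proof (rule fin[of "\<lambda>t. (ramp' t)\<^sup>2 * (norm d)\<^sup>2 / 2 + W (g t)" B])
    show "(ramp' t)\<^sup>2 * (norm d)\<^sup>2 / 2 + W (g t) \<le> B" if "t \<in> {0..1}" for t
    proof -
      have "(ramp' t)\<^sup>2 * (norm d)\<^sup>2 \<ge> 0" by simp
      then show ?thesis using B[OF that] by linarith
    qed
  qed (use gW r0 in auto)
  ultimately show thesis using that by (auto simp: admissible_def)
qed

section \<open>Existence of a minimizer\<close>

text \<open>The times in \<open>{s..T}\<close> with \<open>g t \<le> \<delta>\<close> form a compact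
  set; at its largest element the intermediate value theorem forces equality.\<close>

lemma last_time:
  fixes g :: "real \<Rightarrow> real"
  assumes cont: "continuous_on UNIV g" and T: "g T > \<delta>" and s: "s \<le> T" "g s \<le> \<delta>"
  obtains \<tau> where "\<tau> < T" "g \<tau> = \<delta>" "\<And>t. \<tau> < t \<Longrightarrow> t \<le> T \<Longrightarrow> g t > \<delta>"
proof -
  let ?A = "{s..T} \<inter> {t. g t \<le> \<delta>}"
  have "closed {t. g t \<le> \<delta>}" by (rule closed_Collect_le[OF cont continuous_on_const])
  then have "compact ?A" by (intro compact_Int_closed compact_Icc)
  moreover have "?A \<noteq> {}" using s by auto
  ultimately have "\<exists>\<tau>\<in>?A. \<forall>t\<in>?A. t \<le> \<tau>" by (rule compact_attains_sup)
  then obtain \<tau> where \<tau>: "\<tau> \<in> ?A" "\<And>t. t \<in> ?A \<Longrightarrow> t \<le> \<tau>" by blast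
  have gt: "g t > \<delta>" if "\<tau> < t" "t \<le> T" for t
    using \<tau>(2)[of t] \<tau>(1) that by (cases "g t \<le> \<delta>") auto
  have lt: "\<tau> < T" using \<tau>(1) T by (cases "\<tau> = T") auto
  have "g \<tau> = \<delta>"
  proof (rule ccontr)
    assume "g \<tau> \<noteq> \<delta>"
    then have "g \<tau> < \<delta>" using \<tau>(1) by simp
    then obtain x where "\<tau> \<le> x" "x \<le> T" "g x = \<delta>"
      using IVT'[of g \<tau> \<delta> T] T lt continuous_on_subset[OF cont] by (metis less_imp_le subset_UNIV)
    then show False using gt[of x] \<open>g \<tau> \<noteq> \<delta>\<close> by (cases "x = \<tau>") auto
  qed
  then show thesis using that lt gt by blast
qed

text \<open>The Hoelder bound passes to the limit, and a grid of mesh \<open>h / 2\<close> leaves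
  finitely many points to control. The thirds of \<open>e\<close> cover the oscillation of
  \<open>f i\<close>, the error on the grid and the oscillation of \<open>l\<close>.\<close>

lemma Hoelder_pointwise_imp_uniform:
  fixes f :: "nat \<Rightarrow> real \<Rightarrow> 'b::real_normed_vector"
  assumes hol: "\<And>i s t. s \<le> t \<Longrightarrow> (norm (f i t - f i s))\<^sup>2 \<le> (t - s) * M"
    and lim: "\<And>t. (\<lambda>i. f i t) \<longlonglongrightarrow> l t" and e: "e > 0"
  shows "eventually (\<lambda>i. \<forall>t\<in>{p..q}. dist (f i t) (l t) < e) sequentially"
proof -
  have hol_l: "(norm (l t - l s))\<^sup>2 \<le> (t - s) * M" if "s \<le> t" for s t
  proof (rule LIMSEQ_le_const2)
    show "(\<lambda>i. (norm (f i t - f i s))\<^sup>2) \<longlonglongrightarrow> (norm (l t - l s))\<^sup>2" by (intro tendsto_intros lim)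
    show "\<exists>N. \<forall>n\<ge>N. (norm (f n t - f n s))\<^sup>2 \<le> (t - s) * M" using hol[OF that] by blast
  qed
  define h where "h = (e / 3)\<^sup>2 / (\<bar>M\<bar> + 1)"
  have h: "h > 0" using e by (simp add: h_def)
  have close: "dist (k t) (k s) < e / 3" if "s \<le> t" "t - s < h" "(norm (k t - k s))\<^sup>2 \<le> (t - s) * M" for k :: "real \<Rightarrow> 'b" and s t
  proof -
    have "(t - s) * M \<le> (t - s) * (\<bar>M\<bar> + 1)" using that by (intro mult_left_mono) auto
    also have "\<dots> < h * (\<bar>M\<bar> + 1)" using that by (intro mult_strict_right_mono) auto
    also have "\<dots> = (e / 3)\<^sup>2"
    proof -
      have "z / (\<bar>M\<bar> + 1) * (\<bar>M\<bar> + 1) = z" for z by simp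
      then show ?thesis unfolding h_def .
    qed
    finally have "(norm (k t - k s))\<^sup>2 < (e / 3)\<^sup>2" using that(3) by linarith
    then have "norm (k t - k s) < e / 3" by (rule power2_less_imp_less) (use e in simp)
    then show ?thesis by (simp only: dist_norm)
  qed
  obtain N :: nat where N: "(q - p) / (h / 2) \<le> real N" using real_arch_simple by blast
  define G where "G = (\<lambda>j. p + real j * (h / 2)) ` {..N}"
  have "eventually (\<lambda>i. \<forall>s\<in>G. dist (f i s) (l s) < e / 3) sequentially"
    unfolding G_def using e by (intro eventually_ball_finite ballI tendstoD[OF lim]) auto
  then show ?thesis
  proof eventually_elim
    case (elim i)
    show ?case
    proof
      fix t assume t: "t \<in> {p..q}"
      define j where "j = nat \<lfloor>(t - p) / (h / 2)\<rfloor>"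
      have nn: "(t - p) / (h / 2) \<ge> 0" using t h by simp
      then have j: "real j \<le> (t - p) / (h / 2)" "(t - p) / (h / 2) < real j + 1"
        unfolding j_def by (auto simp: floor_correct)
      have "(t - p) / (h / 2) \<le> (q - p) / (h / 2)" using t h by (intro divide_right_mono) auto
      then have "real j \<le> real N" using j N by linarith
      then have "p + real j * (h / 2) \<in> G" unfolding G_def by auto
      then have 1: "dist (f i (p + real j * (h / 2))) (l (p + real j * (h / 2))) < e / 3" using elim by blast
      have le: "p + real j * (h / 2) \<le> t" using j(1) h by (simp add: field_simps)
      have "t < p + (real j + 1) * (h / 2)" using j(2) h by (simp add: field_simps)
      moreover have "(real j + 1) * (h / 2) = real j * (h / 2) + h / 2" by (simp add: distrib_right)
      ultimately have lt: "t - (p + real j * (h / 2)) < h" using h by linarith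
      show "dist (f i t) (l t) < e"
        using close[where k = "f i", OF le lt hol[OF le]] close[where k = l, OF le lt hol_l[OF le]] 1
          dist_triangle[of "f i t" "l t" "f i (p + real j * (h / 2))"]
          dist_triangle[of "f i (p + real j * (h / 2))" "l t" "l (p + real j * (h / 2))"]
        by (simp add: dist_commute)
    qed
  qed
qed

text \<open>The two slabs share only a hyperplane, a null set. This superadditivity is what lets the
  quanta of successive exits accumulate.\<close>

lemma slab_energy_split:
  assumes [measurable]: "W \<in> borel_measurable borel" "u \<in> borel_measurable borel" "grad_sq Du \<in> borel_measurable borel"
    and "c \<le> \<tau>"
  shows "slab_energy W u Du {\<tau>..\<tau> + 1} + slab_energy W u Du {\<tau> + 1..} \<le> slab_energy W u Du {c..}"
proof -
  let ?f = "\<lambda>x. ennreal (grad_sq Du x / 2 + W (u x))"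
  have "slab_energy W u Du {\<tau>..\<tau> + 1} + slab_energy W u Du {\<tau> + 1..}
    = (\<integral>\<^sup>+x. ?f x * indicator (slab {\<tau>..\<tau> + 1}) x + ?f x * indicator (slab {\<tau> + 1..}) x \<partial>lborel)"
    unfolding slab_energy_def by (rule nn_integral_add[symmetric]) measurable
  also have "\<dots> \<le> slab_energy W u Du {c..}"
    unfolding slab_energy_def
  proof (rule nn_integral_mono_AE)
    show "AE x in lborel. ?f x * indicator (slab {\<tau>..\<tau> + 1}) x + ?f x * indicator (slab {\<tau> + 1..}) x \<le> ?f x * indicator (slab {c..}) x"
      using AE_lborel_hyperplane[OF e1_Basis, of "\<tau> + 1"]
      by eventually_elim (use \<open>c \<le> \<tau>\<close> in \<open>auto simp: indicator_def mem_slab inner_e1\<close>)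
  qed
  finally show ?thesis .
qed

lemma slab_energy_eq:
  assumes "\<And>z. W z \<ge> 0" and [measurable]: "W \<in> borel_measurable borel" "u \<in> borel_measurable borel" "grad_sq Du \<in> borel_measurable borel"
  shows "slab_energy W u Du UNIV = ennreal (1/2) * Dirichlet Du UNIV + (\<integral>\<^sup>+x\<in>slab UNIV. ennreal (W (u x)) \<partial>lborel)"
proof -
  have "slab_energy W u Du UNIV = (\<integral>\<^sup>+x. ennreal (1/2) * (ennreal (grad_sq Du x) * indicator (slab UNIV) x) + 1 * (ennreal (W (u x)) * indicator (slab UNIV) x) \<partial>lborel)"
    unfolding slab_energy_def
  proof (intro nn_integral_cong)
    fix x
    have "ennreal (grad_sq Du x / 2 + W (u x)) = ennreal (1/2) * ennreal (grad_sq Du x) + ennreal (W (u x))"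
      using assms(1)[of "u x"] grad_sq_nonneg[of Du x]
      by (subst ennreal_mult[symmetric], simp, simp, subst ennreal_plus[symmetric]) auto
    then show "ennreal (grad_sq Du x / 2 + W (u x)) * indicator (slab UNIV) x = ennreal (1/2) * (ennreal (grad_sq Du x) * indicator (slab UNIV) x) + 1 * (ennreal (W (u x)) * indicator (slab UNIV) x)"
      by (simp only: mult_1_left distrib_right mult.assoc)
  qed
  also have "\<dots> = ennreal (1/2) * Dirichlet Du UNIV + 1 * (\<integral>\<^sup>+x\<in>slab UNIV. ennreal (W (u x)) \<partial>lborel)"
    unfolding Dirichlet_def by (rule nn_integral_linear) measurable
  finally show ?thesis by simp
qed

text \<open>The Dirichlet part of the energy converges along the sequence, hence so does the potential part, and the
  two semicontinuity statements add up.\<close>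

lemma limit_energy_le:
  fixes W :: "real \<times> (real^'m) \<Rightarrow> real"
  assumes W_cont: "continuous_on UNIV W" and W_nonneg: "\<And>z. W z \<ge> 0"
    and u: "\<And>i. H1per (u i) (Du i)" and v: "H1per v Dv"
    and q: "\<And>i. Dirichlet (Du i) UNIV = ennreal (q i)" "q \<longlonglongrightarrow> Q" "\<And>i. q i \<ge> 0"
    and E: "\<And>i. slab_energy W (u i) (Du i) UNIV = ennreal (En i)" "En \<longlonglongrightarrow> I" "\<And>i. En i \<ge> 0"
    and conv: "AE x in lborel. x \<in> slab UNIV \<longrightarrow> (\<lambda>i. u i x) \<longlonglongrightarrow> v x"
    and dir: "\<And>c. eventually (\<lambda>i. Dirichlet (Du i) UNIV \<le> c) sequentially \<Longrightarrow> Dirichlet Dv UNIV \<le> c"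
  shows "slab_energy W v Dv UNIV \<le> ennreal I"
proof -
  have [measurable]: "W \<in> borel_measurable borel" using W_cont by (rule borel_measurable_continuous_onI)
  have [measurable]: "u i \<in> borel_measurable borel" "grad_sq (Du i) \<in> borel_measurable borel" for i
    using H1div_D(4)[OF H1per_D(1)[OF u]] H1per_D(4)[OF u] by auto
  have [measurable]: "v \<in> borel_measurable borel" "grad_sq Dv \<in> borel_measurable borel"
    using H1div_D(4)[OF H1per_D(1)[OF v]] H1per_D(4)[OF v] by auto
  have P: "(\<integral>\<^sup>+x\<in>slab UNIV. ennreal (W (u i x)) \<partial>lborel) = ennreal (En i - q i / 2)" for i
  proof -
    let ?P = "\<integral>\<^sup>+x\<in>slab UNIV. ennreal (W (u i x)) \<partial>lborel"
    have "slab_energy W (u i) (Du i) UNIV = ennreal (1/2) * Dirichlet (Du i) UNIV + ?P"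
      by (rule slab_energy_eq) (auto simp: W_nonneg)
    then have "ennreal (En i) = ennreal (1/2) * ennreal (q i) + ?P" unfolding E(1) q(1) .
    also have "ennreal (1/2) * ennreal (q i) = ennreal (q i / 2)"
      using q(3)[of i] by (subst ennreal_mult[symmetric]) auto
    finally have eq: "ennreal (En i) = ennreal (q i / 2) + ?P" .
    show ?thesis
      using q(3)[of i] E(3)[of i] arg_cong[OF eq, of "\<lambda>z. z - ennreal (q i / 2)"]
      by (simp add: ennreal_minus)
  qed
  have Q0: "Q \<ge> 0" using q(2,3) by (intro LIMSEQ_le_const) auto
  have "Dirichlet Dv UNIV \<le> ennreal Q"
  proof (rule ennreal_le_epsilon)
    fix e :: real assume e: "e > 0"
    have "eventually (\<lambda>i. q i < Q + e) sequentially" using q(2) e by (intro order_tendstoD) auto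
    then have "eventually (\<lambda>i. Dirichlet (Du i) UNIV \<le> ennreal (Q + e)) sequentially"
      by eventually_elim (auto simp: q(1) intro: ennreal_leI)
    from dir[OF this] show "Dirichlet Dv UNIV \<le> ennreal Q + ennreal e" using Q0 e by (simp add: ennreal_plus)
  qed
  moreover have "(\<integral>\<^sup>+x\<in>slab UNIV. ennreal (W (v x)) \<partial>lborel) \<le> ennreal (I - Q / 2)"
  proof -
    have "(\<integral>\<^sup>+x\<in>slab UNIV. ennreal (W (v x)) \<partial>lborel) \<le> (\<integral>\<^sup>+x. liminf (\<lambda>i. ennreal (W (u i x)) * indicator (slab UNIV) x) \<partial>lborel)"
    proof (rule nn_integral_mono_AE)
      show "AE x in lborel. ennreal (W (v x)) * indicator (slab UNIV) x \<le> liminf (\<lambda>i. ennreal (W (u i x)) * indicator (slab UNIV) x)"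
        using conv
      proof eventually_elim
        case (elim x)
        show ?case
        proof (cases "x \<in> slab UNIV")
          case True
          then have "(\<lambda>i. u i x) \<longlonglongrightarrow> v x" using elim by simp
          then have "(\<lambda>i. W (u i x)) \<longlonglongrightarrow> W (v x)"
            using W_cont by (intro isCont_tendsto_compose[of _ W]) (auto simp only: continuous_on_eq_continuous_at[OF open_UNIV])
          then have "(\<lambda>i. ennreal (W (u i x))) \<longlonglongrightarrow> ennreal (W (v x))" by (rule tendsto_ennrealI)
          from lim_imp_Liminf[OF _ this] show ?thesis using True by simp
        qed simp
      qed
    qed
    also have "\<dots> \<le> liminf (\<lambda>i. \<integral>\<^sup>+x\<in>slab UNIV. ennreal (W (u i x)) \<partial>lborel)"
      by (rule nn_integral_liminf) measurable
    also have "\<dots> = ennreal (I - Q / 2)"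
      unfolding P by (rule lim_imp_Liminf) (auto intro!: tendsto_ennrealI tendsto_intros E(2) q(2))
    finally show ?thesis .
  qed
  moreover have IQ: "I - Q / 2 \<ge> 0"
  proof (rule LIMSEQ_le_const)
    show "(\<lambda>i. En i - q i / 2) \<longlonglongrightarrow> I - Q / 2" by (intro tendsto_intros E(2) q(2)) simp
    have h: "ennreal (1/2) * ennreal (q i) \<le> ennreal (En i)" for i
      unfolding E(1)[symmetric] q(1)[symmetric]
      by (rule half_Dirichlet_le_slab_energy[OF W_nonneg]) simp_all
    have "0 \<le> En i - q i / 2" for i
    proof -
      have "ennreal (1/2 * q i) \<le> ennreal (En i)" using h[of i] q(3)[of i] by (subst ennreal_mult) auto
      then show ?thesis using E(3)[of i] by simp
    qed
    then show "\<exists>N. \<forall>n\<ge>N. 0 \<le> En n - q n / 2" by blast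
  qed
  ultimately have "slab_energy W v Dv UNIV \<le> ennreal (1/2) * ennreal Q + ennreal (I - Q / 2)"
    by (subst slab_energy_eq[OF W_nonneg]) (auto intro!: add_mono mult_left_mono)
  also have "\<dots> = ennreal I"
    using Q0 IQ by (subst ennreal_mult[symmetric], simp, simp, subst ennreal_plus[symmetric]) auto
  finally show ?thesis .
qed

lemma Dirichlet_shift:
  fixes Du :: "real \<times> (real^'m) \<Rightarrow> real \<times> (real^'m) \<Rightarrow> real \<times> (real^'m)"
  assumes [measurable]: "grad_sq Du \<in> borel_measurable borel"
  shows "Dirichlet (\<lambda>x. Du (x + (\<tau>, 0))) UNIV = Dirichlet Du UNIV"
  unfolding Dirichlet_def grad_sq_shift
  using nn_integral_slab_UNIV_shift[of "\<lambda>x. ennreal (grad_sq Du x)" \<tau>] by simp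

text \<open>Two adjustments are made to an ordinary minimizing sequence: gradients are replaced by
  periodic ones, at unchanged energy, and a subsequence makes the Dirichlet energies converge, as
  \<open>limit_energy_le\<close> requires.\<close>

lemma minimizing_sequence:
  fixes W :: "real \<times> (real^'m) \<Rightarrow> real"
  assumes W_cont: "continuous_on UNIV W" and W_nonneg: "\<And>z. W z \<ge> 0"
    and S_a: "{z. fst z = a \<and> W z = 0} = {um, up}"
  obtains I :: real and w Dw ub and En q :: "nat \<Rightarrow> real" and Q :: real where
    "\<And>v Dv. admissible um up v Dv \<Longrightarrow> ennreal I \<le> energy W v Dv"
    "\<And>n. H1per (w n) (Dw n)" "\<And>n. slice_avg (w n) (ub n)" "\<And>n t. fst (ub n t) = a"
    "\<And>n. (ub n \<longlongrightarrow> um) at_bot" "\<And>n. (ub n \<longlongrightarrow> up) at_top"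
    "\<And>n. slab_energy W (w n) (Dw n) UNIV = ennreal (En n)" "En \<longlonglongrightarrow> I" "\<And>n. En n \<ge> 0"
    "\<And>n. Dirichlet (Dw n) UNIV = ennreal (q n)" "q \<longlonglongrightarrow> Q" "\<And>n. q n \<ge> 0" "\<And>n. q n \<le> 2 * En n" "\<And>n. En n \<le> I + 1"
proof -
  define A where "A = {p. admissible um up (fst p) (snd p)}"
  define I0 where "I0 = (INF p\<in>A. energy W (fst p) (snd p))"
  obtain u0 Du0 where "admissible um up u0 Du0" "energy W u0 Du0 < \<infinity>"
    using finite_energy_competitor[OF W_cont S_a] .
  then have "I0 < \<infinity>"
    unfolding I0_def A_def by (intro le_less_trans[OF INF_lower[of "(u0, Du0)"]]) auto
  then obtain I where I: "I0 = ennreal I" "I \<ge> 0" by (cases I0) auto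
  have low: "ennreal I \<le> energy W v Dv" if "admissible um up v Dv" for v Dv
    unfolding I(1)[symmetric] I0_def using that INF_lower[of "(v, Dv)" A "\<lambda>p. energy W (fst p) (snd p)"] by (simp add: A_def)
  have "\<exists>u Du f. H1per u Du \<and> slice_avg u f \<and> (f \<longlongrightarrow> um) at_bot \<and> (f \<longlongrightarrow> up) at_top \<and>
      slab_energy W u Du UNIV < ennreal (I + 1 / real (Suc n)) \<and> ennreal I \<le> slab_energy W u Du UNIV" for n
  proof -
    have "I0 < ennreal (I + 1 / real (Suc n))" unfolding I(1) using I(2) by (intro ennreal_lessI add_nonneg_pos) auto
    then obtain p where "p \<in> A" "energy W (fst p) (snd p) < ennreal (I + 1 / real (Suc n))"
      unfolding I0_def INF_less_iff by blast
    then obtain u Du where u: "admissible um up u Du" "energy W u Du < ennreal (I + 1 / real (Suc n))"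
      by (auto simp: A_def)
    obtain f where f: "slice_avg u f" "(f \<longlongrightarrow> um) at_bot" "(f \<longlongrightarrow> up) at_top"
      using u(1) unfolding admissible_def avg_limits_def slice_avg_def by blast
    have "H1div u Du" using u(1) by (simp add: admissible_def)
    then obtain Du' where Du': "H1per u Du'" "AE x in lborel. \<forall>b\<in>Basis. Du' x b = Du x b"
      using H1div_imp_H1per by blast
    have "energy W u Du' = energy W u Du"
      unfolding energy_def
    proof (rule nn_integral_cong_AE)
      show "AE x in lborel. ennreal (grad_sq Du' x / 2 + W (u x)) * indicator cell x = ennreal (grad_sq Du x / 2 + W (u x)) * indicator cell x"
        using Du'(2) by eventually_elim (simp add: grad_sq_def)
    qed
    then have "slab_energy W u Du' UNIV < ennreal (I + 1 / real (Suc n))" "ennreal I \<le> slab_energy W u Du' UNIV"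
      using u(2) low[OF u(1)] by (simp_all add: energy_eq)
    then show ?thesis using Du'(1) f by blast
  qed
  then obtain w Dw ub where w: "\<And>n. H1per (w n) (Dw n)" "\<And>n. slice_avg (w n) (ub n)"
    "\<And>n. (ub n \<longlongrightarrow> um) at_bot" "\<And>n. (ub n \<longlongrightarrow> up) at_top"
    "\<And>n. slab_energy W (w n) (Dw n) UNIV < ennreal (I + 1 / real (Suc n))" "\<And>n. ennreal I \<le> slab_energy W (w n) (Dw n) UNIV"
    by metis
  define En where "En n = enn2real (slab_energy W (w n) (Dw n) UNIV)" for n
  define q where "q n = enn2real (Dirichlet (Dw n) UNIV)" for n
  have En: "slab_energy W (w n) (Dw n) UNIV = ennreal (En n)" "En n \<ge> 0" for n
    using less_trans[OF w(5)[of n] ennreal_less_top] by (auto simp: En_def)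
  have q: "Dirichlet (Dw n) UNIV = ennreal (q n)" "q n \<ge> 0" for n
    using Dirichlet_finite[OF H1per_D(1)[OF w(1)], of n UNIV] by (auto simp: q_def)
  have Eb: "I \<le> En n" "En n \<le> I + inverse (real (Suc n))" for n
  proof -
    show "I \<le> En n" using w(6)[of n] En(2)[of n] unfolding En(1) by simp
    have "En n < I + 1 / real (Suc n)"
      using w(5)[of n] unfolding En(1) by (simp only: ennreal_less_iff[OF En(2)])
    then show "En n \<le> I + inverse (real (Suc n))" by (simp add: divide_inverse)
  qed
  have Elim: "En \<longlonglongrightarrow> I"
  proof (rule tendsto_sandwich[OF always_eventually always_eventually tendsto_const])
    show "\<forall>n. I \<le> En n" "\<forall>n. En n \<le> I + inverse (real (Suc n))" using Eb by auto
    show "(\<lambda>n. I + inverse (real (Suc n))) \<longlonglongrightarrow> I"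
      using tendsto_add[OF tendsto_const LIMSEQ_inverse_real_of_nat, of I] by simp
  qed
  have E1: "En n \<le> I + 1" for n
  proof -
    have "inverse (real (Suc n)) \<le> 1" by (simp add: inverse_le_1_iff)
    then show ?thesis using Eb(2)[of n] by linarith
  qed
  have qE: "q n \<le> 2 * En n" for n
  proof -
    have "ennreal (1/2) * ennreal (q n) \<le> ennreal (En n)"
      unfolding En(1)[symmetric] q(1)[symmetric]
      by (rule half_Dirichlet_le_slab_energy[OF W_nonneg H1per_D(4)[OF w(1)]]) simp
    then have "ennreal (1/2 * q n) \<le> ennreal (En n)" using q(2)[of n] by (subst ennreal_mult) auto
    then show ?thesis using En(2)[of n] by simp
  qed
  have "bounded (range q)"
    unfolding bounded_iff
  proof (intro exI ballI)
    fix y assume "y \<in> range q"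
    then obtain n where "y = q n" by blast
    then show "norm y \<le> 2 * (I + 1)" using q(2)[of n] qE[of n] E1[of n] by simp
  qed
  then obtain Q \<sigma> where \<sigma>: "strict_mono (\<sigma> :: nat \<Rightarrow> nat)" "(q \<circ> \<sigma>) \<longlonglongrightarrow> Q"
    using bounded_imp_convergent_subsequence[of q] by blast
  \<comment> \<open>The constant first component is read off at the right end, where the average
    tends to \<open>up\<close>.\<close>
  have afst: "fst (ub n t) = a" for n t
  proof -
    have "((\<lambda>t. fst (ub n t)) \<longlongrightarrow> fst up) at_top" by (rule tendsto_fst[OF w(4)])
    moreover have "(\<lambda>t. fst (ub n t)) = (\<lambda>_. fst (ub n 0))" using slice_avg_fst_const[OF w(1,2)] by blast
    ultimately have "((\<lambda>_. fst (ub n 0)) \<longlongrightarrow> fst up) (at_top :: real filter)" by simp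
    then have "fst (ub n 0) = fst up" by (simp add: tendsto_const_iff)
    moreover have "fst up = a" using S_a by blast
    ultimately show ?thesis using slice_avg_fst_const[OF w(1,2), of n t 0] by simp
  qed
  show thesis
  proof (rule that[of I "w \<circ> \<sigma>" "Dw \<circ> \<sigma>" "ub \<circ> \<sigma>" "En \<circ> \<sigma>" "q \<circ> \<sigma>" Q])
    show "(En \<circ> \<sigma>) \<longlonglongrightarrow> I" by (rule LIMSEQ_subseq_LIMSEQ[OF Elim \<sigma>(1)])
  qed (use low w afst En q \<sigma> qE E1 in \<open>simp_all add: o_def\<close>)
qed

theorem theorem2p1:
  fixes W :: "real \<times> (real^'m) \<Rightarrow> real" and a :: real
    and um up :: "real \<times> (real^'m)"
  assumes W_cont: "continuous_on UNIV W"
    and W_nonneg: "\<And>z. W z \<ge> 0"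
    and S_a: "{z. fst z = a \<and> W z = 0} = {um, up}" and distinct: "um \<noteq> up"
    and liminf: "\<exists>c>0. \<exists>\<delta>>0. \<exists>R. \<forall>z1 z'. \<bar>z1 - a\<bar> < \<delta> \<and> norm z' > R \<longrightarrow> W (z1, z') \<ge> c"
  shows "\<exists>u Du. admissible um up u Du \<and>
           (\<forall>v Dv. admissible um up v Dv \<longrightarrow> energy W u Du \<le> energy W v Dv)"
proof -
  obtain I :: real and w Dw ub and En q :: "nat \<Rightarrow> real" and Q :: real where
    low: "\<And>v Dv. admissible um up v Dv \<Longrightarrow> ennreal I \<le> energy W v Dv"
    and H: "\<And>n. H1per (w n) (Dw n)" and ub: "\<And>n. slice_avg (w n) (ub n)" and afst: "\<And>n t. fst (ub n t) = a"
    and lim_bot: "\<And>n. (ub n \<longlongrightarrow> um) at_bot" and lim_top: "\<And>n. (ub n \<longlongrightarrow> up) at_top"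
    and En: "\<And>n. slab_energy W (w n) (Dw n) UNIV = ennreal (En n)" "En \<longlonglongrightarrow> I" "\<And>n. En n \<ge> 0"
    and q: "\<And>n. Dirichlet (Dw n) UNIV = ennreal (q n)" "q \<longlonglongrightarrow> Q" "\<And>n. q n \<ge> 0" "\<And>n. q n \<le> 2 * En n"
    and E1: "\<And>n. En n \<le> I + 1"
  proof (rule minimizing_sequence[OF W_cont W_nonneg S_a], goal_cases)
    case (1 I w Dw ub En q Q)
    show thesis by (rule that) (fact 1)+
  qed
  \<comment> \<open>A quarter of the distance: a point at distance \<open>\<delta>\<close> from
    \<open>um\<close> is at least \<open>3 * \<delta>\<close> from \<open>up\<close>, and a point
    within \<open>2 * \<delta>\<close> of \<open>up\<close> is more than \<open>\<delta>\<close>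
    from \<open>um\<close>.\<close>
  define \<delta> where "\<delta> = dist um up / 4"
  have \<delta>: "\<delta> > 0" using distinct by (simp add: \<delta>_def)
  have D: "dist um up = 4 * \<delta>" by (simp add: \<delta>_def)
  obtain \<kappa> :: real where \<kappa>: "\<kappa> > 0"
    "\<And>u Du ub t. H1per u Du \<Longrightarrow> slice_avg u ub \<Longrightarrow> fst (ub t) = a \<Longrightarrow> \<delta> \<le> dist (ub t) um \<Longrightarrow> \<delta> \<le> dist (ub t) up
       \<Longrightarrow> ennreal \<kappa> \<le> slab_energy W u Du {t..t + 1}"
    using slab_energy_lower_bound[OF W_cont W_nonneg S_a liminf \<delta>] by blast
  have [measurable]: "W \<in> borel_measurable borel" using W_cont by (rule borel_measurable_continuous_onI)
  have wm: "w n \<in> borel_measurable borel" "grad_sq (Dw n) \<in> borel_measurable borel" for n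
    using H1div_D(4)[OF H1per_D(1)[OF H]] H1per_D(4)[OF H] by auto
  have cont: "continuous_on UNIV (ub n)" for n using ub by (simp add: slice_avg_def)
  \<comment> \<open>Bounds all Dirichlet energies, since \<open>q n \<le> 2 * En n\<close> and
    \<open>En n \<le> I + 1\<close>.\<close>
  define M where "M = 2 * (I + 1)"
  have qM: "q n \<le> M" for n using q(4)[of n] E1[of n] by (simp add: M_def)
  have hol: "(norm (ub n t - ub n s))\<^sup>2 \<le> (t - s) * M" if "s \<le> t" for n s t
  proof -
    have "(norm (ub n t - ub n s))\<^sup>2 \<le> (t - s) * q n"
      using slice_avg_flux(3)[OF H[of n] ub[of n] that] q(1)[of n] q(3)[of n] by simp
    also have "\<dots> \<le> (t - s) * M" using that qM by (intro mult_left_mono) auto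
    finally show ?thesis .
  qed
  \<comment> \<open>With a point of the sphere of radius \<open>\<delta>\<close> around
    \<open>um\<close> translated to 0, the averages are bounded at 0 and compactness applies. The
    limit has energy at most \<open>I\<close>, but compactness does not decide which well it
    approaches at either end.\<close>
  have limit_profile: "\<exists>\<rho> v Dv vb. strict_mono (\<rho> :: nat \<Rightarrow> nat) \<and> H1per v Dv \<and> slice_avg v vb \<and>
      (\<forall>t. (\<lambda>i. ub (r (\<rho> i)) (t + \<tau> (\<rho> i))) \<longlonglongrightarrow> vb t) \<and> slab_energy W v Dv UNIV \<le> ennreal I \<and>
      ((vb \<longlongrightarrow> um) at_top \<or> (vb \<longlongrightarrow> up) at_top) \<and> ((vb \<longlongrightarrow> um) at_bot \<or> (vb \<longlongrightarrow> up) at_bot)"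
    if r: "strict_mono (r :: nat \<Rightarrow> nat)" and \<tau>: "\<And>n. dist (ub (r n) (\<tau> n)) um = \<delta>" for r \<tau>
  proof -
    let ?u = "\<lambda>n x. w (r n) (x + (\<tau> n, 0))" and ?Du = "\<lambda>n x. Dw (r n) (x + (\<tau> n, 0))"
      and ?ub = "\<lambda>n t. ub (r n) (t + \<tau> n)"
    have uH: "H1per (?u n) (?Du n)" for n by (rule H1per_shift[OF H])
    have uavg: "slice_avg (?u n) (?ub n)" for n by (rule slice_avg_shift[OF ub])
    have dq: "Dirichlet (?Du n) UNIV = ennreal (q (r n))" for n
      unfolding q(1)[symmetric] by (rule Dirichlet_shift[OF wm(2)])
    have uE: "slab_energy W (?u n) (?Du n) UNIV = ennreal (En (r n))" for n
      unfolding En(1)[symmetric] by (rule slab_energy_shift[OF _ wm]) simp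
    have C0: "norm (?ub n 0) \<le> norm um + \<delta>" for n
      using \<tau>[of n] norm_triangle_sub[of "ub (r n) (\<tau> n)" um] by (simp add: dist_norm)
    have dM: "Dirichlet (?Du n) UNIV \<le> ennreal M" for n unfolding dq by (intro ennreal_leI qM)
    obtain \<rho> v Dv vb where \<rho>: "strict_mono (\<rho> :: nat \<Rightarrow> nat)" and v: "H1per v Dv" and vb: "slice_avg v vb"
      and conv: "AE x in lborel. x \<in> slab UNIV \<longrightarrow> (\<lambda>i. ?u (\<rho> i) x) \<longlonglongrightarrow> v x"
      and ulim: "\<And>t. (\<lambda>i. ?ub (\<rho> i) t) \<longlonglongrightarrow> vb t"
      and dir: "\<And>c. eventually (\<lambda>i. Dirichlet (?Du (\<rho> i)) UNIV \<le> c) sequentially \<Longrightarrow> Dirichlet Dv UNIV \<le> c"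
    proof (rule H1per_compactness[where u = ?u and Du = ?Du and ub = ?ub, OF uH uavg C0 dM], goal_cases)
      case (1 \<rho> v Dv vb)
      show thesis by (rule that) (fact 1)+
    qed
    have sub: "strict_mono (\<lambda>i. r (\<rho> i))" using strict_mono_o[OF r \<rho>] by (simp add: o_def)
    have qlim: "(\<lambda>i. q (r (\<rho> i))) \<longlonglongrightarrow> Q" using LIMSEQ_subseq_LIMSEQ[OF q(2) sub] by (simp add: o_def)
    have Elim: "(\<lambda>i. En (r (\<rho> i))) \<longlonglongrightarrow> I" using LIMSEQ_subseq_LIMSEQ[OF En(2) sub] by (simp add: o_def)
    have Ev: "slab_energy W v Dv UNIV \<le> ennreal I"
      by (rule limit_energy_le[OF W_cont W_nonneg uH v dq qlim q(3) uE Elim En(3) conv dir])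
    have av: "fst (vb t) = a" for t
      using LIMSEQ_unique[OF tendsto_fst[OF ulim[of t]], of a] afst by simp
    have fin: "slab_energy W v Dv UNIV < \<infinity>" using Ev by (auto intro: le_less_trans)
    show ?thesis
      using \<rho> v vb ulim Ev slice_avg_limits[OF W_cont W_nonneg S_a distinct liminf v vb fin av] by blast
  qed
  \<comment> \<open>Such a profile is admissible with energy at most the infimum, hence a
    minimizer.\<close>
  define good where "good \<longleftrightarrow> (\<exists>v Dv vb. H1per v Dv \<and> slice_avg v vb \<and> slab_energy W v Dv UNIV \<le> ennreal I \<and>
      (vb \<longlongrightarrow> um) at_bot \<and> (vb \<longlongrightarrow> up) at_top)"
  \<comment> \<open>\<open>C k\<close>: energy quanta of \<open>k\<close> exits of \<open>w (r n)\<close> lie to the right of the exit time \<open>\<tau> n\<close>\<close>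
  define C where "C k \<longleftrightarrow> (\<exists>r \<tau> e. strict_mono (r :: nat \<Rightarrow> nat) \<and> (\<forall>n. dist (ub (r n) (\<tau> n)) um = \<delta>) \<and>
      (\<forall>n t. \<tau> n < t \<and> t < e n \<longrightarrow> \<delta> \<le> dist (ub (r n) t) um) \<and>
      filterlim (\<lambda>n. e n - \<tau> n) at_top sequentially \<and>
      (\<forall>n. ennreal (real k * \<kappa>) \<le> slab_energy W (w (r n)) (Dw (r n)) {\<tau> n + 1..}))" for k :: nat
  have dcont: "continuous_on UNIV (\<lambda>t. dist (ub n t) um)" for n
    by (intro continuous_intros cont)
  have start: "\<exists>s\<le>T. dist (ub n s) um \<le> \<delta>" for n T
  proof -
    have "eventually (\<lambda>s. dist (ub n s) um < \<delta>) at_bot" by (rule tendstoD[OF lim_bot \<delta>])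
    then have "eventually (\<lambda>s. s \<le> T \<and> dist (ub n s) um < \<delta>) at_bot" using eventually_le_at_bot by (rule eventually_conj[rotated])
    then obtain s where "s \<le> T" "dist (ub n s) um < \<delta>" by (auto dest!: eventually_happens)
    then show ?thesis by (auto intro: less_imp_le)
  qed
  have C_0: "C 0"
  proof -
    have "\<exists>\<tau>. dist (ub n \<tau>) um = \<delta> \<and> (\<forall>t>\<tau>. \<delta> \<le> dist (ub n t) um)" for n
    proof -
      have "eventually (\<lambda>t. dist (ub n t) up < \<delta>) at_top" by (rule tendstoD[OF lim_top \<delta>])
      then obtain T where T: "\<And>t. t \<ge> T \<Longrightarrow> dist (ub n t) up < \<delta>" by (auto simp: eventually_at_top_linorder)
      have far: "dist (ub n t) um > \<delta>" if "t \<ge> T" for t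
        using T[OF that] D dist_triangle[of um up "ub n t"] \<delta> by (simp add: dist_commute)
      obtain s where s: "s \<le> T" "dist (ub n s) um \<le> \<delta>" using start by blast
      obtain \<tau> where \<tau>: "\<tau> < T" "dist (ub n \<tau>) um = \<delta>" "\<And>t. \<tau> < t \<Longrightarrow> t \<le> T \<Longrightarrow> dist (ub n t) um > \<delta>"
        using last_time[OF dcont far[OF order_refl] s] by blast
      have "\<delta> \<le> dist (ub n t) um" if "t > \<tau>" for t
        using \<tau>(3)[OF that] far[of t] by (cases "t \<le> T") auto
      then show ?thesis using \<tau>(2) by blast
    qed
    then obtain \<tau> where \<tau>: "\<And>n. dist (ub n (\<tau> n)) um = \<delta>" "\<And>n t. t > \<tau> n \<Longrightarrow> \<delta> \<le> dist (ub n t) um" by metis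
    \<comment> \<open>The last exit is never followed by a return, so any right end at growing
      distance serves as \<open>e\<close>.\<close>
    have "filterlim (\<lambda>n. (\<tau> n + real n) - \<tau> n) at_top sequentially"
      by (simp add: filterlim_real_sequentially)
    then show ?thesis
      unfolding C_def using \<tau> strict_mono_id
      by (intro exI[of _ id] exI[of _ \<tau>] exI[of _ "\<lambda>n. \<tau> n + real n"]) (auto simp: strict_mono_def)
  qed
  have C_Suc: "C (Suc k)" if Ck: "C k" and nogood: "\<not> good" for k
  proof -
    obtain r \<tau> e where r: "strict_mono (r :: nat \<Rightarrow> nat)" and \<tau>: "\<And>n. dist (ub (r n) (\<tau> n)) um = \<delta>"
      and e: "\<And>n t. \<tau> n < t \<and> t < e n \<Longrightarrow> \<delta> \<le> dist (ub (r n) t) um"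
      and gap: "filterlim (\<lambda>n. e n - \<tau> n) at_top sequentially"
      and en: "\<And>n. ennreal (real k * \<kappa>) \<le> slab_energy W (w (r n)) (Dw (r n)) {\<tau> n + 1..}"
      using Ck unfolding C_def by blast
    obtain \<rho> v Dv vb where \<rho>: "strict_mono (\<rho> :: nat \<Rightarrow> nat)" and v: "H1per v Dv" and vb: "slice_avg v vb"
      and ulim: "\<And>t. (\<lambda>i. ub (r (\<rho> i)) (t + \<tau> (\<rho> i))) \<longlonglongrightarrow> vb t" and Ev: "slab_energy W v Dv UNIV \<le> ennreal I"
      and lims: "(vb \<longlongrightarrow> um) at_top \<or> (vb \<longlongrightarrow> up) at_top" "(vb \<longlongrightarrow> um) at_bot \<or> (vb \<longlongrightarrow> up) at_bot"
      using limit_profile[OF r \<tau>] by blast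
    \<comment> \<open>For fixed \<open>t > 0\<close> the position
      \<open>t + \<tau> (\<rho> i)\<close> lies before \<open>e (\<rho> i)\<close> eventually, so
      the profile keeps its distance from \<open>um\<close> on the right. Of the two possible limits
      there, only \<open>up\<close> remains.\<close>
    have right: "\<delta> \<le> dist (vb t) um" if "t > 0" for t
    proof (rule tendsto_lowerbound)
      show "(\<lambda>i. dist (ub (r (\<rho> i)) (t + \<tau> (\<rho> i))) um) \<longlonglongrightarrow> dist (vb t) um" by (intro tendsto_intros ulim)
      have "eventually (\<lambda>i. t < e (\<rho> i) - \<tau> (\<rho> i)) sequentially"
        using filterlim_compose[OF gap filterlim_subseq[OF \<rho>]] by (simp add: filterlim_at_top_dense)
      then show "eventually (\<lambda>i. \<delta> \<le> dist (ub (r (\<rho> i)) (t + \<tau> (\<rho> i))) um) sequentially"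
        by eventually_elim (rule e, use that in auto)
    qed simp
    have top: "(vb \<longlongrightarrow> up) at_top"
    proof (rule ccontr)
      assume "\<not> ?thesis"
      then have "(vb \<longlongrightarrow> um) at_top" using lims(1) by blast
      then have "eventually (\<lambda>t. dist (vb t) um < \<delta> \<and> t > 0) at_top"
        using tendstoD[OF _ \<delta>] eventually_gt_at_top by (intro eventually_conj) auto
      then obtain t where "dist (vb t) um < \<delta>" "t > 0" by (auto dest!: eventually_happens)
      then show False using right[of t] by simp
    qed
    then have bot: "(vb \<longlongrightarrow> up) at_bot" using nogood lims(2) v vb Ev unfolding good_def by blast
    have "eventually (\<lambda>t. dist (vb t) up < \<delta> \<and> t < 0) at_bot"
      using tendstoD[OF bot \<delta>] eventually_gt_at_bot by (intro eventually_conj) auto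
    then obtain T0 where T0: "\<And>t. t \<le> T0 \<Longrightarrow> dist (vb t) up < \<delta> \<and> t < 0"
      by (auto simp: eventually_at_bot_linorder)
    have T0neg: "T0 < 0" using T0 by blast
    \<comment> \<open>To the left of \<open>T0\<close> the profile is near \<open>up\<close>, so
      uniform convergence keeps the fields away from \<open>um\<close> on a window of any prescribed
      length \<open>L\<close>. This is what drives the preceding exit to infinity.\<close>
    have far: "eventually (\<lambda>i. \<forall>t\<in>{T0 - L..T0}. dist (ub (r (\<rho> i)) (t + \<tau> (\<rho> i))) um > \<delta>) sequentially" for L
    proof -
      have "eventually (\<lambda>i. \<forall>t\<in>{T0 - L..T0}. dist (ub (r (\<rho> i)) (t + \<tau> (\<rho> i))) (vb t) < \<delta>) sequentially"
      proof (rule Hoelder_pointwise_imp_uniform[OF _ ulim \<delta>])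
        show "(norm (ub (r (\<rho> i)) (t + \<tau> (\<rho> i)) - ub (r (\<rho> i)) (s + \<tau> (\<rho> i))))\<^sup>2 \<le> (t - s) * M" if "s \<le> t" for i s t
          using hol[of "s + \<tau> (\<rho> i)" "t + \<tau> (\<rho> i)" "r (\<rho> i)"] that by simp
      qed
      then show ?thesis
      proof eventually_elim
        case (elim i)
        show ?case
        proof
          fix t assume t: "t \<in> {T0 - L..T0}"
          let ?z = "ub (r (\<rho> i)) (t + \<tau> (\<rho> i))"
          have "dist ?z (vb t) < \<delta>" "dist (vb t) up < \<delta>" using elim T0[of t] t by auto
          then have "dist ?z up < 2 * \<delta>" using dist_triangle[of ?z up "vb t"] by linarith
          then show "dist ?z um > \<delta>" using D \<delta> dist_triangle[of um up ?z] by (simp add: dist_commute)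
        qed
      qed
    qed
    obtain N where N: "\<And>i t. i \<ge> N \<Longrightarrow> t \<in> {T0 - 1..T0} \<Longrightarrow> dist (ub (r (\<rho> i)) (t + \<tau> (\<rho> i))) um > \<delta>"
      using far[of 1] unfolding eventually_sequentially by blast
    \<comment> \<open>Dropping the first \<open>N\<close> indices makes the window of length 1 free
      of exits for every index, as needed in \<open>step1\<close>.\<close>
    define m where "m i = \<rho> (i + N)" for i
    define T where "T i = T0 + \<tau> (m i)" for i
    have gT: "dist (ub (r (m i)) (T i)) um > \<delta>" for i
      using N[of "i + N" T0] by (simp add: m_def T_def)
    have "\<exists>\<tau>'. \<tau>' < T i \<and> dist (ub (r (m i)) \<tau>') um = \<delta> \<and> (\<forall>t. \<tau>' < t \<longrightarrow> t \<le> T i \<longrightarrow> dist (ub (r (m i)) t) um > \<delta>)" for i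
    proof -
      obtain s where "s \<le> T i" "dist (ub (r (m i)) s) um \<le> \<delta>" using start by blast
      from last_time[OF dcont gT this] show ?thesis by blast
    qed
    \<comment> \<open>The new exit is the last crossing before \<open>T i\<close>, so
      \<open>T i\<close> can serve as its right end; later returns to \<open>um\<close> beyond
      \<open>T i\<close> are left open.\<close>
    then obtain \<tau>' where \<tau>': "\<And>i. \<tau>' i < T i" "\<And>i. dist (ub (r (m i)) (\<tau>' i)) um = \<delta>"
      "\<And>i t. \<tau>' i < t \<Longrightarrow> t \<le> T i \<Longrightarrow> dist (ub (r (m i)) t) um > \<delta>"
      by metis
    have before: "\<tau>' i < T i - L" if "\<And>t. t \<in> {T0 - L..T0} \<Longrightarrow> dist (ub (r (m i)) (t + \<tau> (m i))) um > \<delta>" for i L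
    proof (rule ccontr)
      assume "\<not> ?thesis"
      then have "\<tau>' i - \<tau> (m i) \<in> {T0 - L..T0}" using \<tau>'(1)[of i] by (auto simp: T_def)
      from that[OF this] show False using \<tau>'(2)[of i] by simp
    qed
    \<comment> \<open>The window has length 1 and \<open>T0\<close> is negative, so the unit slab of
      the old exit lies inside \<open>{\<tau>' i + 1..}\<close> and its quantum can be added to
      those already counted.\<close>
    have step1: "\<tau>' i + 1 \<le> \<tau> (m i)" for i
      using before[of 1 i] N[of "i + N"] T0neg by (simp add: m_def T_def)
    have "filterlim (\<lambda>i. T i - \<tau>' i) at_top sequentially"
      unfolding filterlim_at_top_dense
    proof
      fix L
      have "eventually (\<lambda>i. \<forall>t\<in>{T0 - L..T0}. dist (ub (r (m i)) (t + \<tau> (m i))) um > \<delta>) sequentially"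
        unfolding m_def using far[of L] by (rule eventually_sequentially_seg[THEN iffD2])
      then show "eventually (\<lambda>i. L < T i - \<tau>' i) sequentially"
      proof eventually_elim
        case (elim i)
        then show ?case using before[of L i] by force
      qed
    qed
    moreover have "ennreal (real (Suc k) * \<kappa>) \<le> slab_energy W (w (r (m i))) (Dw (r (m i))) {\<tau>' i + 1..}" for i
    proof -
      \<comment> \<open>At the old exit time both wells are at distance at least
        \<open>\<delta>\<close>, so the unit slab starting there costs \<open>\<kappa>\<close>; the
        \<open>k\<close> quanta counted before lie to its right.\<close>
      have "dist (ub (r (m i)) (\<tau> (m i))) up \<ge> \<delta>"
        using \<tau>[of "m i"] D dist_triangle[of um up "ub (r (m i)) (\<tau> (m i))"] \<delta> by (simp add: dist_commute)
      then have "ennreal \<kappa> \<le> slab_energy W (w (r (m i))) (Dw (r (m i))) {\<tau> (m i)..\<tau> (m i) + 1}"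
        using \<kappa>(2)[OF H ub afst] \<tau>[of "m i"] by simp
      then have "ennreal \<kappa> + ennreal (real k * \<kappa>) \<le> slab_energy W (w (r (m i))) (Dw (r (m i))) {\<tau> (m i)..\<tau> (m i) + 1}
          + slab_energy W (w (r (m i))) (Dw (r (m i))) {\<tau> (m i) + 1..}"
        by (intro add_mono en)
      also have "\<dots> \<le> slab_energy W (w (r (m i))) (Dw (r (m i))) {\<tau>' i + 1..}"
        by (rule slab_energy_split[OF _ wm step1]) simp
      also have "ennreal \<kappa> + ennreal (real k * \<kappa>) = ennreal (real (Suc k) * \<kappa>)"
        using \<kappa>(1) by (subst ennreal_plus[symmetric]) (auto simp: algebra_simps)
      finally show ?thesis .
    qed
    moreover have "strict_mono (\<lambda>i. r (m i))"
      using r \<rho> by (auto simp: strict_mono_def m_def)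
    ultimately show ?thesis
      unfolding C_def using \<tau>'(2,3)
      by (intro exI[of _ "\<lambda>i. r (m i)"] exI[of _ \<tau>'] exI[of _ T]) (auto intro: less_imp_le)
  qed
  \<comment> \<open>Otherwise \<open>C k\<close> would hold for every \<open>k\<close>, and
    \<open>k\<close> quanta \<open>\<kappa>\<close> would fit into an energy of at most
    \<open>I + 1\<close> for arbitrarily large \<open>k\<close>.\<close>
  have good
  proof (rule ccontr)
    assume ng: "\<not> good"
    have "C k" for k by (induction k) (use C_0 C_Suc ng in blast)+
    moreover obtain k :: nat where k: "I + 1 < real k * \<kappa>"
      using reals_Archimedean3[OF \<kappa>(1)] by blast
    ultimately obtain r :: "nat \<Rightarrow> nat" and \<tau> :: "nat \<Rightarrow> real" where "ennreal (real k * \<kappa>) \<le> slab_energy W (w (r 0)) (Dw (r 0)) {\<tau> 0 + 1..}"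
      unfolding C_def by blast
    also have "\<dots> \<le> ennreal (En (r 0))" unfolding En(1)[symmetric] by (rule slab_energy_mono) simp
    also have "\<dots> \<le> ennreal (I + 1)" by (intro ennreal_leI E1)
    finally have "real k * \<kappa> \<le> I + 1" using En(3)[of 0] E1[of 0] by (subst (asm) ennreal_le_iff) auto
    then show False using k by simp
  qed
  then obtain v Dv vb where v: "H1per v Dv" "slice_avg v vb" "slab_energy W v Dv UNIV \<le> ennreal I"
    "(vb \<longlongrightarrow> um) at_bot" "(vb \<longlongrightarrow> up) at_top"
    unfolding good_def by blast
  have "admissible um up v Dv"
    unfolding admissible_def avg_limits_def using H1per_D(1)[OF v(1)] v(2,4,5) unfolding slice_avg_def by blast
  moreover have "energy W v Dv \<le> energy W v' Dv'" if "admissible um up v' Dv'" for v' Dv'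
    using v(3) low[OF that] unfolding energy_eq by (rule order_trans)
  ultimately show ?thesis by blast
qed

end
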